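(* Let $\lambda$ be a cardinal with $\lambda=\lambda^{\aleph_0}$ and let $p$ be either $0$ or a prime number. Then there is a field $K$ of characteristic $p$ and cardinality $\lambda$ whose automorphism group $\mathrm{Aut}(K)$ is a free group of cardinality $2^\lambda$.
   Context: $\mathrm{Aut}(K)$ denotes the group of all field automorphisms of $K$ under composition. Work in ZFC. *)

theory Defs
  imports
    "HOL-Algebra.QuotRing"
    "HOL-Algebra.Bij"
    "HOL-Computational_Algebra.Primes"
begin

unbundle cardinal_syntax

section \<open>Characteristic and automorphism group\<close>

definition ring_characteristic :: "('a, 'b) ring_scheme \<Rightarrow> nat" where
  "ring_characteristic R =
     (if \<exists>n::nat. 0 < n \<and> [n] \<cdot>\<^bsub>R\<^esub> \<one>\<^bsub>R\<^esub> = \<zero>\<^bsub>R\<^esub>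
      then LEAST n::nat. 0 < n \<and> [n] \<cdot>\<^bsub>R\<^esub> \<one>\<^bsub>R\<^esub> = \<zero>\<^bsub>R\<^esub>
      else 0)"

text \<open>
  The intersection with \<^term>\<open>Bij (carrier R)\<close> keeps only the representative of each
  automorphism that is \<^const>\<open>undefined\<close> outside the carrier; otherwise the cardinality of
  the group would depend on the ambient type. This mirrors \<^const>\<open>AutoGroup\<close>.
\<close>

definition ring_AutoGroup :: "('a, 'b) ring_scheme \<Rightarrow> ('a \<Rightarrow> 'a) monoid" where
  "ring_AutoGroup R =
     BijGroup (carrier R) \<lparr>carrier := ring_iso R R \<inter> Bij (carrier R)\<rparr>"

lemma (in ring) group_ring_AutoGroup: "group (ring_AutoGroup R)"
proof -
  let ?A = "ring_iso R R \<inter> Bij (carrier R)"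
  have "subgroup ?A (BijGroup (carrier R))"
  proof (rule subgroup.intro)
    show "?A \<subseteq> carrier (BijGroup (carrier R))"
      by (auto simp: BijGroup_def)
  next
    fix f g assume fg: "f \<in> ?A" "g \<in> ?A"
    then have "compose (carrier R) f g \<in> Bij (carrier R)"
      by (blast intro: compose_Bij)
    moreover from this have "bij_betw (compose (carrier R) f g) (carrier R) (carrier R)"
      by (simp add: Bij_def)
    ultimately show "f \<otimes>\<^bsub>BijGroup (carrier R)\<^esub> g \<in> ?A"
      using fg by (auto simp: BijGroup_def ring_iso_def ring_hom_def compose_def Pi_iff)
  next
    show "\<one>\<^bsub>BijGroup (carrier R)\<^esub> \<in> ?A"
      using id_Bij[of "carrier R"]
      by (auto simp: BijGroup_def ring_iso_def ring_hom_def Bij_def)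
  next
    fix f assume f: "f \<in> ?A"
    let ?g = "\<lambda>x\<in>carrier R. inv_into (carrier R) f x"
    have fB: "f \<in> Bij (carrier R)" and fh: "f \<in> ring_hom R R"
      using f by (auto simp: ring_iso_def)
    have gB: "?g \<in> Bij (carrier R)"
      using fB by (rule restrict_inv_into_Bij)
    have inj: "inj_on f (carrier R)"
      using fB by (simp add: Bij_def bij_betw_def)
    have "inv_into (carrier R) f \<one> = \<one>"
      by (metis inj fh inv_into_f_f one_closed ring_hom_one)
    moreover have "inv_into (carrier R) f (x \<otimes> y) =
        inv_into (carrier R) f x \<otimes> inv_into (carrier R) f y"
      if "x \<in> carrier R" "y \<in> carrier R" for x y
      by (rule Bij_inv_into_lemma) (use that fB fh in \<open>auto simp: ring_hom_def\<close>)
    moreover have "inv_into (carrier R) f (x \<oplus> y) =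
        inv_into (carrier R) f x \<oplus> inv_into (carrier R) f y"
      if "x \<in> carrier R" "y \<in> carrier R" for x y
      by (rule Bij_inv_into_lemma) (use that fB fh in \<open>auto simp: ring_hom_def\<close>)
    moreover have "inv_into (carrier R) f x \<in> carrier R" if "x \<in> carrier R" for x
      using fB that by (rule Bij_inv_into_mem)
    ultimately have "?g \<in> ring_hom R R"
      by (auto simp: ring_hom_def)
    then show "inv\<^bsub>BijGroup (carrier R)\<^esub> f \<in> ?A"
      using gB fB by (simp add: inv_BijGroup ring_iso_def Bij_def)
  qed
  then show ?thesis
    unfolding ring_AutoGroup_def
    by (simp add: subgroup.subgroup_is_group group_BijGroup)
qed


section \<open>Free groups\<close>

text \<open>
  A word is a list of letters; the letter \<open>(x, True)\<close> stands for \<open>x\<close> and \<open>(x, False)\<close> for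
  its formal inverse.
\<close>

fun letter_value :: "('a, 'b) monoid_scheme \<Rightarrow> 'a \<times> bool \<Rightarrow> 'a" where
  "letter_value G (x, b) = (if b then x else inv\<^bsub>G\<^esub> x)"

fun word_value :: "('a, 'b) monoid_scheme \<Rightarrow> ('a \<times> bool) list \<Rightarrow> 'a" where
  "word_value G [] = \<one>\<^bsub>G\<^esub>"
| "word_value G (l # w) = letter_value G l \<otimes>\<^bsub>G\<^esub> word_value G w"

definition reduced :: "('a \<times> bool) list \<Rightarrow> bool" where
  "reduced w \<longleftrightarrow> successively (\<lambda>(x, b) (y, c). \<not> (x = y \<and> b \<noteq> c)) w"

definition reduced_words :: "'a set \<Rightarrow> ('a \<times> bool) list set" where
  "reduced_words S = {w \<in> lists (S \<times> UNIV). reduced w}"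

text \<open>
  \<open>S\<close> is a free basis of \<open>G\<close> if every element of \<open>G\<close> is the value of exactly one reduced
  word over \<open>S\<close>; the universal property is derived below.
\<close>

definition free_basis :: "('a, 'b) monoid_scheme \<Rightarrow> 'a set \<Rightarrow> bool" where
  "free_basis G S \<longleftrightarrow>
     S \<subseteq> carrier G \<and> bij_betw (word_value G) (reduced_words S) (carrier G)"

definition free_group :: "('a, 'b) monoid_scheme \<Rightarrow> bool" where
  "free_group G \<longleftrightarrow> group G \<and> (\<exists>S. free_basis G S)"

lemma (in group) letter_value_closed:
  "fst l \<in> carrier G \<Longrightarrow> letter_value G l \<in> carrier G"
  by (cases l) auto

lemma (in group) word_value_closed:
  "w \<in> lists (carrier G \<times> UNIV) \<Longrightarrow> word_value G w \<in> carrier G"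
  by (induction w) (auto simp del: letter_value.simps intro!: letter_value_closed)

lemma (in group) word_value_append:
  assumes "v \<in> lists (carrier G \<times> UNIV)" "w \<in> lists (carrier G \<times> UNIV)"
  shows "word_value G (v @ w) = word_value G v \<otimes> word_value G w"
  using assms(1)
proof (induction v)
  case Nil
  then show ?case by (simp add: word_value_closed[OF assms(2)])
next
  case (Cons l v)
  have "letter_value G l \<in> carrier G"
    using Cons.hyps(1) by (intro letter_value_closed) auto
  then show ?case
    using Cons.IH word_value_closed[OF Cons.hyps(2)] word_value_closed[OF assms(2)]
    by (simp add: m_assoc)
qed

lemma (in group) word_value_cancel:
  assumes "x \<in> carrier G" "w \<in> lists (carrier G \<times> UNIV)" "b \<noteq> c"
  shows "word_value G ((x, b) # (x, c) # w) = word_value G w"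
proof -
  have w: "word_value G w \<in> carrier G" by (rule word_value_closed[OF assms(2)])
  show ?thesis
  proof (cases b)
    case True
    then show ?thesis using assms(1,3) w by (simp flip: m_assoc)
  next
    case False
    then show ?thesis using assms(1,3) w by (simp flip: m_assoc)
  qed
qed

lemma reduced_Cons_Cons:
  "reduced ((x, b) # (y, c) # w) \<longleftrightarrow> \<not> (x = y \<and> b \<noteq> c) \<and> reduced ((y, c) # w)"
  by (simp add: reduced_def)

lemma reduced_tl: "reduced (l # w) \<Longrightarrow> reduced w"
  by (cases w) (auto simp: reduced_def)

lemma exists_reduced_word:
  assumes G: "group G" and H: "group H"
    and S: "S \<subseteq> carrier G" and f: "f \<in> S \<rightarrow> carrier H"
    and w: "w \<in> lists (S \<times> UNIV)"
  shows "\<exists>v \<in> reduced_words S. word_value G v = word_value G w \<and>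
           word_value H (map (apfst f) v) = word_value H (map (apfst f) w)"
  using w
proof (induction w)
  case Nil
  show ?case by (rule bexI[of _ "[]"]) (auto simp: reduced_words_def reduced_def)
next
  case (Cons l w)
  obtain x b where l: "l = (x, b)" by force
  from Cons obtain v where v: "v \<in> reduced_words S"
    and vG: "word_value G v = word_value G w"
    and vH: "word_value H (map (apfst f) v) = word_value H (map (apfst f) w)"
    by blast
  have x: "x \<in> S" using Cons.hyps l by auto
  show ?case
  proof (cases "\<exists>c v'. v = (x, c) # v' \<and> b \<noteq> c")
    case True
    then obtain c v' where v': "v = (x, c) # v'" "b \<noteq> c" by blast
    have r: "v' \<in> reduced_words S"
      using v v' by (auto simp: reduced_words_def dest: reduced_tl)
    have "v' \<in> lists (carrier G \<times> UNIV)"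
      using r S by (auto simp: reduced_words_def)
    then have "word_value G ((x, b) # (x, c) # v') = word_value G v'"
      using x S v' group.word_value_cancel[OF G] by blast
    moreover have "map (apfst f) v' \<in> lists (carrier H \<times> UNIV)"
      using r f by (force simp: reduced_words_def Pi_iff)
    then have "word_value H ((f x, b) # (f x, c) # map (apfst f) v')
        = word_value H (map (apfst f) v')"
      using x f v' group.word_value_cancel[OF H] by blast
    ultimately show ?thesis
      using r vG vH v' l by (intro bexI[of _ v']) auto
  next
    case False
    then have "reduced (l # v)"
      using v l by (cases v) (auto simp: reduced_words_def reduced_Cons_Cons, simp add: reduced_def)
    then have "l # v \<in> reduced_words S"
      using v x l by (auto simp: reduced_words_def)
    then show ?thesis
      using vG vH by (intro bexI[of _ "l # v"]) auto
  qed
qed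

theorem free_basis_universal:
  assumes G: "group G" and H: "group H"
    and S: "free_basis G S" and f: "f \<in> S \<rightarrow> carrier H"
  shows "\<exists>!h. h \<in> hom G H \<inter> extensional (carrier G) \<and> (\<forall>x\<in>S. h x = f x)"
proof -
  interpret G: group G by fact
  interpret H: group H by fact
  let ?R = "reduced_words S"
  have SG: "S \<subseteq> carrier G" and bij: "bij_betw (word_value G) ?R (carrier G)"
    using S by (auto simp: free_basis_def)
  have inG: "w \<in> lists (carrier G \<times> UNIV)" if "w \<in> lists (S \<times> UNIV)" for w
    using that SG by auto
  have inH: "map (apfst f) w \<in> lists (carrier H \<times> UNIV)" if "w \<in> lists (S \<times> UNIV)" for w
    using that f by (fastforce simp: Pi_iff)
  have RS: "w \<in> lists (S \<times> UNIV)" if "w \<in> ?R" for w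
    using that by (auto simp: reduced_words_def)
  define nf where "nf = inv_into ?R (word_value G)"
  have nf: "nf g \<in> ?R" "word_value G (nf g) = g" if "g \<in> carrier G" for g
    using that bij unfolding nf_def
    by (auto simp: bij_betw_def inv_into_into f_inv_into_f)
  define h where "h = (\<lambda>g\<in>carrier G. word_value H (map (apfst f) (nf g)))"
  have h: "h (word_value G w) = word_value H (map (apfst f) w)"
    if w: "w \<in> lists (S \<times> UNIV)" for w
  proof -
    obtain v where v: "v \<in> ?R" "word_value G v = word_value G w"
      "word_value H (map (apfst f) v) = word_value H (map (apfst f) w)"
      using exists_reduced_word[OF G H SG f w] by blast
    have "nf (word_value G v) = v"
      using v(1) bij by (simp add: nf_def bij_betw_def)
    then show ?thesis
      using v G.word_value_closed[OF inG[OF w]] by (simp add: h_def)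
  qed
  have "h \<in> hom G H"
  proof (rule homI)
    fix a assume a: "a \<in> carrier G"
    show "h a \<in> carrier H"
      using a by (simp add: h_def H.word_value_closed[OF inH[OF RS[OF nf(1)]]])
  next
    fix a b assume ab: "a \<in> carrier G" "b \<in> carrier G"
    note la = RS[OF nf(1)[OF ab(1)]] and lb = RS[OF nf(1)[OF ab(2)]]
    have "a \<otimes>\<^bsub>G\<^esub> b = word_value G (nf a @ nf b)"
      using G.word_value_append[OF inG[OF la] inG[OF lb]] nf(2) ab by simp
    then have "h (a \<otimes>\<^bsub>G\<^esub> b) = word_value H (map (apfst f) (nf a @ nf b))"
      using h[of "nf a @ nf b"] la lb by simp
    also have "\<dots> = h a \<otimes>\<^bsub>H\<^esub> h b"
      using H.word_value_append[OF inH[OF la] inH[OF lb]] ab by (simp add: h_def)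
    finally show "h (a \<otimes>\<^bsub>G\<^esub> b) = h a \<otimes>\<^bsub>H\<^esub> h b" .
  qed
  moreover have "h \<in> extensional (carrier G)"
    by (simp add: h_def)
  moreover have "h x = f x" if x: "x \<in> S" for x
  proof -
    have "x \<in> carrier G" "f x \<in> carrier H" using x SG f by auto
    moreover have "h (word_value G [(x, True)]) = word_value H (map (apfst f) [(x, True)])"
      by (rule h) (use x in simp)
    ultimately show ?thesis by simp
  qed
  moreover have "k = h"
    if k: "k \<in> hom G H" "k \<in> extensional (carrier G)" "\<forall>x\<in>S. k x = f x" for k
  proof (rule extensionalityI[OF k(2)])
    show "h \<in> extensional (carrier G)" by (simp add: h_def)
    interpret k: group_hom G H k
      by unfold_locales (rule k(1))
    have *: "k (word_value G w) = word_value H (map (apfst f) w)"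
      if "w \<in> lists (S \<times> UNIV)" for w
      using that
    proof (induction w)
      case Nil
      show ?case by simp
    next
      case (Cons l w)
      obtain x b where l: "l = (x, b)" by force
      have "x \<in> carrier G" "k x = f x" using Cons.hyps l SG k(3) by auto
      moreover have "word_value G w \<in> carrier G"
        using Cons.hyps by (intro G.word_value_closed inG) auto
      ultimately show ?case using Cons.IH l by simp
    qed
    fix a assume a: "a \<in> carrier G"
    show "k a = h a"
      using *[OF RS[OF nf(1)[OF a]]] nf(2)[OF a] a by (simp add: h_def)
  qed
  ultimately show ?thesis
    by blast
qed

end

(* Let x_v be independent variables indexed by a set V, and let l, q be distinct large primes. The field K
   is generated over the prime field by the l-power roots of the variables and by q-th roots of 1 + x^g for
   all exponents g in a set Gamma. Up to constants, the monomials are the elements with l-power roots of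
   every order, and by Kummer theory 1 + c x^a is a q-th power only if a is an integral multiple of an element of
   Gamma. Hence an automorphism permutes the monomials, considering total degrees it permutes the variables, and
   Aut(K) is the group of permutations of V preserving Gamma.

   Gamma encodes a structure on V whose symmetries are the families (h_s) of elements of the free group on
   nat -> bool, indexed by the sequences s : nat -> lambda and compatible with passing to subsequences. Since
   countably many sequences are subsequences of a single one, the lengths of the reduced words h_s are bounded,
   and such a family is given by a unique reduced word over lambda -> bool. So the group is free on 2^lambda
   generators, while |V| = lambda because lambda^aleph_0 = lambda. *)

theory Submission
  imports
    Defs
    "HOL-Library.Poly_Mapping"
    "HOL-Library.Countable_Set"
    "HOL-Algebra.Algebraic_Closure_Type"
    "HOL-Computational_Algebra.Fraction_Field"
    "Berlekamp_Zassenhaus.Finite_Field"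
begin

section \<open>Laurent-Puiseux series in infinitely many variables\<close>

text \<open>No automorphism beyond the permutations may survive, and the choice of l and q sees to
  this. Both are odd primes larger than the characteristic, so the prime field has no nontrivial
  l-th or q-th root of unity (in characteristic p > 0 because neither divides p - 1). Hence roots of
  a monomial or of 1 + x^g cannot be changed by a root of unity. Kummer theory, on the other hand,
  needs these roots of unity. It is therefore applied in \<open>Kc\<close>, where algebraically
  closed constants are added, and leading coefficients bring the result back to the prime field.

  Kummer theory alone yields integral multiples k g of exponents in Gamma; that k = 1 comes from
  applying the inverse automorphism as well.

  Everything takes place in the fraction field of a ring of generalised power series. This supplies
  canonical roots (those with constant term 1), an action of all permutations of the variables, and
  a valuation in the lexicographically ordered exponents. Comparing leading exponents provides the
  transcendence statements.\<close>

abbreviation lookup :: "('v \<Rightarrow>\<^sub>0 'b::zero) \<Rightarrow> 'v \<Rightarrow> 'b" where "lookup \<equiv> Poly_Mapping.lookup"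
abbreviation keys :: "('v \<Rightarrow>\<^sub>0 'b::zero) \<Rightarrow> 'v set" where "keys \<equiv> Poly_Mapping.keys"

type_synonym 'v expo = "'v \<Rightarrow>\<^sub>0 rat"

definition bexp :: "'v set \<Rightarrow> nat \<Rightarrow> nat \<Rightarrow> 'v expo set" where
  "bexp W m N = {\<alpha>. keys \<alpha> \<subseteq> W \<and> (\<forall>v. of_nat m * lookup \<alpha> v \<in> \<int> \<and> - of_nat N \<le> lookup \<alpha> v)}"

lemma bexp_mono:
  assumes "W \<subseteq> W'" "m dvd m'" "N \<le> N'"
  shows "bexp W m N \<subseteq> bexp W' m' N'"
proof
  fix \<alpha> assume a: "\<alpha> \<in> bexp W m N"
  obtain k where k: "m' = m * k" using assms(2) by auto
  have "of_nat m' * lookup \<alpha> v \<in> \<int>" for v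
  proof -
    have "of_nat m * lookup \<alpha> v \<in> \<int>" using a unfolding bexp_def by blast
    then have "of_nat k * (of_nat m * lookup \<alpha> v) \<in> \<int>"
      by (rule Ints_mult[OF Ints_of_nat])
    then show ?thesis by (simp add: k mult_ac)
  qed
  moreover have "- of_nat N' \<le> lookup \<alpha> v" for v
  proof -
    have "- of_nat N \<le> lookup \<alpha> v" using a by (auto simp: bexp_def)
    moreover have "(of_nat N :: rat) \<le> of_nat N'" using assms(3) by simp
    ultimately show ?thesis by linarith
  qed
  ultimately show "\<alpha> \<in> bexp W' m' N'"
    using a assms(1) by (auto simp: bexp_def)
qed

lemma bexp_add:
  assumes "\<alpha> \<in> bexp W m N" "\<beta> \<in> bexp W m N'"
  shows "\<alpha> + \<beta> \<in> bexp W m (N + N')"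
proof -
  have "of_nat m * lookup (\<alpha> + \<beta>) v \<in> \<int>" "- of_nat (N + N') \<le> lookup (\<alpha> + \<beta>) v" for v
  proof -
    have "of_nat m * lookup \<alpha> v + of_nat m * lookup \<beta> v \<in> \<int>"
      using assms by (intro Ints_add) (auto simp: bexp_def)
    then show "of_nat m * lookup (\<alpha> + \<beta>) v \<in> \<int>" by (simp add: lookup_add distrib_left)
    have "- of_nat N \<le> lookup \<alpha> v" "- of_nat N' \<le> lookup \<beta> v"
      using assms by (auto simp: bexp_def)
    then show "- of_nat (N + N') \<le> lookup (\<alpha> + \<beta>) v" by (simp add: lookup_add)
  qed
  moreover have "keys (\<alpha> + \<beta>) \<subseteq> W"
    using Poly_Mapping.keys_add[of \<alpha> \<beta>] assms by (auto simp: bexp_def)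
  ultimately show ?thesis by (auto simp: bexp_def)
qed

lemma finite_rat_grid:
  assumes "m > 0"
  shows "finite {x :: rat. of_nat m * x \<in> \<int> \<and> a \<le> x \<and> x \<le> b}"
proof -
  have "{x :: rat. of_nat m * x \<in> \<int> \<and> a \<le> x \<and> x \<le> b}
      \<subseteq> (\<lambda>i. of_int i / of_nat m) ` {\<lfloor>of_nat m * a\<rfloor> .. \<lceil>of_nat m * b\<rceil>}"
  proof
    fix x :: rat assume x: "x \<in> {x :: rat. of_nat m * x \<in> \<int> \<and> a \<le> x \<and> x \<le> b}"
    then obtain i where i: "of_nat m * x = of_int i" by (auto elim: Ints_cases)
    have "of_nat m * a \<le> of_nat m * x" "of_nat m * x \<le> of_nat m * b"
      using x assms by (auto intro!: mult_left_mono)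
    then have "i \<in> {\<lfloor>of_nat m * a\<rfloor> .. \<lceil>of_nat m * b\<rceil>}"
      unfolding i by (auto simp: floor_le_iff le_ceiling_iff)
    moreover have "x = of_int i / of_nat m"
      using i assms by (simp add: field_simps)
    ultimately show "x \<in> (\<lambda>i. of_int i / of_nat m) ` {\<lfloor>of_nat m * a\<rfloor> .. \<lceil>of_nat m * b\<rceil>}"
      by blast
  qed
  then show ?thesis by (rule finite_subset) simp
qed

text \<open>Bounding \<gamma> - \<alpha> from below bounds \<alpha> from above, so every coordinate
  of \<alpha> lies in a finite grid, and only the finitely many coordinates in \<open>W\<close> can
  be nonzero.\<close>

lemma finite_bexp_decompositions:
  assumes "finite W" "m > 0"
  shows "finite {\<alpha> \<in> bexp W m N. \<gamma> - \<alpha> \<in> bexp W m N}"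
proof -
  let ?S = "{\<alpha> \<in> bexp W m N. \<gamma> - \<alpha> \<in> bexp W m N}"
  let ?G = "\<lambda>v. {x :: rat. of_nat m * x \<in> \<int> \<and> - of_nat N \<le> x \<and> x \<le> lookup \<gamma> v + of_nat N}"
  have "(\<lambda>\<alpha>. restrict (lookup \<alpha>) W) ` ?S \<subseteq> PiE W ?G"
  proof (intro image_subsetI PiE_I)
    fix \<alpha> v assume a: "\<alpha> \<in> ?S" and v: "v \<in> W"
    have "- of_nat N \<le> lookup (\<gamma> - \<alpha>) v" using a unfolding bexp_def by blast
    then have "lookup \<alpha> v \<le> lookup \<gamma> v + of_nat N"
      by (simp add: lookup_minus)
    then show "restrict (lookup \<alpha>) W v \<in> ?G v"
      using a v by (auto simp: bexp_def)
  qed auto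
  moreover have "finite (PiE W ?G)"
    using assms by (intro finite_PiE finite_rat_grid)
  ultimately have "finite ((\<lambda>\<alpha>. restrict (lookup \<alpha>) W) ` ?S)"
    by (rule finite_subset)
  moreover have "inj_on (\<lambda>\<alpha>. restrict (lookup \<alpha>) W) ?S"
  proof (rule inj_onI)
    fix \<alpha> \<beta> assume ab: "\<alpha> \<in> ?S" "\<beta> \<in> ?S" and eq: "restrict (lookup \<alpha>) W = restrict (lookup \<beta>) W"
    show "\<alpha> = \<beta>"
    proof (rule poly_mapping_eqI)
      fix v show "lookup \<alpha> v = lookup \<beta> v"
      proof (cases "v \<in> W")
        case True then show ?thesis using fun_cong[OF eq, of v] by simp
      next
        case False
        then have "v \<notin> keys \<alpha>" "v \<notin> keys \<beta>" using ab by (auto simp: bexp_def)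
        then show ?thesis by (simp add: in_keys_iff)
      qed
    qed
  qed
  ultimately show ?thesis by (rule finite_imageD)
qed

text \<open>The bounds make products of such series finite sums at every exponent: only finitely many variables
  occur, with bounded denominators and exponents bounded below.\<close>

typedef (overloaded) ('v, 'k) pser =
  "{f :: 'v expo \<Rightarrow> 'k :: zero. \<exists>W m N. finite W \<and> m > 0 \<and> {\<alpha>. f \<alpha> \<noteq> 0} \<subseteq> bexp W m N}"
  morphisms pcoeff Abs_pser
  by (rule exI[of _ "\<lambda>_. 0"]) auto

setup_lifting type_definition_pser

lemma pser_eqI: "(\<And>\<alpha>. pcoeff f \<alpha> = pcoeff g \<alpha>) \<Longrightarrow> f = g"
  by (auto simp: pcoeff_inject[symmetric])

definition psupp :: "('v, 'k :: zero) pser \<Rightarrow> 'v expo set" where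
  "psupp f = {\<alpha>. pcoeff f \<alpha> \<noteq> 0}"

lemma psupp_bexp:
  obtains W m N where "finite W" "m > 0" "psupp f \<subseteq> bexp W m N"
  using pcoeff[of f] that by (auto simp: psupp_def)

lemma psupp_bexp2:
  obtains W m N where "finite W" "m > 0" "psupp f \<subseteq> bexp W m N" "psupp g \<subseteq> bexp W m N"
proof -
  obtain W m N where 1: "finite W" "m > 0" "psupp f \<subseteq> bexp W m N" by (rule psupp_bexp)
  obtain W' m' N' where 2: "finite W'" "m' > 0" "psupp g \<subseteq> bexp W' m' N'" by (rule psupp_bexp)
  show ?thesis
  proof (rule that[of "W \<union> W'" "m * m'" "max N N'"])
    show "psupp f \<subseteq> bexp (W \<union> W') (m * m') (max N N')"
      using 1 bexp_mono[of W "W \<union> W'" m "m * m'" N "max N N'"] by auto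
    show "psupp g \<subseteq> bexp (W \<union> W') (m * m') (max N N')"
      using 2 bexp_mono[of W' "W \<union> W'" m' "m * m'" N' "max N N'"] by auto
  qed (use 1 2 in auto)
qed

lemma psupp_bexp3:
  obtains W m N where "finite W" "m > 0" "psupp f \<subseteq> bexp W m N" "psupp g \<subseteq> bexp W m N"
    "psupp h \<subseteq> bexp W m N"
proof -
  obtain W m N where 1: "finite W" "m > 0" "psupp f \<subseteq> bexp W m N" "psupp g \<subseteq> bexp W m N"
    by (rule psupp_bexp2)
  obtain W' m' N' where 2: "finite W'" "m' > 0" "psupp h \<subseteq> bexp W' m' N'" by (rule psupp_bexp)
  show ?thesis
  proof (rule that[of "W \<union> W'" "m * m'" "max N N'"])
    show "psupp f \<subseteq> bexp (W \<union> W') (m * m') (max N N')" "psupp g \<subseteq> bexp (W \<union> W') (m * m') (max N N')"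
      using 1 bexp_mono[of W "W \<union> W'" m "m * m'" N "max N N'"] by auto
    show "psupp h \<subseteq> bexp (W \<union> W') (m * m') (max N N')"
      using 2 bexp_mono[of W' "W \<union> W'" m' "m * m'" N' "max N N'"] by auto
  qed (use 1 2 in auto)
qed

section \<open>The ring of generalised power series\<close>

instantiation pser :: (type, ab_group_add) ab_group_add
begin
lift_definition zero_pser :: "('a, 'b) pser" is "\<lambda>_. 0" by auto
lift_definition plus_pser :: "('a, 'b) pser \<Rightarrow> ('a, 'b) pser \<Rightarrow> ('a, 'b) pser" is "\<lambda>f g \<alpha>. f \<alpha> + g \<alpha>"
proof -
  fix f g :: "'a expo \<Rightarrow> 'b"
  assume fg: "\<exists>W m N. finite W \<and> m > 0 \<and> {\<alpha>. f \<alpha> \<noteq> 0} \<subseteq> bexp W m N"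
    "\<exists>W m N. finite W \<and> m > 0 \<and> {\<alpha>. g \<alpha> \<noteq> 0} \<subseteq> bexp W m N"
  obtain W m N where *: "finite W" "m > 0" "psupp (Abs_pser f) \<subseteq> bexp W m N" "psupp (Abs_pser g) \<subseteq> bexp W m N"
    by (rule psupp_bexp2)
  moreover have "psupp (Abs_pser f) = {\<alpha>. f \<alpha> \<noteq> 0}" "psupp (Abs_pser g) = {\<alpha>. g \<alpha> \<noteq> 0}"
    using fg by (simp_all add: psupp_def Abs_pser_inverse)
  moreover have "{\<alpha>. f \<alpha> + g \<alpha> \<noteq> 0} \<subseteq> {\<alpha>. f \<alpha> \<noteq> 0} \<union> {\<alpha>. g \<alpha> \<noteq> 0}"
    by auto
  ultimately have "{\<alpha>. f \<alpha> + g \<alpha> \<noteq> 0} \<subseteq> bexp W m N"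
    by blast
  then show "\<exists>W m N. finite W \<and> m > 0 \<and> {\<alpha>. f \<alpha> + g \<alpha> \<noteq> 0} \<subseteq> bexp W m N"
    using * by blast
qed
lift_definition uminus_pser :: "('a, 'b) pser \<Rightarrow> ('a, 'b) pser" is "\<lambda>f \<alpha>. - f \<alpha>" by auto
definition minus_pser :: "('a, 'b) pser \<Rightarrow> ('a, 'b) pser \<Rightarrow> ('a, 'b) pser" where
  "minus_pser f g = f + (- g)"

lemma pcoeff_0 [simp]: "pcoeff (0 :: ('a, 'b) pser) \<alpha> = 0"
  by (simp add: zero_pser.rep_eq)
lemma pcoeff_add [simp]: "pcoeff (f + g) \<alpha> = pcoeff f \<alpha> + pcoeff (g :: ('a, 'b) pser) \<alpha>"
  by (simp add: plus_pser.rep_eq)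
lemma pcoeff_uminus [simp]: "pcoeff (- f) \<alpha> = - pcoeff (f :: ('a, 'b) pser) \<alpha>"
  by (simp add: uminus_pser.rep_eq)

instance
proof
  fix f g h :: "('a, 'b) pser"
  show "f + g + h = f + (g + h)" by (rule pser_eqI) (simp add: add.assoc)
  show "f + g = g + f" by (rule pser_eqI) (simp add: add.commute)
  show "0 + f = f" by (rule pser_eqI) simp
  show "- f + f = 0" by (rule pser_eqI) simp
  show "f - g = f + - g" by (simp add: minus_pser_def)
qed
end

lemma pcoeff_diff [simp]: "pcoeff (f - g) \<alpha> = pcoeff f \<alpha> - pcoeff g \<alpha>"
  unfolding minus_pser_def by (simp del: add_uminus_conv_diff)

definition conv :: "('v expo \<Rightarrow> 'k) \<Rightarrow> ('v expo \<Rightarrow> 'k) \<Rightarrow> 'v expo \<Rightarrow> 'k :: semiring_0" where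
  "conv f g \<gamma> = (\<Sum>\<alpha> | f \<alpha> \<noteq> 0 \<and> g (\<gamma> - \<alpha>) \<noteq> 0. f \<alpha> * g (\<gamma> - \<alpha>))"

lemma conv_eq:
  assumes "finite S" "\<And>\<alpha>. f \<alpha> \<noteq> 0 \<Longrightarrow> g (\<gamma> - \<alpha>) \<noteq> 0 \<Longrightarrow> \<alpha> \<in> S"
  shows "conv f g \<gamma> = (\<Sum>\<alpha>\<in>S. f \<alpha> * g (\<gamma> - \<alpha>))"
  unfolding conv_def by (rule sum.mono_neutral_left) (use assms in auto)

lemma conv_nonzero:
  assumes "conv f g \<gamma> \<noteq> 0"
  obtains \<alpha> \<beta> where "\<gamma> = \<alpha> + \<beta>" "f \<alpha> \<noteq> 0" "g \<beta> \<noteq> 0"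
proof -
  have "\<exists>\<alpha>. f \<alpha> \<noteq> 0 \<and> g (\<gamma> - \<alpha>) \<noteq> 0"
  proof (rule ccontr)
    assume "\<not> ?thesis"
    then have "conv f g \<gamma> = 0" unfolding conv_def by (intro sum.neutral) blast
    with assms show False by contradiction
  qed
  then obtain \<alpha> where "f \<alpha> \<noteq> 0" "g (\<gamma> - \<alpha>) \<noteq> 0" by blast
  then show ?thesis by (intro that[of \<alpha> "\<gamma> - \<alpha>"]) auto
qed

instantiation pser :: (type, comm_ring_1) comm_ring_1
begin
lift_definition one_pser :: "('a, 'b) pser" is "\<lambda>\<alpha>. if \<alpha> = 0 then 1 else 0"
  by (rule exI[of _ "{}"], rule exI[of _ 1], rule exI[of _ 0]) (auto simp: bexp_def)
lift_definition times_pser :: "('a, 'b) pser \<Rightarrow> ('a, 'b) pser \<Rightarrow> ('a, 'b) pser" is conv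
proof -
  fix f g :: "'a expo \<Rightarrow> 'b"
  assume f: "\<exists>W m N. finite W \<and> m > 0 \<and> {\<alpha>. f \<alpha> \<noteq> 0} \<subseteq> bexp W m N"
    and g: "\<exists>W m N. finite W \<and> m > 0 \<and> {\<alpha>. g \<alpha> \<noteq> 0} \<subseteq> bexp W m N"
  obtain W m N where *: "finite W" "m > 0" "psupp (Abs_pser f) \<subseteq> bexp W m N" "psupp (Abs_pser g) \<subseteq> bexp W m N"
    by (rule psupp_bexp2)
  then have 1: "{\<alpha>. f \<alpha> \<noteq> 0} \<subseteq> bexp W m N" "{\<alpha>. g \<alpha> \<noteq> 0} \<subseteq> bexp W m N"
    using f g by (auto simp: psupp_def Abs_pser_inverse)
  have "{\<alpha>. conv f g \<alpha> \<noteq> 0} \<subseteq> bexp W m (N + N)"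
  proof
    fix \<gamma> assume "\<gamma> \<in> {\<alpha>. conv f g \<alpha> \<noteq> 0}"
    then have "conv f g \<gamma> \<noteq> 0" by simp
    then obtain \<alpha> \<beta> where "\<gamma> = \<alpha> + \<beta>" "f \<alpha> \<noteq> 0" "g \<beta> \<noteq> 0" by (rule conv_nonzero)
    then show "\<gamma> \<in> bexp W m (N + N)" using 1 bexp_add[of \<alpha> W m N \<beta> N] by auto
  qed
  then show "\<exists>W m N. finite W \<and> m > 0 \<and> {\<alpha>. conv f g \<alpha> \<noteq> 0} \<subseteq> bexp W m N"
    using * by blast
qed

lemma pcoeff_times_eq:
  fixes f g :: "('a, 'b) pser"
  assumes "finite S" "\<And>\<alpha>. pcoeff f \<alpha> \<noteq> 0 \<Longrightarrow> pcoeff g (\<gamma> - \<alpha>) \<noteq> 0 \<Longrightarrow> \<alpha> \<in> S"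
  shows "pcoeff (f * g) \<gamma> = (\<Sum>\<alpha>\<in>S. pcoeff f \<alpha> * pcoeff g (\<gamma> - \<alpha>))"
  using assms by (simp add: times_pser.rep_eq conv_eq)

lemma pcoeff_times_nonzero:
  fixes f g :: "('a, 'b) pser"
  assumes "pcoeff (f * g) \<gamma> \<noteq> 0"
  obtains \<alpha> \<beta> where "\<gamma> = \<alpha> + \<beta>" "pcoeff f \<alpha> \<noteq> 0" "pcoeff g \<beta> \<noteq> 0"
  using assms unfolding times_pser.rep_eq by (rule conv_nonzero)

instance
proof
  fix f g h :: "('a, 'b) pser"
  obtain W m N where W: "finite W" "m > 0" and fgh: "psupp f \<subseteq> bexp W m N" "psupp g \<subseteq> bexp W m N"
    "psupp h \<subseteq> bexp W m N" by (rule psupp_bexp3)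
  have le: "bexp W m N \<subseteq> bexp W m (N + N)" by (rule bexp_mono) auto
  \<comment> \<open>The doubled bound admits sums of two exponents of the factors. One finite index
    set per \<gamma> then serves all products below, and associativity becomes an exchange of two
    finite sums.\<close>
  define S where "S = (\<lambda>\<gamma>. {\<alpha> \<in> bexp W m (N + N). \<gamma> - \<alpha> \<in> bexp W m (N + N)})"
  have finS: "finite (S \<gamma>)" for \<gamma>
    unfolding S_def using W by (rule finite_bexp_decompositions)
  have in1: "\<alpha> \<in> bexp W m N" if "pcoeff f \<alpha> \<noteq> 0 \<or> pcoeff g \<alpha> \<noteq> 0 \<or> pcoeff h \<alpha> \<noteq> 0" for \<alpha>
    using that fgh by (auto simp: psupp_def)
  have inS: "\<alpha> \<in> S \<gamma>" if "\<alpha> \<in> bexp W m N" "\<gamma> - \<alpha> \<in> bexp W m N" for \<alpha> \<gamma>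
    using that le by (auto simp: S_def)
  show "f * g * h = f * (g * h)"
  proof (rule pser_eqI)
    fix \<gamma>
    have L: "pcoeff (f * g * h) \<gamma> = (\<Sum>\<beta>\<in>S \<gamma>. pcoeff (f * g) \<beta> * pcoeff h (\<gamma> - \<beta>))"
    proof (rule pcoeff_times_eq[OF finS])
      fix \<beta> assume fg: "pcoeff (f * g) \<beta> \<noteq> 0" and h: "pcoeff h (\<gamma> - \<beta>) \<noteq> 0"
      obtain a b where "\<beta> = a + b" "pcoeff f a \<noteq> 0" "pcoeff g b \<noteq> 0"
        by (rule pcoeff_times_nonzero[OF fg])
      then have "\<beta> \<in> bexp W m (N + N)" using in1 bexp_add[of a W m N b N] by simp
      then show "\<beta> \<in> S \<gamma>" using in1 h le by (auto simp: S_def)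
    qed
    have "pcoeff (f * g) \<beta> * pcoeff h (\<gamma> - \<beta>) =
        (\<Sum>\<alpha>\<in>S \<gamma>. pcoeff f \<alpha> * (pcoeff g (\<beta> - \<alpha>) * pcoeff h (\<gamma> - \<beta>)))" for \<beta>
    proof (cases "pcoeff h (\<gamma> - \<beta>) = 0")
      case False
      have "pcoeff (f * g) \<beta> = (\<Sum>\<alpha>\<in>S \<gamma>. pcoeff f \<alpha> * pcoeff g (\<beta> - \<alpha>))"
      proof (rule pcoeff_times_eq[OF finS])
        fix \<alpha> assume a: "pcoeff f \<alpha> \<noteq> 0" "pcoeff g (\<beta> - \<alpha>) \<noteq> 0"
        have "(\<gamma> - \<beta>) + (\<beta> - \<alpha>) \<in> bexp W m (N + N)"
          using False a in1 by (intro bexp_add) auto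
        then show "\<alpha> \<in> S \<gamma>" using a in1 le by (auto simp: S_def)
      qed
      then show ?thesis by (simp add: sum_distrib_right mult.assoc)
    qed auto
    then have "pcoeff (f * g * h) \<gamma> =
        (\<Sum>\<alpha>\<in>S \<gamma>. \<Sum>\<beta>\<in>S \<gamma>. pcoeff f \<alpha> * (pcoeff g (\<beta> - \<alpha>) * pcoeff h (\<gamma> - \<beta>)))"
      unfolding L by (subst sum.swap) simp
    also have "\<dots> = (\<Sum>\<alpha>\<in>S \<gamma>. pcoeff f \<alpha> * pcoeff (g * h) (\<gamma> - \<alpha>))"
    proof (rule sum.cong[OF refl])
      fix \<alpha>
      show "(\<Sum>\<beta>\<in>S \<gamma>. pcoeff f \<alpha> * (pcoeff g (\<beta> - \<alpha>) * pcoeff h (\<gamma> - \<beta>)))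
          = pcoeff f \<alpha> * pcoeff (g * h) (\<gamma> - \<alpha>)"
      proof (cases "pcoeff f \<alpha> = 0")
        case False
        have "pcoeff (g * h) (\<gamma> - \<alpha>) =
            (\<Sum>\<delta>\<in>(\<lambda>\<beta>. \<beta> - \<alpha>) ` S \<gamma>. pcoeff g \<delta> * pcoeff h (\<gamma> - \<alpha> - \<delta>))"
        proof (rule pcoeff_times_eq)
          fix \<delta> assume d: "pcoeff g \<delta> \<noteq> 0" "pcoeff h (\<gamma> - \<alpha> - \<delta>) \<noteq> 0"
          have "\<alpha> + \<delta> \<in> bexp W m (N + N)"
            using False d in1 by (intro bexp_add) auto
          moreover have "\<gamma> - (\<alpha> + \<delta>) \<in> bexp W m N"
            using in1 d(2) by (auto simp: diff_diff_add)
          ultimately have "\<alpha> + \<delta> \<in> S \<gamma>" using le by (auto simp: S_def)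
          then show "\<delta> \<in> (\<lambda>\<beta>. \<beta> - \<alpha>) ` S \<gamma>" by (intro image_eqI[of _ _ "\<alpha> + \<delta>"]) auto
        qed (use finS in auto)
        also have "\<dots> = (\<Sum>\<beta>\<in>S \<gamma>. pcoeff g (\<beta> - \<alpha>) * pcoeff h (\<gamma> - \<beta>))"
          by (subst sum.reindex) (auto simp: inj_on_def)
        finally show ?thesis by (simp add: sum_distrib_left)
      qed auto
    qed
    also have "\<dots> = pcoeff (f * (g * h)) \<gamma>"
    proof (rule pcoeff_times_eq[OF finS, symmetric])
      fix \<alpha> assume a: "pcoeff f \<alpha> \<noteq> 0" "pcoeff (g * h) (\<gamma> - \<alpha>) \<noteq> 0"
      obtain b c where "\<gamma> - \<alpha> = b + c" "pcoeff g b \<noteq> 0" "pcoeff h c \<noteq> 0"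
        by (rule pcoeff_times_nonzero[OF a(2)])
      then have "\<gamma> - \<alpha> \<in> bexp W m (N + N)" using in1 bexp_add[of b W m N c N] by simp
      then show "\<alpha> \<in> S \<gamma>" using in1 a le by (auto simp: S_def)
    qed
    finally show "pcoeff (f * g * h) \<gamma> = pcoeff (f * (g * h)) \<gamma>" .
  qed
  show "f * g = g * f"
  proof (rule pser_eqI)
    fix \<gamma>
    have "pcoeff (f * g) \<gamma> = (\<Sum>\<alpha>\<in>S \<gamma>. pcoeff f \<alpha> * pcoeff g (\<gamma> - \<alpha>))"
      by (rule pcoeff_times_eq[OF finS]) (use in1 inS in auto)
    also have "\<dots> = (\<Sum>\<alpha>\<in>S \<gamma>. pcoeff g \<alpha> * pcoeff f (\<gamma> - \<alpha>))"
      by (rule sum.reindex_bij_witness[of _ "\<lambda>\<alpha>. \<gamma> - \<alpha>" "\<lambda>\<alpha>. \<gamma> - \<alpha>"]) (auto simp: S_def mult.commute)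
    also have "\<dots> = pcoeff (g * f) \<gamma>"
      by (rule pcoeff_times_eq[OF finS, symmetric]) (use in1 inS in auto)
    finally show "pcoeff (f * g) \<gamma> = pcoeff (g * f) \<gamma>" .
  qed
  show "1 * f = f"
  proof (rule pser_eqI)
    fix \<gamma>
    have "pcoeff (1 * f) \<gamma> = (\<Sum>\<alpha>\<in>{0}. pcoeff 1 \<alpha> * pcoeff f (\<gamma> - \<alpha>))"
      by (rule pcoeff_times_eq) (auto simp: one_pser.rep_eq split: if_splits)
    then show "pcoeff (1 * f) \<gamma> = pcoeff f \<gamma>" by (simp add: one_pser.rep_eq)
  qed
  show "(f + g) * h = f * h + g * h"
  proof (rule pser_eqI)
    fix \<gamma>
    have "pcoeff ((f + g) * h) \<gamma> = (\<Sum>\<alpha>\<in>S \<gamma>. pcoeff (f + g) \<alpha> * pcoeff h (\<gamma> - \<alpha>))"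
    proof (rule pcoeff_times_eq[OF finS])
      fix \<alpha> assume a: "pcoeff (f + g) \<alpha> \<noteq> 0" "pcoeff h (\<gamma> - \<alpha>) \<noteq> 0"
      then have "pcoeff f \<alpha> \<noteq> 0 \<or> pcoeff g \<alpha> \<noteq> 0" by auto
      then show "\<alpha> \<in> S \<gamma>" using in1 a by (intro inS) blast+
    qed
    moreover have "pcoeff (f * h) \<gamma> = (\<Sum>\<alpha>\<in>S \<gamma>. pcoeff f \<alpha> * pcoeff h (\<gamma> - \<alpha>))"
      by (rule pcoeff_times_eq[OF finS]) (use in1 inS in auto)
    moreover have "pcoeff (g * h) \<gamma> = (\<Sum>\<alpha>\<in>S \<gamma>. pcoeff g \<alpha> * pcoeff h (\<gamma> - \<alpha>))"
      by (rule pcoeff_times_eq[OF finS]) (use in1 inS in auto)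
    ultimately show "pcoeff ((f + g) * h) \<gamma> = pcoeff (f * h + g * h) \<gamma>"
      by (simp add: distrib_right sum.distrib)
  qed
  show "(0 :: ('a, 'b) pser) \<noteq> 1"
  proof
    assume "(0 :: ('a, 'b) pser) = 1"
    then have "pcoeff (0 :: ('a, 'b) pser) 0 = pcoeff 1 0" by simp
    then show False by (simp add: one_pser.rep_eq)
  qed
qed
end

lemma pcoeff_1: "pcoeff 1 \<alpha> = (if \<alpha> = 0 then 1 else 0)"
  by (simp add: one_pser.rep_eq)

text \<open>The order on exponents is lexicographic, decided at the least variable where they
  differ. Each coordinate ranges over a discrete set bounded below, so its minimum can be selected
  one variable at a time, the least variable first; hence the induction that removes the minimum of
  \<open>W\<close>.\<close>

lemma bexp_has_least:
  fixes S :: "('v :: linorder) expo set"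
  assumes "finite W" "m > 0" "S \<subseteq> bexp W m N" "S \<noteq> {}"
  shows "\<exists>\<alpha>\<in>S. \<forall>\<beta>\<in>S. \<alpha> \<le> \<beta>"
  using assms(1,3,4)
proof (induction W arbitrary: S rule: finite_linorder_min_induct)
  case empty
  then obtain \<alpha> where "\<alpha> \<in> S" by blast
  moreover have "\<beta> = 0" if "\<beta> \<in> S" for \<beta>
    using that empty by (auto simp: bexp_def)
  ultimately show ?case by (intro bexI[of _ \<alpha>]) auto
next
  case (insert w W)
  \<comment> \<open>Clearing the denominator and shifting by the lower bound turns the coordinate at
    \<open>w\<close> into a natural number, where minima exist.\<close>
  define h where "h = (\<lambda>\<alpha> :: 'v expo. nat \<lfloor>of_nat m * (lookup \<alpha> w + of_nat N)\<rfloor>)"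
  have h: "of_nat (h \<alpha>) = of_nat m * (lookup \<alpha> w + of_nat N)" if "\<alpha> \<in> S" for \<alpha>
  proof -
    have a: "\<alpha> \<in> bexp (insert w W) m N" using that insert by blast
    have "of_nat m * (lookup \<alpha> w + of_nat N) = of_nat m * lookup \<alpha> w + of_nat (m * N)"
      by (simp add: distrib_left)
    also have "\<dots> \<in> \<int>"
      by (rule Ints_add) (use a in \<open>auto simp: bexp_def simp del: of_nat_mult\<close>)
    finally have i: "of_nat m * (lookup \<alpha> w + of_nat N) \<in> \<int>" .
    have "- of_nat N \<le> lookup \<alpha> w" using a by (auto simp: bexp_def)
    then have "0 \<le> of_nat m * (lookup \<alpha> w + of_nat N)" by (intro mult_nonneg_nonneg) auto
    with i show ?thesis by (auto simp: h_def elim!: Ints_cases)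
  qed
  obtain \<alpha>0 where a0: "\<alpha>0 \<in> S" "\<And>\<beta>. \<beta> \<in> S \<Longrightarrow> h \<alpha>0 \<le> h \<beta>"
    using insert.prems(2) ex_has_least_nat[of "\<lambda>\<alpha>. \<alpha> \<in> S" _ h] by blast
  have min: "lookup \<alpha>0 w \<le> lookup \<beta> w" if "\<beta> \<in> S" for \<beta>
  proof -
    have "(of_nat (h \<alpha>0) :: rat) \<le> of_nat (h \<beta>)" using a0(2)[OF that] by simp
    then show ?thesis using h[OF that] h[OF a0(1)] assms(2) by simp
  qed
  define c where "c = lookup \<alpha>0 w"
  define S' where "S' = {\<alpha> \<in> S. lookup \<alpha> w = c}"
  \<comment> \<open>On \<open>S'\<close> the coordinate at \<open>w\<close> is constantly
    \<open>c\<close>; removing it leaves exponents supported in \<open>W\<close>, to which the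
    induction hypothesis applies.\<close>
  define t where "t = (\<lambda>\<alpha> :: 'v expo. \<alpha> - Poly_Mapping.single w c)"
  have lt: "lookup (t \<alpha>) v = (if v = w then lookup \<alpha> w - c else lookup \<alpha> v)" for \<alpha> v
    by (auto simp: t_def lookup_minus lookup_single when_def)
  have "t ` S' \<subseteq> bexp W m N"
  proof
    fix \<beta> assume "\<beta> \<in> t ` S'"
    then obtain \<alpha> where a: "\<alpha> \<in> S" "lookup \<alpha> w = c" "\<beta> = t \<alpha>" by (auto simp: S'_def)
    have b: "\<alpha> \<in> bexp (insert w W) m N" using a insert by blast
    have "keys \<beta> \<subseteq> W"
    proof
      fix v assume "v \<in> keys \<beta>"
      then have "v \<noteq> w" "v \<in> keys \<alpha>" using lt[of \<alpha> v] a by (auto simp: in_keys_iff split: if_splits)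
      then show "v \<in> W" using b by (auto simp: bexp_def)
    qed
    then show "\<beta> \<in> bexp W m N" using b lt a by (auto simp: bexp_def)
  qed
  moreover have "t ` S' \<noteq> {}" using a0 by (auto simp: S'_def c_def)
  ultimately obtain \<alpha> where al: "\<alpha> \<in> S'" "\<And>\<beta>. \<beta> \<in> S' \<Longrightarrow> t \<alpha> \<le> t \<beta>"
    using insert.IH[of "t ` S'"] by blast
  have "\<alpha> \<le> \<beta>" if b: "\<beta> \<in> S" for \<beta>
  proof (cases "\<beta> \<in> S'")
    case True
    then have "t \<alpha> + Poly_Mapping.single w c \<le> t \<beta> + Poly_Mapping.single w c"
      using al(2) by (intro add_right_mono)
    then show ?thesis by (simp add: t_def)
  next
    case False
    then have "lookup \<alpha> w < lookup \<beta> w" using b min[OF b] al(1) by (auto simp: S'_def c_def)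
    moreover have "lookup \<alpha> v = lookup \<beta> v" if "v < w" for v
    proof -
      have "v \<notin> insert w W" using that insert.hyps by auto
      then have "v \<notin> keys \<alpha>" "v \<notin> keys \<beta>"
        using insert.prems(1) b al(1) by (auto simp: bexp_def S'_def)
      then show ?thesis by (simp add: in_keys_iff)
    qed
    ultimately have "\<alpha> < \<beta>" by (auto simp: less_poly_mapping.rep_eq less_fun_def)
    then show ?thesis by simp
  qed
  moreover have "\<alpha> \<in> S" using al by (auto simp: S'_def)
  ultimately show ?case by blast
qed

section \<open>Leading exponents and coefficients of series\<close>

definition pdeg :: "('v :: linorder, 'k :: zero) pser \<Rightarrow> 'v expo" where
  "pdeg f = Least (\<lambda>\<alpha>. \<alpha> \<in> psupp f)"

lemma psupp_empty_iff: "psupp f = {} \<longleftrightarrow> f = (0 :: ('v, 'k :: ab_group_add) pser)"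
  by (auto simp: psupp_def intro: pser_eqI)

lemma
  fixes f :: "('v :: linorder, 'k :: ab_group_add) pser"
  assumes "f \<noteq> 0"
  shows pdeg_in: "pcoeff f (pdeg f) \<noteq> 0"
    and pdeg_le: "pcoeff f \<beta> \<noteq> 0 \<Longrightarrow> pdeg f \<le> \<beta>"
proof -
  obtain W m N where "finite W" "m > 0" "psupp f \<subseteq> bexp W m N" by (rule psupp_bexp)
  then obtain \<alpha> where a: "\<alpha> \<in> psupp f" "\<forall>\<beta>\<in>psupp f. \<alpha> \<le> \<beta>"
    using bexp_has_least[of W m "psupp f" N] assms psupp_empty_iff[of f] by blast
  then have "pdeg f = \<alpha>" unfolding pdeg_def by (intro Least_equality) auto
  then show "pcoeff f (pdeg f) \<noteq> 0" "pcoeff f \<beta> \<noteq> 0 \<Longrightarrow> pdeg f \<le> \<beta>"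
    using a by (auto simp: psupp_def)
qed

lemma pdeg_eqI:
  fixes f :: "('v :: linorder, 'k :: ab_group_add) pser"
  assumes "pcoeff f \<alpha> \<noteq> 0" "\<And>\<beta>. pcoeff f \<beta> \<noteq> 0 \<Longrightarrow> \<alpha> \<le> \<beta>"
  shows "pdeg f = \<alpha>"
  unfolding pdeg_def psupp_def by (rule Least_equality) (use assms in auto)

text \<open>Both leading exponents are minima, so no other pair of exponents with nonzero
  coefficients has the same sum.\<close>

lemma pcoeff_times_lead:
  fixes f g :: "('v :: linorder, 'k :: comm_ring_1) pser"
  assumes "f \<noteq> 0" "g \<noteq> 0"
  shows "pcoeff (f * g) (pdeg f + pdeg g) = pcoeff f (pdeg f) * pcoeff g (pdeg g)"
proof -
  have "pcoeff (f * g) (pdeg f + pdeg g) = (\<Sum>\<alpha>\<in>{pdeg f}. pcoeff f \<alpha> * pcoeff g (pdeg f + pdeg g - \<alpha>))"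
  proof (rule pcoeff_times_eq)
    fix \<alpha> assume a: "pcoeff f \<alpha> \<noteq> 0" "pcoeff g (pdeg f + pdeg g - \<alpha>) \<noteq> 0"
    have 1: "pdeg f \<le> \<alpha>" "pdeg g \<le> pdeg f + pdeg g - \<alpha>"
      using pdeg_le[OF assms(1) a(1)] pdeg_le[OF assms(2) a(2)] by auto
    have "\<alpha> + pdeg g \<le> pdeg f + pdeg g"
      using add_left_mono[OF 1(2), of \<alpha>] by simp
    then show "\<alpha> \<in> {pdeg f}" using 1(1) by simp
  qed auto
  then show ?thesis by simp
qed

lemma pcoeff_times_below:
  fixes f g :: "('v :: linorder, 'k :: comm_ring_1) pser"
  assumes "pcoeff (f * g) \<gamma> \<noteq> 0"
  shows "pdeg f + pdeg g \<le> \<gamma>"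
proof -
  obtain a b where ab: "\<gamma> = a + b" "pcoeff f a \<noteq> 0" "pcoeff g b \<noteq> 0"
    using assms by (rule pcoeff_times_nonzero)
  then have "f \<noteq> 0" "g \<noteq> 0" by auto
  then show ?thesis using ab by (auto intro!: add_mono pdeg_le)
qed

instance pser :: (linorder, idom) idom
proof
  fix f g :: "('a, 'b) pser" assume fg: "f \<noteq> 0" "g \<noteq> 0"
  then have "pcoeff (f * g) (pdeg f + pdeg g) \<noteq> 0"
    by (simp add: pcoeff_times_lead pdeg_in)
  then show "f * g \<noteq> 0" by auto
qed

definition plc :: "('v :: linorder, 'k :: zero) pser \<Rightarrow> 'k" where
  "plc f = pcoeff f (pdeg f)"

lemma
  fixes f g :: "('v :: linorder, 'k :: idom) pser"
  assumes "f \<noteq> 0" "g \<noteq> 0"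
  shows pdeg_mult: "pdeg (f * g) = pdeg f + pdeg g"
    and plc_mult: "plc (f * g) = plc f * plc g"
proof -
  show "pdeg (f * g) = pdeg f + pdeg g"
    by (rule pdeg_eqI) (use assms in \<open>simp_all add: pcoeff_times_lead pdeg_in pcoeff_times_below\<close>)
  then show "plc (f * g) = plc f * plc g"
    using assms by (simp add: plc_def pcoeff_times_lead)
qed

lemma single_exponent_bexp:
  fixes c :: "'k :: zero" and \<alpha> :: "'v expo"
  shows "\<exists>W m N. finite W \<and> m > 0 \<and> {\<beta>. (if \<beta> = \<alpha> then c else 0) \<noteq> 0} \<subseteq> bexp W m N"
proof -
  define m where "m = (\<Prod>v\<in>keys \<alpha>. nat (snd (quotient_of (lookup \<alpha> v))))"
  define N where "N = (\<Sum>v\<in>keys \<alpha>. nat \<lceil>- lookup \<alpha> v\<rceil>)"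
  have dpos: "snd (quotient_of (lookup \<alpha> v)) > 0" for v by (rule quotient_of_denom_pos')
  have "m > 0" unfolding m_def by (intro prod_pos) (use dpos in auto)
  have "\<alpha> \<in> bexp (keys \<alpha>) m N"
  proof -
    have "of_nat m * lookup \<alpha> v \<in> \<int> \<and> - of_nat N \<le> lookup \<alpha> v" for v
    proof (cases "v \<in> keys \<alpha>")
      case True
      let ?d = "snd (quotient_of (lookup \<alpha> v))"
      have "nat ?d dvd m" unfolding m_def using True by (intro dvd_prodI) auto
      then obtain k where k: "m = nat ?d * k" by auto
      have q: "lookup \<alpha> v = of_int (fst (quotient_of (lookup \<alpha> v))) / of_int ?d"
        by (metis prod.collapse quotient_of_div)
      have "of_nat (nat ?d) * lookup \<alpha> v = of_int (fst (quotient_of (lookup \<alpha> v)))"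
        using dpos[of v] by (subst q) (simp add: of_nat_nat)
      then have "of_nat m * lookup \<alpha> v = of_nat k * of_int (fst (quotient_of (lookup \<alpha> v)))"
        by (simp add: k mult_ac)
      then have 1: "of_nat m * lookup \<alpha> v \<in> \<int>" by simp
      have "nat \<lceil>- lookup \<alpha> v\<rceil> \<le> N" unfolding N_def using True by (intro member_le_sum) auto
      then have "of_nat (nat \<lceil>- lookup \<alpha> v\<rceil>) \<le> (of_nat N :: rat)" by simp
      moreover have "- lookup \<alpha> v \<le> of_nat (nat \<lceil>- lookup \<alpha> v\<rceil>)" by (rule of_nat_ceiling)
      ultimately show ?thesis using 1 by linarith
    qed (simp add: in_keys_iff)
    then show ?thesis by (auto simp: bexp_def)
  qed
  then show "\<exists>W m N. finite W \<and> m > 0 \<and> {\<beta>. (if \<beta> = \<alpha> then c else 0) \<noteq> 0} \<subseteq> bexp W m N"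
    using \<open>m > 0\<close> by (intro exI[of _ "keys \<alpha>"] exI[of _ m] exI[of _ N]) auto
qed

definition pmono :: "'k \<Rightarrow> 'v expo \<Rightarrow> ('v, 'k :: zero) pser" where
  "pmono c \<alpha> = Abs_pser (\<lambda>\<beta>. if \<beta> = \<alpha> then c else 0)"

lemma pcoeff_pmono: "pcoeff (pmono c \<alpha>) \<beta> = (if \<beta> = \<alpha> then c else 0)"
  unfolding pmono_def by (subst Abs_pser_inverse) (use single_exponent_bexp in blast)+

lemma pmono_mult: "pmono c \<alpha> * pmono d \<beta> = pmono (c * d :: 'k :: comm_ring_1) (\<alpha> + \<beta>)"
proof (rule pser_eqI)
  fix \<gamma>
  have "pcoeff (pmono c \<alpha> * pmono d \<beta>) \<gamma> = (\<Sum>\<delta>\<in>{\<alpha>}. pcoeff (pmono c \<alpha>) \<delta> * pcoeff (pmono d \<beta>) (\<gamma> - \<delta>))"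
    by (rule pcoeff_times_eq) (auto simp: pcoeff_pmono split: if_splits)
  then show "pcoeff (pmono c \<alpha> * pmono d \<beta>) \<gamma> = pcoeff (pmono (c * d) (\<alpha> + \<beta>)) \<gamma>"
    by (auto simp: pcoeff_pmono algebra_simps)
qed

lemma pmono_add: "pmono (c + d) \<alpha> = pmono c \<alpha> + pmono (d :: 'k :: ab_group_add) \<alpha>"
  by (rule pser_eqI) (auto simp: pcoeff_pmono)

lemma pmono_1_0: "pmono 1 0 = (1 :: ('v, 'k :: comm_ring_1) pser)"
  by (rule pser_eqI) (auto simp: pcoeff_pmono pcoeff_1)

lemma pmono_eq_0_iff: "pmono c \<alpha> = (0 :: ('v, 'k :: ab_group_add) pser) \<longleftrightarrow> c = 0"
proof
  assume "pmono c \<alpha> = (0 :: ('v, 'k) pser)"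
  then have "pcoeff (pmono c \<alpha>) \<alpha> = 0" by simp
  then show "c = 0" by (simp add: pcoeff_pmono)
qed (auto intro!: pser_eqI simp: pcoeff_pmono)

lemma pdeg_pmono: "c \<noteq> 0 \<Longrightarrow> pdeg (pmono (c :: 'k :: ab_group_add) \<alpha>) = \<alpha>"
  by (rule pdeg_eqI) (auto simp: pcoeff_pmono split: if_splits)

lemma plc_pmono: "c \<noteq> 0 \<Longrightarrow> plc (pmono (c :: 'k :: ab_group_add) \<alpha>) = c"
  by (simp add: plc_def pdeg_pmono pcoeff_pmono)

section \<open>Subfields generated by sets, finite extensions and Kummer extensions\<close>

abbreviation coeff :: "'a::zero poly \<Rightarrow> nat \<Rightarrow> 'a" where "coeff \<equiv> Polynomial.coeff"
abbreviation degree :: "'a::zero poly \<Rightarrow> nat" where "degree \<equiv> Polynomial.degree"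
abbreviation monom :: "'a::zero \<Rightarrow> nat \<Rightarrow> 'a poly" where "monom \<equiv> Polynomial.monom"

text \<open>Subfields are sets inside one ambient field type. Since \<open>inverse 0 = 0\<close>,
  closure under \<open>inverse\<close> can be demanded without excluding 0.\<close>

definition is_subfield :: "'a :: field set \<Rightarrow> bool" where
  "is_subfield F \<longleftrightarrow> 0 \<in> F \<and> 1 \<in> F \<and> (\<forall>x\<in>F. \<forall>y\<in>F. x + y \<in> F \<and> x * y \<in> F) \<and>
     (\<forall>x\<in>F. - x \<in> F \<and> inverse x \<in> F)"

lemma is_subfieldI:
  assumes "0 \<in> F" "1 \<in> F" "\<And>x y. x \<in> F \<Longrightarrow> y \<in> F \<Longrightarrow> x + y \<in> F"
    "\<And>x y. x \<in> F \<Longrightarrow> y \<in> F \<Longrightarrow> x * y \<in> F" "\<And>x. x \<in> F \<Longrightarrow> - x \<in> F" "\<And>x. x \<in> F \<Longrightarrow> inverse x \<in> F"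
  shows "is_subfield F"
  using assms by (auto simp: is_subfield_def)

context
  fixes F :: "'a :: field set"
  assumes F: "is_subfield F"
begin

lemma subfield_0: "0 \<in> F" and subfield_1: "1 \<in> F"
  and subfield_add: "x \<in> F \<Longrightarrow> y \<in> F \<Longrightarrow> x + y \<in> F"
  and subfield_mult: "x \<in> F \<Longrightarrow> y \<in> F \<Longrightarrow> x * y \<in> F"
  and subfield_uminus: "x \<in> F \<Longrightarrow> - x \<in> F"
  and subfield_inverse: "x \<in> F \<Longrightarrow> inverse x \<in> F"
  using F by (auto simp: is_subfield_def)

lemma subfield_diff: "x \<in> F \<Longrightarrow> y \<in> F \<Longrightarrow> x - y \<in> F"
  using subfield_add[of x "- y"] subfield_uminus by simp

lemma subfield_divide: "x \<in> F \<Longrightarrow> y \<in> F \<Longrightarrow> x / y \<in> F"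
  by (simp add: divide_inverse subfield_mult subfield_inverse)

lemma subfield_power: "x \<in> F \<Longrightarrow> x ^ n \<in> F"
  by (induction n) (auto intro: subfield_1 subfield_mult)

lemma subfield_sum: "(\<And>i. i \<in> A \<Longrightarrow> f i \<in> F) \<Longrightarrow> sum f A \<in> F"
  by (induction A rule: infinite_finite_induct) (auto intro: subfield_0 subfield_add)

lemma subfield_prod: "(\<And>i. i \<in> A \<Longrightarrow> f i \<in> F) \<Longrightarrow> prod f A \<in> F"
  by (induction A rule: infinite_finite_induct) (auto intro: subfield_1 subfield_mult)

text \<open>By Bezout \<open>z\<close> is a quotient of powers of \<open>z ^ a\<close> and
  \<open>z ^ b\<close>. In the Kummer arguments this recovers \<open>z\<close> from any power of
  \<open>z\<close> with exponent prime to \<open>q\<close>.\<close>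

lemma subfield_coprime_powers:
  assumes "z \<noteq> 0" "z ^ a \<in> F" "z ^ b \<in> F" "coprime a b"
  shows "z \<in> F"
proof (cases "a = 0")
  case True
  then show ?thesis using assms by simp
next
  case False
  obtain x y where xy: "a * x = b * y + gcd a b" using bezout_nat[OF False] by blast
  have "z ^ (a * x) = z ^ (b * y) * z" using xy assms(4) by simp
  then have "z = (z ^ a) ^ x / (z ^ b) ^ y" using assms(1) by (simp add: power_mult field_simps)
  then show ?thesis using assms by (metis subfield_divide subfield_power)
qed

end

text \<open>In particular \<open>gf {}\<close> is the prime field, and
  \<open>gf (insert z F)\<close> is the simple extension F(z) of a subfield F.\<close>

definition gf :: "'a :: field set \<Rightarrow> 'a set" where
  "gf S = \<Inter> {F. is_subfield F \<and> S \<subseteq> F}"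

lemma is_subfield_gf [simp]: "is_subfield (gf S)"
  unfolding gf_def is_subfield_def by blast

lemma gf_superset: "S \<subseteq> gf S" and gf_least: "is_subfield F \<Longrightarrow> S \<subseteq> F \<Longrightarrow> gf S \<subseteq> F"
  unfolding gf_def by blast+

lemma gf_in: "x \<in> S \<Longrightarrow> x \<in> gf S"
  using gf_superset by blast

lemma gf_mono: "S \<subseteq> T \<Longrightarrow> gf S \<subseteq> gf T"
  unfolding gf_def by blast

lemma gf_subfield: "is_subfield F \<Longrightarrow> gf F = F"
  using gf_superset gf_least[of F F] by blast

lemma gf_Un_gf: "gf (gf S \<union> T) = gf (S \<union> T)"
proof
  show "gf (gf S \<union> T) \<subseteq> gf (S \<union> T)"
    by (rule gf_least) (use gf_mono[of S "S \<union> T"] gf_superset[of "S \<union> T"] in auto)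
  show "gf (S \<union> T) \<subseteq> gf (gf S \<union> T)"
    by (rule gf_mono) (use gf_superset[of S] in auto)
qed

lemma is_subfield_directed_union:
  assumes "\<And>i. i \<in> I \<Longrightarrow> is_subfield (F i)" "I \<noteq> {}"
    and "\<And>i j. i \<in> I \<Longrightarrow> j \<in> I \<Longrightarrow> \<exists>k\<in>I. F i \<subseteq> F k \<and> F j \<subseteq> F k"
  shows "is_subfield (\<Union>i\<in>I. F i)"
proof -
  obtain i0 where i0: "i0 \<in> I" using assms(2) by blast
  show ?thesis
  proof (rule is_subfieldI)
    show "0 \<in> (\<Union>i\<in>I. F i)" "1 \<in> (\<Union>i\<in>I. F i)"
      using i0 subfield_0[OF assms(1)] subfield_1[OF assms(1)] by auto
  next
    fix x y assume "x \<in> (\<Union>i\<in>I. F i)" "y \<in> (\<Union>i\<in>I. F i)"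
    then obtain i j where "i \<in> I" "x \<in> F i" "j \<in> I" "y \<in> F j" by blast
    then obtain k where "k \<in> I" "x \<in> F k" "y \<in> F k" using assms(3) by blast
    then show "x + y \<in> (\<Union>i\<in>I. F i)" "x * y \<in> (\<Union>i\<in>I. F i)"
      using subfield_add[OF assms(1), of k x y] subfield_mult[OF assms(1), of k x y] by auto
  next
    fix x assume "x \<in> (\<Union>i\<in>I. F i)"
    then obtain k where "k \<in> I" "x \<in> F k" by blast
    then show "- x \<in> (\<Union>i\<in>I. F i)" "inverse x \<in> (\<Union>i\<in>I. F i)"
      using subfield_uminus[OF assms(1), of k x] subfield_inverse[OF assms(1), of k x] by auto
  qed
qed

section \<open>Polynomials over a subfield and simple extensions\<close>

definition polys :: "'a :: field set \<Rightarrow> 'a poly set" where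
  "polys F = {p. \<forall>i. coeff p i \<in> F}"

lemma polys_coeff: "p \<in> polys F \<Longrightarrow> coeff p i \<in> F"
  by (simp add: polys_def)

context
  fixes F :: "'a :: field set"
  assumes F: "is_subfield F"
begin

lemma polys_0: "0 \<in> polys F" and polys_1: "1 \<in> polys F"
  by (auto simp: polys_def subfield_0[OF F] subfield_1[OF F] coeff_1)

lemma polys_add: "p \<in> polys F \<Longrightarrow> q \<in> polys F \<Longrightarrow> p + q \<in> polys F"
  by (auto simp: polys_def intro: subfield_add[OF F])

lemma polys_diff: "p \<in> polys F \<Longrightarrow> q \<in> polys F \<Longrightarrow> p - q \<in> polys F"
  by (auto simp: polys_def intro: subfield_diff[OF F])

lemma polys_uminus: "p \<in> polys F \<Longrightarrow> - p \<in> polys F"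
  by (auto simp: polys_def intro: subfield_uminus[OF F])

lemma polys_mult: "p \<in> polys F \<Longrightarrow> q \<in> polys F \<Longrightarrow> p * q \<in> polys F"
  by (auto simp: polys_def coeff_mult intro!: subfield_sum[OF F] subfield_mult[OF F])

lemma polys_smult: "c \<in> F \<Longrightarrow> q \<in> polys F \<Longrightarrow> smult c q \<in> polys F"
  by (auto simp: polys_def intro!: subfield_mult[OF F])

lemma polys_monom: "c \<in> F \<Longrightarrow> monom c n \<in> polys F"
  by (auto simp: polys_def subfield_0[OF F])

lemma polys_const: "c \<in> F \<Longrightarrow> [:c:] \<in> polys F"
  using polys_monom[of c 0] by (simp add: monom_0)

lemma polys_power: "p \<in> polys F \<Longrightarrow> p ^ n \<in> polys F"
  by (induction n) (auto intro: polys_1 polys_mult)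

lemma polys_sum: "(\<And>i. i \<in> A \<Longrightarrow> f i \<in> polys F) \<Longrightarrow> sum f A \<in> polys F"
  by (induction A rule: infinite_finite_induct) (auto intro: polys_0 polys_add)

lemma polys_prod: "(\<And>i. i \<in> A \<Longrightarrow> f i \<in> polys F) \<Longrightarrow> prod f A \<in> polys F"
  by (induction A rule: infinite_finite_induct) (auto intro: polys_1 polys_mult)

lemma poly_in_subfield: "p \<in> polys F \<Longrightarrow> x \<in> F \<Longrightarrow> poly p x \<in> F"
  by (auto simp: poly_altdef polys_def intro!: subfield_sum[OF F] subfield_mult[OF F] subfield_power[OF F])

text \<open>Long division performs only field operations on the coefficients, so quotient and
  remainder stay over \<open>F\<close>.\<close>

lemma polys_division:
  assumes "a \<in> polys F" "b \<in> polys F" "b \<noteq> 0"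
  shows "\<exists>q r. q \<in> polys F \<and> r \<in> polys F \<and> a = b * q + r \<and> (r = 0 \<or> degree r < degree b)"
  using assms(1)
proof (induction "degree a" arbitrary: a rule: less_induct)
  case less
  show ?case
  proof (cases "a = 0 \<or> degree a < degree b")
    case True
    then show ?thesis using less.prems by (intro exI[of _ 0] exI[of _ a]) (auto simp: polys_0)
  next
    case False
    define c where "c = monom (lead_coeff a / lead_coeff b) (degree a - degree b)"
    have c: "c \<in> polys F" unfolding c_def
      using less.prems assms(2) by (intro polys_monom subfield_divide[OF F]) (auto simp: polys_def)
    define a' where "a' = a - b * c"
    have a': "a' \<in> polys F" unfolding a'_def using less.prems assms(2) c by (intro polys_diff polys_mult)
    have c0: "c \<noteq> 0" using False assms(3) by (simp add: c_def)
    have dbc: "degree (b * c) = degree a"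
      using False assms(3) c0 by (simp add: degree_mult_eq) (simp add: c_def degree_monom_eq)
    have "coeff (b * c) (degree a) = lead_coeff a"
    proof -
      have "lead_coeff c = lead_coeff a / lead_coeff b"
        using False assms(3) by (simp add: c_def degree_monom_eq)
      then have "lead_coeff (b * c) = lead_coeff a" using assms(3) by (simp add: lead_coeff_mult)
      then show ?thesis by (simp only: dbc)
    qed
    then have ca: "coeff a' (degree a) = 0" by (simp add: a'_def)
    have "degree a' \<le> degree a" unfolding a'_def using degree_diff_le_max[of a "b * c"] dbc by simp
    show ?thesis
    proof (cases "a' = 0")
      case True
      then show ?thesis using c
        by (intro exI[of _ c] exI[of _ 0]) (auto simp: a'_def polys_0)
    next
      case a'0: False
      then have "degree a' < degree a"
        using ca \<open>degree a' \<le> degree a\<close> by (metis le_neq_implies_less leading_coeff_0_iff)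
      then obtain q r where "q \<in> polys F" "r \<in> polys F" "a' = b * q + r" "r = 0 \<or> degree r < degree b"
        using less.hyps a' by blast
      then show ?thesis using c
        by (intro exI[of _ "q + c"] exI[of _ r]) (auto simp: a'_def algebra_simps intro: polys_add)
    qed
  qed
qed

lemma gf_insert_eq:
  "gf (insert z F) = {poly p z / poly r z | p r. p \<in> polys F \<and> r \<in> polys F \<and> poly r z \<noteq> 0}"
    (is "_ = ?R")
proof
  have X: "[:0, 1:] \<in> polys F"
    using polys_monom[of 1 1] subfield_1[OF F] by (simp add: monom_altdef)
  show "gf (insert z F) \<subseteq> ?R"
  proof (rule gf_least)
    show "insert z F \<subseteq> ?R"
    proof
      fix x assume "x \<in> insert z F"
      then consider "x = z" | "x \<in> F" by blast
      then show "x \<in> ?R"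
      proof cases
        case 1
        then have "x = poly [:0, 1:] z / poly 1 z" by simp
        then show ?thesis using X polys_1 by fastforce
      next
        case 2
        then have "x = poly [:x:] z / poly 1 z" by simp
        then show ?thesis using polys_const[OF 2] polys_1 by fastforce
      qed
    qed
    show "is_subfield ?R"
    proof (rule is_subfieldI)
      show "0 \<in> ?R" by (intro CollectI exI[of _ 0] exI[of _ 1]) (auto simp: polys_0 polys_1)
      show "1 \<in> ?R" by (intro CollectI exI[of _ 1] exI[of _ 1]) (auto simp: polys_0 polys_1)
    next
      fix x y assume "x \<in> ?R" "y \<in> ?R"
      then obtain p r p' r' where *: "x = poly p z / poly r z" "y = poly p' z / poly r' z"
        "p \<in> polys F" "r \<in> polys F" "p' \<in> polys F" "r' \<in> polys F" "poly r z \<noteq> 0" "poly r' z \<noteq> 0"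
        by blast
      show "x + y \<in> ?R"
        by (intro CollectI exI[of _ "p * r' + p' * r"] exI[of _ "r * r'"])
          (use * in \<open>simp add: polys_add polys_mult add_frac_eq\<close>)
      show "x * y \<in> ?R"
        by (intro CollectI exI[of _ "p * p'"] exI[of _ "r * r'"])
          (use * in \<open>auto simp: polys_mult\<close>)
    next
      fix x assume "x \<in> ?R"
      then obtain p r where *: "x = poly p z / poly r z" "p \<in> polys F" "r \<in> polys F" "poly r z \<noteq> 0"
        by blast
      show "- x \<in> ?R"
        by (intro CollectI exI[of _ "- p"] exI[of _ r]) (use * in \<open>auto simp: polys_uminus\<close>)
      show "inverse x \<in> ?R"
      proof (cases "poly p z = 0")
        case True
        then have "x = 0" using * by simp
        then show ?thesis by (intro CollectI exI[of _ 0] exI[of _ 1]) (auto simp: polys_0 polys_1)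
      next
        case False
        then show ?thesis by (intro CollectI exI[of _ r] exI[of _ p]) (use * in auto)
      qed
    qed
  qed
  show "?R \<subseteq> gf (insert z F)"
  proof
    fix x assume "x \<in> ?R"
    then obtain p r where *: "x = poly p z / poly r z" "p \<in> polys F" "r \<in> polys F" by blast
    have "poly s z \<in> gf (insert z F)" if "s \<in> polys F" for s
      unfolding poly_altdef using polys_coeff[OF that]
      by (intro subfield_sum[OF is_subfield_gf] subfield_mult[OF is_subfield_gf]
          subfield_power[OF is_subfield_gf] gf_in) auto
    then show "x \<in> gf (insert z F)"
      unfolding *(1) using * by (intro subfield_divide[OF is_subfield_gf]) auto
  qed
qed

text \<open>Euclidean descent. Dividing \<open>m\<close> by a nonconstant \<open>r\<close> of
  smaller degree leaves a remainder \<open>t\<close> that does not vanish at \<open>z\<close>, since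
  otherwise the remainder or the quotient would contradict the minimality of \<open>m\<close>; an
  inverse of \<open>t\<close> at \<open>z\<close> then gives one of \<open>r\<close>. Polynomials of
  larger degree are first reduced modulo \<open>m\<close>.\<close>

lemma algebraic_inverse:
  assumes m: "m \<in> polys F" "m \<noteq> 0" "poly m z = 0"
    and min: "\<And>p. p \<in> polys F \<Longrightarrow> p \<noteq> 0 \<Longrightarrow> poly p z = 0 \<Longrightarrow> degree m \<le> degree p"
    and r: "r \<in> polys F" "poly r z \<noteq> 0"
  shows "\<exists>s\<in>polys F. poly s z * poly r z = 1"
  using r
proof (induction "degree r" arbitrary: r rule: less_induct)
  case less
  have base: "\<exists>s\<in>polys F. poly s z * poly r z = 1"
    if r: "r \<in> polys F" "poly r z \<noteq> 0" "degree r < degree m"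
      and IH: "\<And>t. t \<in> polys F \<Longrightarrow> poly t z \<noteq> 0 \<Longrightarrow> degree t < degree r \<Longrightarrow> \<exists>s\<in>polys F. poly s z * poly t z = 1"
    for r
  proof (cases "degree r = 0")
    case True
    then obtain c where c: "r = [:c:]" using degree_eq_zeroE by blast
    then have "c \<in> F" "c \<noteq> 0" using r polys_coeff[of r F 0] by auto
    then show ?thesis using c by (intro bexI[of _ "[:inverse c:]"]) (auto intro: polys_const subfield_inverse[OF F])
  next
    case False
    have r0: "r \<noteq> 0" using r by auto
    obtain q t where qt: "q \<in> polys F" "t \<in> polys F" "m = r * q + t" "t = 0 \<or> degree t < degree r"
      using polys_division[OF m(1) r(1) r0] by blast
    have eq: "poly r z * poly q z + poly t z = 0" using m(3) unfolding qt(3) by simp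
    have t0: "poly t z \<noteq> 0"
    proof
      assume t: "poly t z = 0"
      then have "poly q z = 0" using eq r by simp
      moreover have "t = 0"
      proof (rule ccontr)
        assume "t \<noteq> 0"
        then show False using min[OF qt(2)] t qt(4) r(3) by auto
      qed
      moreover from this have "q \<noteq> 0" "degree m = degree r + degree q"
        using m(2) qt(3) r0 by (auto simp: degree_mult_eq)
      ultimately show False using min[OF qt(1)] False by simp
    qed
    then have "degree t < degree r" using qt(4) by auto
    then obtain s where s: "s \<in> polys F" "poly s z * poly t z = 1" using IH qt(2) t0 by blast
    have "poly (- (s * q)) z * poly r z = 1"
    proof -
      have "poly t z = - (poly r z * poly q z)" using eq by (simp add: eq_neg_iff_add_eq_0 add.commute)
      then show ?thesis using s(2) by (simp add: mult_ac)
    qed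
    then show ?thesis using s qt by (intro bexI[of _ "- (s * q)"]) (auto intro: polys_uminus polys_mult)
  qed
  show ?case
  proof (cases "degree r < degree m")
    case True
    show ?thesis by (rule base[OF less.prems True]) (use less.hyps in blast)
  next
    case False
    obtain q t where qt: "q \<in> polys F" "t \<in> polys F" "r = m * q + t" "t = 0 \<or> degree t < degree m"
      using polys_division[OF less.prems(1) m(1,2)] by blast
    have rt: "poly r z = poly t z" unfolding qt(3) using m(3) by simp
    then have "degree t < degree m" using qt(4) less.prems by auto
    then have "degree t < degree r" using False by simp
    then show ?thesis using less.hyps[of t] qt(2) less.prems(2) rt by simp
  qed
qed

text \<open>Denominators are inverted by \<open>algebraic_inverse\<close>, using an annihilating
  polynomial of least degree; the resulting polynomial in \<open>z\<close> is then reduced modulo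
  the given \<open>p\<close>.\<close>

lemma gf_insert_algebraic:
  assumes p: "p \<in> polys F" "p \<noteq> 0" "poly p z = 0" and x: "x \<in> gf (insert z F)"
  shows "\<exists>r\<in>polys F. x = poly r z \<and> (r = 0 \<or> degree r < degree p)"
proof -
  define P where "P = (\<lambda>m. m \<in> polys F \<and> m \<noteq> 0 \<and> poly m z = 0)"
  obtain m where m: "P m" "\<And>n. P n \<Longrightarrow> degree m \<le> degree n"
    using p ex_has_least_nat[of P p degree] by (auto simp: P_def)
  obtain a r where ar: "x = poly a z / poly r z" "a \<in> polys F" "r \<in> polys F" "poly r z \<noteq> 0"
    using x unfolding gf_insert_eq by blast
  obtain s where s: "s \<in> polys F" "poly s z * poly r z = 1"
    using algebraic_inverse[of m z r] m ar by (auto simp: P_def)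
  have "x * (poly s z * poly r z) = poly a z * poly s z" using ar(1,4) by simp
  then have xs: "x = poly (a * s) z" using s(2) by simp
  obtain q t where qt: "q \<in> polys F" "t \<in> polys F" "a * s = p * q + t" "t = 0 \<or> degree t < degree p"
    using polys_division[of "a * s" p] ar s p polys_mult by blast
  then have "x = poly t z" using xs p(3) by simp
  then show ?thesis using qt by blast
qed

end

section \<open>Linear algebra over a subfield and finite extensions\<close>

definition lspan :: "'a :: field set \<Rightarrow> 'a set \<Rightarrow> 'a set" where
  "lspan F S = {\<Sum>s\<in>S. c s * s | c. c ` S \<subseteq> F}"

text \<open>Only containment in a finitely spanned space is required, so the notion passes at once
  to smaller \<open>E\<close>.\<close>

definition fin_over :: "'a :: field set \<Rightarrow> 'a set \<Rightarrow> bool" where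
  "fin_over F E \<longleftrightarrow> (\<exists>S. finite S \<and> E \<subseteq> lspan F S)"

lemma lspan_image:
  assumes F: "is_subfield F" and "finite I" "\<And>i. i \<in> I \<Longrightarrow> c i \<in> F"
  shows "(\<Sum>i\<in>I. c i * b i) \<in> lspan F (b ` I)"
proof -
  have "(\<Sum>i\<in>I. c i * b i) = (\<Sum>y\<in>b ` I. \<Sum>i | i \<in> I \<and> b i = y. c i * b i)"
    using assms(2) by (rule sum.image_gen)
  also have "\<dots> = (\<Sum>y\<in>b ` I. (\<Sum>i | i \<in> I \<and> b i = y. c i) * y)"
    by (intro sum.cong) (auto simp: sum_distrib_right)
  finally show ?thesis
    unfolding lspan_def using assms(3) by (auto intro!: exI[of _ "\<lambda>y. \<Sum>i | i \<in> I \<and> b i = y. c i"] subfield_sum[OF F])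
qed

lemma fin_over_trans:
  assumes F: "is_subfield F" and "fin_over F E" "fin_over E L"
  shows "fin_over F L"
proof -
  obtain S T where S: "finite S" "E \<subseteq> lspan F S" and T: "finite T" "L \<subseteq> lspan E T"
    using assms by (auto simp: fin_over_def)
  have "L \<subseteq> lspan F ((\<lambda>(s, t). s * t) ` (S \<times> T))"
  proof
    fix x assume "x \<in> L"
    then obtain c where c: "x = (\<Sum>t\<in>T. c t * t)" "c ` T \<subseteq> E" using T by (auto simp: lspan_def)
    have "\<forall>t\<in>T. \<exists>d. c t = (\<Sum>s\<in>S. d s * s) \<and> d ` S \<subseteq> F"
    proof
      fix t assume "t \<in> T"
      then have "c t \<in> lspan F S" using c S by blast
      then show "\<exists>d. c t = (\<Sum>s\<in>S. d s * s) \<and> d ` S \<subseteq> F" by (auto simp: lspan_def)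
    qed
    then obtain d where d: "\<And>t. t \<in> T \<Longrightarrow> c t = (\<Sum>s\<in>S. d t s * s) \<and> d t ` S \<subseteq> F"
      by metis
    have "x = (\<Sum>t\<in>T. \<Sum>s\<in>S. d t s * (s * t))"
      unfolding c(1) using d by (intro sum.cong) (auto simp: sum_distrib_right mult.assoc)
    also have "\<dots> = (\<Sum>s\<in>S. \<Sum>t\<in>T. d t s * (s * t))" by (rule sum.swap)
    also have "\<dots> = (\<Sum>i\<in>S \<times> T. d (snd i) (fst i) * (case i of (s, t) \<Rightarrow> s * t))"
      by (simp add: sum.cartesian_product case_prod_unfold)
    also have "\<dots> \<in> lspan F ((\<lambda>(s, t). s * t) ` (S \<times> T))"
      by (rule lspan_image[OF F]) (use S T d in \<open>auto simp: image_subset_iff\<close>)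
    finally show "x \<in> lspan F ((\<lambda>(s, t). s * t) ` (S \<times> T))" .
  qed
  moreover have "finite ((\<lambda>(s, t). s * t) ` (S \<times> T))" using S T by simp
  ultimately show ?thesis unfolding fin_over_def by (intro exI conjI)
qed

text \<open>Gaussian elimination. The unknown \<open>p\<close> is the pivot for the equation
  \<open>s\<close>, \<open>B\<close> is the reduced system, and \<open>c'\<close> recovers the pivot
  from a solution of it; no step leaves \<open>F\<close>.\<close>

lemma homogeneous_system_solvable:
  fixes A :: "'i \<Rightarrow> 's \<Rightarrow> 'a :: field"
  assumes F: "is_subfield F" and "finite S" "finite I" "card S < card I"
    and "\<And>i s. i \<in> I \<Longrightarrow> s \<in> S \<Longrightarrow> A i s \<in> F"
  shows "\<exists>c. (\<forall>i\<in>I. c i \<in> F) \<and> (\<exists>i\<in>I. c i \<noteq> 0) \<and> (\<forall>s\<in>S. (\<Sum>i\<in>I. c i * A i s) = 0)"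
  using assms(2-5)
proof (induction S arbitrary: I A rule: finite_induct)
  case empty
  then obtain i where "i \<in> I" by fastforce
  then show ?case by (intro exI[of _ "\<lambda>_. 1"]) (auto simp: subfield_1[OF F])
next
  case (insert s S)
  show ?case
  proof (cases "\<forall>i\<in>I. A i s = 0")
    case True
    then show ?thesis using insert.IH[of I A] insert.prems insert.hyps by auto
  next
    case False
    then obtain p where p: "p \<in> I" "A p s \<noteq> 0" by blast
    define J where "J = I - {p}"
    have J: "finite J" "card S < card J" "I = insert p J" "p \<notin> J"
      using insert.prems insert.hyps p by (auto simp: J_def)
    define B where "B = (\<lambda>i t. A i t - A i s / A p s * A p t)"
    have "B i t \<in> F" if "i \<in> J" "t \<in> S" for i t
      unfolding B_def using that insert.prems(3) p J
      by (intro subfield_diff[OF F] subfield_mult[OF F] subfield_divide[OF F]) auto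
    then obtain c where c: "\<forall>i\<in>J. c i \<in> F" "\<exists>i\<in>J. c i \<noteq> 0" "\<forall>t\<in>S. (\<Sum>i\<in>J. c i * B i t) = 0"
      using insert.IH[of J B] J by blast
    define c' where "c' = c(p := - (\<Sum>i\<in>J. c i * (A i s / A p s)))"
    have "(\<Sum>i\<in>I. c' i * A i t) = (\<Sum>i\<in>J. c i * B i t)" for t
    proof -
      have "(\<Sum>i\<in>I. c' i * A i t) = c' p * A p t + (\<Sum>i\<in>J. c' i * A i t)"
        using J by simp
      also have "(\<Sum>i\<in>J. c' i * A i t) = (\<Sum>i\<in>J. c i * A i t)"
        using J by (intro sum.cong) (auto simp: c'_def)
      also have "c' p * A p t + \<dots> = (\<Sum>i\<in>J. c i * B i t)"
        by (simp add: c'_def B_def sum_subtractf right_diff_distrib sum_distrib_right mult.assoc)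
      finally show ?thesis .
    qed
    moreover have "(\<Sum>i\<in>J. c i * B i s) = 0" using p by (simp add: B_def)
    moreover have "c' i \<in> F" if "i \<in> I" for i
      using that c J insert.prems(3) p
      by (auto simp: c'_def intro!: subfield_uminus[OF F] subfield_sum[OF F] subfield_mult[OF F] subfield_divide[OF F])
    moreover have "\<exists>i\<in>I. c' i \<noteq> 0" using c(2) J by (auto simp: c'_def)
    ultimately show ?thesis using c(3) by (intro exI[of _ c']) auto
  qed
qed

text \<open>The bound \<open>n\<close> depends only on the extension. It is this uniformity that is
  contradicted in \<open>divisible_unit_trivial\<close> by the powers of a root of high
  order.\<close>

lemma fin_over_dependent:
  assumes F: "is_subfield F" and fin: "fin_over F E"
  obtains n :: nat where "\<And>x. (\<And>i. i \<le> n \<Longrightarrow> x i \<in> E) \<Longrightarrow>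
    \<exists>c. (\<forall>i\<le>n. c i \<in> F) \<and> (\<exists>i\<le>n. c i \<noteq> 0) \<and> (\<Sum>i\<le>n. c i * x i) = 0"
proof -
  obtain S where S: "finite S" "E \<subseteq> lspan F S" using fin by (auto simp: fin_over_def)
  show ?thesis
  proof (rule that[of "card S"])
    fix x :: "nat \<Rightarrow> 'a" assume x: "\<And>i. i \<le> card S \<Longrightarrow> x i \<in> E"
    have "\<forall>i. \<exists>a. i \<le> card S \<longrightarrow> x i = (\<Sum>s\<in>S. a s * s) \<and> a ` S \<subseteq> F"
      using x S(2) by (fastforce simp: lspan_def)
    then obtain A where A: "\<And>i. i \<le> card S \<Longrightarrow> x i = (\<Sum>s\<in>S. A i s * s) \<and> A i ` S \<subseteq> F"
      by metis
    obtain c where c: "\<forall>i\<in>{..card S}. c i \<in> F" "\<exists>i\<in>{..card S}. c i \<noteq> 0"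
      "\<forall>s\<in>S. (\<Sum>i\<in>{..card S}. c i * A i s) = 0"
    proof (rule exE[OF homogeneous_system_solvable[OF F S(1), of "{..card S}" A]])
      show "A i s \<in> F" if "i \<in> {..card S}" "s \<in> S" for i s using that A[of i] by auto
    qed auto
    have "(\<Sum>i\<le>card S. c i * x i) = (\<Sum>i\<le>card S. \<Sum>s\<in>S. c i * A i s * s)"
      using A by (intro sum.cong) (auto simp: sum_distrib_left mult.assoc)
    also have "\<dots> = (\<Sum>s\<in>S. (\<Sum>i\<le>card S. c i * A i s) * s)"
      by (subst sum.swap) (simp add: sum_distrib_right)
    also have "\<dots> = 0" using c(3) by simp
    finally show "\<exists>c. (\<forall>i\<le>card S. c i \<in> F) \<and> (\<exists>i\<le>card S. c i \<noteq> 0) \<and> (\<Sum>i\<le>card S. c i * x i) = 0"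
      using c by auto
  qed
qed

lemma fin_over_algebraic:
  assumes F: "is_subfield F" and E: "is_subfield E" and fin: "fin_over F E" and x: "x \<in> E"
  shows "\<exists>p\<in>polys F. p \<noteq> 0 \<and> poly p x = 0"
proof -
  obtain n :: nat where "\<And>x. (\<And>i. i \<le> n \<Longrightarrow> x i \<in> E) \<Longrightarrow>
    \<exists>c. (\<forall>i\<le>n. c i \<in> F) \<and> (\<exists>i\<le>n. c i \<noteq> 0) \<and> (\<Sum>i\<le>n. c i * x i) = 0"
    using fin_over_dependent[OF F fin] by blast
  then obtain c where c: "\<forall>i\<le>n. c i \<in> F" "\<exists>i\<le>n. c i \<noteq> 0" "(\<Sum>i\<le>n. c i * x ^ i) = 0"
    using subfield_power[OF E x] by blast
  define p where "p = (\<Sum>i\<le>n. monom (c i) i)"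
  have "coeff p i = (if i \<le> n then c i else 0)" for i
    by (simp add: p_def coeff_sum)
  moreover have "p \<in> polys F" unfolding p_def using c(1) by (intro polys_sum[OF F] polys_monom[OF F]) auto
  moreover have "poly p x = 0" using c(3) by (simp add: p_def poly_sum poly_monom)
  ultimately show ?thesis using c(2) by (metis coeff_0)
qed

lemma fin_over_insert:
  assumes F: "is_subfield F" and p: "p \<in> polys F" "p \<noteq> 0" "poly p z = 0"
  shows "fin_over F (gf (insert z F))"
  unfolding fin_over_def
proof (intro exI conjI subsetI)
  fix x assume "x \<in> gf (insert z F)"
  then obtain r where r: "r \<in> polys F" "x = poly r z" "r = 0 \<or> degree r < degree p"
    using gf_insert_algebraic[OF F p] by blast
  have "x = (\<Sum>i<Suc (degree p). coeff r i * z ^ i)"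
    unfolding r(2) poly_altdef using r(3) by (intro sum.mono_neutral_left) (auto simp: coeff_eq_0)
  also have "\<dots> \<in> lspan F ((\<lambda>i. z ^ i) ` {..<Suc (degree p)})"
    by (rule lspan_image[OF F]) (use r in \<open>auto simp: polys_def\<close>)
  finally show "x \<in> lspan F ((\<lambda>i. z ^ i) ` {..<Suc (degree p)})" .
qed auto

lemma fin_over_refl: "is_subfield F \<Longrightarrow> fin_over F F"
  unfolding fin_over_def by (rule exI[of _ "{1}"]) (auto simp: lspan_def)

lemma fin_over_adjoin_set:
  assumes F: "is_subfield F" and "finite Z" "\<And>z. z \<in> Z \<Longrightarrow> \<exists>p\<in>polys F. p \<noteq> 0 \<and> poly p z = 0"
  shows "fin_over F (gf (F \<union> Z))"
  using assms(2,3)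
proof (induction Z rule: finite_induct)
  case empty
  then show ?case using F by (simp add: gf_subfield fin_over_refl)
next
  case (insert z Z)
  let ?E = "gf (F \<union> Z)"
  obtain p where p: "p \<in> polys F" "p \<noteq> 0" "poly p z = 0" using insert.prems by blast
  have "p \<in> polys ?E" using p(1) gf_superset[of "F \<union> Z"] by (auto simp: polys_def)
  then have "fin_over ?E (gf (insert z ?E))" using p by (intro fin_over_insert) auto
  moreover have "gf (insert z ?E) = gf (F \<union> insert z Z)"
    using gf_Un_gf[of "F \<union> Z" "{z}"] by simp
  ultimately show ?case using fin_over_trans[OF F] insert by auto
qed

section \<open>Kummer extensions of prime degree\<close>

lemma dvd_prod_linear:
  fixes p :: "'a :: field poly"
  assumes "finite I" "p dvd (\<Prod>i\<in>I. [:- a i, 1:])"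
  shows "\<exists>J\<subseteq>I. \<exists>c. p = smult c (\<Prod>i\<in>J. [:- a i, 1:])"
  using assms
proof (induction I arbitrary: p rule: finite_induct)
  case empty
  then have "p dvd 1" by simp
  then obtain c where "p = [:c:]" by (rule is_unit_poly_iff[THEN iffD1, THEN exE]) blast
  then show ?case by (intro exI[of _ "{}"]) (auto intro: exI[of _ c])
next
  case (insert i I)
  let ?l = "[:- a i, 1:]"
  let ?R = "\<Prod>i\<in>I. [:- a i, 1:]"
  have "p dvd ?l * ?R"
    using insert.prems unfolding prod.insert[OF insert.hyps(1,2), of "\<lambda>i. [:- a i, 1:]"] .
  then obtain k where k: "?l * ?R = p * k" unfolding dvd_def by blast
  have l0: "?l \<noteq> 0" by simp
  \<comment> \<open>The linear factor is divided out of \<open>p\<close> if \<open>p\<close>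
    vanishes at \<open>a i\<close>, and otherwise out of the cofactor \<open>k\<close>.\<close>
  show ?case
  proof (cases "poly p (a i) = 0")
    case True
    then obtain p' where p': "p = ?l * p'" by (auto simp: poly_eq_0_iff_dvd elim: dvdE)
    have "?l * ?R = ?l * (p' * k)" unfolding k p' by (simp only: mult.assoc)
    then have "?R = p' * k" using l0 mult_left_cancel by blast
    then obtain J c where "J \<subseteq> I" "p' = smult c (\<Prod>i\<in>J. [:- a i, 1:])"
      using insert.IH[of p'] by auto
    moreover have "finite J" using \<open>J \<subseteq> I\<close> insert.hyps finite_subset by blast
    moreover have "i \<notin> J" using \<open>J \<subseteq> I\<close> insert.hyps by blast
    ultimately show ?thesis unfolding p'
      by (intro exI[of _ "insert i J"] conjI exI[of _ c]) (auto simp del: mult_pCons_left mult_pCons_right)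
  next
    case False
    have "poly (p * k) (a i) = 0" unfolding k[symmetric] by simp
    then have "poly k (a i) = 0" using False by simp
    then obtain k' where k': "k = ?l * k'" by (auto simp: poly_eq_0_iff_dvd elim: dvdE)
    have "?l * ?R = ?l * (p * k')" unfolding k k' by (simp only: mult_ac)
    then have "?R = p * k'" using l0 mult_left_cancel by blast
    then have "p dvd ?R" by simp
    then show ?thesis using insert.IH[of p] by blast
  qed
qed

lemma prime_root_powers_inj:
  fixes \<zeta> :: "'a :: field"
  assumes q: "Factorial_Ring.prime q" and z: "\<zeta> ^ q = 1" "\<zeta> \<noteq> 1"
  shows "inj_on (\<lambda>i. \<zeta> ^ i) {..<q}"
proof (rule linorder_inj_onI')
  fix i j assume ij: "i \<in> {..<q}" "j \<in> {..<q}" "i < j"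
  have z0: "\<zeta> \<noteq> 0" using z q by (auto simp: power_0_left prime_gt_0_nat)
  show "\<zeta> ^ i \<noteq> \<zeta> ^ j"
  proof
    assume "\<zeta> ^ i = \<zeta> ^ j"
    also have "\<zeta> ^ j = \<zeta> ^ i * \<zeta> ^ (j - i)" using ij by (simp flip: power_add)
    finally have d: "\<zeta> ^ (j - i) = 1" using z0 by simp
    have "\<not> q dvd j - i" using ij by (auto dest: dvd_imp_le)
    then have cop: "coprime (j - i) q" using q by (metis coprime_commute prime_imp_coprime)
    have "j - i \<noteq> 0" using ij by simp
    then obtain x y where "(j - i) * x = q * y + gcd (j - i) q" using bezout_nat by blast
    then have "\<zeta> ^ ((j - i) * x) = \<zeta> ^ (q * y) * \<zeta>" using cop by simp
    then show False using d z by (simp add: power_mult)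
  qed
qed

lemma degree_X_pow_minus_const:
  assumes "q > 0"
  shows "degree (monom 1 q - [:c :: 'a :: field:]) = q"
proof (rule antisym)
  show "degree (monom 1 q - [:c:]) \<le> q"
    using degree_diff_le_max[of "monom 1 q" "[:c:]"] by (simp add: degree_monom_eq)
  show "q \<le> degree (monom 1 q - [:c:])"
    using assms by (intro le_degree) (simp add: coeff_pCons split: nat.split)
qed

text \<open>Both sides are monic of degree \<open>q\<close>, so their difference has degree below
  \<open>q\<close> or is 0; yet it vanishes at \<open>q\<close> distinct points.\<close>

lemma prod_linear_roots:
  fixes \<zeta> z :: "'a :: field"
  assumes q: "Factorial_Ring.prime q" and z: "\<zeta> ^ q = 1" "\<zeta> \<noteq> 1" and z0: "z \<noteq> 0"
  shows "(\<Prod>i<q. [:- (\<zeta> ^ i * z), 1:]) = monom 1 q - [:z ^ q:]"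
proof -
  have q0: "q > 0" using q by (rule prime_gt_0_nat)
  define A where "A = (\<lambda>i. \<zeta> ^ i * z) ` {..<q}"
  have inj: "inj_on (\<lambda>i. \<zeta> ^ i * z) {..<q}"
    using prime_root_powers_inj[OF q z] z0 by (auto simp: inj_on_def)
  then have cA: "card A = q" by (simp add: A_def card_image)
  let ?P = "\<Prod>i<q. [:- (\<zeta> ^ i * z), 1:]" and ?Q = "monom 1 q - [:z ^ q:]"
  have dP: "degree ?P = q" by (subst degree_prod_eq_sum_degree) auto
  have lP: "lead_coeff ?P = 1" by (subst lead_coeff_prod) simp
  have dQ: "degree ?Q = q"
    using q0 by (rule degree_X_pow_minus_const)
  have "coeff (?P - ?Q) q = 0"
    using lP dP q0 by (cases q) (auto simp: coeff_pCons)
  moreover have "degree (?P - ?Q) \<le> q" using degree_diff_le_max[of ?P ?Q] dP dQ by simp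
  ultimately have deg: "degree (?P - ?Q) < q \<or> ?P - ?Q = 0"
    by (metis le_neq_implies_less leading_coeff_0_iff)
  have "poly (?P - ?Q) x = 0" if xA: "x \<in> A" for x
  proof -
    obtain i where i: "i < q" "x = \<zeta> ^ i * z" using xA by (auto simp: A_def)
    have "poly ?P x = 0" using i by (auto simp: poly_prod intro!: prod_zero)
    moreover have "x ^ q = z ^ q"
    proof -
      have "(\<zeta> ^ i) ^ q = (\<zeta> ^ q) ^ i" by (simp only: mult.commute flip: power_mult)
      then show ?thesis unfolding i(2) using z by (simp add: power_mult_distrib)
    qed
    ultimately show ?thesis by (simp add: poly_monom)
  qed
  then have roots: "A \<subseteq> {x. poly (?P - ?Q) x = 0}" by blast
  have "?P - ?Q = 0"
  proof (rule ccontr)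
    assume n0: "?P - ?Q \<noteq> 0"
    have "card A \<le> card {x. poly (?P - ?Q) x = 0}"
      by (rule card_mono[OF poly_roots_finite[OF n0] roots])
    also have "\<dots> \<le> degree (?P - ?Q)" by (rule card_poly_roots_bound[OF n0])
    finally show False using deg n0 cA by simp
  qed
  then show ?thesis by simp
qed

context
  fixes E :: "'a :: field set" and q :: nat and z \<zeta> :: 'a
  assumes E: "is_subfield E" and q: "Factorial_Ring.prime q"
    and zE: "z \<notin> E" "z ^ q \<in> E" and zeta: "\<zeta> \<in> E" "\<zeta> ^ q = 1" "\<zeta> \<noteq> 1"
begin

text \<open>An annihilating polynomial of least degree divides X^q - z^q and so is, up to a
  constant, a product of some of the linear factors. If its degree d were below \<open>q\<close>,
  its constant term would put z^d into \<open>E\<close>, and d is prime to \<open>q\<close>, so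
  \<open>z\<close> itself would lie in \<open>E\<close>.\<close>

lemma kummer_min_degree:
  assumes p: "p \<in> polys E" "p \<noteq> 0" "poly p z = 0"
  shows "q \<le> degree p"
proof (rule ccontr)
  have q0: "q > 0" using q by (rule prime_gt_0_nat)
  have z0: "z \<noteq> 0" using zE(1) subfield_0[OF E] by auto
  assume less: "\<not> q \<le> degree p"
  define P where "P = (\<lambda>m. m \<in> polys E \<and> m \<noteq> 0 \<and> poly m z = 0)"
  obtain m where m: "P m" "\<And>n. P n \<Longrightarrow> degree m \<le> degree n"
    using p ex_has_least_nat[of P p degree] by (auto simp: P_def)
  have dm: "degree m < q" using m(2)[of p] p less by (simp add: P_def)
  let ?Q = "monom 1 q - [:z ^ q:]"
  have QE: "?Q \<in> polys E"
    using zE(2) subfield_1[OF E] by (intro polys_diff[OF E] polys_monom[OF E] polys_const[OF E])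
  obtain k t where kt: "k \<in> polys E" "t \<in> polys E" "?Q = m * k + t" "t = 0 \<or> degree t < degree m"
    using polys_division[OF E QE, of m] m(1) by (auto simp: P_def)
  have "poly (m * k + t) z = 0" unfolding kt(3)[symmetric] by (simp add: poly_monom)
  then have "poly t z = 0" using m(1) by (simp add: P_def)
  have "t = 0"
  proof (rule ccontr)
    assume "t \<noteq> 0"
    then show False using m(2)[of t] kt(2,4) \<open>poly t z = 0\<close> by (simp add: P_def)
  qed
  then have "m dvd (\<Prod>i<q. [:- (\<zeta> ^ i * z), 1:])"
    unfolding prod_linear_roots[OF q zeta(2,3) z0] kt(3) by simp
  then obtain J c where J: "J \<subseteq> {..<q}" "m = smult c (\<Prod>i\<in>J. [:- (\<zeta> ^ i * z), 1:])"
    using dvd_prod_linear[of "{..<q}" m "\<lambda>i. \<zeta> ^ i * z"] by blast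
  have finJ: "finite J" using J(1) finite_subset by blast
  have c0: "c \<noteq> 0" using m(1) J(2) by (auto simp: P_def)
  have "degree (\<Prod>i\<in>J. [:- (\<zeta> ^ i * z), 1:]) = card J"
    by (subst degree_prod_eq_sum_degree) auto
  then have cJ: "card J = degree m" using J(2) c0 by simp
  have "degree m \<noteq> 0"
  proof
    assume "degree m = 0"
    then obtain d where "m = [:d:]" by (rule degree_eq_zeroE)
    then show False using m(1) by (auto simp: P_def)
  qed
  have "lead_coeff (\<Prod>i\<in>J. [:- (\<zeta> ^ i * z), 1:]) = 1" by (subst lead_coeff_prod) simp
  then have "lead_coeff m = c" using J(2) c0 by simp
  then have cE: "c \<in> E" using m(1) by (auto simp: P_def polys_def)
  have "poly m 0 = c * (\<Prod>i\<in>J. - (\<zeta> ^ i * z))" unfolding J(2) by (simp add: poly_prod)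
  also have "(\<Prod>i\<in>J. - (\<zeta> ^ i * z)) = (\<Prod>i\<in>J. - (\<zeta> ^ i)) * z ^ card J"
    by (simp add: prod.distrib flip: mult_minus_left)
  finally have "poly m 0 = c * (\<Prod>i\<in>J. - (\<zeta> ^ i)) * z ^ card J" by (simp add: mult_ac)
  moreover have "(\<Prod>i\<in>J. - (\<zeta> ^ i)) \<noteq> 0"
    using zeta(2) q0 finJ by (auto simp: power_0_left)
  ultimately have "z ^ card J = poly m 0 / (c * (\<Prod>i\<in>J. - (\<zeta> ^ i)))"
    using c0 by (simp add: field_simps)
  also have "\<dots> \<in> E"
    using m(1) cE zeta(1)
    by (intro subfield_divide[OF E] subfield_mult[OF E] subfield_prod[OF E] subfield_uminus[OF E]
        subfield_power[OF E] poly_in_subfield[OF E] subfield_0[OF E]) (auto simp: P_def)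
  finally have 1: "z ^ degree m \<in> E" unfolding cJ .
  have "\<not> q dvd degree m" using \<open>degree m \<noteq> 0\<close> dm by (auto dest: dvd_imp_le)
  then have "coprime (degree m) q" using q by (metis coprime_commute prime_imp_coprime)
  then have "z \<in> E" using subfield_coprime_powers[OF E z0 1 zE(2)] by blast
  with zE(1) show False by contradiction
qed

text \<open>By \<open>kummer_min_degree\<close> the polynomial is a multiple of X^q - z^q, which
  also vanishes at \<zeta> z. This takes the place of the automorphism z -> \<zeta> z of the
  extension.\<close>

lemma kummer_conjugate_root:
  assumes p: "p \<in> polys E" "poly p z = 0"
  shows "poly p (\<zeta> * z) = 0"
proof -
  have q0: "q > 0" using q by (rule prime_gt_0_nat)
  let ?Q = "monom 1 q - [:z ^ q:]"
  have QE: "?Q \<in> polys E"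
    using zE(2) subfield_1[OF E] by (intro polys_diff[OF E] polys_monom[OF E] polys_const[OF E])
  have dQ: "degree ?Q = q"
    using q0 by (rule degree_X_pow_minus_const)
  then have "?Q \<noteq> 0" using q0 by auto
  then obtain k t where kt: "k \<in> polys E" "t \<in> polys E" "p = ?Q * k + t" "t = 0 \<or> degree t < q"
    using polys_division[OF E p(1) QE] dQ by metis
  have "poly (?Q * k + t) z = 0" unfolding kt(3)[symmetric] using p by simp
  then have "poly t z = 0" by (simp add: poly_monom)
  then have "t = 0" using kummer_min_degree[of t] kt by fastforce
  then show ?thesis unfolding kt(3) by (simp add: poly_monom power_mult_distrib zeta)
qed

lemma kummer_roots_aux:
  assumes w: "w \<in> gf (insert z E)" "w ^ r \<in> E" and roots: "\<And>x. x ^ r = 1 \<Longrightarrow> x \<in> E"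
  shows "\<exists>c\<in>E. \<exists>j<q. w = c * z ^ j"
proof (cases "w = 0")
  case True
  then show ?thesis using subfield_0[OF E] prime_gt_0_nat[OF q] by auto
next
  case False
  let ?Q = "monom 1 q - [:z ^ q:]"
  have q0: "q > 0" using q by (rule prime_gt_0_nat)
  have QE: "?Q \<in> polys E"
    using zE(2) subfield_1[OF E] by (intro polys_diff[OF E] polys_monom[OF E] polys_const[OF E])
  have dQ: "degree ?Q = q"
    using q0 by (rule degree_X_pow_minus_const)
  then have "?Q \<noteq> 0" "poly ?Q z = 0" using q0 by (auto simp: poly_monom)
  then obtain C where C: "C \<in> polys E" "w = poly C z" "C = 0 \<or> degree C < q"
    using gf_insert_algebraic[OF E QE _ _ w(1)] dQ by metis
  have C0: "C \<noteq> 0" using C False by auto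
  \<comment> \<open>The polynomial C^r - w^r vanishes at z, hence at the conjugate of z. So the
    conjugate of w differs from w by an r-th root of unity, named \<xi> below.\<close>
  have "poly (C ^ r - [:w ^ r:]) (\<zeta> * z) = 0"
  proof (rule kummer_conjugate_root)
    show "C ^ r - [:w ^ r:] \<in> polys E"
      using C w by (intro polys_diff[OF E] polys_power[OF E] polys_const[OF E])
  qed (simp add: C(2))
  then have "(poly C (\<zeta> * z) / w) ^ r = 1" using False by (simp add: power_divide)
  define \<xi> where "\<xi> = poly C (\<zeta> * z) / w"
  have xi: "\<xi> \<in> E" unfolding \<xi>_def by (rule roots) fact
  \<comment> \<open>This is C(\<zeta> X) - \<xi> C(X). It vanishes at z and has degree below q, so
    it is zero, which forces \<zeta>^i = \<xi> for every exponent i occurring in C.\<close>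
  define D where "D = (\<Sum>i<q. monom (coeff C i * (\<zeta> ^ i - \<xi>)) i)"
  have cD: "coeff D i = (if i < q then coeff C i * (\<zeta> ^ i - \<xi>) else 0)" for i
    by (simp add: D_def coeff_sum)
  have "D \<in> polys E"
    unfolding D_def using C xi zeta
    by (intro polys_sum[OF E] polys_monom[OF E] subfield_mult[OF E] subfield_diff[OF E] subfield_power[OF E])
      (auto simp: polys_def)
  moreover have "poly D z = 0"
  proof -
    have ev: "poly C x = (\<Sum>i<q. coeff C i * x ^ i)" for x
      unfolding poly_altdef using C(3) C0 by (intro sum.mono_neutral_left) (auto simp: coeff_eq_0)
    have "poly D z = (\<Sum>i<q. coeff C i * (\<zeta> * z) ^ i - \<xi> * (coeff C i * z ^ i))"
      by (simp add: D_def poly_sum poly_monom power_mult_distrib algebra_simps)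
    also have "\<dots> = poly C (\<zeta> * z) - \<xi> * poly C z"
      by (simp add: sum_subtractf sum_distrib_left ev)
    finally show ?thesis using False C(2) by (simp add: \<xi>_def)
  qed
  moreover have "D = 0 \<or> degree D < q"
  proof (cases "D = 0")
    case False
    then have "coeff D (degree D) \<noteq> 0" by simp
    then show ?thesis unfolding cD by (auto split: if_splits)
  qed simp
  ultimately have "D = 0" using kummer_min_degree[of D] by fastforce
  then have eq: "coeff C i = 0 \<or> \<zeta> ^ i = \<xi>" if "i < q" for i
    using cD[of i] that by simp
  define j where "j = degree C"
  have j: "j < q" "coeff C j \<noteq> 0" using C C0 by (auto simp: j_def)
  have z: "coeff C i = 0" if "i < q" "i \<noteq> j" for i
  proof (rule ccontr)
    assume "coeff C i \<noteq> 0"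
    then have "\<zeta> ^ i = \<zeta> ^ j" using eq j that by metis
    then show False using prime_root_powers_inj[OF q zeta(2,3)] that j by (auto simp: inj_on_def)
  qed
  have "w = (\<Sum>i<q. coeff C i * z ^ i)"
    unfolding C(2) poly_altdef using C(3) C0 by (intro sum.mono_neutral_left) (auto simp: coeff_eq_0)
  also have "\<dots> = (\<Sum>i\<in>{j}. coeff C i * z ^ i)"
    using j z by (intro sum.mono_neutral_right) auto
  finally show ?thesis using j C(1) by (auto simp: polys_def)
qed

end

text \<open>Conjugating \<open>w\<close> by \<open>z \<mapsto> \<zeta> z\<close> multiplies it by an \<open>r\<close>-th root of unity, which lies in \<open>E\<close>; so \<open>w\<close> is a
  polynomial in \<open>z\<close> of degree \<open>< q\<close> that is an eigenvector, i.e. a monomial.\<close>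

lemma kummer_roots:
  fixes E :: "'a :: field set"
  assumes E: "is_subfield E" and q: "Factorial_Ring.prime q" and z: "z ^ q \<in> E"
    and zeta: "\<zeta> \<in> E" "\<zeta> ^ q = 1" "\<zeta> \<noteq> 1"
    and w: "w \<in> gf (insert z E)" "w ^ r \<in> E" and roots: "\<And>x. x ^ r = 1 \<Longrightarrow> x \<in> E"
  shows "\<exists>c\<in>E. \<exists>j<q. w = c * z ^ j"
proof (cases "z \<in> E")
  case True
  then have "w \<in> E" using w E by (simp add: insert_absorb gf_subfield)
  then show ?thesis using prime_gt_0_nat[OF q] by (intro bexI[of _ w] exI[of _ 0]) auto
next
  case False
  then show ?thesis using kummer_roots_aux[OF E q False z zeta w roots] by blast
qed

text \<open>By \<open>kummer_roots\<close> w = c z^j. If j were not 0, then z^(j r) would lie in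
  \<open>E\<close> with j r prime to \<open>q\<close>, and so would \<open>z\<close>.\<close>

lemma kummer_coprime_roots:
  fixes E :: "'a :: field set"
  assumes E: "is_subfield E" and q: "Factorial_Ring.prime q" and z: "z ^ q \<in> E"
    and zeta: "\<zeta> \<in> E" "\<zeta> ^ q = 1" "\<zeta> \<noteq> 1"
    and w: "w \<in> gf (insert z E)" "w ^ r \<in> E" and roots: "\<And>x. x ^ r = 1 \<Longrightarrow> x \<in> E"
    and r: "Factorial_Ring.prime r" "r \<noteq> q"
  shows "w \<in> E"
proof (cases "z \<in> E \<or> w = 0")
  case True
  then show ?thesis using w E by (auto simp: insert_absorb gf_subfield subfield_0)
next
  case False
  obtain c j where cj: "c \<in> E" "j < q" "w = c * z ^ j"
    using kummer_roots[OF E q z zeta w roots] by blast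
  have c0: "c \<noteq> 0" and z0: "z \<noteq> 0" using False cj subfield_0[OF E] by auto
  show ?thesis
  proof (cases "j = 0")
    case True
    then show ?thesis using cj by simp
  next
    case j: False
    have "z ^ (j * r) = w ^ r / c ^ r" using cj c0 by (simp add: power_mult_distrib power_mult)
    then have 1: "z ^ (j * r) \<in> E" using w(2) cj(1) by (simp add: subfield_divide[OF E] subfield_power[OF E])
    have "coprime j q" using j cj(2) q
      by (metis coprime_commute dvd_imp_le not_le prime_imp_coprime bot_nat_0.not_eq_extremum)
    moreover have "coprime r q" using r q by (simp add: primes_coprime)
    ultimately have "coprime (j * r) q" by simp
    then have "z \<in> E" using subfield_coprime_powers[OF E z0 1 z] by blast
    then show ?thesis using False by blast
  qed
qed

section \<open>The leading exponent on the fraction field\<close>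

type_synonym ('v, 'k) pfield = "('v, 'k) pser fract"

lemma pfield_cases:
  fixes x :: "('v :: linorder, 'k :: field) pfield"
  obtains a b where "b \<noteq> 0" "x = to_fract a / to_fract b"
proof -
  obtain a b where "x = Fract a b" "b \<noteq> 0" by (cases x) auto
  then have "x = to_fract a / to_fract b" by (simp add: to_fract_def)
  then show ?thesis using \<open>b \<noteq> 0\<close> that by blast
qed

text \<open>A valuation with values in the lexicographically ordered group of exponents. No
  representation qualifies for the element 0, where the value is arbitrary; hence the hypotheses of
  the form x \<noteq> 0 below.\<close>

definition lexp :: "('v :: linorder, 'k :: field) pfield \<Rightarrow> 'v expo" where
  "lexp x = (let (a, b) = (SOME (a, b). a \<noteq> 0 \<and> b \<noteq> 0 \<and> x = to_fract a / to_fract b) in pdeg a - pdeg b)"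

definition lco :: "('v :: linorder, 'k :: field) pfield \<Rightarrow> 'k" where
  "lco x = (let (a, b) = (SOME (a, b). a \<noteq> 0 \<and> b \<noteq> 0 \<and> x = to_fract a / to_fract b) in plc a / plc b)"

lemma plc_nonzero: "f \<noteq> 0 \<Longrightarrow> plc f \<noteq> (0 :: 'k :: idom)"
  by (simp add: plc_def pdeg_in)

lemma
  fixes a b :: "('v :: linorder, 'k :: field) pser"
  assumes "a \<noteq> 0" "b \<noteq> 0"
  shows lexp_frac: "lexp (to_fract a / to_fract b) = pdeg a - pdeg b"
    and lco_frac: "lco (to_fract a / to_fract b) = plc a / plc b"
proof -
  let ?P = "\<lambda>(c, d). c \<noteq> 0 \<and> d \<noteq> 0 \<and> to_fract a / to_fract b = to_fract c / to_fract d"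
  obtain c d where cd: "(SOME p. ?P p) = (c, d)" by (cases "SOME p. ?P p") auto
  have "?P (SOME p. ?P p)" by (rule someI[of ?P "(a, b)"]) (use assms in auto)
  then have *: "c \<noteq> 0" "d \<noteq> 0" "to_fract a / to_fract b = to_fract c / to_fract d"
    unfolding cd by auto
  then have "to_fract (a * d) = to_fract (c * b)"
    using assms by (simp add: to_fract_mult field_simps)
  then have eq: "a * d = c * b" by (simp only: to_fract_eq_iff)
  then have "pdeg a + pdeg d = pdeg c + pdeg b" "plc a * plc d = plc c * plc b"
    using assms * by (simp_all flip: pdeg_mult plc_mult)
  moreover have "plc b \<noteq> 0" "plc d \<noteq> 0" using assms * plc_nonzero by auto
  ultimately have "pdeg c - pdeg d = pdeg a - pdeg b" "plc c / plc d = plc a / plc b"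
    by (simp_all add: field_simps)
  then show "lexp (to_fract a / to_fract b) = pdeg a - pdeg b"
    "lco (to_fract a / to_fract b) = plc a / plc b"
    unfolding lexp_def lco_def cd by auto
qed

lemma pdeg_1: "pdeg (1 :: ('v :: linorder, 'k :: field) pser) = 0"
  and plc_1: "plc (1 :: ('v :: linorder, 'k :: field) pser) = 1"
  by (simp_all add: pdeg_pmono plc_pmono flip: pmono_1_0)

lemma
  fixes a :: "('v :: linorder, 'k :: field) pser"
  assumes "a \<noteq> 0"
  shows lexp_to_fract: "lexp (to_fract a) = pdeg a"
    and lco_to_fract: "lco (to_fract a) = plc a"
  using lexp_frac[OF assms, of 1] lco_frac[OF assms, of 1] by (simp_all add: pdeg_1 plc_1)

context
  fixes x y :: "('v :: linorder, 'k :: field) pfield"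
  assumes xy: "x \<noteq> 0" "y \<noteq> 0"
begin

lemma lexp_mult: "lexp (x * y) = lexp x + lexp y"
  and lco_mult: "lco (x * y) = lco x * lco y"
proof -
  obtain a b where a: "b \<noteq> 0" "x = to_fract a / to_fract b" by (rule pfield_cases)
  obtain c d where c: "d \<noteq> 0" "y = to_fract c / to_fract d" by (rule pfield_cases)
  have 0: "a \<noteq> 0" "c \<noteq> 0" using xy a c by auto
  have e: "x * y = to_fract (a * c) / to_fract (b * d)" using a c by (simp add: to_fract_mult)
  have n: "a * c \<noteq> 0" "b * d \<noteq> 0" using 0 a(1) c(1) by auto
  have l: "lexp (x * y) = pdeg (a * c) - pdeg (b * d)" "lco (x * y) = plc (a * c) / plc (b * d)"
    unfolding e by (rule lexp_frac[OF n], rule lco_frac[OF n])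
  have "lexp x = pdeg a - pdeg b" "lexp y = pdeg c - pdeg d" "lco x = plc a / plc b" "lco y = plc c / plc d"
    unfolding a(2) c(2) using 0 a(1) c(1) by (simp_all add: lexp_frac lco_frac)
  then show "lexp (x * y) = lexp x + lexp y" "lco (x * y) = lco x * lco y"
    unfolding l using 0 a(1) c(1) by (simp_all add: pdeg_mult plc_mult)
qed

lemma lco_nonzero: "lco x \<noteq> 0"
proof -
  obtain a b where a: "b \<noteq> 0" "x = to_fract a / to_fract b" by (rule pfield_cases)
  then have "a \<noteq> 0" using xy by auto
  then show ?thesis unfolding a(2) using a(1) by (subst lco_frac) (auto simp: plc_nonzero)
qed

lemma common_denominator:
  obtains a b d where "a \<noteq> 0" "b \<noteq> 0" "d \<noteq> 0" "x = to_fract a / to_fract d" "y = to_fract b / to_fract d"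
proof -
  obtain a b where a: "b \<noteq> 0" "x = to_fract a / to_fract b" by (rule pfield_cases)
  obtain c d where c: "d \<noteq> 0" "y = to_fract c / to_fract d" by (rule pfield_cases)
  have "a * d \<noteq> 0" "c * b \<noteq> 0" "b * d \<noteq> 0" using xy a c by auto
  moreover have "x = to_fract (a * d) / to_fract (b * d)" "y = to_fract (c * b) / to_fract (b * d)"
    using a c by (simp_all add: to_fract_mult)
  ultimately show ?thesis using that by blast
qed

lemma
  assumes less: "lexp x < lexp y"
  shows lexp_add_less: "x + y \<noteq> 0" "lexp (x + y) = lexp x" "lco (x + y) = lco x"
proof -
  obtain a b d where *: "a \<noteq> 0" "b \<noteq> 0" "d \<noteq> 0" "x = to_fract a / to_fract d" "y = to_fract b / to_fract d"
    by (rule common_denominator)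
  have "pdeg a - pdeg d < pdeg b - pdeg d" using less * by (simp add: lexp_frac)
  then have lt: "pdeg a < pdeg b" by simp
  have b0: "pcoeff b (pdeg a) = 0" using pdeg_le[OF *(2), of "pdeg a"] lt by force
  have deg: "pdeg (a + b) = pdeg a"
  proof (rule pdeg_eqI)
    show "pcoeff (a + b) (pdeg a) \<noteq> 0" using b0 pdeg_in[OF *(1)] by simp
    fix \<beta> assume "pcoeff (a + b) \<beta> \<noteq> 0"
    then have "pcoeff a \<beta> \<noteq> 0 \<or> pcoeff b \<beta> \<noteq> 0" by auto
    then show "pdeg a \<le> \<beta>" using pdeg_le[OF *(1)] pdeg_le[OF *(2)] lt by fastforce
  qed
  have lc: "plc (a + b) = plc a" unfolding plc_def deg using b0 by simp
  have ab: "a + b \<noteq> 0"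
  proof
    assume "a + b = 0"
    then have "pcoeff (a + b) (pdeg a) = 0" by simp
    then show False using b0 pdeg_in[OF *(1)] by simp
  qed
  have e: "x + y = to_fract (a + b) / to_fract d" using * by (simp add: add_divide_distrib)
  show "x + y \<noteq> 0" unfolding e using ab *(3) by (simp del: to_fract_add)
  have "lexp (x + y) = pdeg (a + b) - pdeg d" "lco (x + y) = plc (a + b) / plc d"
    unfolding e by (rule lexp_frac[OF ab *(3)], rule lco_frac[OF ab *(3)])
  then show "lexp (x + y) = lexp x" "lco (x + y) = lco x"
    unfolding *(4) using * deg lc by (simp_all add: lexp_frac lco_frac)
qed

lemma lexp_diff_greater:
  assumes "lexp x = lexp y" "lco x = lco y" "x \<noteq> y"
  shows "lexp x < lexp (x - y)"
proof -
  obtain a b d where *: "a \<noteq> 0" "b \<noteq> 0" "d \<noteq> 0" "x = to_fract a / to_fract d" "y = to_fract b / to_fract d"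
    by (rule common_denominator)
  have deg: "pdeg a = pdeg b" and lc: "plc a = plc b"
    using assms * plc_nonzero[OF *(3)] by (simp_all add: lexp_frac lco_frac)
  have e: "x - y = to_fract (a - b) / to_fract d" using * by (simp add: to_fract_diff diff_divide_distrib)
  have ab: "a - b \<noteq> 0" using assms * by auto
  have "pcoeff (a - b) (pdeg a) = 0" using lc deg by (simp add: plc_def)
  then have "pdeg (a - b) \<noteq> pdeg a" using pdeg_in[OF ab] by metis
  moreover have "pdeg a \<le> pdeg (a - b)"
  proof -
    have "pcoeff a (pdeg (a - b)) \<noteq> 0 \<or> pcoeff b (pdeg (a - b)) \<noteq> 0" using pdeg_in[OF ab] by auto
    then show ?thesis using pdeg_le[OF *(1)] pdeg_le[OF *(2)] deg by auto
  qed
  moreover have "lexp (x - y) = pdeg (a - b) - pdeg d" unfolding e by (rule lexp_frac[OF ab *(3)])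
  moreover have "lexp x = pdeg a - pdeg d" unfolding *(4) by (rule lexp_frac[OF *(1,3)])
  ultimately show ?thesis by simp
qed

lemma lexp_add_ge:
  assumes "x + y \<noteq> 0" "\<beta> \<le> lexp x" "\<beta> \<le> lexp y"
  shows "\<beta> \<le> lexp (x + y)"
proof -
  obtain a b d where *: "a \<noteq> 0" "b \<noteq> 0" "d \<noteq> 0" "x = to_fract a / to_fract d" "y = to_fract b / to_fract d"
    by (rule common_denominator)
  have e: "x + y = to_fract (a + b) / to_fract d" using * by (simp add: to_fract_add add_divide_distrib)
  have ab: "a + b \<noteq> 0"
  proof
    assume "a + b = 0"
    then have "x + y = 0" unfolding e by (simp only: to_fract_0 div_0)
    with assms show False by simp
  qed
  then have "pcoeff a (pdeg (a + b)) \<noteq> 0 \<or> pcoeff b (pdeg (a + b)) \<noteq> 0" using pdeg_in[OF ab] by auto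
  then have "pdeg a \<le> pdeg (a + b) \<or> pdeg b \<le> pdeg (a + b)"
    using pdeg_le[OF *(1)] pdeg_le[OF *(2)] by auto
  moreover have "\<beta> \<le> pdeg a - pdeg d" "\<beta> \<le> pdeg b - pdeg d" using assms * by (simp_all add: lexp_frac)
  ultimately have "\<beta> \<le> pdeg (a + b) - pdeg d"
    by (meson diff_right_mono order_trans)
  then show ?thesis unfolding e lexp_frac[OF ab *(3)] .
qed

end

lemma lexp_1: "lexp (1 :: ('v :: linorder, 'k :: field) pfield) = 0"
  and lco_1: "lco (1 :: ('v :: linorder, 'k :: field) pfield) = 1"
  using lexp_to_fract[of "1 :: ('v, 'k) pser"] lco_to_fract[of "1 :: ('v, 'k) pser"]
  by (simp_all add: pdeg_1 plc_1)

lemma lco_power: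
  fixes x :: "('v :: linorder, 'k :: field) pfield"
  assumes "x \<noteq> 0"
  shows "lco (x ^ n) = lco x ^ n"
  using assms by (induction n) (simp_all add: lco_1 lco_mult)

lemma lexp_uminus:
  fixes x :: "('v :: linorder, 'k :: field) pfield"
  assumes "x \<noteq> 0"
  shows "lexp (- x) = lexp x"
proof -
  have "pmono (- 1) 0 = (- 1 :: ('v, 'k) pser)"
    by (rule pser_eqI) (auto simp: pcoeff_pmono pcoeff_1)
  then have m1: "- (1 :: ('v, 'k) pfield) = to_fract (pmono (- 1) 0)"
    by (simp add: to_fract_uminus)
  have n0: "pmono (- 1) 0 \<noteq> (0 :: ('v, 'k) pser)" by (simp add: pmono_eq_0_iff)
  have "lexp (- 1 :: ('v, 'k) pfield) = 0"
    unfolding m1 using n0 by (simp add: lexp_to_fract pdeg_pmono)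
  then show ?thesis using lexp_mult[of "- 1" x] assms by simp
qed

text \<open>An open ball around 0 for the valuation \<open>lexp\<close>; it is an additive subgroup.
  The element 0 is added by hand because \<open>lexp 0\<close> is arbitrary.\<close>

definition vgt :: "'v expo \<Rightarrow> ('v :: linorder, 'k :: field) pfield set" where
  "vgt \<beta> = {x. x = 0 \<or> \<beta> < lexp x}"

lemma vgt_add: "x \<in> vgt \<beta> \<Longrightarrow> y \<in> vgt \<beta> \<Longrightarrow> x + y \<in> vgt \<beta>"
proof -
  assume *: "x \<in> vgt \<beta>" "y \<in> vgt \<beta>"
  show "x + y \<in> vgt \<beta>"
  proof (cases "x = 0 \<or> y = 0 \<or> x + y = 0")
    case True
    then show ?thesis using * by (auto simp: vgt_def)
  next
    case False
    then have 1: "min (lexp x) (lexp y) \<le> lexp (x + y)" by (intro lexp_add_ge) auto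
    have "\<beta> < min (lexp x) (lexp y)" using * False by (auto simp: vgt_def)
    then have "\<beta> < lexp (x + y)" using 1 by (rule less_le_trans)
    then show ?thesis by (simp add: vgt_def)
  qed
qed

lemma vgt_sum: "(\<And>i. i \<in> I \<Longrightarrow> f i \<in> vgt \<beta>) \<Longrightarrow> sum f I \<in> vgt \<beta>"
  by (induction I rule: infinite_finite_induct) (auto intro: vgt_add, auto simp: vgt_def)

lemma vgt_mult: "x \<in> vgt \<beta> \<Longrightarrow> y = 0 \<or> 0 \<le> lexp y \<Longrightarrow> x * y \<in> vgt \<beta>"
proof (cases "x = 0 \<or> y = 0")
  case False
  assume "x \<in> vgt \<beta>" "y = 0 \<or> 0 \<le> lexp y"
  then have "\<beta> + 0 < lexp x + lexp y" using False by (intro add_less_le_mono) (auto simp: vgt_def)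
  then show ?thesis using False by (simp add: vgt_def lexp_mult)
qed (auto simp: vgt_def)

text \<open>The nonzero term with the least leading exponent cannot be cancelled by the others. The
  transcendence statements over \<open>F0 v\<close> below all rest on this.\<close>

lemma sum_distinct_lexp_nonzero:
  fixes f :: "'i \<Rightarrow> ('v :: linorder, 'k :: field) pfield"
  assumes "finite I" "i0 \<in> I" "f i0 \<noteq> 0"
    and dist: "\<And>i j. i \<in> I \<Longrightarrow> j \<in> I \<Longrightarrow> i \<noteq> j \<Longrightarrow> f i \<noteq> 0 \<Longrightarrow> f j \<noteq> 0 \<Longrightarrow> lexp (f i) \<noteq> lexp (f j)"
  shows "sum f I \<noteq> 0"
proof -
  define J where "J = {i \<in> I. f i \<noteq> 0}"
  have J: "finite J" "J \<noteq> {}" using assms by (auto simp: J_def)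
  obtain i where i: "i \<in> J" "\<And>j. j \<in> J \<Longrightarrow> lexp (f i) \<le> lexp (f j)"
    using arg_min_if_finite[OF J, of "\<lambda>i. lexp (f i)"] by (metis not_le)
  have "f j \<in> vgt (lexp (f i))" if "j \<in> J - {i}" for j
    using that i dist[of i j] by (auto simp: vgt_def J_def intro: le_neq_trans)
  then have r: "sum f (J - {i}) \<in> vgt (lexp (f i))" by (rule vgt_sum)
  have "sum f I = sum f J" unfolding J_def by (rule sum.mono_neutral_right) (use assms in auto)
  also have "\<dots> = f i + sum f (J - {i})" using J i by (simp add: sum.remove)
  also have "\<dots> \<noteq> 0"
  proof
    assume "f i + sum f (J - {i}) = 0"
    then have e: "sum f (J - {i}) = - f i" by (simp add: eq_neg_iff_add_eq_0 add.commute)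
    have "f i \<noteq> 0" using i by (simp add: J_def)
    then show False using r unfolding e by (simp add: vgt_def lexp_uminus)
  qed
  finally show ?thesis .
qed

text \<open>Up to terms with larger leading exponent, (1 + h)^n is 1 + n h, and n is a nonzero
  constant. Raising to the n-th power thus keeps the valuation of the distance from 1.\<close>

lemma lexp_one_plus_power:
  fixes h :: "('v :: linorder, 'k :: field) pfield"
  assumes h: "h \<noteq> 0" "0 < lexp h" and n: "of_nat n \<noteq> (0 :: 'k)"
  shows "(1 + h) ^ n \<noteq> 1" "lexp ((1 + h) ^ n - 1) = lexp h"
proof -
  have of_nat: "(of_nat m :: ('v, 'k) pfield) = to_fract (pmono (of_nat m :: 'k) 0)" for m
  proof (induction m)
    case 0
    have "pmono 0 0 = (0 :: ('v, 'k) pser)" by (simp add: pmono_eq_0_iff)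
    then show ?case by simp
  next
    case (Suc m)
    have "pmono (of_nat (Suc m)) 0 = (1 + pmono (of_nat m) 0 :: ('v, 'k) pser)"
      by (simp add: pmono_add pmono_1_0)
    then show ?case using Suc by (simp add: to_fract_add)
  qed
  have nat0: "(of_nat m :: ('v, 'k) pfield) = 0 \<or> 0 \<le> lexp (of_nat m :: ('v, 'k) pfield)" for m
    unfolding of_nat by (cases "of_nat m = (0 :: 'k)") (auto simp: lexp_to_fract pdeg_pmono pmono_eq_0_iff)
  have hh: "h \<in> vgt 0" "h * h \<in> vgt (lexp h)"
    using h by (auto simp: vgt_def lexp_mult)
  have "(1 + h) ^ m - 1 - of_nat m * h \<in> vgt (lexp h)" for m
  proof (induction m)
    case 0
    then show ?case by (simp add: vgt_def)
  next
    case (Suc m)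
    let ?r = "(1 + h) ^ m - 1 - of_nat m * h"
    have "(1 + h) ^ Suc m - 1 - of_nat (Suc m) * h = ?r + ?r * h + (h * h) * of_nat m"
      by (simp add: algebra_simps)
    also have "\<dots> \<in> vgt (lexp h)"
      using vgt_mult[OF Suc disjI2[OF less_imp_le[OF h(2)]]] vgt_mult[OF hh(2) nat0] Suc by (intro vgt_add)
    finally show ?case .
  qed
  then have r: "(1 + h) ^ n - 1 - of_nat n * h \<in> vgt (lexp h)" (is "?r \<in> _") .
  have n0: "of_nat n \<noteq> (0 :: ('v, 'k) pfield)" unfolding of_nat using n by (simp add: pmono_eq_0_iff)
  have ln: "lexp (of_nat n * h) = lexp h"
    using n n0 h unfolding of_nat by (simp add: lexp_mult lexp_to_fract pdeg_pmono pmono_eq_0_iff)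
  have e: "(1 + h) ^ n - 1 = of_nat n * h + ?r" by simp
  have "of_nat n * h + ?r \<noteq> 0 \<and> lexp (of_nat n * h + ?r) = lexp h"
  proof (cases "?r = 0")
    case True
    then show ?thesis using n0 h ln by simp
  next
    case False
    then have "lexp (of_nat n * h) < lexp ?r" using r ln by (simp add: vgt_def)
    then show ?thesis using lexp_add_less(1,2)[of "of_nat n * h" ?r] False n0 h ln by simp
  qed
  then show "(1 + h) ^ n \<noteq> 1" "lexp ((1 + h) ^ n - 1) = lexp h" unfolding e[symmetric] by auto
qed

lemma root_of_unity_lco_1:
  fixes x :: "('v :: linorder, 'k :: field) pfield"
  assumes "x ^ n = 1" "of_nat n \<noteq> (0 :: 'k)" "x \<noteq> 0" "lexp x = 0" "lco x = 1"
  shows "x = 1"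
proof (rule ccontr)
  assume "x \<noteq> 1"
  moreover from this have "lexp x < lexp (x - 1)"
    using assms by (intro lexp_diff_greater) (auto simp: lexp_1 lco_1)
  ultimately show False using lexp_one_plus_power(1)[of "x - 1" n] assms by simp
qed

section \<open>Fractions with restricted exponents and coefficients\<close>

definition is_expo_group :: "'v expo set \<Rightarrow> bool" where
  "is_expo_group H \<longleftrightarrow> 0 \<in> H \<and> (\<forall>\<alpha>\<in>H. \<forall>\<beta>\<in>H. \<alpha> + \<beta> \<in> H) \<and> (\<forall>\<alpha>\<in>H. - \<alpha> \<in> H)"

text \<open>Fields given by generators are enclosed in fields of this kind, which confines their
  leading exponents to \<open>H\<close> and their leading coefficients to \<open>k\<close>.\<close>

definition fracs :: "'v expo set \<Rightarrow> 'k set \<Rightarrow> ('v :: linorder, 'k :: field) pfield set" where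
  "fracs H k = {to_fract a / to_fract b | a b.
     b \<noteq> 0 \<and> psupp a \<subseteq> H \<and> psupp b \<subseteq> H \<and> range (pcoeff a) \<subseteq> k \<and> range (pcoeff b) \<subseteq> k}"

lemma fracsI:
  assumes "x = to_fract a / to_fract b" "b \<noteq> 0" "psupp a \<subseteq> H" "psupp b \<subseteq> H"
    "range (pcoeff a) \<subseteq> k" "range (pcoeff b) \<subseteq> k"
  shows "x \<in> fracs H k"
  unfolding fracs_def using assms by blast

context
  fixes H :: "('v :: linorder) expo set" and k :: "'k :: field set"
  assumes H: "is_expo_group H" and k: "is_subfield k"
begin

lemma pser_times_coeffs:
  fixes a b :: "('v, 'k) pser"
  assumes "psupp a \<subseteq> H" "psupp b \<subseteq> H" "range (pcoeff a) \<subseteq> k" "range (pcoeff b) \<subseteq> k"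
  shows "psupp (a * b) \<subseteq> H" "range (pcoeff (a * b)) \<subseteq> k"
proof -
  show "psupp (a * b) \<subseteq> H"
  proof
    fix \<gamma> assume "\<gamma> \<in> psupp (a * b)"
    then have "pcoeff (a * b) \<gamma> \<noteq> 0" by (simp add: psupp_def)
    then obtain \<alpha> \<beta> where \<gamma>: "\<gamma> = \<alpha> + \<beta>" "pcoeff a \<alpha> \<noteq> 0" "pcoeff b \<beta> \<noteq> 0" by (rule pcoeff_times_nonzero)
    then have "\<alpha> \<in> H" "\<beta> \<in> H" using assms by (auto simp: psupp_def)
    then show "\<gamma> \<in> H" unfolding \<gamma>(1) using H unfolding is_expo_group_def by blast
  qed
  show "range (pcoeff (a * b)) \<subseteq> k"
    unfolding times_pser.rep_eq conv_def using assms
    by (auto intro!: subfield_sum[OF k] subfield_mult[OF k])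
qed

lemma is_subfield_fracs: "is_subfield (fracs H k :: ('v, 'k) pfield set)"
proof -
  have 0: "psupp (0 :: ('v, 'k) pser) \<subseteq> H" "range (pcoeff (0 :: ('v, 'k) pser)) \<subseteq> k"
    by (auto simp: psupp_def subfield_0[OF k])
  have 1: "psupp (1 :: ('v, 'k) pser) \<subseteq> H" "range (pcoeff (1 :: ('v, 'k) pser)) \<subseteq> k"
    using H by (auto simp: psupp_def pcoeff_1 subfield_0[OF k] subfield_1[OF k] is_expo_group_def split: if_splits)
  show ?thesis
  proof (rule is_subfieldI)
    show "0 \<in> (fracs H k :: ('v, 'k) pfield set)"
      by (rule fracsI[OF _ one_neq_zero 0(1) 1(1) 0(2) 1(2)]) simp
    show "1 \<in> (fracs H k :: ('v, 'k) pfield set)"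
      by (rule fracsI[OF _ one_neq_zero 1(1) 1(1) 1(2) 1(2)]) simp
  next
    fix x y :: "('v, 'k) pfield" assume "x \<in> fracs H k" "y \<in> fracs H k"
    then obtain a b c d where *: "x = to_fract a / to_fract b" "y = to_fract c / to_fract d" "b \<noteq> 0" "d \<noteq> 0"
      and s: "psupp a \<subseteq> H" "psupp b \<subseteq> H" "psupp c \<subseteq> H" "psupp d \<subseteq> H"
      "range (pcoeff a) \<subseteq> k" "range (pcoeff b) \<subseteq> k" "range (pcoeff c) \<subseteq> k" "range (pcoeff d) \<subseteq> k"
      unfolding fracs_def by blast
    have p: "psupp (f + g) \<subseteq> psupp f \<union> psupp g" for f g :: "('v, 'k) pser" by (auto simp: psupp_def)
    have r: "range (pcoeff (f + g)) \<subseteq> k" if "range (pcoeff f) \<subseteq> k" "range (pcoeff g) \<subseteq> k"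
      for f g :: "('v, 'k) pser" using that by (auto intro!: subfield_add[OF k])
    have e1: "x + y = to_fract (a * d + c * b) / to_fract (b * d)"
      using * by (simp add: to_fract_add to_fract_mult add_frac_eq)
    have e2: "x * y = to_fract (a * c) / to_fract (b * d)" using * by (simp add: to_fract_mult)
    note ad = pser_times_coeffs[OF s(1,4,5,8)] and cb = pser_times_coeffs[OF s(3,2,7,6)]
      and bd = pser_times_coeffs[OF s(2,4,6,8)] and ac = pser_times_coeffs[OF s(1,3,5,7)]
    have bd0: "b * d \<noteq> 0" using *(3,4) by simp
    have "psupp (a * d + c * b) \<subseteq> H" using p[of "a * d" "c * b"] ad cb by blast
    then show "x + y \<in> fracs H k"
      by (rule fracsI[OF e1 bd0 _ bd(1) r[OF ad(2) cb(2)] bd(2)])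
    show "x * y \<in> fracs H k" by (rule fracsI[OF e2 bd0 ac(1) bd(1) ac(2) bd(2)])
  next
    fix x :: "('v, 'k) pfield" assume "x \<in> fracs H k"
    then obtain a b where *: "x = to_fract a / to_fract b" "b \<noteq> 0"
      and s: "psupp a \<subseteq> H" "psupp b \<subseteq> H" "range (pcoeff a) \<subseteq> k" "range (pcoeff b) \<subseteq> k"
      unfolding fracs_def by blast
    have "- x = to_fract (- a) / to_fract b" using * by simp
    moreover have "psupp (- a) \<subseteq> H" using s by (auto simp: psupp_def)
    moreover have "range (pcoeff (- a)) \<subseteq> k" using s by (auto intro!: subfield_uminus[OF k])
    ultimately show "- x \<in> fracs H k" using fracsI * s by blast
    show "inverse x \<in> fracs H k"
    proof (cases "a = 0")
      case True
      then have "inverse x = to_fract 0 / to_fract 1" using * by simp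
      then show ?thesis by (rule fracsI[OF _ one_neq_zero 0(1) 1(1) 0(2) 1(2)])
    next
      case False
      have "inverse x = to_fract b / to_fract a" using * by simp
      then show ?thesis by (rule fracsI[OF _ False s(2,1,4,3)])
    qed
  qed
qed

lemma
  assumes "x \<in> fracs H k" "x \<noteq> (0 :: ('v, 'k) pfield)"
  shows lexp_fracs: "lexp x \<in> H" and lco_fracs: "lco x \<in> k"
proof -
  obtain a b where *: "x = to_fract a / to_fract b" "b \<noteq> 0"
    and s: "psupp a \<subseteq> H" "psupp b \<subseteq> H" "range (pcoeff a) \<subseteq> k" "range (pcoeff b) \<subseteq> k"
    using assms unfolding fracs_def by blast
  have a0: "a \<noteq> 0" using * assms by auto
  have "pdeg a \<in> H" "pdeg b \<in> H" using s pdeg_in[OF a0] pdeg_in[OF *(2)] by (auto simp: psupp_def)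
  then have "pdeg a + - pdeg b \<in> H" using H unfolding is_expo_group_def by blast
  then show "lexp x \<in> H" unfolding *(1) using a0 *(2) by (simp add: lexp_frac)
  show "lco x \<in> k" unfolding *(1) using a0 *(2) s
    by (auto simp: lco_frac plc_def intro!: subfield_divide[OF k])
qed

lemma to_fract_in_fracs:
  fixes a :: "('v, 'k) pser"
  assumes "psupp a \<subseteq> H" "range (pcoeff a) \<subseteq> k"
  shows "to_fract a \<in> fracs H k"
proof -
  have "psupp (1 :: ('v, 'k) pser) \<subseteq> H" "range (pcoeff (1 :: ('v, 'k) pser)) \<subseteq> k"
    using H by (auto simp: psupp_def pcoeff_1 subfield_0[OF k] subfield_1[OF k] is_expo_group_def split: if_splits)
  then show ?thesis using assms by (intro fracsI[of _ a 1]) auto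
qed

end

section \<open>Constants, monomials and roots of binomials\<close>

definition cst :: "'k \<Rightarrow> ('v :: linorder, 'k :: field) pfield" where
  "cst c = to_fract (pmono c 0)"

definition xmon :: "'v expo \<Rightarrow> ('v :: linorder, 'k :: field) pfield" where
  "xmon \<alpha> = to_fract (pmono 1 \<alpha>)"

text \<open>Scalar multiplication in the rational vector space of exponents.\<close>

definition rsm :: "rat \<Rightarrow> 'v expo \<Rightarrow> 'v expo" where
  "rsm r \<alpha> = Poly_Mapping.map ((*) r) \<alpha>"

lemma lookup_rsm [simp]: "lookup (rsm r \<alpha>) v = r * lookup \<alpha> v"
  by (simp add: rsm_def Poly_Mapping.map.rep_eq when_def)

lemma rsm_simps [simp]: "rsm 0 \<alpha> = 0" "rsm 1 \<alpha> = \<alpha>" "rsm r 0 = 0"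
  by (auto intro!: poly_mapping_eqI)

lemma rsm_add_left: "rsm (r + s) \<alpha> = rsm r \<alpha> + rsm s \<alpha>"
  and rsm_rsm: "rsm r (rsm s \<alpha>) = rsm (r * s) \<alpha>"
  by (auto intro!: poly_mapping_eqI simp: lookup_add algebra_simps)

lemma cst_simps [simp]:
  "cst 0 = (0 :: ('v :: linorder, 'k :: field) pfield)" "cst 1 = (1 :: ('v, 'k) pfield)"
  "cst (a + b) = (cst a + cst b :: ('v, 'k) pfield)" "cst (a * b) = (cst a * cst b :: ('v, 'k) pfield)"
  "cst (- a) = (- cst a :: ('v, 'k) pfield)"
proof -
  have 0: "pmono 0 0 = (0 :: ('v, 'k) pser)" by (simp add: pmono_eq_0_iff)
  show "cst 0 = (0 :: ('v, 'k) pfield)" by (simp add: cst_def 0)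
  show "cst 1 = (1 :: ('v, 'k) pfield)" by (simp add: cst_def pmono_1_0)
  show "cst (a + b) = (cst a + cst b :: ('v, 'k) pfield)" by (simp add: cst_def pmono_add)
  show "cst (a * b) = (cst a * cst b :: ('v, 'k) pfield)"
    by (simp add: cst_def pmono_mult flip: to_fract_mult)
  have "pmono (- a) 0 = (- pmono a 0 :: ('v, 'k) pser)" by (rule pser_eqI) (simp add: pcoeff_pmono)
  then show "cst (- a) = (- cst a :: ('v, 'k) pfield)" by (simp add: cst_def)
qed

lemma cst_eq_0_iff [simp]: "cst c = 0 \<longleftrightarrow> c = 0"
  by (simp add: cst_def pmono_eq_0_iff)

lemma cst_inverse: "cst (inverse c) = (inverse (cst c) :: ('v :: linorder, 'k :: field) pfield)"
proof (cases "c = 0")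
  case False
  then have "cst c * cst (inverse c) = (1 :: ('v, 'k) pfield)" by (simp flip: cst_simps(4))
  then show ?thesis by (simp add: inverse_unique)
qed simp

lemma cst_power: "cst (a ^ n) = cst a ^ n"
  by (induction n) auto

lemma cst_of_nat: "cst (of_nat n) = of_nat n"
  by (induction n) auto

lemma cst_diff: "cst (a - b) = cst a - cst b"
  using cst_simps(3)[of a "- b"] by simp

lemma lexp_cst: "c \<noteq> 0 \<Longrightarrow> lexp (cst c) = 0" and lco_cst: "c \<noteq> 0 \<Longrightarrow> lco (cst c) = c"
  by (simp_all add: cst_def lexp_to_fract lco_to_fract pmono_eq_0_iff pdeg_pmono plc_pmono)

lemma xmon_nonzero [simp]: "xmon \<alpha> \<noteq> 0"
  by (simp add: xmon_def pmono_eq_0_iff)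

lemma xmon_0 [simp]: "xmon 0 = 1"
  by (simp add: xmon_def pmono_1_0)

lemma xmon_add: "xmon (\<alpha> + \<beta>) = xmon \<alpha> * xmon \<beta>"
  by (simp add: xmon_def pmono_mult flip: to_fract_mult)

lemma xmon_uminus: "xmon (- \<alpha>) = (inverse (xmon \<alpha>) :: ('v :: linorder, 'k :: field) pfield)"
proof -
  have "xmon \<alpha> * xmon (- \<alpha>) = (1 :: ('v, 'k) pfield)" by (simp flip: xmon_add)
  then show ?thesis by (simp add: inverse_unique)
qed

lemma xmon_rsm: "xmon (rsm (of_nat n) \<alpha>) = xmon \<alpha> ^ n"
  by (induction n) (simp_all add: rsm_add_left xmon_add)

lemma lexp_xmon [simp]: "lexp (xmon \<alpha>) = \<alpha>" and lco_xmon [simp]: "lco (xmon \<alpha>) = 1"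
  by (simp_all add: xmon_def lexp_to_fract lco_to_fract pmono_eq_0_iff pdeg_pmono plc_pmono)

lemma xmon_inj: "xmon \<alpha> = (xmon \<beta> :: ('v :: linorder, 'k :: field) pfield) \<Longrightarrow> \<alpha> = \<beta>"
proof -
  assume "xmon \<alpha> = (xmon \<beta> :: ('v, 'k) pfield)"
  then have "lexp (xmon \<alpha> :: ('v, 'k) pfield) = lexp (xmon \<beta> :: ('v, 'k) pfield)" by (rule arg_cong)
  then show "\<alpha> = \<beta>" by simp
qed

lemma lexp_pow: "x \<noteq> 0 \<Longrightarrow> lexp (x ^ n) = rsm (of_nat n) (lexp x)"
  by (induction n) (simp_all add: lexp_1 lexp_mult rsm_add_left)

lemma cst_in_fracs:
  assumes "is_expo_group H" "is_subfield k" "c \<in> k"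
  shows "cst c \<in> fracs H k"
  unfolding cst_def using assms
  by (intro to_fract_in_fracs) (auto simp: psupp_def pcoeff_pmono is_expo_group_def subfield_0 split: if_splits)

lemma xmon_in_fracs:
  assumes "is_expo_group H" "is_subfield k" "\<alpha> \<in> H"
  shows "xmon \<alpha> \<in> fracs H k"
  unfolding xmon_def using assms
  by (intro to_fract_in_fracs) (auto simp: psupp_def pcoeff_pmono subfield_0 subfield_1 split: if_splits)

section \<open>Roots of binomials as power series in a monomial\<close>

definition natexpo :: "'v expo \<Rightarrow> bool" where
  "natexpo \<gamma> \<longleftrightarrow> \<gamma> \<noteq> 0 \<and> (\<forall>v. lookup \<gamma> v \<in> \<nat>)"

lemma rsm_inj: "\<gamma> \<noteq> 0 \<Longrightarrow> rsm r \<gamma> = rsm s \<gamma> \<Longrightarrow> r = s"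
proof -
  assume g: "\<gamma> \<noteq> 0" and eq: "rsm r \<gamma> = rsm s \<gamma>"
  obtain v where "lookup \<gamma> v \<noteq> 0" using g by (metis lookup_zero poly_mapping_eqI)
  moreover have "r * lookup \<gamma> v = s * lookup \<gamma> v" using arg_cong[OF eq, of "\<lambda>a. lookup a v"] by simp
  ultimately show ?thesis by simp
qed

text \<open>The value of the one-variable series \<open>s\<close> at the monomial with exponent
  \<gamma>. As \<gamma> \<noteq> 0, distinct n give distinct multiples of \<gamma>, so
  \<open>THE\<close> picks out the only possible n.\<close>

definition ps_subst :: "'v expo \<Rightarrow> 'k fps \<Rightarrow> ('v, 'k :: field) pser" where
  "ps_subst \<gamma> s = Abs_pser (\<lambda>\<delta>. if \<exists>n. \<delta> = rsm (of_nat n) \<gamma> then fps_nth s (THE n. \<delta> = rsm (of_nat n) \<gamma>) else 0)"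

context
  fixes \<gamma> :: "'v expo"
  assumes g: "natexpo \<gamma>"
begin

lemma rsm_of_nat_eq_iff: "rsm (of_nat m) \<gamma> = rsm (of_nat n) \<gamma> \<longleftrightarrow> m = n"
  using g rsm_inj[of \<gamma> "of_nat m" "of_nat n"] by (auto simp: natexpo_def)

lemma pcoeff_ps_subst':
  "pcoeff (ps_subst \<gamma> s) \<delta> = (if \<exists>n. \<delta> = rsm (of_nat n) \<gamma> then fps_nth s (THE n. \<delta> = rsm (of_nat n) \<gamma>) else 0)"
proof -
  have "rsm (of_nat n) \<gamma> \<in> bexp (keys \<gamma>) 1 0" for n
  proof -
    have "keys (rsm (of_nat n) \<gamma>) \<subseteq> keys \<gamma>" by (auto simp: in_keys_iff)
    moreover have "of_nat n * lookup \<gamma> v \<in> \<nat>" for v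
      using g by (auto simp: natexpo_def intro: Nats_mult)
    ultimately show ?thesis using Nats_subset_Ints Nats_altdef2 by (auto simp: bexp_def)
  qed
  then have "{\<delta>. (if \<exists>n. \<delta> = rsm (of_nat n) \<gamma> then fps_nth s (THE n. \<delta> = rsm (of_nat n) \<gamma>) else 0) \<noteq> 0} \<subseteq> bexp (keys \<gamma>) 1 0"
    by (auto split: if_splits)
  then have "\<exists>W m N. finite W \<and> m > 0 \<and> {\<delta>. (if \<exists>n. \<delta> = rsm (of_nat n) \<gamma> then fps_nth s (THE n. \<delta> = rsm (of_nat n) \<gamma>) else 0) \<noteq> 0} \<subseteq> bexp W m N"
    by (intro exI[of _ "keys \<gamma>"] exI[of _ 1] exI[of _ 0]) auto
  then show ?thesis unfolding ps_subst_def by (subst Abs_pser_inverse) auto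
qed

lemma pcoeff_ps_subst [simp]: "pcoeff (ps_subst \<gamma> s) (rsm (of_nat n) \<gamma>) = fps_nth s n"
proof -
  have "(THE k. rsm (of_nat n) \<gamma> = rsm (of_nat k) \<gamma>) = n"
    by (rule the_equality) (auto simp: rsm_of_nat_eq_iff)
  then show ?thesis unfolding pcoeff_ps_subst' by auto
qed

lemma pcoeff_ps_subst_0: "(\<And>n. \<delta> \<noteq> rsm (of_nat n) \<gamma>) \<Longrightarrow> pcoeff (ps_subst \<gamma> s) \<delta> = 0"
  unfolding pcoeff_ps_subst' by auto

lemma ps_subst_eqI:
  assumes "\<And>n. pcoeff f (rsm (of_nat n) \<gamma>) = fps_nth s n" "\<And>\<delta>. (\<And>n. \<delta> \<noteq> rsm (of_nat n) \<gamma>) \<Longrightarrow> pcoeff f \<delta> = 0"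
  shows "f = ps_subst \<gamma> s"
proof (rule pser_eqI)
  fix \<delta> show "pcoeff f \<delta> = pcoeff (ps_subst \<gamma> s) \<delta>"
    using assms pcoeff_ps_subst_0[of \<delta> s] by (cases "\<exists>n. \<delta> = rsm (of_nat n) \<gamma>") auto
qed

lemma ps_subst_mult: "ps_subst \<gamma> (s * t) = ps_subst \<gamma> s * ps_subst \<gamma> t"
proof (rule ps_subst_eqI[symmetric])
  fix n
  let ?S = "(\<lambda>i. rsm (of_nat i) \<gamma>) ` {0..n}"
  have d: "rsm (of_nat n) \<gamma> - rsm (of_nat i) \<gamma> = rsm (of_nat (n - i)) \<gamma>" if "i \<le> n" for i
    using rsm_add_left[of "of_nat (n - i)" "of_nat i" \<gamma>] that by (simp add: of_nat_diff algebra_simps)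
  have "pcoeff (ps_subst \<gamma> s * ps_subst \<gamma> t) (rsm (of_nat n) \<gamma>) =
      (\<Sum>\<alpha>\<in>?S. pcoeff (ps_subst \<gamma> s) \<alpha> * pcoeff (ps_subst \<gamma> t) (rsm (of_nat n) \<gamma> - \<alpha>))"
  proof (rule pcoeff_times_eq)
    fix \<alpha> assume a: "pcoeff (ps_subst \<gamma> s) \<alpha> \<noteq> 0" "pcoeff (ps_subst \<gamma> t) (rsm (of_nat n) \<gamma> - \<alpha>) \<noteq> 0"
    obtain i j where ij: "\<alpha> = rsm (of_nat i) \<gamma>" "rsm (of_nat n) \<gamma> - \<alpha> = rsm (of_nat j) \<gamma>"
      using a pcoeff_ps_subst_0 by metis
    then have "rsm (of_nat n) \<gamma> = rsm (of_nat (i + j)) \<gamma>" by (simp add: rsm_add_left algebra_simps)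
    then have "n = i + j" by (simp only: rsm_of_nat_eq_iff)
    then show "\<alpha> \<in> ?S" using ij by auto
  qed auto
  also have "\<dots> = (\<Sum>i=0..n. pcoeff (ps_subst \<gamma> s) (rsm (of_nat i) \<gamma>) * pcoeff (ps_subst \<gamma> t) (rsm (of_nat n) \<gamma> - rsm (of_nat i) \<gamma>))"
    by (subst sum.reindex) (auto simp: inj_on_def rsm_of_nat_eq_iff)
  also have "\<dots> = fps_nth (s * t) n"
    unfolding fps_mult_nth
  proof (rule sum.cong[OF refl])
    fix i assume "i \<in> {0..n}"
    then have "i \<le> n" by simp
    show "pcoeff (ps_subst \<gamma> s) (rsm (of_nat i) \<gamma>) * pcoeff (ps_subst \<gamma> t) (rsm (of_nat n) \<gamma> - rsm (of_nat i) \<gamma>)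
        = fps_nth s i * fps_nth t (n - i)"
      by (simp only: d[OF \<open>i \<le> n\<close>] pcoeff_ps_subst)
  qed
  finally show "pcoeff (ps_subst \<gamma> s * ps_subst \<gamma> t) (rsm (of_nat n) \<gamma>) = fps_nth (s * t) n" .
next
  fix \<delta> assume nd: "\<And>n. \<delta> \<noteq> rsm (of_nat n) \<gamma>"
  show "pcoeff (ps_subst \<gamma> s * ps_subst \<gamma> t) \<delta> = 0"
  proof (rule ccontr)
    assume "pcoeff (ps_subst \<gamma> s * ps_subst \<gamma> t) \<delta> \<noteq> 0"
    then obtain \<alpha> \<beta> where ab: "\<delta> = \<alpha> + \<beta>" "pcoeff (ps_subst \<gamma> s) \<alpha> \<noteq> 0" "pcoeff (ps_subst \<gamma> t) \<beta> \<noteq> 0"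
      by (rule pcoeff_times_nonzero)
    then obtain i j where "\<alpha> = rsm (of_nat i) \<gamma>" "\<beta> = rsm (of_nat j) \<gamma>"
      using pcoeff_ps_subst_0 by metis
    then have "\<delta> = rsm (of_nat (i + j)) \<gamma>" using ab by (simp add: rsm_add_left)
    with nd show False by blast
  qed
qed

lemma ps_subst_1: "ps_subst \<gamma> 1 = (1 :: ('v, 'k :: field) pser)"
  and ps_subst_1_plus_X: "ps_subst \<gamma> (1 + fps_X) = (1 + pmono 1 \<gamma> :: ('v, 'k) pser)"
proof -
  have g0: "rsm (of_nat n) \<gamma> = 0 \<longleftrightarrow> n = 0" "rsm (of_nat n) \<gamma> = \<gamma> \<longleftrightarrow> n = 1" for n
    using rsm_of_nat_eq_iff[of n 0] rsm_of_nat_eq_iff[of n 1] by simp_all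
  have n: "\<delta> \<noteq> 0" "\<delta> \<noteq> \<gamma>" if "\<And>n. \<delta> \<noteq> rsm (of_nat n) \<gamma>" for \<delta>
    using that[of 0] that[of 1] by simp_all
  show "ps_subst \<gamma> 1 = (1 :: ('v, 'k) pser)"
  proof (rule ps_subst_eqI[symmetric])
    fix n show "pcoeff 1 (rsm (of_nat n) \<gamma>) = fps_nth (1 :: 'k fps) n" by (simp add: pcoeff_1 g0)
  next
    fix \<delta> assume "\<And>n. \<delta> \<noteq> rsm (of_nat n) \<gamma>"
    then show "pcoeff (1 :: ('v, 'k) pser) \<delta> = 0" using n(1)[of \<delta>] by (simp add: pcoeff_1)
  qed
  show "ps_subst \<gamma> (1 + fps_X) = (1 + pmono 1 \<gamma> :: ('v, 'k) pser)"
  proof (rule ps_subst_eqI[symmetric])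
    fix n show "pcoeff (1 + pmono 1 \<gamma>) (rsm (of_nat n) \<gamma>) = fps_nth (1 + fps_X :: 'k fps) n"
      by (simp add: pcoeff_1 pcoeff_pmono g0)
  next
    fix \<delta> assume "\<And>n. \<delta> \<noteq> rsm (of_nat n) \<gamma>"
    then show "pcoeff (1 + pmono 1 \<gamma> :: ('v, 'k) pser) \<delta> = 0"
      using n[of \<delta>] by (simp add: pcoeff_1 pcoeff_pmono)
  qed
qed

lemma ps_subst_power: "ps_subst \<gamma> (s ^ n) = ps_subst \<gamma> s ^ n"
  by (induction n) (simp_all add: ps_subst_1 ps_subst_mult)

end

text \<open>The binomial series (1 + X)^(1/q). Generalised binomial coefficients would divide by
  factorials, which may vanish in positive characteristic; the compositional inverse of (1 + X)^q -
  1 divides only by powers of its linear coefficient q.\<close>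

definition qroot :: "nat \<Rightarrow> 'k :: field fps" where
  "qroot q = 1 + fps_inv ((1 + fps_X) ^ q - 1)"

lemma qroot_nth_0: "fps_nth (qroot q) 0 = 1"
  by (simp add: qroot_def fps_inv_def)

lemma qroot_power:
  assumes "of_nat q \<noteq> (0 :: 'k :: field)"
  shows "qroot q ^ q = (1 + fps_X :: 'k fps)"
proof -
  let ?a = "(1 + fps_X) ^ q - 1 :: 'k fps"
  have c0: "fps_nth ((1 + fps_X :: 'k fps) ^ n) 0 = 1" for n by (induction n) auto
  have c1: "fps_nth ((1 + fps_X :: 'k fps) ^ n) 1 = of_nat n" for n
    by (induction n) (auto simp: fps_mult_nth_1 c0)
  have inv: "?a oo fps_inv ?a = fps_X"
    by (rule fps_inv_right) (use assms c0 c1[of q] in auto)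
  have i0: "fps_nth (fps_inv ?a) 0 = 0" by (simp add: fps_inv_def)
  have "qroot q = (1 + fps_X) oo fps_inv ?a"
    by (simp add: qroot_def fps_compose_add_distrib fps_X_fps_compose_startby0[OF i0])
  then have "qroot q ^ q = (1 + fps_X) ^ q oo fps_inv ?a"
    by (simp only: fps_compose_power[OF i0])
  also have "\<dots> = (?a + 1) oo fps_inv ?a" by simp
  also have "\<dots> = fps_X + 1"
    by (simp only: fps_compose_add_distrib inv fps_compose_1)
  finally show ?thesis by (simp add: add.commute)
qed

text \<open>The recursion for the compositional inverse stays inside every subfield, so the
  coefficients lie in the prime field. This is what keeps the leading coefficients of elements of
  \<open>K\<close> in the prime field.\<close>

lemma qroot_coeffs:
  fixes k :: "'k :: field set"
  assumes k: "is_subfield k"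
  shows "fps_nth (qroot q) n \<in> k"
proof -
  have m: "(\<And>n. fps_nth s n \<in> k) \<Longrightarrow> (\<And>n. fps_nth t n \<in> k) \<Longrightarrow> fps_nth (s * t) n \<in> k" for s t :: "'k fps" and n
    by (auto simp: fps_mult_nth intro!: subfield_sum[OF k] subfield_mult[OF k])
  have p: "(\<And>n. fps_nth s n \<in> k) \<Longrightarrow> fps_nth (s ^ i) n \<in> k" for s :: "'k fps" and i n
    by (induction i arbitrary: n) (auto simp: subfield_0[OF k] subfield_1[OF k] intro!: m)
  define a where "a = ((1 + fps_X) ^ q - 1 :: 'k fps)"
  have x: "fps_nth (1 + fps_X :: 'k fps) n \<in> k" for n
    by (auto intro!: subfield_add[OF k] simp: subfield_0[OF k] subfield_1[OF k] fps_X_def)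
  have a: "fps_nth a n \<in> k" for n
    using p[OF x, of q n] by (auto intro!: subfield_diff[OF k] simp: a_def subfield_0[OF k] subfield_1[OF k])
  have "compinv a n \<in> k" for n
  proof (induction n rule: less_induct)
    case (less n)
    show ?case
    proof (cases n)
      case 0
      then show ?thesis by (simp add: subfield_0[OF k])
    next
      case (Suc i)
      have "fps_nth (fps_X :: 'k fps) (Suc i) \<in> k" by (simp add: fps_X_def subfield_0[OF k] subfield_1[OF k])
      then show ?thesis unfolding Suc compinv.simps using less Suc a p[OF a]
        by (intro subfield_divide[OF k] subfield_diff[OF k] subfield_sum[OF k] subfield_mult[OF k] subfield_power[OF k]) auto
    qed
  qed
  then show ?thesis by (auto simp: qroot_def fps_inv_def subfield_0[OF k] subfield_1[OF k] simp flip: a_def intro!: subfield_add[OF k])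
qed

text \<open>Among the q-th roots of 1 + X^\<gamma> this is the one with constant term 1. The
  normalisation makes permutations of the variables permute the chosen roots
  (\<open>oact_yroot\<close>).\<close>

definition yroot :: "nat \<Rightarrow> 'v expo \<Rightarrow> ('v :: linorder, 'k :: field) pfield" where
  "yroot q \<gamma> = to_fract (ps_subst \<gamma> (qroot q))"

lemma yroot_power:
  assumes "natexpo \<gamma>" "of_nat q \<noteq> (0 :: 'k :: field)"
  shows "yroot q \<gamma> ^ q = (1 + xmon \<gamma> :: ('v :: linorder, 'k) pfield)"
proof -
  have tp: "to_fract (a ^ n) = to_fract a ^ n" for a :: "('v, 'k) pser" and n by (induction n) auto
  have "yroot q \<gamma> ^ q = to_fract (ps_subst \<gamma> (qroot q ^ q) :: ('v, 'k) pser)"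
    unfolding yroot_def ps_subst_power[OF assms(1)] tp ..
  then show ?thesis by (simp add: qroot_power[OF assms(2)] ps_subst_1_plus_X[OF assms(1)] xmon_def)
qed

lemma natexpo_nonneg:
  fixes \<gamma> :: "('v :: linorder) expo"
  assumes "\<And>v. 0 \<le> lookup \<gamma> v"
  shows "0 \<le> \<gamma>"
proof (rule ccontr)
  assume "\<not> 0 \<le> \<gamma>"
  then have "\<gamma> < 0" by simp
  then obtain v where "lookup \<gamma> v < 0" by (auto simp: less_poly_mapping.rep_eq less_fun_def)
  with assms[of v] show False by simp
qed

lemma yroot_nonzero:
  assumes "natexpo \<gamma>"
  shows "yroot q \<gamma> \<noteq> (0 :: ('v :: linorder, 'k :: field) pfield)"
proof -
  have "pcoeff (ps_subst \<gamma> (qroot q) :: ('v, 'k) pser) 0 = 1"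
    using pcoeff_ps_subst[OF assms, of "qroot q" 0] by (simp add: qroot_nth_0)
  then have "ps_subst \<gamma> (qroot q) \<noteq> (0 :: ('v, 'k) pser)" by auto
  then show ?thesis by (simp add: yroot_def)
qed

lemma yroot_in_fracs:
  fixes \<gamma> :: "('v :: linorder) expo"
  assumes "is_expo_group H" "is_subfield k" "natexpo \<gamma>" "\<gamma> \<in> H"
  shows "yroot q \<gamma> \<in> fracs H k"
  unfolding yroot_def
proof (rule to_fract_in_fracs[OF assms(1,2)])
  have H: "rsm (of_nat n) \<gamma> \<in> H" for n
    using assms(1,4) by (induction n) (auto simp: rsm_add_left is_expo_group_def)
  show "psupp (ps_subst \<gamma> (qroot q)) \<subseteq> H"
    unfolding psupp_def using pcoeff_ps_subst_0[OF assms(3)] H by (metis (mono_tags, lifting) mem_Collect_eq subsetI)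
  have "pcoeff (ps_subst \<gamma> (qroot q)) \<delta> \<in> k" for \<delta>
  proof (cases "\<exists>n. \<delta> = rsm (of_nat n) \<gamma>")
    case True
    then show ?thesis using pcoeff_ps_subst[OF assms(3)] qroot_coeffs[OF assms(2)] by metis
  next
    case False
    then show ?thesis using pcoeff_ps_subst_0[OF assms(3), of \<delta>] subfield_0[OF assms(2)] by metis
  qed
  then show "range (pcoeff (ps_subst \<gamma> (qroot q))) \<subseteq> k" by blast
qed

section \<open>Permutations of the variables\<close>

abbreviation invf :: "('a \<Rightarrow> 'b) \<Rightarrow> 'b \<Rightarrow> 'a" where "invf \<equiv> inv_into UNIV"

text \<open>\<open>map_key\<close> composes with its argument on the inside; the inverse makes the
  coordinate at v move to \<pi> v, which gives a left action.\<close>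

definition eact :: "('v \<Rightarrow> 'v) \<Rightarrow> 'v expo \<Rightarrow> 'v expo" where
  "eact \<pi> \<alpha> = Poly_Mapping.map_key (invf \<pi>) \<alpha>"

lemma lookup_eact: "bij \<pi> \<Longrightarrow> lookup (eact \<pi> \<alpha>) v = lookup \<alpha> (invf \<pi> v)"
  by (simp add: eact_def map_key.rep_eq bij_imp_bij_inv bij_is_inj)

context
  fixes \<pi> :: "'v \<Rightarrow> 'v"
  assumes bij: "bij \<pi>"
begin

lemma eact_add: "eact \<pi> (\<alpha> + \<beta>) = eact \<pi> \<alpha> + eact \<pi> \<beta>"
  by (rule poly_mapping_eqI) (simp add: lookup_eact[OF bij] lookup_add)

lemma eact_diff: "eact \<pi> (\<alpha> - \<beta>) = eact \<pi> \<alpha> - eact \<pi> \<beta>"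
  by (rule poly_mapping_eqI) (simp add: lookup_eact[OF bij] lookup_minus)

lemma eact_0: "eact \<pi> 0 = 0"
  by (rule poly_mapping_eqI) (simp add: lookup_eact[OF bij])

lemma eact_rsm: "eact \<pi> (rsm r \<alpha>) = rsm r (eact \<pi> \<alpha>)"
  by (rule poly_mapping_eqI) (simp add: lookup_eact[OF bij])

lemma eact_inv: "eact (invf \<pi>) (eact \<pi> \<alpha>) = \<alpha>" "eact \<pi> (eact (invf \<pi>) \<alpha>) = \<alpha>"
proof -
  have "invf \<pi> (invf (invf \<pi>) v) = v" "invf (invf \<pi>) (invf \<pi> v) = v" for v
    using bij bij_imp_bij_inv[OF bij] by (simp_all add: bij_is_inj bij_is_surj surj_f_inv_f)
  then show "eact (invf \<pi>) (eact \<pi> \<alpha>) = \<alpha>" "eact \<pi> (eact (invf \<pi>) \<alpha>) = \<alpha>"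
    by (auto intro!: poly_mapping_eqI simp: lookup_eact bij bij_imp_bij_inv)
qed

lemma eact_eq_iff: "eact \<pi> \<alpha> = \<beta> \<longleftrightarrow> \<alpha> = eact (invf \<pi>) \<beta>"
  using eact_inv by metis

lemma natexpo_eact: "natexpo \<gamma> \<Longrightarrow> natexpo (eact \<pi> \<gamma>)"
  using eact_eq_iff[of \<gamma> 0] by (auto simp: natexpo_def lookup_eact[OF bij]) (metis eact_0 eact_inv(1) eact_def bij)

text \<open>A permutation may disturb the order of the variables, so leading exponents are not
  preserved. The action exists because the conditions on supports do not refer to that
  order.\<close>

definition pact :: "('v, 'k) pser \<Rightarrow> ('v, 'k :: field) pser" where
  "pact f = Abs_pser (\<lambda>\<alpha>. pcoeff f (eact (invf \<pi>) \<alpha>))"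

lemma pcoeff_pact: "pcoeff (pact f) \<alpha> = pcoeff f (eact (invf \<pi>) \<alpha>)"
proof -
  obtain W m N where W: "finite W" "m > 0" "psupp f \<subseteq> bexp W m N" by (rule psupp_bexp)
  have "{\<alpha>. pcoeff f (eact (invf \<pi>) \<alpha>) \<noteq> 0} \<subseteq> bexp (\<pi> ` W) m N"
  proof
    fix \<alpha> assume "\<alpha> \<in> {\<alpha>. pcoeff f (eact (invf \<pi>) \<alpha>) \<noteq> 0}"
    then have b: "eact (invf \<pi>) \<alpha> \<in> bexp W m N" using W by (auto simp: psupp_def)
    have l: "lookup (eact (invf \<pi>) \<alpha>) v = lookup \<alpha> (\<pi> v)" for v
      using bij by (simp add: lookup_eact bij_imp_bij_inv inv_inv_eq)
    have l': "lookup \<alpha> v = lookup (eact (invf \<pi>) \<alpha>) (invf \<pi> v)" for v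
      unfolding l using bij by (simp add: bij_is_surj surj_f_inv_f)
    have "keys \<alpha> \<subseteq> \<pi> ` W"
    proof
      fix v assume "v \<in> keys \<alpha>"
      then have "invf \<pi> v \<in> keys (eact (invf \<pi>) \<alpha>)" using l'[of v] by (simp add: in_keys_iff)
      then have "invf \<pi> v \<in> W" using b by (auto simp: bexp_def)
      then show "v \<in> \<pi> ` W" using bij by (intro image_eqI[of _ _ "invf \<pi> v"]) (simp_all add: bij_is_surj surj_f_inv_f)
    qed
    moreover have "of_nat m * lookup \<alpha> v \<in> \<int> \<and> - of_nat N \<le> lookup \<alpha> v" for v
      unfolding l'[of v] using b by (auto simp: bexp_def)
    ultimately show "\<alpha> \<in> bexp (\<pi> ` W) m N" by (auto simp: bexp_def)
  qed
  then have "\<exists>W m N. finite W \<and> m > 0 \<and> {\<alpha>. pcoeff f (eact (invf \<pi>) \<alpha>) \<noteq> 0} \<subseteq> bexp W m N"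
    using W by (intro exI[of _ "\<pi> ` W"] exI[of _ m] exI[of _ N]) auto
  then show ?thesis unfolding pact_def by (subst Abs_pser_inverse) auto
qed

lemma pact_simps:
  "pact 0 = (0 :: ('v, 'k :: field) pser)" "pact 1 = (1 :: ('v, 'k) pser)"
  "pact (f + g) = (pact f + pact g :: ('v, 'k) pser)"
  "pact (pmono c \<alpha>) = (pmono c (eact \<pi> \<alpha>) :: ('v, 'k) pser)"
proof -
  have z: "eact (invf \<pi>) \<alpha> = \<beta> \<longleftrightarrow> \<alpha> = eact \<pi> \<beta>" for \<alpha> \<beta> using eact_inv by metis
  show "pact 0 = (0 :: ('v, 'k) pser)" "pact (f + g) = (pact f + pact g :: ('v, 'k) pser)"
    by (rule pser_eqI; simp add: pcoeff_pact)+
  show "pact 1 = (1 :: ('v, 'k) pser)"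
    by (rule pser_eqI) (simp add: pcoeff_pact pcoeff_1 z eact_0)
  show "pact (pmono c \<alpha>) = (pmono c (eact \<pi> \<alpha>) :: ('v, 'k) pser)"
    by (rule pser_eqI) (simp add: pcoeff_pact pcoeff_pmono z)
qed

lemma pact_mult: "pact (f * g) = (pact f * pact g :: ('v, 'k :: field) pser)"
proof (rule pser_eqI)
  fix \<gamma>
  let ?S = "{\<alpha>. pcoeff f \<alpha> \<noteq> 0 \<and> pcoeff g (eact (invf \<pi>) \<gamma> - \<alpha>) \<noteq> 0}"
  obtain W m N where W: "finite W" "m > 0" "psupp f \<subseteq> bexp W m N" "psupp g \<subseteq> bexp W m N"
    by (rule psupp_bexp2)
  have fin: "finite ?S"
    by (rule finite_subset[OF _ finite_bexp_decompositions[OF W(1,2)]]) (use W in \<open>auto simp: psupp_def\<close>)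
  have d: "eact (invf \<pi>) (\<gamma> - eact \<pi> \<alpha>) = eact (invf \<pi>) \<gamma> - \<alpha>" for \<alpha>
    using eact_inv(1)[of \<alpha>] bij
    by (intro poly_mapping_eqI) (simp add: lookup_eact bij_imp_bij_inv lookup_minus inv_inv_eq bij_is_inj)
  have "pcoeff (pact f * pact g) \<gamma> = (\<Sum>\<alpha>\<in>eact \<pi> ` ?S. pcoeff (pact f) \<alpha> * pcoeff (pact g) (\<gamma> - \<alpha>))"
  proof (rule pcoeff_times_eq)
    fix \<alpha> assume a: "pcoeff (pact f) \<alpha> \<noteq> 0" "pcoeff (pact g) (\<gamma> - \<alpha>) \<noteq> 0"
    let ?b = "eact (invf \<pi>) \<alpha>"
    have "\<alpha> = eact \<pi> ?b" by (simp add: eact_inv)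
    then have "eact (invf \<pi>) (\<gamma> - \<alpha>) = eact (invf \<pi>) \<gamma> - ?b" using d[of ?b] by simp
    then have "?b \<in> ?S" using a by (simp add: pcoeff_pact)
    then show "\<alpha> \<in> eact \<pi> ` ?S" using \<open>\<alpha> = eact \<pi> ?b\<close> by blast
  qed (use fin in auto)
  also have "\<dots> = (\<Sum>\<alpha>\<in>?S. pcoeff f \<alpha> * pcoeff g (eact (invf \<pi>) \<gamma> - \<alpha>))"
    by (subst sum.reindex) (auto simp: inj_on_def pcoeff_pact d eact_inv dest: eact_eq_iff[THEN iffD1])
  also have "\<dots> = pcoeff (f * g) (eact (invf \<pi>) \<gamma>)"
    by (rule pcoeff_times_eq[symmetric]) (use fin in auto)
  finally show "pcoeff (pact (f * g)) \<gamma> = pcoeff (pact f * pact g) \<gamma>" by (simp add: pcoeff_pact)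
qed

lemma pact_ps_subst:
  assumes "natexpo \<gamma>"
  shows "pact (ps_subst \<gamma> s) = ps_subst (eact \<pi> \<gamma>) s"
proof (rule ps_subst_eqI[OF natexpo_eact[OF assms]])
  fix n show "pcoeff (pact (ps_subst \<gamma> s)) (rsm (of_nat n) (eact \<pi> \<gamma>)) = fps_nth s n"
    by (simp add: pcoeff_pact eact_inv pcoeff_ps_subst[OF assms] flip: eact_rsm)
next
  fix \<delta> assume "\<And>n. \<delta> \<noteq> rsm (of_nat n) (eact \<pi> \<gamma>)"
  then have "eact (invf \<pi>) \<delta> \<noteq> rsm (of_nat n) \<gamma>" for n using eact_inv eact_rsm by metis
  then show "pcoeff (pact (ps_subst \<gamma> s)) \<delta> = 0"
    unfolding pcoeff_pact by (rule pcoeff_ps_subst_0[OF assms])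
qed

lemma pact_eq_0_iff: "pact f = 0 \<longleftrightarrow> f = 0"
proof
  assume a: "pact f = 0"
  show "f = 0"
  proof (rule pser_eqI)
    fix \<alpha> have "pcoeff (pact f) (eact \<pi> \<alpha>) = 0" using a by simp
    then show "pcoeff f \<alpha> = pcoeff 0 \<alpha>" by (simp add: pcoeff_pact eact_inv)
  qed
qed (simp add: pact_simps)

end

definition oact :: "('v \<Rightarrow> 'v) \<Rightarrow> ('v, 'k) pfield \<Rightarrow> ('v :: linorder, 'k :: field) pfield" where
  "oact \<pi> x = (let (a, b) = (SOME (a, b). b \<noteq> 0 \<and> x = to_fract a / to_fract b)
     in to_fract (pact \<pi> a) / to_fract (pact \<pi> b))"

context
  fixes \<pi> :: "('v :: linorder) \<Rightarrow> 'v"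
  assumes bij: "bij \<pi>"
begin

lemma oact_frac:
  fixes a b :: "('v, 'k :: field) pser"
  assumes "b \<noteq> 0"
  shows "oact \<pi> (to_fract a / to_fract b) = to_fract (pact \<pi> a) / to_fract (pact \<pi> b)"
proof -
  let ?P = "\<lambda>(c, d). d \<noteq> 0 \<and> to_fract a / to_fract b = to_fract c / to_fract d"
  obtain c d where cd: "(SOME p. ?P p) = (c, d)" by (cases "SOME p. ?P p") auto
  have "?P (SOME p. ?P p)" by (rule someI[of ?P "(a, b)"]) (use assms in auto)
  then have *: "d \<noteq> 0" "to_fract a / to_fract b = to_fract c / to_fract d"
    unfolding cd by auto
  then have "to_fract (a * d) = to_fract (c * b)"
    using assms by (simp add: field_simps)
  then have "a * d = c * b" by (simp only: to_fract_eq_iff)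
  then have "pact \<pi> a * pact \<pi> d = pact \<pi> c * pact \<pi> b" by (simp flip: pact_mult[OF bij])
  then have "to_fract (pact \<pi> a) * to_fract (pact \<pi> d) = to_fract (pact \<pi> c) * to_fract (pact \<pi> b)"
    by (simp flip: to_fract_mult)
  then have "to_fract (pact \<pi> c) / to_fract (pact \<pi> d) = to_fract (pact \<pi> a) / to_fract (pact \<pi> b)"
    using assms * by (simp add: field_simps pact_eq_0_iff[OF bij])
  then show ?thesis unfolding oact_def cd by simp
qed

lemma oact_to_fract: "oact \<pi> (to_fract a) = to_fract (pact \<pi> a)"
  using oact_frac[of 1 a] by (simp add: pact_simps[OF bij])

lemma
  fixes x y :: "('v, 'k :: field) pfield"
  shows oact_add: "oact \<pi> (x + y) = oact \<pi> x + oact \<pi> y"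
    and oact_mult: "oact \<pi> (x * y) = oact \<pi> x * oact \<pi> y"
proof -
  obtain a b where a: "b \<noteq> 0" "x = to_fract a / to_fract b" by (rule pfield_cases)
  obtain c d where c: "d \<noteq> 0" "y = to_fract c / to_fract d" by (rule pfield_cases)
  have e: "x + y = to_fract (a * d + c * b) / to_fract (b * d)" "x * y = to_fract (a * c) / to_fract (b * d)"
    using a c by (simp_all add: add_frac_eq)
  have bd: "b * d \<noteq> 0" using a c by simp
  have nz: "pact \<pi> b \<noteq> 0" "pact \<pi> d \<noteq> 0" using a c by (simp_all add: pact_eq_0_iff[OF bij])
  have xy: "oact \<pi> x = to_fract (pact \<pi> a) / to_fract (pact \<pi> b)" "oact \<pi> y = to_fract (pact \<pi> c) / to_fract (pact \<pi> d)"
    unfolding a(2) c(2) using oact_frac a(1) c(1) by blast+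
  show "oact \<pi> (x + y) = oact \<pi> x + oact \<pi> y"
    unfolding e(1) oact_frac[OF bd] xy using nz by (simp add: pact_simps[OF bij] pact_mult[OF bij] add_frac_eq)
  show "oact \<pi> (x * y) = oact \<pi> x * oact \<pi> y"
    unfolding e(2) oact_frac[OF bd] xy by (simp add: pact_mult[OF bij])
qed

lemma oact_0: "oact \<pi> 0 = 0" and oact_1: "oact \<pi> 1 = 1"
  using oact_to_fract[of 0] oact_to_fract[of 1] by (simp_all add: pact_simps[OF bij])

lemma oact_eq_0_iff: "oact \<pi> x = 0 \<longleftrightarrow> x = 0"
proof -
  obtain a b where a: "b \<noteq> 0" "x = to_fract a / to_fract b" by (rule pfield_cases)
  show ?thesis unfolding a(2) oact_frac[OF a(1)] using a(1) by (simp add: pact_eq_0_iff[OF bij])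
qed

lemma oact_uminus: "oact \<pi> (- x) = - oact \<pi> x"
  using oact_add[of x "- x"] by (simp add: oact_0 eq_neg_iff_add_eq_0 add.commute)

lemma oact_diff: "oact \<pi> (x - y) = oact \<pi> x - oact \<pi> y"
  using oact_add[of x "- y"] by (simp add: oact_uminus)

lemma oact_inverse: "oact \<pi> (inverse x) = inverse (oact \<pi> x)"
proof (cases "x = 0")
  case False
  then have "oact \<pi> x * oact \<pi> (inverse x) = 1" by (simp add: oact_1 flip: oact_mult)
  then show ?thesis by (simp add: inverse_unique)
qed (simp add: oact_0)

lemma inj_oact: "inj (oact \<pi>)"
  by (rule injI) (metis eq_iff_diff_eq_0 oact_diff oact_eq_0_iff)

lemma oact_xmon: "oact \<pi> (xmon \<alpha>) = xmon (eact \<pi> \<alpha>)"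
  by (simp add: xmon_def oact_to_fract pact_simps[OF bij])

lemma oact_yroot: "natexpo \<gamma> \<Longrightarrow> oact \<pi> (yroot q \<gamma>) = yroot q (eact \<pi> \<gamma>)"
  by (simp add: yroot_def oact_to_fract pact_ps_subst[OF bij])

lemma oact_image_gf: "oact \<pi> ` gf S = gf (oact \<pi> ` S)"
proof
  have "is_subfield {x. oact \<pi> x \<in> gf (oact \<pi> ` S)}"
    by (rule is_subfieldI)
      (auto simp: oact_0 oact_1 oact_add oact_mult oact_uminus oact_inverse subfield_0 subfield_1 subfield_add
        subfield_mult subfield_uminus subfield_inverse)
  then have "gf S \<subseteq> {x. oact \<pi> x \<in> gf (oact \<pi> ` S)}"
    by (rule gf_least) (auto intro: gf_in)
  then show "oact \<pi> ` gf S \<subseteq> gf (oact \<pi> ` S)" by blast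
  have sf: "is_subfield (gf S)" by simp
  have "is_subfield (oact \<pi> ` gf S)"
  proof (rule is_subfieldI)
    show "0 \<in> oact \<pi> ` gf S" using subfield_0[OF sf] by (intro image_eqI[of _ _ 0]) (simp add: oact_0)
    show "1 \<in> oact \<pi> ` gf S" using subfield_1[OF sf] by (intro image_eqI[of _ _ 1]) (simp add: oact_1)
  next
    fix x y assume "x \<in> oact \<pi> ` gf S" "y \<in> oact \<pi> ` gf S"
    then show "x + y \<in> oact \<pi> ` gf S" "x * y \<in> oact \<pi> ` gf S"
      using subfield_add[OF sf] subfield_mult[OF sf] by (auto simp flip: oact_add oact_mult)
  next
    fix x assume "x \<in> oact \<pi> ` gf S"
    then show "- x \<in> oact \<pi> ` gf S" "inverse x \<in> oact \<pi> ` gf S"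
      using subfield_uminus[OF sf] subfield_inverse[OF sf] by (auto simp flip: oact_uminus oact_inverse)
  qed
  then show "gf (oact \<pi> ` S) \<subseteq> oact \<pi> ` gf S"
    by (rule gf_least) (auto intro: gf_in)
qed

end

section \<open>Infinitely divisible elements\<close>

lemma gf_insert_common_denominator:
  fixes x :: "nat \<Rightarrow> 'a :: field"
  assumes F: "is_subfield F" and x: "\<And>i. i < n \<Longrightarrow> x i \<in> gf (insert z F)"
  shows "\<exists>P r. r \<in> polys F \<and> poly r z \<noteq> 0 \<and> (\<forall>i<n. P i \<in> polys F \<and> x i = poly (P i) z / poly r z)"
  using x
proof (induction n)
  case 0
  then show ?case using polys_1[OF F] by (intro exI[of _ "\<lambda>_. 0"] exI[of _ 1]) auto
next
  case (Suc n)
  then obtain P r where r: "r \<in> polys F" "poly r z \<noteq> 0" "\<And>i. i < n \<Longrightarrow> P i \<in> polys F \<and> x i = poly (P i) z / poly r z"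
    by (metis less_SucI)
  obtain p s where p: "x n = poly p z / poly s z" "p \<in> polys F" "s \<in> polys F" "poly s z \<noteq> 0"
    using Suc.prems[of n] unfolding gf_insert_eq[OF F] by auto
  define P' where "P' = (\<lambda>i. if i = n then p * r else P i * s)"
  have "P' i \<in> polys F \<and> x i = poly (P' i) z / poly (r * s) z" if "i < Suc n" for i
    using that r p polys_mult[OF F] by (cases "i = n") (auto simp: P'_def)
  then show ?case using r p polys_mult[OF F] by (intro exI[of _ P'] exI[of _ "r * s"]) auto
qed

text \<open>X^n - 1 splits into linear factors over the algebraically closed constants. Evaluating
  the factorisation at \<open>x\<close> gives a product equal to 0 in a field, so \<open>x\<close>
  equals one of the constant roots.\<close>

lemma roots_of_unity_constant:
  fixes x :: "('v :: linorder, 'k :: alg_closed_field) pfield"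
  assumes "x ^ n = 1" "n > 0"
  shows "x \<in> range cst"
proof -
  define p where "p = monom 1 n - [:1 :: 'k:]"
  have dp: "degree p = n" unfolding p_def using assms(2) by (rule degree_X_pow_minus_const)
  then have "p \<noteq> 0" using assms(2) by auto
  then obtain A where A: "p = smult (lead_coeff p) (\<Prod>x\<in>#A. [:- x, 1:])"
    using alg_closed_imp_factorization by blast
  have c: "poly (map_poly cst (f * g)) x = poly (map_poly cst f) x * poly (map_poly cst g) x" for f g :: "'k poly"
  proof -
    have "map_poly cst (f * g) = (map_poly cst f * map_poly cst g :: ('v, 'k) pfield poly)"
    proof (rule poly_eqI)
      have s: "cst (sum h S) = (\<Sum>i\<in>S. cst (h i) :: ('v, 'k) pfield)" for h and S :: "nat set"
        by (induction S rule: infinite_finite_induct) auto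
      fix i show "coeff (map_poly cst (f * g)) i = coeff (map_poly cst f * map_poly cst g :: ('v, 'k) pfield poly) i"
        by (simp add: coeff_map_poly coeff_mult s)
    qed
    then show ?thesis by simp
  qed
  have k: "poly (map_poly cst [:a:]) x = cst a" for a
  proof -
    have "map_poly cst [:a:] = ([:cst a:] :: ('v, 'k) pfield poly)"
      by (rule poly_eqI) (simp add: coeff_map_poly coeff_pCons split: nat.split)
    then show ?thesis by simp
  qed
  have l: "poly (map_poly cst [:- a, 1:]) x = x - cst a" for a
    by (simp add: map_poly_pCons)
  have "poly (map_poly cst (\<Prod>x\<in>#A. [:- x, 1:])) x = (\<Prod>a\<in>#A. x - cst a)"
    by (induction A) (simp_all add: c l del: mult_pCons_left mult_pCons_right)
  moreover have "poly (map_poly cst p) x = poly (map_poly cst [:lead_coeff p:]) x * poly (map_poly cst (\<Prod>x\<in>#A. [:- x, 1:])) x"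
    by (subst A) (simp flip: c)
  moreover have "poly (map_poly cst p) x = 0"
  proof -
    have "map_poly cst p = (monom 1 n - [:1:] :: ('v, 'k) pfield poly)"
      by (rule poly_eqI) (auto simp: p_def coeff_map_poly cst_diff coeff_pCons split: nat.split)
    then show ?thesis using assms(1) by (simp add: poly_monom)
  qed
  moreover have "poly (map_poly cst [:lead_coeff p:]) x = cst (lead_coeff p)"
    by (rule k)
  moreover have "cst (lead_coeff p) \<noteq> (0 :: ('v, 'k) pfield)" using \<open>p \<noteq> 0\<close> by simp
  ultimately have "(\<Prod>a\<in>#A. x - cst a) = 0" by (metis mult_eq_0_iff)
  then show ?thesis by (auto simp: prod_mset_zero_iff)
qed

text \<open>Take a root of 1 + X + ... + X^(q-1); it differs from 1, where the value is q \<noteq>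
  0.\<close>

lemma exists_prime_root_of_unity:
  assumes "Factorial_Ring.prime q" "of_nat q \<noteq> (0 :: 'k :: alg_closed_field)"
  shows "\<exists>\<zeta> :: 'k. \<zeta> ^ q = 1 \<and> \<zeta> \<noteq> 1"
proof -
  have q: "q > 1" using assms(1) by (rule prime_gt_1_nat)
  define p where "p = (\<Sum>i<q. monom (1 :: 'k) i)"
  have cp: "coeff p i = (if i < q then 1 else 0)" for i by (simp add: p_def coeff_sum)
  have "degree p \<ge> q - 1" by (rule le_degree) (use q cp in auto)
  then have "0 < degree p" using q by linarith
  then obtain \<zeta> where z: "poly p \<zeta> = 0" using alg_closed_imp_poly_has_root by blast
  have pz: "poly p x = (\<Sum>i<q. x ^ i)" for x by (simp add: p_def poly_sum poly_monom)
  have "\<zeta> ^ q - 1 = (\<zeta> - 1) * (\<Sum>i<q. \<zeta> ^ i)" by (rule power_diff_1_eq)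
  then have "\<zeta> ^ q = 1" using z pz by simp
  moreover have "\<zeta> \<noteq> 1" using z pz[of 1] assms(2) by auto
  ultimately show ?thesis by blast
qed

text \<open>The field \<open>K\<close> below adjoins to the prime field all \<open>l\<close>-power roots of the variables, and a \<open>q\<close>-th root
  of \<open>1 + X\<^sup>\<gamma>\<close> for each \<open>\<gamma> \<in> \<Gamma>\<close>; \<open>Kc\<close> has the algebraically closed field of constants adjoined in addition.
  \<open>Ef v m J\<close> is generated by everything not involving \<open>v\<close>, the \<open>l ^ m\<close>-th root \<open>tau v m\<close> of the
  variable \<open>v\<close> and the \<open>q\<close>-th roots for \<open>\<gamma> \<in> J\<close>.\<close>

locale binomial_field =
  fixes q l :: nat and \<Gamma> :: "('v :: linorder) expo set" and k0 :: "'k :: alg_closed_field set"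
  assumes q: "Factorial_Ring.prime q" and l: "Factorial_Ring.prime l" and ql: "q \<noteq> l"
    and q0: "of_nat q \<noteq> (0 :: 'k)" and l0: "of_nat l \<noteq> (0 :: 'k)"
    and G_nat: "\<gamma> \<in> \<Gamma> \<Longrightarrow> natexpo \<gamma>"
    and G_char: "\<gamma> \<in> \<Gamma> \<Longrightarrow> lookup \<gamma> v = of_nat n \<Longrightarrow> n \<noteq> 0 \<Longrightarrow> of_nat n \<noteq> (0 :: 'k)"
    and G_indep: "\<gamma> \<in> \<Gamma> \<Longrightarrow> \<gamma>' \<in> \<Gamma> \<Longrightarrow> rsm a \<gamma> = rsm b \<gamma>' \<Longrightarrow> a \<noteq> 0 \<Longrightarrow> \<gamma> = \<gamma>'"
    and G_single: "Poly_Mapping.single v 1 \<in> \<Gamma>"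
    and k0: "k0 = gf {}"
    and k0_l: "x \<in> k0 \<Longrightarrow> x ^ l = 1 \<Longrightarrow> x = 1" and k0_q: "x \<in> k0 \<Longrightarrow> x ^ q = 1 \<Longrightarrow> x = 1"
begin

text \<open>Exponents with denominators powers of \<open>l\<close>, that is, those of the monomials
  in all \<open>l\<close>-power roots of the variables.\<close>

definition Al :: "'v expo set" where
  "Al = {\<alpha>. \<forall>v. \<exists>j. of_nat (l ^ j) * lookup \<alpha> v \<in> \<int>}"

definition Kc :: "('v, 'k) pfield set" where
  "Kc = gf (range cst \<union> xmon ` Al \<union> yroot q ` \<Gamma>)"

definition K :: "('v, 'k) pfield set" where
  "K = gf (xmon ` Al \<union> yroot q ` \<Gamma>)"

definition F0 :: "'v \<Rightarrow> ('v, 'k) pfield set" where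
  "F0 v = gf (range cst \<union> xmon ` {\<alpha> \<in> Al. lookup \<alpha> v = 0})"

definition tau :: "'v \<Rightarrow> nat \<Rightarrow> ('v, 'k) pfield" where
  "tau v m = xmon (Poly_Mapping.single v (1 / of_nat (l ^ m)))"

definition Ef :: "'v \<Rightarrow> nat \<Rightarrow> 'v expo set \<Rightarrow> ('v, 'k) pfield set" where
  "Ef v m J = gf (F0 v \<union> insert (tau v m) (yroot q ` J))"

lemma K_subset_Kc: "K \<subseteq> Kc"
  unfolding K_def Kc_def by (rule gf_mono) auto

lemma l_gt_1: "l > 1" and q_gt_1: "q > 1"
  by (rule prime_gt_1_nat[OF l], rule prime_gt_1_nat[OF q])

lemma lpow_nonzero: "of_nat (l ^ n) \<noteq> (0 :: 'k)"
  using l0 by simp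

lemma Al_group: "is_expo_group Al"
  unfolding is_expo_group_def
proof (intro conjI ballI)
  show "0 \<in> Al" by (auto simp: Al_def)
next
  fix \<alpha> \<beta> assume ab: "\<alpha> \<in> Al" "\<beta> \<in> Al"
  show "\<alpha> + \<beta> \<in> Al"
    unfolding Al_def
  proof (intro CollectI allI)
    fix v
    obtain i j where ij: "of_nat (l ^ i) * lookup \<alpha> v \<in> \<int>" "of_nat (l ^ j) * lookup \<beta> v \<in> \<int>"
      using ab unfolding Al_def by blast
    have "of_nat (l ^ (i + j)) * lookup (\<alpha> + \<beta>) v =
        of_nat (l ^ j) * (of_nat (l ^ i) * lookup \<alpha> v) + of_nat (l ^ i) * (of_nat (l ^ j) * lookup \<beta> v)"
      by (simp add: lookup_add power_add algebra_simps)
    also have "\<dots> \<in> \<int>" by (intro Ints_add Ints_mult[OF Ints_of_nat ij(1)] Ints_mult[OF Ints_of_nat ij(2)])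
    finally show "\<exists>j. of_nat (l ^ j) * lookup (\<alpha> + \<beta>) v \<in> \<int>" by blast
  qed
next
  fix \<alpha> assume "\<alpha> \<in> Al"
  then show "- \<alpha> \<in> Al" by (auto simp: Al_def simp del: of_nat_power)
qed

lemma Al_add: "\<alpha> \<in> Al \<Longrightarrow> \<beta> \<in> Al \<Longrightarrow> \<alpha> + \<beta> \<in> Al" and Al_uminus: "\<alpha> \<in> Al \<Longrightarrow> - \<alpha> \<in> Al"
  and Al_0: "0 \<in> Al"
  using Al_group by (auto simp: is_expo_group_def)

lemma Al_diff: "\<alpha> \<in> Al \<Longrightarrow> \<beta> \<in> Al \<Longrightarrow> \<alpha> - \<beta> \<in> Al"
  using Al_add[of \<alpha> "- \<beta>"] Al_uminus by simp

lemma Al_root: "\<alpha> \<in> Al \<Longrightarrow> rsm (1 / of_nat (l ^ n)) \<alpha> \<in> Al"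
  unfolding Al_def
proof (intro CollectI allI)
  fix v assume "\<alpha> \<in> {\<alpha>. \<forall>v. \<exists>j. of_nat (l ^ j) * lookup \<alpha> v \<in> \<int>}"
  then obtain j where j: "of_nat (l ^ j) * lookup \<alpha> v \<in> \<int>" by blast
  have "of_nat (l ^ (j + n)) * lookup (rsm (1 / of_nat (l ^ n)) \<alpha>) v = of_nat (l ^ j) * lookup \<alpha> v"
    using l_gt_1 by (simp add: power_add)
  then show "\<exists>j. of_nat (l ^ j) * lookup (rsm (1 / of_nat (l ^ n)) \<alpha>) v \<in> \<int>" using j by metis
qed

lemma Al_single: "Poly_Mapping.single v (1 / of_nat (l ^ m)) \<in> Al"
  unfolding Al_def
proof (intro CollectI allI)
  fix w
  have "of_nat (l ^ m) * lookup (Poly_Mapping.single v (1 / of_nat (l ^ m))) w \<in> (\<int> :: rat set)"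
    using l_gt_1 by (auto simp: lookup_single when_def)
  then show "\<exists>j. of_nat (l ^ j) * lookup (Poly_Mapping.single v (1 / of_nat (l ^ m))) w \<in> (\<int> :: rat set)" by blast
qed

lemma Al_natexpo: "natexpo \<gamma> \<Longrightarrow> \<gamma> \<in> Al"
  unfolding Al_def natexpo_def using Nats_subset_Ints by (intro CollectI allI exI[of _ 0]) auto

lemma yroot_pow: "\<gamma> \<in> \<Gamma> \<Longrightarrow> yroot q \<gamma> ^ q = (1 + xmon \<gamma> :: ('v, 'k) pfield)"
  by (rule yroot_power[OF G_nat q0])

lemma cst_in_F0: "cst c \<in> F0 v"
  unfolding F0_def by (rule gf_in) auto

lemma subfields [simp]: "is_subfield (F0 v)" "is_subfield (Ef v m J)" "is_subfield Kc" "is_subfield K"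
  by (simp_all add: F0_def Ef_def Kc_def K_def)

lemma F0_subset_Ef: "F0 v \<subseteq> Ef v m J" and tau_in_Ef: "tau v m \<in> Ef v m J"
  and yroot_in_Ef: "\<gamma> \<in> J \<Longrightarrow> yroot q \<gamma> \<in> Ef v m J"
  unfolding Ef_def by (auto intro!: gf_in subsetI)

lemma cst_in_Ef: "cst c \<in> Ef v m J"
  using cst_in_F0 F0_subset_Ef by blast

lemma roots_in_Ef: "x ^ n = 1 \<Longrightarrow> n > 0 \<Longrightarrow> x \<in> Ef v m J"
  using roots_of_unity_constant cst_in_Ef by blast

lemma tau_Suc_power: "tau v (Suc m) ^ l = tau v m"
proof -
  have "rsm (of_nat l) (Poly_Mapping.single v (1 / of_nat (l ^ Suc m))) = Poly_Mapping.single v (1 / of_nat (l ^ m))"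
    using l_gt_1 by (intro poly_mapping_eqI) (auto simp: lookup_single when_def)
  then show ?thesis unfolding tau_def by (simp only: flip: xmon_rsm)
qed

lemma Ef_mono_Suc: "Ef v m J \<subseteq> Ef v (Suc m) J"
  unfolding Ef_def[of v m J]
proof (rule gf_least)
  have "tau v m \<in> Ef v (Suc m) J"
    using subfield_power[OF subfields(2)[of v "Suc m" J] tau_in_Ef, of l] by (simp only: tau_Suc_power)
  then show "F0 v \<union> insert (tau v m) (yroot q ` J) \<subseteq> Ef v (Suc m) J"
    using F0_subset_Ef yroot_in_Ef by blast
qed simp

lemma Ef_mono: "m \<le> m' \<Longrightarrow> J \<subseteq> J' \<Longrightarrow> Ef v m J \<subseteq> Ef v m' J'"
proof -
  assume mm: "m \<le> m'" and J: "J \<subseteq> J'"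
  have "Ef v m J \<subseteq> Ef v m' J"
    using mm by (induction rule: dec_induct) (use Ef_mono_Suc in blast)+
  also have "\<dots> \<subseteq> Ef v m' J'" unfolding Ef_def using J by (intro gf_mono) auto
  finally show ?thesis .
qed

lemma xmon_in_F0_tau:
  assumes a: "\<alpha> \<in> Al" "of_nat (l ^ m) * lookup \<alpha> v \<in> \<int>"
  shows "xmon \<alpha> \<in> gf (insert (tau v m) (F0 v))"
proof -
  obtain z where z: "of_nat (l ^ m) * lookup \<alpha> v = of_int z" using a(2) by (auto elim: Ints_cases)
  define \<beta> where "\<beta> = \<alpha> - Poly_Mapping.single v (lookup \<alpha> v)"
  have "lookup \<alpha> v = of_int z * (1 / of_nat (l ^ m))" using z l_gt_1 by (simp add: field_simps)
  then have s: "Poly_Mapping.single v (lookup \<alpha> v) = rsm (of_int z) (Poly_Mapping.single v (1 / of_nat (l ^ m)))"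
    by (intro poly_mapping_eqI) (auto simp: lookup_single when_def)
  have sA: "Poly_Mapping.single v (lookup \<alpha> v) \<in> Al"
    unfolding Al_def
  proof (intro CollectI allI)
    fix w show "\<exists>j. of_nat (l ^ j) * lookup (Poly_Mapping.single v (lookup \<alpha> v)) w \<in> (\<int> :: rat set)"
      using a(2) by (intro exI[of _ m]) (auto simp: lookup_single when_def)
  qed
  have "\<beta> \<in> Al" unfolding \<beta>_def by (rule Al_diff[OF a(1) sA])
  moreover have "lookup \<beta> v = 0" by (simp add: \<beta>_def lookup_minus)
  ultimately have "xmon \<beta> \<in> F0 v" unfolding F0_def by (intro gf_in) auto
  then have 1: "xmon \<beta> \<in> gf (insert (tau v m) (F0 v))" by (intro gf_in) auto
  have t: "tau v m \<in> gf (insert (tau v m) (F0 v))" by (intro gf_in) auto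
  have "xmon (Poly_Mapping.single v (lookup \<alpha> v)) \<in> gf (insert (tau v m) (F0 v))"
  proof (cases "z \<ge> 0")
    case True
    then have "(of_int z :: rat) = of_nat (nat z)" by simp
    then show ?thesis unfolding s using subfield_power[OF is_subfield_gf t, of "nat z"]
      by (simp only: xmon_rsm tau_def)
  next
    case False
    then have z': "(of_int z :: rat) = - of_nat (nat (- z))" by simp
    have n: "rsm (- r) \<delta> = - rsm r \<delta>" for r and \<delta> :: "'v expo" by (rule poly_mapping_eqI) simp
    show ?thesis unfolding s z' n xmon_uminus
      using subfield_inverse[OF is_subfield_gf subfield_power[OF is_subfield_gf t, of "nat (- z)"]]
      by (simp only: xmon_rsm tau_def)
  qed
  moreover have "xmon \<alpha> = xmon \<beta> * xmon (Poly_Mapping.single v (lookup \<alpha> v))"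
    unfolding \<beta>_def by (simp flip: xmon_add)
  ultimately show ?thesis using 1 subfield_mult[OF is_subfield_gf] by metis
qed

lemma gf_insert_tau_subset_Ef: "gf (insert (tau v m) (F0 v)) \<subseteq> Ef v m J"
  unfolding Ef_def by (rule gf_mono) auto

text \<open>An element involves finitely many of the generators. Those not containing
  \<open>v\<close> are already in \<open>F0 v\<close>, apart from the roots \<open>yroot\<close>, so
  one level \<open>m\<close> and one finite \<open>J\<close> suffice; the fields
  \<open>Ef v m J\<close> form a directed system.\<close>

lemma adjoin_in_Ef:
  assumes "x \<in> gf (range cst \<union> xmon ` Al \<union> yroot q ` S)"
  shows "\<exists>m J. finite J \<and> J \<subseteq> S \<and> x \<in> Ef v m J"
proof -
  define I where "I = {i :: nat \<times> 'v expo set. finite (snd i) \<and> snd i \<subseteq> S}"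
  define U where "U = (\<Union>i\<in>I. Ef v (fst i) (snd i))"
  have U: "y \<in> U" if "y \<in> Ef v m J" "finite J" "J \<subseteq> S" for y m J
    unfolding U_def using that by (intro UN_I[of "(m, J)"]) (auto simp: I_def)
  have "is_subfield U"
    unfolding U_def
  proof (rule is_subfield_directed_union)
    show "I \<noteq> {}" by (auto simp: I_def intro!: exI[of _ "{}"])
    fix i j assume ij: "i \<in> I" "j \<in> I"
    let ?k = "(max (fst i) (fst j), snd i \<union> snd j)"
    have "Ef v (fst i) (snd i) \<subseteq> Ef v (fst ?k) (snd ?k)" "Ef v (fst j) (snd j) \<subseteq> Ef v (fst ?k) (snd ?k)"
      by (intro Ef_mono; simp)+
    moreover have "?k \<in> I" using ij by (auto simp: I_def)
    ultimately show "\<exists>k\<in>I. Ef v (fst i) (snd i) \<subseteq> Ef v (fst k) (snd k) \<and> Ef v (fst j) (snd j) \<subseteq> Ef v (fst k) (snd k)"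
      by blast
  qed simp
  moreover have "xmon \<alpha> \<in> U" if a: "\<alpha> \<in> Al" for \<alpha>
  proof -
    obtain m where "of_nat (l ^ m) * lookup \<alpha> v \<in> \<int>" using a unfolding Al_def by blast
    then have "xmon \<alpha> \<in> Ef v m {}" using xmon_in_F0_tau[OF a] gf_insert_tau_subset_Ef by blast
    then show ?thesis by (rule U) auto
  qed
  moreover have "yroot q \<gamma> \<in> U" if "\<gamma> \<in> S" for \<gamma>
    using that by (intro U[OF yroot_in_Ef[of \<gamma> "{\<gamma>}"]]) auto
  moreover have "cst c \<in> U" for c
    by (rule U[OF cst_in_Ef[of c v 0 "{}"]]) auto
  ultimately have "gf (range cst \<union> xmon ` Al \<union> yroot q ` S) \<subseteq> U" by (intro gf_least) auto
  then obtain i where "i \<in> I" "x \<in> Ef v (fst i) (snd i)" using assms unfolding U_def by blast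
  then show ?thesis unfolding I_def by blast
qed

lemma Kc_in_Ef: "x \<in> Kc \<Longrightarrow> \<exists>m J. finite J \<and> J \<subseteq> \<Gamma> \<and> x \<in> Ef v m J"
  unfolding Kc_def by (rule adjoin_in_Ef)

text \<open>Contains the leading exponents of nonzero elements of \<open>Ef v m J\<close>
  (\<open>Ef_fracs\<close>): exponents in \<Gamma> are integral, so adjoining the q-th roots leaves
  the denominators at \<open>v\<close> unchanged.\<close>

definition Zv :: "'v \<Rightarrow> nat \<Rightarrow> 'v expo set" where
  "Zv v m = {\<alpha>. of_nat (l ^ m) * lookup \<alpha> v \<in> \<int>}"

lemma Zv_group: "is_expo_group (Zv v m)"
  by (auto simp: is_expo_group_def Zv_def lookup_add distrib_left simp del: of_nat_power)

lemma zero_group: "is_expo_group {\<alpha>. lookup \<alpha> v = 0}"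
  by (auto simp: is_expo_group_def lookup_add)

lemma UNIV_subfield: "is_subfield UNIV"
  by (auto simp: is_subfield_def)

lemma F0_fracs: "F0 v \<subseteq> fracs {\<alpha>. lookup \<alpha> v = 0} UNIV"
  unfolding F0_def
  by (rule gf_least[OF is_subfield_fracs[OF zero_group UNIV_subfield]])
    (auto intro!: cst_in_fracs xmon_in_fracs zero_group UNIV_subfield)

lemma Ef_fracs: "J \<subseteq> \<Gamma> \<Longrightarrow> Ef v m J \<subseteq> fracs (Zv v m) UNIV"
  unfolding Ef_def
proof (rule gf_least[OF is_subfield_fracs[OF Zv_group UNIV_subfield]])
  assume J: "J \<subseteq> \<Gamma>"
  have "F0 v \<subseteq> fracs (Zv v m) UNIV"
    unfolding F0_def
  proof (rule gf_least[OF is_subfield_fracs[OF Zv_group UNIV_subfield]])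
    have "{\<alpha> \<in> Al. lookup \<alpha> v = 0} \<subseteq> Zv v m" by (auto simp: Zv_def)
    then show "range cst \<union> xmon ` {\<alpha> \<in> Al. lookup \<alpha> v = 0} \<subseteq> fracs (Zv v m) UNIV"
      using cst_in_fracs[OF Zv_group UNIV_subfield] xmon_in_fracs[OF Zv_group UNIV_subfield] by blast
  qed
  moreover have "tau v m \<in> fracs (Zv v m) UNIV"
    unfolding tau_def using l_gt_1
    by (intro xmon_in_fracs[OF Zv_group UNIV_subfield]) (simp add: Zv_def)
  moreover have "yroot q \<gamma> \<in> fracs (Zv v m) UNIV" if "\<gamma> \<in> J" for \<gamma>
  proof (rule yroot_in_fracs[OF Zv_group UNIV_subfield])
    show "natexpo \<gamma>" using G_nat J that by blast
    then have "lookup \<gamma> v \<in> \<int>" using Nats_subset_Ints by (auto simp: natexpo_def)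
    then show "\<gamma> \<in> Zv v m" unfolding Zv_def by (intro CollectI Ints_mult[OF Ints_of_nat])
  qed
  ultimately show "F0 v \<union> insert (tau v m) (yroot q ` J) \<subseteq> fracs (Zv v m) UNIV" by blast
qed

text \<open>Nonzero coefficients have leading exponents that are 0 at \<open>v\<close>, while the
  i-th power of \<open>z\<close> contributes i times a nonzero number there. The terms of the
  polynomial at \<open>z\<close> thus have distinct leading exponents.\<close>

lemma transcendental_over_F0:
  assumes z: "z \<noteq> 0" "lookup (lexp z) v \<noteq> 0" and p: "p \<in> polys (F0 v)" "poly p z = 0"
  shows "p = 0"
proof (rule ccontr)
  assume "p \<noteq> 0"
  have "(\<Sum>i\<le>degree p. coeff p i * z ^ i) \<noteq> 0"
  proof (rule sum_distinct_lexp_nonzero)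
    show "coeff p (degree p) * z ^ degree p \<noteq> 0" using z \<open>p \<noteq> 0\<close> by simp
  next
    fix i j assume ij: "i \<noteq> j" "coeff p i * z ^ i \<noteq> 0" "coeff p j * z ^ j \<noteq> 0"
    have c: "lookup (lexp (coeff p i)) v = 0" if "coeff p i \<noteq> 0" for i
      using lexp_fracs[OF zero_group UNIV_subfield _ that] polys_coeff[OF p(1)] F0_fracs by blast
    have lx: "lookup (lexp (coeff p i * z ^ i)) v = of_nat i * lookup (lexp z) v" if "coeff p i * z ^ i \<noteq> 0" for i
      using that z c[of i] by (simp add: lexp_mult lexp_pow lookup_add)
    show "lexp (coeff p i * z ^ i) \<noteq> lexp (coeff p j * z ^ j)"
    proof
      assume "lexp (coeff p i * z ^ i) = lexp (coeff p j * z ^ j)"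
      then have "of_nat i * lookup (lexp z) v = of_nat j * lookup (lexp z) v" using lx ij by metis
      then show False using z ij by simp
    qed
  qed auto
  with p(2) show False by (simp add: poly_altdef)
qed

text \<open>The previous lemma is applied to z - 1 and p(1 + X). In this form it covers elements
  with leading term 1, whose own leading exponent carries no information.\<close>

lemma transcendental_over_F0_shift:
  assumes z: "z \<noteq> 1" "lookup (lexp (z - 1)) v \<noteq> 0" and p: "p \<in> polys (F0 v)" "poly p z = 0"
  shows "p = 0"
proof -
  have F: "is_subfield (F0 v)" by simp
  define r where "r = (\<Sum>i\<le>degree p. smult (coeff p i) ([:1, 1:] ^ i))"
  have X1: "[:1, 1:] \<in> polys (F0 v)"
    using subfield_0[OF F] subfield_1[OF F] by (auto simp: polys_def coeff_pCons split: nat.split)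
  have "r \<in> polys (F0 v)" unfolding r_def
    using polys_coeff[OF p(1)] X1 by (intro polys_sum[OF F] polys_smult[OF F] polys_power[OF F]) auto
  moreover have ev: "poly r x = poly p (1 + x)" for x
    by (simp add: r_def poly_sum poly_altdef[of p])
  ultimately have "r = 0" using transcendental_over_F0[of "z - 1" v r] z p by simp
  have r: "r = pcompose p [:1, 1:]"
    unfolding r_def pcompose_altdef by (simp add: poly_altdef degree_map_poly coeff_map_poly)
  show "p = 0" using \<open>r = 0\<close> unfolding r by (simp add: pcompose_eq_0_iff)
qed

lemma gf_Ef_insert: "gf (insert (yroot q \<gamma>) (Ef v m J)) = Ef v m (insert \<gamma> J)"
proof -
  have "gf (Ef v m J \<union> {yroot q \<gamma>}) = gf ((F0 v \<union> insert (tau v m) (yroot q ` J)) \<union> {yroot q \<gamma>})"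
    unfolding Ef_def by (rule gf_Un_gf)
  then show ?thesis by (simp add: Ef_def insert_commute)
qed

lemma gf_Ef_Suc: "gf (insert (tau v (Suc m)) (Ef v m J)) = Ef v (Suc m) J"
proof
  show "gf (insert (tau v (Suc m)) (Ef v m J)) \<subseteq> Ef v (Suc m) J"
    by (rule gf_least) (use Ef_mono_Suc tau_in_Ef in auto)
  have "F0 v \<union> insert (tau v (Suc m)) (yroot q ` J) \<subseteq> insert (tau v (Suc m)) (Ef v m J)"
    using F0_subset_Ef yroot_in_Ef by blast
  then show "Ef v (Suc m) J \<subseteq> gf (insert (tau v (Suc m)) (Ef v m J))"
    unfolding Ef_def[of v "Suc m"] by (rule gf_mono)
qed

lemma xmon_in_Ef: "\<gamma> \<in> \<Gamma> \<Longrightarrow> xmon \<gamma> \<in> Ef v m J"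
proof -
  assume g: "\<gamma> \<in> \<Gamma>"
  then have "lookup \<gamma> v \<in> \<int>" using G_nat Nats_subset_Ints by (auto simp: natexpo_def)
  then have "of_nat (l ^ m) * lookup \<gamma> v \<in> \<int>" by (rule Ints_mult[OF Ints_of_nat])
  then show ?thesis using xmon_in_F0_tau[OF Al_natexpo[OF G_nat[OF g]]] gf_insert_tau_subset_Ef by blast
qed

lemma yroot_pow_in_Ef: "\<gamma> \<in> \<Gamma> \<Longrightarrow> yroot q \<gamma> ^ q \<in> Ef v m J"
  using xmon_in_Ef subfield_add[OF subfields(2)] subfield_1[OF subfields(2)] by (simp add: yroot_pow)

lemma exists_constant_root:
  assumes "Factorial_Ring.prime r" "of_nat r \<noteq> (0 :: 'k)"
  obtains \<zeta> where "\<zeta> \<in> Ef v m J" "\<zeta> ^ r = 1" "\<zeta> \<noteq> 1"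
proof -
  obtain z :: 'k where z: "z ^ r = 1" "z \<noteq> 1" using exists_prime_root_of_unity[OF assms] by blast
  have "cst z \<noteq> (1 :: ('v, 'k) pfield)"
  proof
    assume "cst z = (1 :: ('v, 'k) pfield)"
    then have "cst (z - 1) = (0 :: ('v, 'k) pfield)" by (simp add: cst_diff)
    then show False using z by simp
  qed
  then show ?thesis using that[of "cst z"] z cst_in_Ef by (metis cst_power cst_simps(2))
qed

text \<open>The q-th roots are removed one at a time: as \<open>l\<close> and \<open>q\<close> are
  distinct primes, an extension by a q-th root creates no new \<open>l\<close>-th roots
  (\<open>kummer_coprime_roots\<close>).\<close>

lemma descend_yroots:
  assumes "finite J'" "J \<union> J' \<subseteq> \<Gamma>" "w ^ l \<in> Ef v m J" "w \<in> Ef v m (J \<union> J')"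
  shows "w \<in> Ef v m J"
  using assms
proof (induction J' rule: finite_induct)
  case (insert \<gamma> J')
  let ?E = "Ef v m (J \<union> J')"
  obtain \<zeta> where z: "\<zeta> \<in> ?E" "\<zeta> ^ q = 1" "\<zeta> \<noteq> 1" using exists_constant_root[OF q q0] by blast
  have "w \<in> gf (insert (yroot q \<gamma>) ?E)" using insert.prems by (simp add: gf_Ef_insert)
  moreover have "w ^ l \<in> ?E" using insert.prems Ef_mono[of m m J "J \<union> J'"] by auto
  moreover have "yroot q \<gamma> ^ q \<in> ?E" using insert.prems by (intro yroot_pow_in_Ef) auto
  moreover have "x \<in> ?E" if "x ^ l = 1" for x using that l_gt_1 by (intro roots_in_Ef[of _ l]) auto
  ultimately have "w \<in> ?E" using kummer_coprime_roots[OF subfields(2) q _ z _ _ _ l ql[symmetric]] by blast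
  then show ?case using insert by auto
qed auto

text \<open>One level down, Kummer theory gives w = c * tau^j with j < l. The exponent of c at
  \<open>v\<close> has denominator dividing l^m', so \<open>lexp w = 0\<close> makes j / l an
  integer, and j = 0.\<close>

lemma descend_tau:
  assumes J: "J \<subseteq> \<Gamma>" and w: "w ^ l \<in> Ef v m J" "w \<noteq> 0" "lexp w = 0" and "m \<le> m'" "w \<in> Ef v m' J"
  shows "w \<in> Ef v m J"
  using assms(5,6)
proof (induction rule: dec_induct)
  case (step m')
  let ?E = "Ef v m' J"
  obtain \<zeta> where z: "\<zeta> \<in> ?E" "\<zeta> ^ l = 1" "\<zeta> \<noteq> 1" using exists_constant_root[OF l l0] by blast
  have 1: "w \<in> gf (insert (tau v (Suc m')) ?E)" using step.prems by (simp add: gf_Ef_Suc)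
  have 2: "w ^ l \<in> ?E" using w Ef_mono[OF step.hyps(1) order_refl] by blast
  have 3: "tau v (Suc m') ^ l \<in> ?E" by (simp add: tau_Suc_power tau_in_Ef)
  have 4: "x \<in> ?E" if "x ^ l = 1" for x using that l_gt_1 by (intro roots_in_Ef[of _ l]) auto
  obtain c j where c: "c \<in> ?E" "j < l" "w = c * tau v (Suc m') ^ j"
    using kummer_roots[OF subfields(2) l 3 z 1 2 4] by blast
  have c0: "c \<noteq> 0" using c w by auto
  have lc: "lexp c \<in> Zv v m'" using lexp_fracs[OF Zv_group UNIV_subfield _ c0] Ef_fracs[OF J] c(1) by blast
  have "lexp w = lexp c + rsm (of_nat j) (Poly_Mapping.single v (1 / of_nat (l ^ Suc m')))"
    unfolding c(3) using c0 by (simp add: lexp_mult lexp_pow tau_def del: power_Suc)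
  then have "0 = lookup (lexp c) v + of_nat j * (1 / of_nat (l ^ Suc m'))"
    using w(3) by (metis lookup_add lookup_rsm lookup_single_eq lookup_zero)
  then have e: "lookup (lexp c) v = - (of_nat j * (1 / of_nat (l ^ Suc m')))" by linarith
  have "of_nat (l ^ m') * lookup (lexp c) v = - (of_nat j / of_nat l)"
    unfolding e using l_gt_1 by simp
  moreover have "of_nat (l ^ m') * lookup (lexp c) v \<in> \<int>" using lc by (simp add: Zv_def)
  ultimately have "(of_nat j / of_nat l :: rat) \<in> \<int>" by simp
  then obtain z where "(of_nat j / of_nat l :: rat) = of_int z" by (auto elim: Ints_cases)
  then have "(of_nat j :: rat) = of_int z * of_nat l" using l_gt_1 by (simp add: field_simps)
  then have "int j = z * int l" by (metis of_int_eq_iff of_int_mult of_int_of_nat_eq)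
  then have "l dvd j" by (metis dvd_triv_right int_dvd_int_iff)
  then have "j = 0" using c(2) by (auto dest: dvd_imp_le)
  then show ?case using c step.IH by simp
qed

lemma descend_l:
  assumes J: "J \<subseteq> \<Gamma>" "finite J" and w: "w \<in> Kc" "w ^ l \<in> Ef v m J" "w \<noteq> 0" "lexp w = 0"
  shows "w \<in> Ef v m J"
proof -
  obtain m' J' where m': "finite J'" "J' \<subseteq> \<Gamma>" "w \<in> Ef v m' J'" using Kc_in_Ef[OF w(1)] by blast
  have "w \<in> Ef v (max m m') (J \<union> J')" using m' Ef_mono[of m' "max m m'" J' "J \<union> J'"] by auto
  moreover have "w ^ l \<in> Ef v (max m m') J" using w Ef_mono[of m "max m m'" J J] by auto
  ultimately have "w \<in> Ef v (max m m') J"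
    using descend_yroots[OF m'(1), of J w v "max m m'"] J m'(2) by blast
  then show ?thesis using descend_tau[OF J(1) w(2-4), of "max m m'"] by simp
qed

lemma descend_l_power:
  assumes J: "J \<subseteq> \<Gamma>" "finite J" and w: "w \<in> Kc" "w ^ (l ^ n) \<in> Ef v m J" "w \<noteq> 0" "lexp w = 0"
  shows "w \<in> Ef v m J"
  using w(2)
proof (induction n)
  case (Suc n)
  have "w ^ (l ^ n) \<in> Ef v m J"
  proof (rule descend_l[OF J])
    show "w ^ l ^ n \<in> Kc" using w by (intro subfield_power) auto
    show "(w ^ l ^ n) ^ l \<in> Ef v m J" using Suc.prems by (simp add: mult.commute flip: power_mult)
    show "lexp (w ^ l ^ n) = 0" using w by (simp add: lexp_pow)
  qed (use w in auto)
  then show ?case by (rule Suc.IH)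
qed simp

end

section \<open>Exchange of transcendental elements and independence of powers\<close>

lemma fin_over_mono: "fin_over F E \<Longrightarrow> E' \<subseteq> E \<Longrightarrow> fin_over F E'"
  unfolding fin_over_def by blast

text \<open>Steinitz exchange: \<open>u\<close> is transcendental over \<open>F\<close> and
  algebraic over F(t), so \<open>t\<close> is algebraic over F(u). After clearing denominators the
  relation is a polynomial in \<open>t\<close> and \<open>u\<close> over \<open>F\<close>, which is
  reordered by powers of \<open>t\<close>.\<close>

lemma gf_insert_exchange:
  fixes F :: "'a :: field set"
  assumes F: "is_subfield F"
    and u: "\<And>p. p \<in> polys F \<Longrightarrow> poly p u = 0 \<Longrightarrow> p = 0"
    and alg: "p \<in> polys (gf (insert t F))" "p \<noteq> 0" "poly p u = 0"
  shows "\<exists>s\<in>polys (gf (insert u F)). s \<noteq> 0 \<and> poly s t = 0"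
proof -
  let ?B = "gf (insert u F)"
  have B: "is_subfield ?B" by simp
  have FB: "F \<subseteq> ?B" and uB: "u \<in> ?B" using gf_superset[of "insert u F"] by auto
  define n where "n = Suc (degree p)"
  have "\<exists>P r. r \<in> polys F \<and> poly r t \<noteq> 0 \<and> (\<forall>i<n. P i \<in> polys F \<and> coeff p i = poly (P i) t / poly r t)"
    by (rule gf_insert_common_denominator[OF F]) (use alg polys_coeff in blast)
  then obtain P r where P: "r \<in> polys F" "poly r t \<noteq> 0" "\<And>i. i < n \<Longrightarrow> P i \<in> polys F"
    "\<And>i. i < n \<Longrightarrow> coeff p i = poly (P i) t / poly r t" by blast
  define D where "D = Suc (\<Sum>i<n. degree (P i))"
  have ev: "poly (P i) x = (\<Sum>j<D. coeff (P i) j * x ^ j)" if "i < n" for i x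
  proof -
    have "degree (P i) \<le> (\<Sum>i<n. degree (P i))" using that by (intro member_le_sum) auto
    then show ?thesis unfolding poly_altdef D_def by (intro sum.mono_neutral_left) (auto simp: coeff_eq_0)
  qed
  \<comment> \<open>The coefficient of t^j in the relation, a polynomial in \<open>u\<close> over
    \<open>F\<close>. It is nonzero for some j because \<open>u\<close> is transcendental.\<close>
  define Q where "Q = (\<lambda>j. \<Sum>i<n. coeff (P i) j * u ^ i)"
  have PB: "coeff (P i) j \<in> ?B" if "i < n" for i j
    using polys_coeff[OF P(3)[OF that]] FB by blast
  have QB: "Q j \<in> ?B" for j unfolding Q_def
    using PB uB by (intro subfield_sum[OF B] subfield_mult[OF B] subfield_power[OF B]) auto
  define s where "s = (\<Sum>j<D. monom (Q j) j)"
  have cs: "coeff s j = (if j < D then Q j else 0)" for j by (simp add: s_def coeff_sum)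
  have "s \<in> polys ?B" unfolding s_def using QB by (intro polys_sum[OF B] polys_monom[OF B])
  moreover have "poly s t = 0"
  proof -
    have "0 = (\<Sum>i<n. coeff p i * u ^ i) * poly r t"
      using alg(3) by (simp add: poly_altdef n_def lessThan_Suc_atMost)
    also have "\<dots> = (\<Sum>i<n. poly (P i) t * u ^ i)"
      unfolding sum_distrib_right using P(2,4) by (intro sum.cong) auto
    also have "\<dots> = (\<Sum>i<n. \<Sum>j<D. coeff (P i) j * t ^ j * u ^ i)"
      by (intro sum.cong) (auto simp: ev sum_distrib_right)
    also have "\<dots> = (\<Sum>j<D. \<Sum>i<n. coeff (P i) j * t ^ j * u ^ i)" by (rule sum.swap)
    also have "\<dots> = poly s t"
      by (simp add: s_def poly_sum poly_monom Q_def sum_distrib_left sum_distrib_right mult_ac)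
    finally show ?thesis by simp
  qed
  moreover have "s \<noteq> 0"
  proof
    assume s0: "s = 0"
    have "coeff p (degree p) \<noteq> 0" using alg by simp
    then have "P (degree p) \<noteq> 0" using P(4)[of "degree p"] by (auto simp: n_def)
    then obtain j where j: "coeff (P (degree p)) j \<noteq> 0" by (auto simp: poly_eq_iff)
    have "j < D"
    proof -
      have "degree (P (degree p)) \<le> (\<Sum>i<n. degree (P i))" by (intro member_le_sum) (auto simp: n_def)
      moreover have "j \<le> degree (P (degree p))" using j by (rule le_degree)
      ultimately show ?thesis by (simp add: D_def)
    qed
    then have "Q j = 0" using cs[of j] s0 by simp
    define w where "w = (\<Sum>i<n. monom (coeff (P i) j) i)"
    have "w \<in> polys F" unfolding w_def using P(3) polys_coeff by (intro polys_sum[OF F] polys_monom[OF F]) auto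
    moreover have "poly w u = 0" using \<open>Q j = 0\<close> by (simp add: w_def poly_sum poly_monom Q_def)
    ultimately have "w = 0" by (rule u)
    moreover have "coeff w (degree p) = coeff (P (degree p)) j" by (simp add: w_def coeff_sum n_def)
    ultimately show False using j by simp
  qed
  ultimately show ?thesis by blast
qed

text \<open>Clearing denominators turns a relation over F(w^M) into a polynomial in \<open>w\<close>
  over \<open>F\<close>. The terms of the i-th summand have exponents congruent to i modulo M, so
  different summands cannot cancel.\<close>

lemma powers_independent:
  fixes F :: "'a :: field set"
  assumes F: "is_subfield F"
    and w: "\<And>p. p \<in> polys F \<Longrightarrow> poly p w = 0 \<Longrightarrow> p = 0"
    and c: "\<And>i. i < M \<Longrightarrow> c i \<in> gf (insert (w ^ M) F)" "(\<Sum>i<M. c i * w ^ i) = 0" and i: "i < M"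
  shows "c i = 0"
proof -
  let ?u = "w ^ M"
  have "\<exists>P r. r \<in> polys F \<and> poly r ?u \<noteq> 0 \<and> (\<forall>i<M. P i \<in> polys F \<and> c i = poly (P i) ?u / poly r ?u)"
    by (rule gf_insert_common_denominator[OF F]) (rule c)
  then obtain P r where P: "r \<in> polys F" "poly r ?u \<noteq> 0" "\<And>i. i < M \<Longrightarrow> P i \<in> polys F"
    "\<And>i. i < M \<Longrightarrow> c i = poly (P i) ?u / poly r ?u" by blast
  define T where "T = (\<Sum>i<M. \<Sum>j\<le>degree (P i). monom (coeff (P i) j) (M * j + i))"
  have "T \<in> polys F" unfolding T_def using P(3) polys_coeff
    by (intro polys_sum[OF F] polys_monom[OF F]) auto
  moreover have "poly T w = 0"
  proof -
    have "0 = (\<Sum>i<M. c i * w ^ i) * poly r ?u" using c by simp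
    also have "\<dots> = (\<Sum>i<M. poly (P i) ?u * w ^ i)"
      unfolding sum_distrib_right using P(2,4) by (intro sum.cong) auto
    also have "\<dots> = (\<Sum>i<M. \<Sum>j\<le>degree (P i). coeff (P i) j * w ^ (M * j + i))"
      by (simp add: poly_altdef sum_distrib_right power_add power_mult mult.assoc)
    also have "\<dots> = poly T w"
      by (simp add: T_def poly_sum poly_monom)
    finally show ?thesis by simp
  qed
  ultimately have T0: "T = 0" by (rule w)
  have "coeff (P i) j = 0" for j
  proof (cases "j \<le> degree (P i)")
    case True
    have eq: "M * j' + i' = M * j + i \<longleftrightarrow> i' = i \<and> j' = j" if "i' < M" for i' j'
    proof
      assume e: "M * j' + i' = M * j + i"
      then have "(M * j' + i') mod M = (M * j + i) mod M" by simp
      then have "i' = i" using that i by simp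
      then show "i' = i \<and> j' = j" using e i by simp
    qed auto
    have "0 = coeff T (M * j + i)" by (simp add: T0)
    also have "\<dots> = (\<Sum>i'<M. \<Sum>j'\<le>degree (P i'). if i' = i \<and> j' = j then coeff (P i') j' else 0)"
      unfolding T_def coeff_sum by (intro sum.cong) (auto simp: eq)
    also have "\<dots> = (\<Sum>i'<M. if i' = i then coeff (P i) j else 0)"
      using True by (intro sum.cong) (auto simp: if_distrib)
    also have "\<dots> = coeff (P i) j" using i by simp
    finally show ?thesis by simp
  qed (auto simp: coeff_eq_0)
  then have "P i = 0" by (simp add: poly_eq_iff)
  then show ?thesis using P(4)[OF i] by simp
qed

section \<open>Elements with roots of every \<open>l\<close>-power order are monomials up to
  constants\<close>

context binomial_field
begin

text \<open>\<open>Ef v m J\<close> is finite over F0(tau) because the q-th roots are algebraic. So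
  \<open>u\<close> is algebraic over F0(tau), the exchange lemma makes tau algebraic over F0(u), and
  the q-th roots are adjoined again.\<close>

lemma fin_over_Ef:
  assumes J: "finite J" "J \<subseteq> \<Gamma>" and u: "u \<in> Ef v m J" "\<And>p. p \<in> polys (F0 v) \<Longrightarrow> poly p u = 0 \<Longrightarrow> p = 0"
  shows "fin_over (gf (insert u (F0 v))) (Ef v m J)"
proof -
  let ?B = "gf (insert u (F0 v))" and ?t = "tau v m"
  let ?T = "gf (insert ?t (F0 v))"
  have y: "\<exists>p\<in>polys E. p \<noteq> 0 \<and> poly p z = 0" if z: "z \<in> yroot q ` J" and E: "is_subfield E" "?T \<subseteq> E" for E z
  proof -
    obtain \<gamma> where g: "\<gamma> \<in> J" "z = yroot q \<gamma>" using z by blast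
    then have gG: "\<gamma> \<in> \<Gamma>" using J by blast
    have "lookup \<gamma> v \<in> \<int>" using G_nat[OF gG] Nats_subset_Ints by (auto simp: natexpo_def)
    then have "of_nat (l ^ m) * lookup \<gamma> v \<in> \<int>" by (rule Ints_mult[OF Ints_of_nat])
    then have "xmon \<gamma> \<in> ?T" by (rule xmon_in_F0_tau[OF Al_natexpo[OF G_nat[OF gG]]])
    then have x: "1 + xmon \<gamma> \<in> E" using E(2) subfield_1[OF E(1)] subfield_add[OF E(1)] by blast
    have "monom 1 q - [:1 + xmon \<gamma>:] \<in> polys E"
      using x subfield_1[OF E(1)] by (intro polys_diff[OF E(1)] polys_monom[OF E(1)] polys_const[OF E(1)])
    moreover have "degree (monom 1 q - [:1 + xmon \<gamma> :: ('v, 'k) pfield:]) = q"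
      using q_gt_1 by (intro degree_X_pow_minus_const) auto
    then have "monom 1 q - [:1 + xmon \<gamma> :: ('v, 'k) pfield:] \<noteq> 0" using q_gt_1 by auto
    moreover have "poly (monom 1 q - [:1 + xmon \<gamma>:]) z = 0"
      unfolding g(2) using yroot_pow[OF gG] by (simp add: poly_monom)
    ultimately show ?thesis by blast
  qed
  have eT: "Ef v m J = gf (?T \<union> yroot q ` J)"
    unfolding Ef_def using gf_Un_gf[of "insert ?t (F0 v)" "yroot q ` J"] by (simp add: Un_commute Un_insert_left)
  have "fin_over ?T (Ef v m J)"
    unfolding eT by (rule fin_over_adjoin_set[OF is_subfield_gf]) (use J y[OF _ is_subfield_gf] in auto)
  then obtain p where p: "p \<in> polys ?T" "p \<noteq> 0" "poly p u = 0"
    using fin_over_algebraic[OF is_subfield_gf subfields(2) _ u(1)] by blast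
  obtain s where s: "s \<in> polys ?B" "s \<noteq> 0" "poly s ?t = 0"
    using gf_insert_exchange[OF subfields(1) u(2) p] by blast
  let ?B1 = "gf (insert ?t ?B)"
  have f1: "fin_over ?B ?B1" by (rule fin_over_insert) (use s in auto)
  have TB1: "?T \<subseteq> ?B1"
    by (rule gf_least) (use gf_superset[of "insert ?t ?B"] gf_superset[of "insert u (F0 v)"] in auto)
  have f2: "fin_over ?B1 (gf (?B1 \<union> yroot q ` J))"
    by (rule fin_over_adjoin_set[OF is_subfield_gf]) (use J y[OF _ is_subfield_gf TB1] in auto)
  have "Ef v m J \<subseteq> gf (?B1 \<union> yroot q ` J)" unfolding eT using TB1 by (intro gf_mono) auto
  with fin_over_trans[OF is_subfield_gf f1 f2] show ?thesis by (rule fin_over_mono)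
qed

text \<open>If \<open>u\<close> is not constant then, for a variable \<open>v\<close> in the leading exponent of \<open>u - 1\<close>, it is transcendental over
  \<open>F0 v\<close>. All \<open>l\<close>-power roots of \<open>u\<close> descend to the same \<open>Ef v m J\<close>, which is finite over \<open>F0 v (u)\<close>,
  although the roots have unbounded degree over \<open>F0 v (u)\<close>.\<close>

lemma divisible_unit_trivial:
  assumes u: "u \<in> Kc" "u \<noteq> 0" "lexp u = 0" "lco u = 1" and roots: "\<And>n. \<exists>w\<in>Kc. w ^ (l ^ n) = u"
  shows "u = 1"
proof (rule ccontr)
  assume u1: "u \<noteq> 1"
  have pos: "0 < lexp (u - 1)"
    using lexp_diff_greater[of u 1] u u1 by (simp add: lexp_1 lco_1)
  then have "lexp (u - 1) \<noteq> 0" by simp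
  then obtain v where v: "lookup (lexp (u - 1)) v \<noteq> 0" by (metis lookup_zero poly_mapping_eqI)
  obtain m J where J: "finite J" "J \<subseteq> \<Gamma>" "u \<in> Ef v m J" using Kc_in_Ef[OF u(1)] by blast
  have tr: "\<And>p. p \<in> polys (F0 v) \<Longrightarrow> poly p u = 0 \<Longrightarrow> p = 0"
    using transcendental_over_F0_shift[OF u1 v] by blast
  have fin: "fin_over (gf (insert u (F0 v))) (Ef v m J)" by (rule fin_over_Ef[OF J tr])
  obtain n :: nat where n: "\<And>x. (\<And>i. i \<le> n \<Longrightarrow> x i \<in> Ef v m J) \<Longrightarrow>
    \<exists>c. (\<forall>i\<le>n. c i \<in> gf (insert u (F0 v))) \<and> (\<exists>i\<le>n. c i \<noteq> 0) \<and> (\<Sum>i\<le>n. c i * x i) = 0"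
    using fin_over_dependent[OF is_subfield_gf fin] by blast
  \<comment> \<open>Since M = l^n > n, the n + 1 powers w^0, ..., w^n of an M-th root w of u are
    independent over F0(u), while \<open>n\<close> was chosen so that any n + 1 elements of
    \<open>Ef v m J\<close> are dependent.\<close>
  define M where "M = l ^ n"
  have nM: "n < M" unfolding M_def using l_gt_1 by (intro power_gt_expt) simp
  obtain w0 where w0: "w0 \<in> Kc" "w0 ^ M = u" using roots[of n] by (auto simp: M_def)
  have w00: "w0 \<noteq> 0" using w0 u nM by auto
  define d where "d = lco w0"
  have d: "d ^ M = 1" using lco_power[OF w00, of M] w0 u by (simp add: d_def)
  have d0: "d \<noteq> 0" unfolding d_def by (rule lco_nonzero[OF w00 w00])
  \<comment> \<open>d is an M-th root of unity, so dividing by it keeps w an M-th root of u and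
    makes its leading coefficient 1. The division stays in \<open>Kc\<close>, which contains all
    constants.\<close>
  define w where "w = w0 / cst d"
  have wK: "w \<in> Kc" unfolding w_def using w0
    by (intro subfield_divide) (auto simp: Kc_def intro!: gf_in)
  have wM: "w ^ M = u" unfolding w_def power_divide w0(2) using d by (simp flip: cst_power)
  have wz: "w \<noteq> 0" using w00 d0 by (simp add: w_def)
  have "rsm (of_nat M) (lexp w) = 0" using lexp_pow[OF wz, of M] wM u by simp
  then have lw: "lexp w = 0" using rsm_inj[of "lexp w" "of_nat M" 0] nM by auto
  have "lco w0 = lco w * lco (cst d :: ('v, 'k) pfield)"
    using lco_mult[of w "cst d"] wz d0 by (simp add: w_def)
  then have cw: "lco w = 1" using d0 by (simp add: lco_cst flip: d_def)
  have w1: "w \<noteq> 1" using wM u1 by auto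
  have posw: "0 < lexp (w - 1)"
    using lexp_diff_greater[of w 1] wz lw cw w1 by (simp add: lexp_1 lco_1)
  \<comment> \<open>M is a power of \<open>l\<close> and hence nonzero in the constants; so w - 1
    has the same leading exponent as u - 1, and w is transcendental over the same
    \<open>F0 v\<close>.\<close>
  have "lexp ((1 + (w - 1)) ^ M - 1) = lexp (w - 1)"
    using w1 posw lpow_nonzero[of n] unfolding M_def by (intro lexp_one_plus_power(2)) auto
  then have lwu: "lexp (w - 1) = lexp (u - 1)" using wM by simp
  have trw: "\<And>p. p \<in> polys (F0 v) \<Longrightarrow> poly p w = 0 \<Longrightarrow> p = 0"
    using transcendental_over_F0_shift[OF w1] v lwu by simp
  have wE: "w \<in> Ef v m J"
    by (rule descend_l_power[OF J(2,1) wK _ wz lw, of n]) (use wM J in \<open>simp add: M_def\<close>)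
  obtain c where c: "\<forall>i\<le>n. c i \<in> gf (insert u (F0 v))" "\<exists>i\<le>n. c i \<noteq> 0" "(\<Sum>i\<le>n. c i * w ^ i) = 0"
    using n[of "\<lambda>i. w ^ i"] subfield_power[OF subfields(2) wE] by auto
  define c' where "c' = (\<lambda>i. if i \<le> n then c i else 0)"
  have "(\<Sum>i<M. c' i * w ^ i) = (\<Sum>i\<le>n. c i * w ^ i)"
    using nM by (intro sum.mono_neutral_cong_right) (auto simp: c'_def)
  moreover have "c' i \<in> gf (insert (w ^ M) (F0 v))" for i
    unfolding wM c'_def using c subfield_0[OF is_subfield_gf] by auto
  ultimately have "c' i = 0" if "i < M" for i
    using powers_independent[OF subfields(1) trw, where M = M and c = c' and i = i] that c(3) by simp
  then show False using c(2) nM unfolding c'_def by (metis le_less_trans)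
qed

lemma lexp_Kc_Al:
  assumes "x \<in> Kc" "x \<noteq> 0"
  shows "lexp x \<in> Al"
proof -
  have "Kc \<subseteq> fracs Al UNIV"
    unfolding Kc_def
    by (rule gf_least[OF is_subfield_fracs[OF Al_group UNIV_subfield]])
      (auto intro!: cst_in_fracs xmon_in_fracs yroot_in_fracs Al_group UNIV_subfield G_nat Al_natexpo)
  then show ?thesis using lexp_fracs[OF Al_group UNIV_subfield] assms by blast
qed

text \<open>Divide \<open>f\<close> by its leading term. The quotient has leading exponent 0 and
  leading coefficient 1, and it inherits the roots because the leading term has them: constants have
  roots, and \<open>Al\<close> is divisible by \<open>l\<close>. So
  \<open>divisible_unit_trivial\<close> applies.\<close>

lemma divisible_monomial:
  assumes f: "f \<in> Kc" "f \<noteq> 0" and roots: "\<And>n. \<exists>w\<in>Kc. w ^ (l ^ n) = f"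
  shows "f = cst (lco f) * xmon (lexp f)"
proof -
  have a: "lexp f \<in> Al" by (rule lexp_Kc_Al[OF f])
  have c0: "lco f \<noteq> 0" by (rule lco_nonzero[OF f(2) f(2)])
  have cK: "cst c \<in> Kc" for c unfolding Kc_def by (rule gf_in) auto
  have xK: "\<alpha> \<in> Al \<Longrightarrow> xmon \<alpha> \<in> Kc" for \<alpha> unfolding Kc_def by (rule gf_in) auto
  define g where "g = (cst (lco f) * xmon (lexp f) :: ('v, 'k) pfield)"
  have g0: "g \<noteq> 0" using c0 by (simp add: g_def)
  have gK: "g \<in> Kc" unfolding g_def using cK xK[OF a] by (intro subfield_mult) auto
  have lg: "lexp g = lexp f" "lco g = lco f"
    using c0 by (simp_all add: g_def lexp_mult lco_mult lexp_cst lco_cst)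
  define u where "u = f / g"
  have u0: "u \<noteq> 0" using f g0 by (simp add: u_def)
  have uf: "u * g = f" using g0 by (simp add: u_def)
  have "lexp u + lexp g = lexp f" "lco u * lco g = lco f"
    using lexp_mult[OF u0 g0] lco_mult[OF u0 g0] uf by simp_all
  then have lu: "lexp u = 0" "lco u = 1" using lg c0 by auto
  have "u = 1"
  proof (rule divisible_unit_trivial[OF _ u0 lu])
    show "u \<in> Kc" unfolding u_def using f gK by (intro subfield_divide) auto
    fix n
    obtain w where w: "w \<in> Kc" "w ^ (l ^ n) = f" using roots by blast
    have "l ^ n > 0" using l_gt_1 by simp
    then obtain d where d: "d ^ (l ^ n) = lco f" using nth_root_exists by blast
    define x :: "('v, 'k) pfield" where "x = xmon (rsm (1 / of_nat (l ^ n)) (lexp f))"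
    have xl: "x ^ (l ^ n) = xmon (lexp f)"
      unfolding x_def using l_gt_1 by (simp add: rsm_rsm del: of_nat_power flip: xmon_rsm)
    have g: "(cst d * x) ^ (l ^ n) = g"
      by (simp add: power_mult_distrib g_def d xl flip: cst_power)
    show "\<exists>w\<in>Kc. w ^ (l ^ n) = u"
    proof (rule bexI)
      show "(w / (cst d * x)) ^ (l ^ n) = u" unfolding power_divide w(2) g u_def ..
      show "w / (cst d * x) \<in> Kc"
        using w cK xK[OF Al_root[OF a]] unfolding x_def by (intro subfield_divide subfield_mult) auto
    qed
  qed
  then show ?thesis using uf by (simp add: g_def)
qed

end

section \<open>Products of binomials modulo powers\<close>

abbreviation rorder :: "'a :: idom \<Rightarrow> 'a poly \<Rightarrow> nat" where "rorder \<equiv> Polynomial.order"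

lemma rorder_power: "p \<noteq> 0 \<Longrightarrow> rorder a (p ^ n) = n * rorder a p"
  by (induction n) (simp_all add: order_mult)

lemma rorder_prod: "finite J \<Longrightarrow> (\<And>j. j \<in> J \<Longrightarrow> f j \<noteq> 0) \<Longrightarrow> rorder a (\<Prod>j\<in>J. f j) = (\<Sum>j\<in>J. rorder a (f j))"
proof (induction J rule: finite_induct)
  case (insert j J)
  then have "f j * (\<Prod>j\<in>J. f j) \<noteq> 0" by (auto simp: prod_zero_iff)
  then show ?case using insert by (simp add: order_mult)
qed simp

definition bin :: "'a :: field \<Rightarrow> nat \<Rightarrow> 'a poly" where
  "bin c n = [:1:] + monom c n"

lemma poly_bin [simp]: "poly (bin c n) x = 1 + c * x ^ n"
  by (simp add: bin_def poly_monom)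

lemma bin_nonzero: "n > 0 \<Longrightarrow> bin c n \<noteq> 0"
proof
  assume "n > 0" "bin c n = 0"
  then have "poly (bin c n) 0 = 0" by simp
  then show False using \<open>n > 0\<close> by (simp add: power_0_left)
qed

lemma rorder_simple_root:
  assumes "poly f a = 0" "poly (pderiv f) a \<noteq> 0"
  shows "rorder a f = 1"
proof -
  have f0: "f \<noteq> 0" using assms by auto
  obtain r where r: "f = [:- a, 1:] * r" using assms(1) by (auto simp: poly_eq_0_iff_dvd elim: dvdE)
  have "poly (pderiv f) a = poly r a" unfolding r pderiv_mult by (simp add: pderiv_pCons)
  then have "rorder a r = 0" using assms by (intro order_0I) auto
  moreover have "rorder a [:- a, 1:] = 1" using order_power_n_n[of a 1] by simp
  ultimately show ?thesis using order_mult[of "[:- a, 1:]" r a] f0 r by simp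
qed

lemma rorder_bin_simple:
  assumes "of_nat n \<noteq> (0 :: 'a :: field)" "c \<noteq> 0" "1 + c * a ^ n = (0 :: 'a)"
  shows "rorder a (bin c n) = 1"
proof (rule rorder_simple_root)
  have n: "n > 0" using assms(1) by (cases n) auto
  then have "a \<noteq> 0" using assms(3) by (auto simp: power_0_left)
  have "pderiv (bin c n) = monom (of_nat n * c) (n - 1)"
    by (simp add: bin_def pderiv_add pderiv_monom pderiv_pCons)
  then show "poly (pderiv (bin c n)) a \<noteq> 0"
    using assms \<open>a \<noteq> 0\<close> by (simp add: poly_monom)
qed (use assms in simp)

text \<open>If the characteristic p divides \<open>N\<close>, then by the additivity of p-th powers
  1 + c X^N is the p-th power of a binomial of degree N / p. Repeating this leads to simple roots,
  so the multiplicity is a power of p or 1, and \<open>q\<close> differs from p.\<close>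

lemma not_dvd_rorder_bin:
  fixes c :: "'a :: alg_closed_field"
  assumes q: "Factorial_Ring.prime q" "of_nat q \<noteq> (0 :: 'a)" and "N > 0" "c \<noteq> 0" "1 + c * a ^ N = 0"
  shows "\<not> q dvd rorder a (bin c N)"
  using assms(3-5)
proof (induction N arbitrary: c rule: less_induct)
  case (less N)
  show ?case
  proof (cases "of_nat N = (0 :: 'a)")
    case False
    then have "rorder a (bin c N) = 1" using less.prems by (intro rorder_bin_simple)
    then show ?thesis using prime_gt_1_nat[OF q(1)] by simp
  next
    case True
    define p where "p = CHAR('a)"
    have pN: "p dvd N" using True by (simp add: p_def of_nat_eq_0_iff_char_dvd)
    have "p > 0" using pN less.prems(1) by (auto intro: Nat.gr0I)
    then have pp: "Factorial_Ring.prime p" unfolding p_def by (rule prime_CHAR_semidom)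
    obtain N' where N': "N = p * N'" using pN by auto
    obtain c' where c': "c' ^ p = c" using nth_root_exists[OF \<open>p > 0\<close>] by blast
    have c0: "c' \<noteq> 0" using c' less.prems \<open>p > 0\<close> by (auto simp: power_0_left)
    have fd: "(x + y) ^ p = x ^ p + y ^ p" for x y :: "'a poly"
      by (rule freshmans_dream) (use pp in \<open>auto simp: p_def\<close>)
    have fd': "(x + y) ^ p = x ^ p + y ^ p" for x y :: 'a
      by (rule freshmans_dream) (use pp in \<open>auto simp: p_def\<close>)
    have e: "bin c N = bin c' N' ^ p"
    proof -
      have "bin c' N' ^ p = [:1:] ^ p + monom c' N' ^ p" unfolding bin_def by (rule fd)
      also have "\<dots> = bin c N" by (simp add: bin_def monom_power c' N' mult.commute one_pCons[symmetric])
      finally show ?thesis ..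
    qed
    have "(1 + c' * a ^ N') ^ p = 1 + c * a ^ N"
      by (simp add: fd' power_mult_distrib c' N' mult.commute power_mult[symmetric])
    then have r: "1 + c' * a ^ N' = 0" using less.prems by simp
    have N'0: "N' > 0" "N' < N" using less.prems(1) N' prime_gt_1_nat[OF pp] by (auto intro: Nat.gr0I)
    have "\<not> q dvd rorder a (bin c' N')" by (rule less.IH[OF N'0(2,1) c0 r])
    moreover have "\<not> q dvd p"
    proof
      assume "q dvd p"
      then have "q = p" using q(1) pp by (simp add: primes_dvd_imp_eq)
      then show False using q(2) by (simp add: p_def)
    qed
    ultimately show ?thesis unfolding e rorder_power[OF bin_nonzero[OF N'0(1)]]
      using q(1) by (simp add: prime_dvd_mult_iff)
  qed
qed

text \<open>The polynomial 1 - X^n splits, and by its derivative all roots are simple, so the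
  multiset of its n roots is a set.\<close>

lemma card_roots_of_unity:
  assumes n: "of_nat n \<noteq> (0 :: 'a :: alg_closed_field)"
  shows "card {x :: 'a. x ^ n = 1} = n"
proof -
  have n0: "n > 0" using n by (cases n) auto
  define f where "f = (bin (- 1) n :: 'a poly)"
  have f0: "f \<noteq> 0" unfolding f_def by (rule bin_nonzero[OF n0])
  obtain A where A: "size A = degree f" "f = smult (lead_coeff f) (\<Prod>x\<in>#A. [:- x, 1:])"
    using alg_closed_imp_factorization[OF f0] by blast
  have "proots (\<Prod>x\<in>#A. [:- x, 1:]) = A"
  proof (induction A)
    case (add x A)
    have p: "(\<Prod>x\<in>#A. [:- x, 1:]) \<noteq> 0" by (auto simp: prod_mset_zero_iff)
    have "[:- x, 1:] \<noteq> 0" by simp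
    from proots_mult[OF this p]
    have "proots ([:- x, 1:] * (\<Prod>x\<in>#A. [:- x, 1:])) = proots [:- x, 1:] + proots (\<Prod>x\<in>#A. [:- x, 1:])" .
    then show ?case using add proots_linear_factor[of "- x"]
      by (simp del: mult_pCons_left mult_pCons_right proots_linear_factor)
  qed simp
  then have pA: "proots f = A" using A(2) f0 by (metis leading_coeff_0_iff proots_smult)
  have "degree f = n"
  proof (rule antisym)
    show "degree f \<le> n" unfolding f_def bin_def by (rule degree_add_le) (auto simp: degree_monom_le)
    show "n \<le> degree f" unfolding f_def bin_def using n0
      by (intro le_degree) (simp add: coeff_pCons split: nat.split)
  qed
  then have sA: "size A = n" using A by simp
  have root: "poly f x = 0 \<longleftrightarrow> x ^ n = 1" for x by (simp add: f_def)
  have "count A x = (if x ^ n = 1 then 1 else 0)" for x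
  proof (cases "x ^ n = 1")
    case True
    then show ?thesis using rorder_bin_simple[of n "- 1" x] n f0 by (simp flip: pA) (simp add: f_def)
  next
    case False
    then have "rorder x f = 0" using root by (intro order_0I) simp
    then show ?thesis using False f0 by (simp flip: pA)
  qed
  moreover have fin: "finite {x :: 'a. x ^ n = 1}" using poly_roots_finite[OF f0] by (simp add: root)
  ultimately have "A = mset_set {x. x ^ n = 1}" by (intro multiset_eqI) simp
  then show ?thesis using sA fin by simp
qed

text \<open>By Bezout all n-th roots of unity are d-th roots of unity for d = gcd n N; as there are
  n of them, n \<le> d.\<close>

lemma roots_of_unity_dvd:
  assumes n: "of_nat n \<noteq> (0 :: 'a :: alg_closed_field)" and "N > 0"
    and sub: "\<And>x :: 'a. x ^ n = 1 \<Longrightarrow> x ^ N = 1"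
  shows "n dvd N"
proof -
  have n0: "n > 0" using n by (cases n) auto
  define d where "d = gcd n N"
  have d0: "d > 0" using n0 by (simp add: d_def)
  have "x ^ d = 1" if x: "x ^ n = 1" for x :: 'a
  proof -
    have x0: "x \<noteq> 0" using x n0 by (auto simp: power_0_left)
    obtain a b where ab: "n * a = N * b + gcd n N" using bezout_nat[of n N] n0 by auto
    have "x ^ (n * a) = x ^ (N * b) * x ^ d" using ab by (simp add: d_def flip: power_add)
    then show ?thesis using x sub[OF x] by (simp add: power_mult)
  qed
  then have 1: "{x :: 'a. x ^ n = 1} \<subseteq> {x. poly (bin (- 1) d) x = 0}" by auto
  have b0: "bin (- 1 :: 'a) d \<noteq> 0" by (rule bin_nonzero[OF d0])
  have "n \<le> card {x :: 'a. poly (bin (- 1) d) x = 0}"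
    using card_mono[OF poly_roots_finite[OF b0] 1] card_roots_of_unity[OF n] by simp
  also have "\<dots> \<le> degree (bin (- 1 :: 'a) d)" by (rule card_poly_roots_bound[OF b0])
  also have "\<dots> \<le> d" unfolding bin_def by (rule degree_add_le) (auto simp: degree_monom_le)
  finally have "n \<le> d" .
  moreover have "d dvd n" by (simp add: d_def)
  ultimately have "d = n" using n0 by (auto dest: dvd_imp_le)
  then show ?thesis unfolding d_def by (metis gcd_dvd2)
qed

text \<open>Compare the orders of both sides modulo \<open>q\<close>: the roots of \<open>1 + C x\<^sup>N\<close> have multiplicity prime to \<open>q\<close>, since it is
  \<open>1\<close> or a power of the characteristic.\<close>

lemma binomial_power_product:
  fixes C D :: "'a :: alg_closed_field" and A B :: "'a poly"
  assumes q: "Factorial_Ring.prime q" "of_nat q \<noteq> (0 :: 'a)"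
    and J: "finite J" "\<And>j. j \<in> J \<Longrightarrow> M j \<noteq> 0" "\<And>j. j \<in> J \<Longrightarrow> of_nat (n j) \<noteq> (0 :: 'a)" "\<And>j. j \<in> J \<Longrightarrow> e j < q"
    and disj: "\<And>i j x. i \<in> J \<Longrightarrow> j \<in> J \<Longrightarrow> 1 + M i * x ^ n i = 0 \<Longrightarrow> 1 + M j * x ^ n j = 0 \<Longrightarrow> i = j"
    and N: "N > 0" "C \<noteq> 0" and nz: "A \<noteq> 0" "B \<noteq> 0" "D \<noteq> 0"
    and eq: "bin C N * B ^ q = monom D b * A ^ q * (\<Prod>j\<in>J. bin (M j) (n j) ^ e j)"
  shows "\<exists>j\<in>J. \<exists>k. N = k * n j \<and> C = - ((- M j) ^ k)"
proof -
  have n0: "n j > 0" if "j \<in> J" for j using J(3)[OF that] by (cases "n j") auto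
  have bn: "bin (M j) (n j) \<noteq> 0" if "j \<in> J" for j by (rule bin_nonzero[OF n0[OF that]])
  have dC: "degree (bin C N) = N"
  proof (rule antisym)
    show "degree (bin C N) \<le> N" unfolding bin_def by (rule degree_add_le) (auto simp: degree_monom_le)
    show "N \<le> degree (bin C N)" unfolding bin_def using N
      by (intro le_degree) (simp add: coeff_pCons split: nat.split)
  qed
  have P0: "(\<Prod>j\<in>J. bin (M j) (n j) ^ e j) \<noteq> 0" using J(1) bn by (simp add: prod_zero_iff)
  have ord: "rorder x (bin C N) + q * rorder x B = q * rorder x A + (\<Sum>j\<in>J. e j * rorder x (bin (M j) (n j)))"
    if x: "x \<noteq> 0" for x
  proof -
    have m: "rorder x (monom D b) = 0" using x nz by (intro order_0I) (simp add: poly_monom)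
    have "rorder x (bin C N * B ^ q) = rorder x (bin C N) + q * rorder x B"
      using nz bin_nonzero[OF N(1), of C] by (simp add: order_mult rorder_power)
    moreover have "rorder x (\<Prod>j\<in>J. bin (M j) (n j) ^ e j) = (\<Sum>j\<in>J. e j * rorder x (bin (M j) (n j)))"
      using J(1) bn by (subst rorder_prod) (auto simp: rorder_power intro!: sum.cong)
    moreover have "monom D b * A ^ q * (\<Prod>j\<in>J. bin (M j) (n j) ^ e j) \<noteq> 0"
      using nz P0 by simp
    then have "rorder x (monom D b * A ^ q * (\<Prod>j\<in>J. bin (M j) (n j) ^ e j)) =
        rorder x (monom D b) + q * rorder x A + rorder x (\<Prod>j\<in>J. bin (M j) (n j) ^ e j)"
      using nz by (simp add: order_mult rorder_power)
    ultimately show ?thesis using m unfolding eq by simp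
  qed
  obtain a where a: "1 + C * a ^ N = 0"
    using alg_closed_imp_poly_has_root[of "bin C N"] dC N by auto
  have a0: "a \<noteq> 0" using a N by (auto simp: power_0_left)
  \<comment> \<open>Otherwise the product on the right does not vanish at a, and all other orders in
    \<open>ord\<close> are multiples of \<open>q\<close>, against
    \<open>not_dvd_rorder_bin\<close>.\<close>
  have "\<exists>j\<in>J. e j \<noteq> 0 \<and> 1 + M j * a ^ n j = 0"
  proof (rule ccontr)
    assume no: "\<not> ?thesis"
    have "e j * rorder a (bin (M j) (n j)) = 0" if "j \<in> J" for j
    proof (cases "e j = 0")
      case False
      then have "poly (bin (M j) (n j)) a \<noteq> 0" using no that by auto
      then show ?thesis by (simp add: order_0I)
    qed simp
    then have "(\<Sum>j\<in>J. e j * rorder a (bin (M j) (n j))) = 0" by (intro sum.neutral ballI)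
    then have s: "rorder a (bin C N) + q * rorder a B = q * rorder a A" using ord[OF a0] by simp
    have "q dvd rorder a (bin C N) + q * rorder a B" unfolding s by simp
    then have "q dvd rorder a (bin C N)" using dvd_add_left_iff[of q "q * rorder a B"] by simp
    then show False using not_dvd_rorder_bin[OF q N a] by contradiction
  qed
  then obtain j where j: "j \<in> J" "e j \<noteq> 0" "1 + M j * a ^ n j = 0" by blast
  \<comment> \<open>Every root of the j-th factor is a root of 1 + C X^N. By \<open>disj\<close> no
    other factor vanishes at x, so the order on the right is \<open>e j\<close> modulo
    \<open>q\<close>, and 0 < e j < q.\<close>
  have roots: "1 + C * x ^ N = 0" if x: "1 + M j * x ^ n j = 0" for x
  proof (rule ccontr)
    assume "1 + C * x ^ N \<noteq> 0"
    then have 0: "rorder x (bin C N) = 0" by (intro order_0I) simp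
    have x0: "x \<noteq> 0" using x n0[OF j(1)] by (auto simp: power_0_left)
    have "(\<Sum>i\<in>J. e i * rorder x (bin (M i) (n i))) = (\<Sum>i\<in>{j}. e i * rorder x (bin (M i) (n i)))"
    proof (rule sum.mono_neutral_right[OF J(1)])
      show "\<forall>i\<in>J - {j}. e i * rorder x (bin (M i) (n i)) = 0"
      proof
        fix i assume i: "i \<in> J - {j}"
        then have "poly (bin (M i) (n i)) x \<noteq> 0" using disj[of i j x] j x by auto
        then show "e i * rorder x (bin (M i) (n i)) = 0" by (simp add: order_0I)
      qed
    qed (use j in auto)
    also have "\<dots> = e j" using rorder_bin_simple[OF J(3)[OF j(1)] J(2)[OF j(1)] x] by simp
    finally have s: "q * rorder x B = q * rorder x A + e j" using ord[OF x0] 0 by simp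
    have "q dvd q * rorder x A + e j" unfolding s[symmetric] by simp
    then have "q dvd e j" using dvd_add_right_iff[of q "q * rorder x A" "e j"] by simp
    then show False using j J(4)[OF j(1)] by (auto dest: dvd_imp_le)
  qed
  \<comment> \<open>Multiplying the root a by an \<open>n j\<close>-th root of unity gives another
    root of the j-th factor, hence of 1 + C X^N.\<close>
  have "n j dvd N"
  proof (rule roots_of_unity_dvd[OF J(3)[OF j(1)] N(1)])
    fix x :: 'a assume x: "x ^ n j = 1"
    have "1 + M j * (x * a) ^ n j = 0" using j(3) x by (simp add: power_mult_distrib)
    then have "1 + C * (x * a) ^ N = 0" by (rule roots)
    then have "1 + C * a ^ N * x ^ N = 0" by (simp add: power_mult_distrib mult_ac)
    moreover have "C * a ^ N = - 1" using a by (simp add: eq_neg_iff_add_eq_0 add.commute)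
    ultimately show "x ^ N = 1" by simp
  qed
  then obtain k where "N = n j * k" by (rule dvdE)
  then have k: "N = k * n j" by simp
  have "M j * a ^ n j = - 1" using j(3) by (simp add: eq_neg_iff_add_eq_0 add.commute)
  then have "(- M j) * a ^ n j = 1" by simp
  then have "((- M j) * a ^ n j) ^ k = 1" by simp
  then have 1: "(- M j) ^ k * a ^ N = 1"
    unfolding k power_mult_distrib by (simp only: mult.commute[of k] power_mult)
  have "C * a ^ N = - 1" using a by (simp add: eq_neg_iff_add_eq_0 add.commute)
  then have "C * a ^ N = - ((- M j) ^ k) * a ^ N" using 1 by simp
  then have "(C + (- M j) ^ k) * a ^ N = 0" by (simp add: distrib_right)
  then have "C = - ((- M j) ^ k)" using a0 by (simp add: eq_neg_iff_add_eq_0)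
  then show ?thesis using j(1) k by blast
qed

lemma
  fixes h :: "'a :: field \<Rightarrow> 'b :: field"
  assumes h: "h 0 = 0" "h 1 = 1" "\<And>x y. h (x + y) = h x + h y" "\<And>x y. h (x * y) = h x * h y"
  shows map_poly_hom_mult: "map_poly h (f * g) = map_poly h f * map_poly h g"
    and map_poly_hom_power: "map_poly h (f ^ n) = map_poly h f ^ n"
    and map_poly_hom_prod: "map_poly h (prod F I) = (\<Prod>i\<in>I. map_poly h (F i))"
    and map_poly_hom_bin: "map_poly h (bin c n) = bin (h c) n"
    and map_poly_hom_monom: "map_poly h (monom c n) = monom (h c) n"
proof -
  have s: "h (sum f A) = (\<Sum>i\<in>A. h (f i))" for f and A :: "nat set"
    by (induction A rule: infinite_finite_induct) (auto simp: h)
  show m: "map_poly h (f * g) = map_poly h f * map_poly h g" for f g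
    by (rule poly_eqI) (simp add: coeff_map_poly h coeff_mult s)
  have 1: "map_poly h 1 = 1" by (rule poly_eqI) (simp add: coeff_map_poly h coeff_1)
  show "map_poly h (f ^ n) = map_poly h f ^ n" by (induction n) (auto simp: m 1)
  show "map_poly h (prod F I) = (\<Prod>i\<in>I. map_poly h (F i))"
    by (induction I rule: infinite_finite_induct) (auto simp: m 1)
  show "map_poly h (bin c n) = bin (h c) n"
    by (rule poly_eqI) (simp add: coeff_map_poly h bin_def coeff_pCons split: nat.split)
  show "map_poly h (monom c n) = monom (h c) n"
    by (rule poly_eqI) (simp add: coeff_map_poly h)
qed

section \<open>Binomials that are q-th powers\<close>

context binomial_field
begin

definition Fm :: "('v, 'k) pfield set" where
  "Fm = gf (range cst \<union> xmon ` Al)"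

lemma Fm_subfield [simp]: "is_subfield Fm"
  by (simp add: Fm_def)

lemma cst_in_Fm: "cst c \<in> Fm" and xmon_in_Fm: "\<alpha> \<in> Al \<Longrightarrow> xmon \<alpha> \<in> Fm"
  unfolding Fm_def by (auto intro!: gf_in)

text \<open>\<open>kummer_roots\<close> splits off a power of one root, h = d * y^j. The q-th power
  of d again lies in \<open>Fm\<close>, so the induction continues with d.\<close>

lemma kummer_product:
  assumes "finite J" "J \<subseteq> \<Gamma>" "h \<in> gf (Fm \<union> yroot q ` J)" "h ^ q \<in> Fm"
  shows "\<exists>c\<in>Fm. \<exists>e. (\<forall>\<gamma>\<in>J. e \<gamma> < q) \<and> h = c * (\<Prod>\<gamma>\<in>J. yroot q \<gamma> ^ e \<gamma>)"
  using assms
proof (induction J arbitrary: h rule: finite_induct)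
  case empty
  then show ?case by (simp add: gf_subfield)
next
  case (insert \<gamma> J)
  let ?E = "gf (Fm \<union> yroot q ` J)"
  have FE: "Fm \<subseteq> ?E" using gf_superset by blast
  have g: "\<gamma> \<in> \<Gamma>" using insert.prems by simp
  have yF: "yroot q \<gamma> ^ q \<in> Fm"
    unfolding yroot_pow[OF g] using xmon_in_Fm[OF Al_natexpo[OF G_nat[OF g]]]
    by (intro subfield_add subfield_1) auto
  have "gf (?E \<union> {yroot q \<gamma>}) = gf (Fm \<union> yroot q ` insert \<gamma> J)"
    using gf_Un_gf[of "Fm \<union> yroot q ` J" "{yroot q \<gamma>}"] by simp
  then have h: "h \<in> gf (insert (yroot q \<gamma>) ?E)" using insert.prems by simp
  obtain z :: 'k where z: "z ^ q = 1" "z \<noteq> 1" using exists_prime_root_of_unity[OF q q0] by blast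
  have zE: "cst z \<in> ?E" using cst_in_Fm FE by blast
  have zq: "cst z ^ q = (1 :: ('v, 'k) pfield)" using z by (simp flip: cst_power)
  have z1: "cst z \<noteq> (1 :: ('v, 'k) pfield)"
  proof
    assume "cst z = (1 :: ('v, 'k) pfield)"
    then have "cst (z - 1) = (0 :: ('v, 'k) pfield)" by (simp add: cst_diff)
    then show False using z by simp
  qed
  have ru: "x \<in> ?E" if "x ^ q = 1" for x
    using roots_of_unity_constant[OF that] cst_in_Fm FE q_gt_1 by auto
  have yE: "yroot q \<gamma> ^ q \<in> ?E" and hE: "h ^ q \<in> ?E" using yF insert.prems FE by auto
  obtain d j where d: "d \<in> ?E" "j < q" "h = d * yroot q \<gamma> ^ j"
    using kummer_roots[OF is_subfield_gf q yE zE zq z1 h hE ru] by blast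
  have y0: "yroot q \<gamma> \<noteq> (0 :: ('v, 'k) pfield)" by (rule yroot_nonzero[OF G_nat[OF g]])
  have "d ^ q = h ^ q / (yroot q \<gamma> ^ q) ^ j"
    using d(3) y0 by (simp add: power_mult_distrib mult.commute flip: power_mult)
  then have "d ^ q \<in> Fm" using insert.prems yF by (simp add: subfield_divide subfield_power)
  then obtain c e where c: "c \<in> Fm" "\<forall>\<gamma>\<in>J. e \<gamma> < q" "d = c * (\<Prod>\<gamma>\<in>J. yroot q \<gamma> ^ e \<gamma>)"
    using insert.IH[of d] insert.prems d(1) by auto
  have "(\<Prod>\<delta>\<in>insert \<gamma> J. yroot q \<delta> ^ (e(\<gamma> := j)) \<delta>) = (yroot q \<gamma> ^ j * (\<Prod>\<delta>\<in>J. yroot q \<delta> ^ e \<delta>) :: ('v, 'k) pfield)"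
  proof -
    have "(\<Prod>\<delta>\<in>J. yroot q \<delta> ^ (e(\<gamma> := j)) \<delta>) = (\<Prod>\<delta>\<in>J. yroot q \<delta> ^ e \<delta> :: ('v, 'k) pfield)"
      using insert.hyps by (intro prod.cong) auto
    then show ?thesis using insert.hyps by simp
  qed
  then have "h = c * (\<Prod>\<delta>\<in>insert \<gamma> J. yroot q \<delta> ^ (e(\<gamma> := j)) \<delta>)"
    unfolding d(3) c(3) by (simp add: mult_ac)
  then show ?case using c d(2) by (intro bexI[of _ c] exI[of _ "e(\<gamma> := j)"]) auto
qed

definition restv :: "'v \<Rightarrow> 'v expo \<Rightarrow> 'v expo" where
  "restv v \<alpha> = \<alpha> - Poly_Mapping.single v (lookup \<alpha> v)"

lemma lookup_restv: "lookup (restv v \<alpha>) w = (if w = v then 0 else lookup \<alpha> w)"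
  by (auto simp: restv_def lookup_minus lookup_single when_def)

lemma restv_Al: "\<alpha> \<in> Al \<Longrightarrow> restv v \<alpha> \<in> Al"
  unfolding Al_def
proof (intro CollectI allI)
  fix w assume "\<alpha> \<in> {\<alpha>. \<forall>v. \<exists>j. of_nat (l ^ j) * lookup \<alpha> v \<in> \<int>}"
  then obtain j where "of_nat (l ^ j) * lookup \<alpha> w \<in> \<int>" by blast
  then show "\<exists>j. of_nat (l ^ j) * lookup (restv v \<alpha>) w \<in> \<int>"
    by (intro exI[of _ j]) (auto simp: lookup_restv)
qed

lemma xmon_restv_F0: "\<alpha> \<in> Al \<Longrightarrow> xmon (restv v \<alpha>) \<in> F0 v"
  unfolding F0_def using restv_Al by (intro gf_in) (auto simp: lookup_restv)

lemma xmon_split: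
  assumes "of_nat (l ^ m) * lookup \<alpha> v = of_nat N"
  shows "xmon \<alpha> = xmon (restv v \<alpha>) * (tau v m ^ N :: ('v, 'k) pfield)"
proof -
  have "lookup \<alpha> v = of_nat N * (1 / of_nat (l ^ m))" using assms l_gt_1 by (simp add: field_simps)
  then have "\<alpha> = restv v \<alpha> + rsm (of_nat N) (Poly_Mapping.single v (1 / of_nat (l ^ m)))"
    by (intro poly_mapping_eqI) (auto simp: lookup_restv lookup_add lookup_single when_def)
  then have "xmon \<alpha> = (xmon (restv v \<alpha>) * xmon (rsm (of_nat N) (Poly_Mapping.single v (1 / of_nat (l ^ m)))) :: ('v, 'k) pfield)"
    by (simp only: flip: xmon_add)
  then show ?thesis by (simp only: xmon_rsm tau_def)
qed

lemma tau_transcendental: "p \<in> polys (F0 v) \<Longrightarrow> poly p (tau v m) = 0 \<Longrightarrow> p = 0"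
  by (rule transcendental_over_F0[of "tau v m" v]) (use l_gt_1 in \<open>auto simp: tau_def\<close>)

lemma bin_in_polys: "is_subfield F \<Longrightarrow> c \<in> F \<Longrightarrow> bin c n \<in> polys F"
  unfolding bin_def by (intro polys_add polys_monom polys_const subfield_1)

text \<open>With t = tau v m the equation becomes a polynomial identity in t over
  \<open>F0 v\<close>, since t is transcendental there, and \<open>binomial_power_product\<close>
  compares multiplicities of roots. The extra monomial with \<beta> and d allows for the passage
  from \<alpha> to - \<alpha> in \<open>binomial_power\<close>.\<close>

lemma binomial_relation:
  assumes a: "\<alpha> \<in> Al" "0 < lookup \<alpha> v" and b: "\<beta> \<in> Al" "0 \<le> lookup \<beta> v"
    and c: "c \<noteq> 0" "d \<noteq> 0" and g: "g \<in> Fm" "g \<noteq> 0" and J: "finite J" "J \<subseteq> \<Gamma>" "\<And>\<gamma>. \<gamma> \<in> J \<Longrightarrow> e \<gamma> < q"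
    and eq: "1 + cst c * xmon \<alpha> = cst d * xmon \<beta> * g ^ q * (\<Prod>\<gamma>\<in>J. (1 + xmon \<gamma>) ^ e \<gamma>)"
  shows "\<exists>\<gamma>\<in>J. \<exists>k::nat. \<alpha> = rsm (of_nat k) \<gamma> \<and> c = - ((- 1) ^ k)"
proof -
  have F: "is_subfield (F0 v)" by simp
  obtain ma where ma: "of_nat (l ^ ma) * lookup \<alpha> v \<in> \<int>" using a(1) unfolding Al_def by blast
  obtain mb where mb: "of_nat (l ^ mb) * lookup \<beta> v \<in> \<int>" using b(1) unfolding Al_def by blast
  obtain mg J' where mg: "J' \<subseteq> {}" "g \<in> Ef v mg J'"
    using adjoin_in_Ef[of g "{}" v] g(1) by (auto simp: Fm_def)
  \<comment> \<open>A common level: the monomials with exponents \<alpha> and \<beta> as well as g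
    are all expressible in tau v m over \<open>F0 v\<close>.\<close>
  define m where "m = max ma (max mb mg)"
  have up: "of_nat (l ^ m) * x \<in> (\<int> :: rat set)" if "of_nat (l ^ m') * x \<in> \<int>" "m' \<le> m" for m' x
  proof -
    have "l ^ m = l ^ (m - m') * l ^ m'" using that(2) by (simp flip: power_add)
    then have e: "of_nat (l ^ m) * x = of_nat (l ^ (m - m')) * (of_nat (l ^ m') * x)"
      by (simp only: of_nat_mult mult.assoc)
    show ?thesis unfolding e by (rule Ints_mult[OF Ints_of_nat that(1)])
  qed
  have na: "\<exists>N. of_nat (l ^ m) * x = of_nat N" if "of_nat (l ^ m') * x \<in> \<int>" "m' \<le> m" "0 \<le> x" for m' and x :: rat
  proof -
    have "of_nat (l ^ m) * x \<in> \<nat>"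
      using up[OF that(1,2)] that(3) unfolding Nats_altdef2 by (intro CollectI conjI mult_nonneg_nonneg) auto
    then show ?thesis by (auto elim!: Nats_cases)
  qed
  obtain N where N: "of_nat (l ^ m) * lookup \<alpha> v = of_nat N" using na[OF ma] a by (auto simp: m_def)
  obtain B where B: "of_nat (l ^ m) * lookup \<beta> v = of_nat B" using na[OF mb _ b(2)] unfolding m_def by (meson max.cobounded1 max.cobounded2 order_trans)
  have N0: "N > 0"
  proof (rule Nat.gr0I)
    assume "N = 0"
    then show False using N a(2) l_gt_1 by simp
  qed
  let ?t = "tau v m :: ('v, 'k) pfield"
  have "mg \<le> m" by (simp add: m_def)
  then have "Ef v mg {} \<subseteq> Ef v m {}" by (intro Ef_mono) auto
  then have "g \<in> Ef v m {}" using mg by auto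
  then have "g \<in> gf (insert ?t (F0 v))" by (simp add: Ef_def)
  then obtain P R where PR: "g = poly P ?t / poly R ?t" "P \<in> polys (F0 v)" "R \<in> polys (F0 v)" "poly R ?t \<noteq> 0"
    unfolding gf_insert_eq[OF F] by blast
  have PR0: "P \<noteq> 0" "R \<noteq> 0" using PR g by auto
  \<comment> \<open>The factors without \<open>v\<close> lie in \<open>F0 v\<close> and are absorbed
    into the coefficient \<open>D\<close>; those in \<open>J1\<close> become genuine binomials in
    t.\<close>
  define J1 where "J1 = {\<gamma> \<in> J. lookup \<gamma> v \<noteq> 0}"
  define J0 where "J0 = {\<gamma> \<in> J. lookup \<gamma> v = 0}"
  have JJ: "J = J0 \<union> J1" "J0 \<inter> J1 = {}" "finite J0" "finite J1" using J(1) by (auto simp: J0_def J1_def)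
  define w where "w = (\<lambda>\<gamma> :: 'v expo. nat \<lfloor>lookup \<gamma> v\<rfloor>)"
  have w: "lookup \<gamma> v = of_nat (w \<gamma>)" if "\<gamma> \<in> J" for \<gamma>
  proof -
    have "lookup \<gamma> v \<in> \<nat>" using G_nat J(2) that by (auto simp: natexpo_def)
    then show ?thesis by (auto simp: w_def elim!: Nats_cases)
  qed
  \<comment> \<open>By \<open>G_char\<close> the exponents at \<open>v\<close> are nonzero in the
    constants. As \<open>l\<close> is nonzero there too, the binomials in t have simple
    roots.\<close>
  have w0: "w \<gamma> \<noteq> 0" "of_nat (w \<gamma>) \<noteq> (0 :: 'k)" if "\<gamma> \<in> J1" for \<gamma>
  proof -
    have "\<gamma> \<in> \<Gamma>" "lookup \<gamma> v = of_nat (w \<gamma>)" "lookup \<gamma> v \<noteq> 0" using that J w by (auto simp: J1_def)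
    then show "w \<gamma> \<noteq> 0" by auto
    then show "of_nat (w \<gamma>) \<noteq> (0 :: 'k)" using G_char \<open>\<gamma> \<in> \<Gamma>\<close> \<open>lookup \<gamma> v = of_nat (w \<gamma>)\<close> by blast
  qed
  have gA: "\<gamma> \<in> Al" if "\<gamma> \<in> J" for \<gamma> using Al_natexpo G_nat J(2) that by blast
  define n where "n = (\<lambda>\<gamma>. l ^ m * w \<gamma>)"
  define M where "M = (\<lambda>\<gamma>. xmon (restv v \<gamma>) :: ('v, 'k) pfield)"
  have MF: "M \<gamma> \<in> F0 v" "M \<gamma> \<noteq> 0" if "\<gamma> \<in> J" for \<gamma>
    using xmon_restv_F0[OF gA[OF that]] by (auto simp: M_def)
  have sp: "xmon \<gamma> = M \<gamma> * ?t ^ n \<gamma>" if "\<gamma> \<in> J" for \<gamma>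
    unfolding M_def by (rule xmon_split) (simp add: n_def w[OF that])
  define C where "C = (cst c * xmon (restv v \<alpha>) :: ('v, 'k) pfield)"
  have CF: "C \<in> F0 v" "C \<noteq> 0" unfolding C_def using cst_in_F0 xmon_restv_F0[OF a(1)] c
    by (auto intro!: subfield_mult)
  define D where "D = (cst d * xmon (restv v \<beta>) * (\<Prod>\<gamma>\<in>J0. (1 + xmon \<gamma>) ^ e \<gamma>) :: ('v, 'k) pfield)"
  have x1: "1 + xmon \<gamma> \<noteq> (0 :: ('v, 'k) pfield)" if "\<gamma> \<in> J" for \<gamma>
  proof
    have g: "\<gamma> \<in> \<Gamma>" using that J by blast
    assume "1 + xmon \<gamma> = (0 :: ('v, 'k) pfield)"
    then have "yroot q \<gamma> ^ q = (0 :: ('v, 'k) pfield)" by (simp add: yroot_pow[OF g])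
    moreover have "yroot q \<gamma> \<noteq> (0 :: ('v, 'k) pfield)" by (rule yroot_nonzero[OF G_nat[OF g]])
    ultimately show False by simp
  qed
  have J0F: "xmon \<gamma> \<in> F0 v" if "\<gamma> \<in> J0" for \<gamma>
    unfolding F0_def using that gA by (intro gf_in) (auto simp: J0_def)
  have DF: "D \<in> F0 v" unfolding D_def
    using cst_in_F0 xmon_restv_F0[OF b(1)] J0F subfield_1[OF F]
    by (intro subfield_mult[OF F] subfield_prod[OF F] subfield_power[OF F] subfield_add[OF F]) auto
  have D0: "D \<noteq> 0" unfolding D_def using c x1 JJ by (auto simp: prod_zero_iff)
  have key: "(1 + C * ?t ^ N) * poly R ?t ^ q = D * ?t ^ B * poly P ?t ^ q * (\<Prod>\<gamma>\<in>J1. (1 + M \<gamma> * ?t ^ n \<gamma>) ^ e \<gamma>)"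
  proof -
    have "(\<Prod>\<gamma>\<in>J. (1 + xmon \<gamma>) ^ e \<gamma>) = (\<Prod>\<gamma>\<in>J0. (1 + xmon \<gamma>) ^ e \<gamma>) * (\<Prod>\<gamma>\<in>J1. (1 + xmon \<gamma>) ^ e \<gamma> :: ('v, 'k) pfield)"
      unfolding JJ(1) using JJ by (intro prod.union_disjoint) auto
    also have "(\<Prod>\<gamma>\<in>J1. (1 + xmon \<gamma>) ^ e \<gamma>) = (\<Prod>\<gamma>\<in>J1. (1 + M \<gamma> * ?t ^ n \<gamma>) ^ e \<gamma>)"
      by (intro prod.cong) (auto simp: sp J1_def)
    finally have p: "(\<Prod>\<gamma>\<in>J. (1 + xmon \<gamma>) ^ e \<gamma>) = (\<Prod>\<gamma>\<in>J0. (1 + xmon \<gamma>) ^ e \<gamma>) * (\<Prod>\<gamma>\<in>J1. (1 + M \<gamma> * ?t ^ n \<gamma>) ^ e \<gamma>)" .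
    have gq: "g ^ q * poly R ?t ^ q = poly P ?t ^ q" unfolding PR(1) using PR(4) by (simp add: power_divide)
    have "1 + C * ?t ^ N = 1 + cst c * xmon \<alpha>"
      unfolding C_def xmon_split[OF N] by (simp add: mult.assoc)
    also have "\<dots> = cst d * (xmon (restv v \<beta>) * ?t ^ B) * g ^ q * (\<Prod>\<gamma>\<in>J. (1 + xmon \<gamma>) ^ e \<gamma>)"
      unfolding eq xmon_split[OF B] ..
    finally have "(1 + C * ?t ^ N) * poly R ?t ^ q =
        cst d * (xmon (restv v \<beta>) * ?t ^ B) * (g ^ q * poly R ?t ^ q) * (\<Prod>\<gamma>\<in>J. (1 + xmon \<gamma>) ^ e \<gamma>)"
      by (simp add: mult_ac)
    then show ?thesis unfolding gq p D_def by (simp add: mult_ac)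
  qed
  have J1J: "J1 \<subseteq> J" by (auto simp: J1_def)
  define L1 where "L1 = bin C N * R ^ q"
  define L2 where "L2 = monom D B * P ^ q * (\<Prod>\<gamma>\<in>J1. bin (M \<gamma>) (n \<gamma>) ^ e \<gamma>)"
  have "L1 - L2 \<in> polys (F0 v)"
    unfolding L1_def L2_def using CF DF MF PR J1J
    by (intro polys_diff[OF F] polys_mult[OF F] polys_power[OF F] polys_prod[OF F] polys_monom[OF F] bin_in_polys[OF F]) auto
  moreover have "poly (L1 - L2) ?t = 0"
    using key by (simp add: L1_def L2_def poly_prod poly_monom)
  ultimately have "L1 - L2 = 0" by (rule tau_transcendental)
  then have L: "bin C N * R ^ q = monom D B * P ^ q * (\<Prod>\<gamma>\<in>J1. bin (M \<gamma>) (n \<gamma>) ^ e \<gamma>)"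
    by (simp add: L1_def L2_def)
  \<comment> \<open>The comparison of multiplicities speaks of roots, so the identity is moved to an
    algebraic closure of the ambient field.\<close>
  let ?h = "to_ac :: ('v, 'k) pfield \<Rightarrow> ('v, 'k) pfield alg_closure"
  note hom = map_poly_hom_mult[of ?h] map_poly_hom_power[of ?h] map_poly_hom_prod[of ?h] map_poly_hom_bin[of ?h] map_poly_hom_monom[of ?h]
  have "map_poly ?h (bin C N * R ^ q) = map_poly ?h (monom D B * P ^ q * (\<Prod>\<gamma>\<in>J1. bin (M \<gamma>) (n \<gamma>) ^ e \<gamma>))"
    by (simp only: L)
  then have L': "bin (?h C) N * map_poly ?h R ^ q =
      monom (?h D) B * map_poly ?h P ^ q * (\<Prod>\<gamma>\<in>J1. bin (?h (M \<gamma>)) (n \<gamma>) ^ e \<gamma>)"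
    by (simp add: hom)
  have nat_ne: "of_nat i \<noteq> (0 :: ('v, 'k) pfield alg_closure)" if "of_nat i \<noteq> (0 :: 'k)" for i
  proof -
    have "cst (of_nat i) \<noteq> (0 :: ('v, 'k) pfield)" using that by simp
    then have "of_nat i \<noteq> (0 :: ('v, 'k) pfield)" by (simp only: cst_of_nat not_False_eq_True)
    then have "?h (of_nat i) \<noteq> 0" by (simp only: to_ac_eq_0_iff not_False_eq_True)
    then show ?thesis by (simp only: to_ac_of_nat not_False_eq_True)
  qed
  have "\<exists>\<gamma>\<in>J1. \<exists>k. N = k * n \<gamma> \<and> ?h C = - ((- ?h (M \<gamma>)) ^ k)"
  proof (rule binomial_power_product[OF q nat_ne[OF q0] JJ(4) _ _ _ _ N0 _ _ _ _ L'])
    show "?h (M \<gamma>) \<noteq> 0" "e \<gamma> < q" if "\<gamma> \<in> J1" for \<gamma> using that MF J J1J by auto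
    show "of_nat (n \<gamma>) \<noteq> (0 :: ('v, 'k) pfield alg_closure)" if "\<gamma> \<in> J1" for \<gamma>
      using w0[OF that] l0 by (intro nat_ne) (simp add: n_def)
    show "?h C \<noteq> 0" "?h D \<noteq> 0" using CF D0 by auto
    show "map_poly ?h P \<noteq> 0" "map_poly ?h R \<noteq> 0" using PR0 by (simp_all add: map_poly_eq_0_iff)
  next
    fix \<gamma> \<delta> x assume gd: "\<gamma> \<in> J1" "\<delta> \<in> J1"
      and r: "1 + ?h (M \<gamma>) * x ^ n \<gamma> = 0" "1 + ?h (M \<delta>) * x ^ n \<delta> = 0"
    have r': "?h (M \<gamma>) * x ^ n \<gamma> = - 1" "?h (M \<delta>) * x ^ n \<delta> = - 1"
      using r by (simp_all add: eq_neg_iff_add_eq_0 add.commute)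
    \<comment> \<open>A common root of two binomials makes \<gamma> and \<delta> proportional, so
      they agree by \<open>G_indep\<close>. The factor 2 in the exponents removes the sign of -
      1.\<close>
    have "(?h (M \<gamma>) * x ^ n \<gamma>) ^ (2 * n \<delta>) = (?h (M \<delta>) * x ^ n \<delta>) ^ (2 * n \<gamma>)" unfolding r' by simp
    then have "?h (M \<gamma>) ^ (2 * n \<delta>) * x ^ (2 * n \<gamma> * n \<delta>) = ?h (M \<delta>) ^ (2 * n \<gamma>) * x ^ (2 * n \<gamma> * n \<delta>)"
      by (simp add: power_mult_distrib mult_ac flip: power_mult)
    moreover have "x \<noteq> 0"
      using r(1) w0[OF gd(1)] l_gt_1 by (auto simp: n_def power_0_left)
    ultimately have "?h (M \<gamma> ^ (2 * n \<delta>)) = ?h (M \<delta> ^ (2 * n \<gamma>))" by simp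
    then have "M \<gamma> ^ (2 * n \<delta>) = M \<delta> ^ (2 * n \<gamma>)" by (simp only: to_ac_eq_iff)
    then have "xmon (rsm (of_nat (2 * n \<delta>)) (restv v \<gamma>)) = (xmon (rsm (of_nat (2 * n \<gamma>)) (restv v \<delta>)) :: ('v, 'k) pfield)"
      unfolding M_def xmon_rsm .
    then have e: "rsm (of_nat (2 * n \<delta>)) (restv v \<gamma>) = rsm (of_nat (2 * n \<gamma>)) (restv v \<delta>)" by (rule xmon_inj)
    have "rsm (of_nat (2 * n \<delta>)) \<gamma> = rsm (of_nat (2 * n \<gamma>)) \<delta>"
    proof (rule poly_mapping_eqI)
      fix u show "lookup (rsm (of_nat (2 * n \<delta>)) \<gamma>) u = lookup (rsm (of_nat (2 * n \<gamma>)) \<delta>) u"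
      proof (cases "u = v")
        case True
        then show ?thesis using w gd J1J by (simp add: n_def subset_iff)
      next
        case False
        then show ?thesis using arg_cong[OF e, of "\<lambda>a. lookup a u"] by (simp add: lookup_restv)
      qed
    qed
    moreover have "(of_nat (2 * n \<delta>) :: rat) \<noteq> 0" using w0[OF gd(2)] l_gt_1 by (simp add: n_def)
    ultimately show "\<gamma> = \<delta>" using G_indep[of \<gamma> \<delta>] gd J J1J by blast
  qed
  then obtain \<gamma> k where k: "\<gamma> \<in> J1" "N = k * n \<gamma>" "?h C = - ((- ?h (M \<gamma>)) ^ k)" by blast
  have "?h C = ?h (- ((- M \<gamma>) ^ k))" unfolding k(3) by simp
  then have "C = - ((- M \<gamma>) ^ k)" by (simp only: to_ac_eq_iff)
  also have "\<dots> = cst (- ((- 1) ^ k)) * xmon (rsm (of_nat k) (restv v \<gamma>))"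
    unfolding M_def xmon_rsm power_minus[of "xmon (restv v \<gamma>)"] by (simp add: cst_power)
  finally have C: "cst c * xmon (restv v \<alpha>) = (cst (- ((- 1) ^ k)) * xmon (rsm (of_nat k) (restv v \<gamma>)) :: ('v, 'k) pfield)"
    unfolding C_def .
  have s0: "- ((- 1) ^ k) \<noteq> (0 :: 'k)" by simp
  have lx: "lexp (cst a * xmon \<delta> :: ('v, 'k) pfield) = \<delta>" "lco (cst a * xmon \<delta> :: ('v, 'k) pfield) = a" if "a \<noteq> 0" for a \<delta>
    using that by (simp_all add: lexp_mult lco_mult lexp_cst lco_cst)
  have re: "restv v \<alpha> = rsm (of_nat k) (restv v \<gamma>)" "c = - ((- 1) ^ k)"
    using lx[OF c(1), of "restv v \<alpha>"] lx[OF s0, of "rsm (of_nat k) (restv v \<gamma>)"] unfolding C by simp_all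
  have "\<alpha> = rsm (of_nat k) \<gamma>"
  proof (rule poly_mapping_eqI)
    fix u show "lookup \<alpha> u = lookup (rsm (of_nat k) \<gamma>) u"
    proof (cases "u = v")
      case True
      have "of_nat (l ^ m) * lookup \<alpha> v = of_nat (l ^ m) * (of_nat k * of_nat (w \<gamma>))"
        unfolding N k(2) n_def by simp
      then have "lookup \<alpha> v = of_nat k * of_nat (w \<gamma>)" using l_gt_1 by simp
      then show ?thesis using True w[of \<gamma>] k(1) J1J by auto
    next
      case False
      then show ?thesis using arg_cong[OF re(1), of "\<lambda>a. lookup a u"] by (simp add: lookup_restv)
    qed
  qed
  then show ?thesis using k(1) J1J re(2) by blast
qed

text \<open>Expand h by \<open>kummer_product\<close> and choose a variable v occurring in \<alpha>.
  If its exponent is positive, \<open>binomial_relation\<close> applies directly. If it is negative,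
  it applies to - \<alpha>; then \<alpha> < 0 is the leading exponent of h^q, hence q times an
  element of \<open>Al\<close>, an alternative excluded in both applications.\<close>

lemma binomial_power:
  assumes h: "h \<in> Kc" "h ^ q = 1 + cst c * xmon \<alpha>" and c: "c \<noteq> 0" and a: "\<alpha> \<in> Al" "\<alpha> \<noteq> 0"
  shows "\<exists>\<gamma>\<in>\<Gamma>. \<exists>k::nat. (\<alpha> = rsm (of_nat k) \<gamma> \<and> c = - ((- 1) ^ k)) \<or>
    (\<alpha> = - rsm (of_nat k) \<gamma> \<and> (\<exists>\<delta>\<in>Al. \<alpha> = rsm (of_nat q) \<delta>))"
proof -
  obtain v where v: "lookup \<alpha> v \<noteq> 0" using a(2) by (metis lookup_zero poly_mapping_eqI)
  obtain m J where J: "finite J" "J \<subseteq> \<Gamma>" "h \<in> Ef v m J" using Kc_in_Ef[OF h(1)] by blast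
  have "F0 v \<subseteq> Fm" unfolding F0_def Fm_def by (rule gf_mono) auto
  moreover have "tau v m \<in> Fm" unfolding tau_def by (rule xmon_in_Fm[OF Al_single])
  ultimately have "Ef v m J \<subseteq> gf (Fm \<union> yroot q ` J)" unfolding Ef_def by (intro gf_mono) auto
  then have hJ: "h \<in> gf (Fm \<union> yroot q ` J)" using J by blast
  have hF: "h ^ q \<in> Fm" unfolding h(2) using cst_in_Fm xmon_in_Fm[OF a(1)]
    by (intro subfield_add subfield_mult subfield_1) auto
  obtain g e where g: "g \<in> Fm" "\<forall>\<gamma>\<in>J. e \<gamma> < q" "h = g * (\<Prod>\<gamma>\<in>J. yroot q \<gamma> ^ e \<gamma>)"
    using kummer_product[OF J(1,2) hJ hF] by blast
  have hq: "1 + cst c * xmon \<alpha> = g ^ q * (\<Prod>\<gamma>\<in>J. (1 + xmon \<gamma>) ^ e \<gamma>)"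
  proof -
    have "(\<Prod>\<gamma>\<in>J. yroot q \<gamma> ^ e \<gamma>) ^ q = (\<Prod>\<gamma>\<in>J. (yroot q \<gamma> ^ q) ^ e \<gamma> :: ('v, 'k) pfield)"
      unfolding prod_power_distrib by (intro prod.cong refl) (simp add: mult.commute flip: power_mult)
    also have "\<dots> = (\<Prod>\<gamma>\<in>J. (1 + xmon \<gamma>) ^ e \<gamma>)"
      using J(2) by (intro prod.cong refl) (simp add: yroot_pow subset_iff)
    finally show ?thesis using h(2) unfolding g(3) power_mult_distrib by simp
  qed
  have lc: "lexp (cst c * xmon \<alpha> :: ('v, 'k) pfield) = \<alpha>" using c by (simp add: lexp_mult lexp_cst)
  have cx0: "cst c * xmon \<alpha> \<noteq> (0 :: ('v, 'k) pfield)" using c by simp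
  have l1: "lexp (1 :: ('v, 'k) pfield) = 0" by (rule lexp_1)
  have h1: "1 + cst c * xmon \<alpha> \<noteq> (0 :: ('v, 'k) pfield)"
  proof (cases "0 < \<alpha>")
    case True
    then show ?thesis using lexp_add_less(1)[of 1 "cst c * xmon \<alpha>"] cx0 lc l1 by simp
  next
    case False
    then have "\<alpha> < 0" using a(2) by simp
    then show ?thesis using lexp_add_less(1)[of "cst c * xmon \<alpha>" 1] cx0 lc l1 by (simp add: add.commute)
  qed
  then have g0: "g \<noteq> 0" using hq q_gt_1 by (auto simp: power_0_left)
  show ?thesis
  proof (cases "0 < lookup \<alpha> v")
    case True
    have "1 + cst c * xmon \<alpha> = cst 1 * xmon 0 * g ^ q * (\<Prod>\<gamma>\<in>J. (1 + xmon \<gamma>) ^ e \<gamma>)"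
      using hq by simp
    then show ?thesis using binomial_relation[OF a(1) True Al_0 _ c one_neq_zero g(1) g0 J(1,2)] g(2) J(2) by fastforce
  next
    case False
    then have vm: "0 < lookup (- \<alpha>) v" using v by simp
    have ci: "inverse c \<noteq> 0" using c by simp
    \<comment> \<open>Multiplying by the inverse of c x^\<alpha> replaces \<alpha> by - \<alpha>, at
      the price of the factor that appears as d and \<beta> in
      \<open>binomial_relation\<close>.\<close>
    have "1 + cst (inverse c) * xmon (- \<alpha>) = cst (inverse c) * xmon (- \<alpha>) * (1 + cst c * xmon \<alpha> :: ('v, 'k) pfield)"
      using c by (simp add: cst_inverse xmon_uminus distrib_left) (simp add: field_simps)
    then have "1 + cst (inverse c) * xmon (- \<alpha>) = cst (inverse c) * xmon (- \<alpha>) * g ^ q * (\<Prod>\<gamma>\<in>J. (1 + xmon \<gamma>) ^ e \<gamma>)"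
      unfolding hq by (simp add: mult_ac)
    then obtain \<gamma> k where gk: "\<gamma> \<in> J" "- \<alpha> = rsm (of_nat k) \<gamma>"
      using binomial_relation[OF Al_uminus[OF a(1)] vm Al_uminus[OF a(1)] less_imp_le[OF vm] ci ci g(1) g0 J(1,2)] g(2) by blast
    have gG: "\<gamma> \<in> \<Gamma>" using gk J by blast
    have ak: "\<alpha> = - rsm (of_nat k) \<gamma>" unfolding gk(2)[symmetric] by simp
    have "0 \<le> rsm (of_nat k) \<gamma>" using G_nat[OF gG] by (intro natexpo_nonneg) (auto simp: natexpo_def Nats_altdef2)
    then have "\<alpha> < 0" using ak a(2) by (simp add: order_less_le)
    then have "lexp (1 + cst c * xmon \<alpha> :: ('v, 'k) pfield) = \<alpha>"
      using lexp_add_less(2)[of "cst c * xmon \<alpha>" 1] cx0 lc l1 by (simp add: add.commute)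
    moreover have h0: "h \<noteq> 0" using h h1 q_gt_1 by (auto simp: power_0_left)
    ultimately have "\<alpha> = rsm (of_nat q) (lexp h)" using lexp_pow[OF h0, of q] h(2) by simp
    moreover have "lexp h \<in> Al" by (rule lexp_Kc_Al[OF h(1) h0])
    ultimately show ?thesis using gG ak by blast
  qed
qed

end

section \<open>The automorphisms\<close>

abbreviation ev :: "'v \<Rightarrow> 'v expo" where "ev v \<equiv> Poly_Mapping.single v 1"

definition tdeg :: "'v expo \<Rightarrow> rat" where
  "tdeg \<alpha> = (\<Sum>v\<in>keys \<alpha>. lookup \<alpha> v)"

lemma tdeg_eq: "finite W \<Longrightarrow> keys \<alpha> \<subseteq> W \<Longrightarrow> tdeg \<alpha> = (\<Sum>v\<in>W. lookup \<alpha> v)"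
  unfolding tdeg_def by (rule sum.mono_neutral_left) (auto simp: in_keys_iff)

lemma tdeg_add: "tdeg (\<alpha> + \<beta>) = tdeg \<alpha> + tdeg \<beta>"
proof -
  have W: "finite (keys \<alpha> \<union> keys \<beta>)" by simp
  show ?thesis
    using tdeg_eq[OF W, of \<alpha>] tdeg_eq[OF W, of \<beta>] tdeg_eq[OF W, of "\<alpha> + \<beta>"] Poly_Mapping.keys_add[of \<alpha> \<beta>]
    by (simp add: lookup_add sum.distrib)
qed

lemma tdeg_rsm: "tdeg (rsm r \<alpha>) = r * tdeg \<alpha>"
proof -
  have "keys (rsm r \<alpha>) \<subseteq> keys \<alpha>" by (auto simp: in_keys_iff)
  then show ?thesis by (simp add: tdeg_eq[of "keys \<alpha>"] sum_distrib_left)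
qed

lemma tdeg_0: "tdeg 0 = 0"
  by (simp add: tdeg_def)

lemma tdeg_sum: "tdeg (sum f A) = (\<Sum>i\<in>A. tdeg (f i))"
  by (induction A rule: infinite_finite_induct) (auto simp: tdeg_0 tdeg_add)

lemma tdeg_ev: "tdeg (ev v) = 1"
  by (simp add: tdeg_def)

lemma expo_sum_ev: "\<alpha> = (\<Sum>v\<in>keys \<alpha>. rsm (lookup \<alpha> v) (ev v))"
proof (rule poly_mapping_eqI)
  fix w
  have "lookup (\<Sum>v\<in>keys \<alpha>. rsm (lookup \<alpha> v) (ev v)) w = (\<Sum>v\<in>keys \<alpha>. if v = w then lookup \<alpha> w else 0)"
    unfolding lookup_sum by (intro sum.cong) (auto simp: lookup_single when_def)
  then show "lookup \<alpha> w = lookup (\<Sum>v\<in>keys \<alpha>. rsm (lookup \<alpha> v) (ev v)) w"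
    by (auto simp: in_keys_iff)
qed

lemma natexpo_tdeg:
  assumes "natexpo \<gamma>"
  shows "1 \<le> tdeg \<gamma>" "tdeg \<gamma> = 1 \<Longrightarrow> \<exists>v. \<gamma> = ev v"
proof -
  obtain v where v: "lookup \<gamma> v \<noteq> 0" using assms unfolding natexpo_def by (metis lookup_zero poly_mapping_eqI)
  have nn: "0 \<le> lookup \<gamma> w" for w using assms by (auto simp: natexpo_def Nats_altdef2)
  have v1: "1 \<le> lookup \<gamma> v"
  proof -
    have "lookup \<gamma> v \<in> \<nat>" using assms by (simp add: natexpo_def)
    then obtain n where n: "lookup \<gamma> v = of_nat n" by (rule Nats_cases)
    then have "1 \<le> n" using v by (cases n) auto
    then show ?thesis unfolding n by simp
  qed
  have vk: "v \<in> keys \<gamma>" using v by (simp add: in_keys_iff)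
  have split: "tdeg \<gamma> = lookup \<gamma> v + (\<Sum>w\<in>keys \<gamma> - {v}. lookup \<gamma> w)"
    unfolding tdeg_def using vk by (simp add: sum.remove)
  have rest: "0 \<le> (\<Sum>w\<in>keys \<gamma> - {v}. lookup \<gamma> w)" by (rule sum_nonneg) (rule nn)
  show "1 \<le> tdeg \<gamma>" using split rest v1 by simp
  assume "tdeg \<gamma> = 1"
  then have "lookup \<gamma> v = 1" "(\<Sum>w\<in>keys \<gamma> - {v}. lookup \<gamma> w) = 0" using split rest v1 by auto
  then have "\<forall>w\<in>keys \<gamma> - {v}. lookup \<gamma> w = 0" using nn by (subst (asm) sum_nonneg_eq_0_iff) auto
  then have "lookup \<gamma> w = lookup (ev v) w" for w
    using \<open>lookup \<gamma> v = 1\<close> by (cases "w = v") (auto simp: lookup_single when_def in_keys_iff)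
  then show "\<exists>v. \<gamma> = ev v" using poly_mapping_eqI by blast
qed

lemma eact_ev: "bij \<pi> \<Longrightarrow> eact \<pi> (ev v) = ev (\<pi> v)"
  by (rule poly_mapping_eqI) (auto simp: lookup_eact lookup_single when_def bij_inv_eq_iff)

section \<open>Automorphisms of a subfield of the ambient field\<close>

definition field_aut :: "'a :: field set \<Rightarrow> ('a \<Rightarrow> 'a) \<Rightarrow> bool" where
  "field_aut K \<sigma> \<longleftrightarrow> bij_betw \<sigma> K K \<and> \<sigma> 1 = 1 \<and>
     (\<forall>x\<in>K. \<forall>y\<in>K. \<sigma> (x + y) = \<sigma> x + \<sigma> y \<and> \<sigma> (x * y) = \<sigma> x * \<sigma> y)"

context
  fixes K :: "'a :: field set" and \<sigma> :: "'a \<Rightarrow> 'a"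
  assumes K: "is_subfield K" and \<sigma>: "field_aut K \<sigma>"
begin

lemma field_aut_add: "x \<in> K \<Longrightarrow> y \<in> K \<Longrightarrow> \<sigma> (x + y) = \<sigma> x + \<sigma> y"
  and field_aut_mult: "x \<in> K \<Longrightarrow> y \<in> K \<Longrightarrow> \<sigma> (x * y) = \<sigma> x * \<sigma> y"
  and field_aut_1: "\<sigma> 1 = 1" and field_aut_bij: "bij_betw \<sigma> K K"
  using \<sigma> by (auto simp: field_aut_def)

lemma field_aut_in: "x \<in> K \<Longrightarrow> \<sigma> x \<in> K"
  using field_aut_bij by (auto simp: bij_betw_def)

lemma field_aut_inj: "x \<in> K \<Longrightarrow> y \<in> K \<Longrightarrow> \<sigma> x = \<sigma> y \<longleftrightarrow> x = y"
  using field_aut_bij by (auto simp: bij_betw_def inj_on_def)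

lemma field_aut_0: "\<sigma> 0 = 0"
  using field_aut_add[OF subfield_0[OF K] subfield_0[OF K]] by (simp only: add_0_left add_cancel_right_right)

lemma field_aut_eq_0_iff: "x \<in> K \<Longrightarrow> \<sigma> x = 0 \<longleftrightarrow> x = 0"
  using field_aut_inj[of x 0] subfield_0[OF K] field_aut_0 by simp

lemma field_aut_uminus: "x \<in> K \<Longrightarrow> \<sigma> (- x) = - \<sigma> x"
  using field_aut_add[of x "- x"] subfield_uminus[OF K] by (simp add: field_aut_0 eq_neg_iff_add_eq_0 add.commute)

lemma field_aut_inverse: "x \<in> K \<Longrightarrow> \<sigma> (inverse x) = inverse (\<sigma> x)"
proof (cases "x = 0")
  case False
  assume x: "x \<in> K"
  then have "\<sigma> x * \<sigma> (inverse x) = 1"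
    using field_aut_mult[of x "inverse x"] subfield_inverse[OF K] False by (simp add: field_aut_1)
  then show ?thesis by (simp add: inverse_unique)
qed (simp add: field_aut_0)

lemma field_aut_power: "x \<in> K \<Longrightarrow> \<sigma> (x ^ n) = \<sigma> x ^ n"
  by (induction n) (simp_all add: field_aut_1 field_aut_mult subfield_power[OF K])

lemma field_aut_inv: "field_aut K (inv_into K \<sigma>)"
proof -
  let ?\<tau> = "inv_into K \<sigma>"
  have inj: "inj_on \<sigma> K" and im: "\<sigma> ` K = K" using field_aut_bij by (auto simp: bij_betw_def)
  have in': "?\<tau> x \<in> K" and f: "\<sigma> (?\<tau> x) = x" if "x \<in> K" for x
    using that im by (auto intro: inv_into_into f_inv_into_f)
  have g: "?\<tau> (\<sigma> x) = x" if "x \<in> K" for x using that inj by simp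
  have "?\<tau> (x + y) = ?\<tau> x + ?\<tau> y" "?\<tau> (x * y) = ?\<tau> x * ?\<tau> y" if "x \<in> K" "y \<in> K" for x y
  proof -
    have "\<sigma> (?\<tau> x + ?\<tau> y) = x + y" "\<sigma> (?\<tau> x * ?\<tau> y) = x * y"
      using that in' f by (simp_all add: field_aut_add field_aut_mult)
    then show "?\<tau> (x + y) = ?\<tau> x + ?\<tau> y" "?\<tau> (x * y) = ?\<tau> x * ?\<tau> y"
      using g[of "?\<tau> x + ?\<tau> y"] g[of "?\<tau> x * ?\<tau> y"] in' that subfield_add[OF K] subfield_mult[OF K] by auto
  qed
  moreover have "?\<tau> 1 = 1" using g[of 1] subfield_1[OF K] field_aut_1 by simp
  ultimately show ?thesis using bij_betw_inv_into[OF field_aut_bij] by (auto simp: field_aut_def)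
qed

lemma field_aut_inv_apply: "x \<in> K \<Longrightarrow> inv_into K \<sigma> (\<sigma> x) = x" "x \<in> K \<Longrightarrow> \<sigma> (inv_into K \<sigma> x) = x"
  using field_aut_bij by (auto simp: bij_betw_def f_inv_into_f)

end

lemma field_hom_eq_on_gf:
  fixes K :: "'a :: field set"
  assumes K: "is_subfield K" and s: "field_aut K \<sigma>" and t: "field_aut K \<rho>"
    and eq: "\<And>x. x \<in> S \<Longrightarrow> \<sigma> x = \<rho> x" and "S \<subseteq> K" "x \<in> gf S"
  shows "\<sigma> x = \<rho> x"
proof -
  have "is_subfield {x \<in> K. \<sigma> x = \<rho> x}"
    by (rule is_subfieldI)
      (use K in \<open>auto simp: field_aut_0[OF K s] field_aut_0[OF K t] field_aut_1[OF K s] field_aut_1[OF K t]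
        field_aut_add[OF K s] field_aut_add[OF K t] field_aut_mult[OF K s] field_aut_mult[OF K t]
        field_aut_uminus[OF K s] field_aut_uminus[OF K t] field_aut_inverse[OF K s] field_aut_inverse[OF K t]
        subfield_0 subfield_1 subfield_add subfield_mult subfield_uminus subfield_inverse\<close>)
  then have "gf S \<subseteq> {x \<in> K. \<sigma> x = \<rho> x}" by (rule gf_least) (use assms in auto)
  then show ?thesis using assms by blast
qed

section \<open>Automorphisms of \<open>K\<close> permute the variables\<close>

context binomial_field
begin

lemma k0_subfield: "is_subfield k0"
  by (simp add: k0)

lemma lco_K:
  assumes "x \<in> K" "x \<noteq> 0"
  shows "lco x \<in> k0"
proof -
  have "K \<subseteq> fracs Al k0"
    unfolding K_def
    by (rule gf_least[OF is_subfield_fracs[OF Al_group k0_subfield]])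
      (auto intro!: xmon_in_fracs yroot_in_fracs Al_group k0_subfield G_nat Al_natexpo)
  then show ?thesis using lco_fracs[OF Al_group k0_subfield] assms by blast
qed

lemma xmon_in_K: "\<alpha> \<in> Al \<Longrightarrow> xmon \<alpha> \<in> K" and yroot_in_K: "\<gamma> \<in> \<Gamma> \<Longrightarrow> yroot q \<gamma> \<in> K"
  unfolding K_def by (auto intro: gf_in)

lemma field_aut_cst:
  assumes s: "field_aut K \<sigma>" and c: "c \<in> k0"
  shows "cst c \<in> K \<and> \<sigma> (cst c) = cst c"
proof -
  have "is_subfield {c :: 'k. cst c \<in> K \<and> \<sigma> (cst c) = cst c}"
    by (rule is_subfieldI)
      (auto simp: cst_inverse field_aut_0[OF subfields(4) s] field_aut_1[OF subfields(4) s] field_aut_add[OF subfields(4) s]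
        field_aut_mult[OF subfields(4) s] field_aut_uminus[OF subfields(4) s] field_aut_inverse[OF subfields(4) s]
        subfield_0 subfield_1 subfield_add subfield_mult subfield_uminus subfield_inverse)
  then have "k0 \<subseteq> {c. cst c \<in> K \<and> \<sigma> (cst c) = cst c}" unfolding k0 by (rule gf_least) simp
  then show ?thesis using c by blast
qed

lemma Al_sum: "(\<And>i. i \<in> A \<Longrightarrow> f i \<in> Al) \<Longrightarrow> sum f A \<in> Al"
  by (induction A rule: infinite_finite_induct) (auto simp: Al_0 Al_add)

lemma k0_l_power: "x \<in> k0 \<Longrightarrow> x ^ (l ^ n) = 1 \<Longrightarrow> x = 1"
proof (induction n)
  case (Suc n)
  have "(x ^ (l ^ n)) ^ l = 1" using Suc.prems(2) unfolding power_Suc2 power_mult .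
  then have "x ^ (l ^ n) = 1" by (rule k0_l[OF subfield_power[OF k0_subfield Suc.prems(1)]])
  then show ?case using Suc by blast
qed simp

text \<open>By \<open>aut_xmon\<close> the image of a monomial is a constant times a monomial;
  \<open>mu\<close> is the induced additive map on \<open>Al\<close>.\<close>

definition mu :: "(('v, 'k) pfield \<Rightarrow> ('v, 'k) pfield) \<Rightarrow> 'v expo \<Rightarrow> 'v expo" where
  "mu \<sigma> \<alpha> = lexp (\<sigma> (xmon \<alpha>))"

context
  fixes \<sigma> :: "('v, 'k) pfield \<Rightarrow> ('v, 'k) pfield"
  assumes s: "field_aut K \<sigma>"
begin

lemmas s_simps = field_aut_add[OF subfields(4) s] field_aut_mult[OF subfields(4) s] field_aut_1[OF subfields(4) s]
  field_aut_power[OF subfields(4) s] field_aut_inverse[OF subfields(4) s]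

lemma aut_xmon_nonzero: "\<alpha> \<in> Al \<Longrightarrow> \<sigma> (xmon \<alpha>) \<noteq> 0"
  using field_aut_eq_0_iff[OF subfields(4) s xmon_in_K] by simp

lemma aut_in_K: "x \<in> K \<Longrightarrow> \<sigma> x \<in> K"
  by (rule field_aut_in[OF subfields(4) s])

text \<open>The monomial has roots of every \<open>l\<close>-power order in \<open>K\<close>, and
  the automorphism carries them to roots of its image; so \<open>divisible_monomial\<close> applies
  in \<open>Kc\<close>. The constant returns to the prime field by \<open>lco_K\<close>.\<close>

lemma aut_xmon:
  assumes a: "\<alpha> \<in> Al"
  obtains c where "c \<in> k0" "c \<noteq> 0" "\<sigma> (xmon \<alpha>) = cst c * xmon (mu \<sigma> \<alpha>)" "mu \<sigma> \<alpha> \<in> Al"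
proof -
  have K1: "\<sigma> (xmon \<alpha>) \<in> K" by (rule aut_in_K[OF xmon_in_K[OF a]])
  have "\<exists>w\<in>Kc. w ^ (l ^ n) = \<sigma> (xmon \<alpha>)" for n
  proof -
    let ?w = "xmon (rsm (1 / of_nat (l ^ n)) \<alpha>) :: ('v, 'k) pfield"
    have wK: "?w \<in> K" by (rule xmon_in_K[OF Al_root[OF a]])
    have "?w ^ (l ^ n) = xmon \<alpha>" using l_gt_1 by (simp add: rsm_rsm del: of_nat_power flip: xmon_rsm)
    then have "\<sigma> ?w ^ (l ^ n) = \<sigma> (xmon \<alpha>)" using wK by (simp flip: s_simps)
    then show ?thesis using aut_in_K[OF wK] K_subset_Kc by blast
  qed
  then have "\<sigma> (xmon \<alpha>) = cst (lco (\<sigma> (xmon \<alpha>))) * xmon (lexp (\<sigma> (xmon \<alpha>)))"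
    using K1 K_subset_Kc aut_xmon_nonzero[OF a] by (intro divisible_monomial) auto
  moreover have "lco (\<sigma> (xmon \<alpha>)) \<in> k0" by (rule lco_K[OF K1 aut_xmon_nonzero[OF a]])
  moreover have "lexp (\<sigma> (xmon \<alpha>)) \<in> Al" using K1 K_subset_Kc aut_xmon_nonzero[OF a] by (intro lexp_Kc_Al) auto
  moreover have "lco (\<sigma> (xmon \<alpha>)) \<noteq> 0" by (rule lco_nonzero[OF aut_xmon_nonzero[OF a] aut_xmon_nonzero[OF a]])
  ultimately show ?thesis using that unfolding mu_def by blast
qed

lemma mu_Al: "\<alpha> \<in> Al \<Longrightarrow> mu \<sigma> \<alpha> \<in> Al"
  using aut_xmon by metis

lemma mu_add: "\<alpha> \<in> Al \<Longrightarrow> \<beta> \<in> Al \<Longrightarrow> mu \<sigma> (\<alpha> + \<beta>) = mu \<sigma> \<alpha> + mu \<sigma> \<beta>"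
  unfolding mu_def using aut_xmon_nonzero by (simp add: xmon_add s_simps xmon_in_K lexp_mult)

lemma mu_0: "mu \<sigma> 0 = 0"
  unfolding mu_def by (simp add: s_simps lexp_1)

lemma mu_rsm: "\<alpha> \<in> Al \<Longrightarrow> mu \<sigma> (rsm (of_nat n) \<alpha>) = rsm (of_nat n) (mu \<sigma> \<alpha>)"
  unfolding mu_def using aut_xmon_nonzero by (simp add: xmon_rsm s_simps xmon_in_K lexp_pow)

lemma mu_sum: "(\<And>i. i \<in> A \<Longrightarrow> f i \<in> Al) \<Longrightarrow> mu \<sigma> (sum f A) = (\<Sum>i\<in>A. mu \<sigma> (f i))"
proof (induction A rule: infinite_finite_induct)
  case (insert i A)
  have "sum f A \<in> Al" by (rule Al_sum) (use insert in auto)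
  then show ?case using insert by (simp add: mu_add)
qed (auto simp: mu_0)

end

lemma ev_Al: "ev v \<in> Al"
  using Al_single[of v 0] by simp

lemma mu_inverse:
  assumes s: "field_aut K \<sigma>" and t: "field_aut K \<tau>" and inv: "\<And>x. x \<in> K \<Longrightarrow> \<tau> (\<sigma> x) = x" and a: "\<alpha> \<in> Al"
  shows "mu \<tau> (mu \<sigma> \<alpha>) = \<alpha>"
proof -
  obtain c where c: "c \<in> k0" "c \<noteq> 0" "\<sigma> (xmon \<alpha>) = cst c * xmon (mu \<sigma> \<alpha>)" "mu \<sigma> \<alpha> \<in> Al"
    by (rule aut_xmon[OF s a])
  obtain d where d: "d \<in> k0" "d \<noteq> 0" "\<tau> (xmon (mu \<sigma> \<alpha>)) = cst d * xmon (mu \<tau> (mu \<sigma> \<alpha>))"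
    by (rule aut_xmon[OF t c(4)])
  have cK: "cst c \<in> K" "\<tau> (cst c) = cst c" using field_aut_cst[OF t c(1)] by auto
  have "xmon \<alpha> = \<tau> (\<sigma> (xmon \<alpha>))" using inv[OF xmon_in_K[OF a]] by simp
  also have "\<dots> = cst c * (cst d * xmon (mu \<tau> (mu \<sigma> \<alpha>)))"
    unfolding c(3) using field_aut_mult[OF subfields(4) t cK(1) xmon_in_K[OF c(4)]] cK d by simp
  finally have "lexp (xmon \<alpha> :: ('v, 'k) pfield) = lexp (cst c * (cst d * xmon (mu \<tau> (mu \<sigma> \<alpha>))) :: ('v, 'k) pfield)" by simp
  then show ?thesis using c d by (simp add: lexp_mult lexp_cst)
qed

text \<open>The image of \<open>yroot q (ev v)\<close> is a q-th root of a binomial, so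
  \<open>binomial_power\<close> applies. Its second alternative would, after applying \<tau>, make
  \<open>ev v\<close> divisible by q in \<open>Al\<close>, where only powers of \<open>l\<close>
  occur as denominators.\<close>

lemma mu_ev_multiple:
  assumes s: "field_aut K \<sigma>" and t: "field_aut K \<tau>" and inv: "\<And>x. x \<in> K \<Longrightarrow> \<tau> (\<sigma> x) = x"
  obtains \<gamma> k where "\<gamma> \<in> \<Gamma>" "k > 0" "mu \<sigma> (ev v) = rsm (of_nat k) \<gamma>" "\<sigma> (xmon (ev v)) = cst (- ((- 1) ^ k)) * xmon (mu \<sigma> (ev v))"
proof -
  obtain c where c: "c \<in> k0" "c \<noteq> 0" "\<sigma> (xmon (ev v)) = cst c * xmon (mu \<sigma> (ev v))" "mu \<sigma> (ev v) \<in> Al"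
    by (rule aut_xmon[OF s ev_Al])
  have inv': "mu \<tau> (mu \<sigma> (ev v)) = ev v" by (rule mu_inverse[OF s t inv ev_Al])
  have ev0: "ev v \<noteq> 0" by (metis lookup_single_eq lookup_zero zero_neq_one)
  have m0: "mu \<sigma> (ev v) \<noteq> 0"
  proof
    assume "mu \<sigma> (ev v) = 0"
    then show False using inv' mu_0[OF t] ev0 by simp
  qed
  let ?h = "\<sigma> (yroot q (ev v))"
  have yK: "yroot q (ev v) \<in> K" by (rule yroot_in_K[OF G_single])
  have "?h ^ q = \<sigma> (1 + xmon (ev v))"
    using yK by (simp add: yroot_pow[OF G_single] flip: field_aut_power[OF subfields(4) s])
  also have "\<dots> = 1 + cst c * xmon (mu \<sigma> (ev v))"
    using xmon_in_K[OF ev_Al] subfield_1[OF subfields(4)]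
    by (simp add: field_aut_add[OF subfields(4) s] field_aut_1[OF subfields(4) s] c(3))
  finally have hq: "?h ^ q = 1 + cst c * xmon (mu \<sigma> (ev v))" .
  have "?h \<in> Kc" using aut_in_K[OF s yK] K_subset_Kc by blast
  from binomial_power[OF this hq c(2,4) m0]
  obtain \<gamma> k where gk: "\<gamma> \<in> \<Gamma>" "(mu \<sigma> (ev v) = rsm (of_nat k) \<gamma> \<and> c = - ((- 1) ^ k)) \<or>
      (\<exists>\<delta>\<in>Al. mu \<sigma> (ev v) = rsm (of_nat q) \<delta>)" by blast
  have no: "\<not> (\<exists>\<delta>\<in>Al. mu \<sigma> (ev v) = rsm (of_nat q) \<delta>)"
  proof
    assume "\<exists>\<delta>\<in>Al. mu \<sigma> (ev v) = rsm (of_nat q) \<delta>"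
    then obtain \<delta> where d: "\<delta> \<in> Al" "mu \<sigma> (ev v) = rsm (of_nat q) \<delta>" by blast
    have "ev v = rsm (of_nat q) (mu \<tau> \<delta>)" using inv' unfolding d(2) mu_rsm[OF t d(1)] by simp
    then have 1: "1 = of_nat q * lookup (mu \<tau> \<delta>) v" by (metis lookup_rsm lookup_single_eq)
    have "mu \<tau> \<delta> \<in> Al" by (rule mu_Al[OF t d(1)])
    then obtain j where "of_nat (l ^ j) * lookup (mu \<tau> \<delta>) v \<in> \<int>" unfolding Al_def by blast
    then obtain z where z: "of_nat (l ^ j) * lookup (mu \<tau> \<delta>) v = of_int z" by (rule Ints_cases)
    have "of_nat (l ^ j) = of_nat q * (of_nat (l ^ j) * lookup (mu \<tau> \<delta>) v)" using 1 by (simp add: mult_ac)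
    then have "of_int (int (l ^ j)) = (of_int (int q * z) :: rat)" unfolding z by simp
    then have "int (l ^ j) = int q * z" by (simp only: of_int_eq_iff)
    then have "int q dvd int (l ^ j)" by simp
    then have "q dvd l ^ j" by (simp only: int_dvd_int_iff)
    then have "q dvd l" by (rule prime_dvd_power[OF q])
    then show False using q l ql by (simp add: primes_dvd_imp_eq)
  qed
  then have m: "mu \<sigma> (ev v) = rsm (of_nat k) \<gamma>" "c = - ((- 1) ^ k)" using gk(2) by auto
  have "k > 0" using m m0 by (auto intro: Nat.gr0I)
  then show ?thesis using that gk(1) m c(3) by blast
qed

text \<open>The inverse \<tau> sends each variable to a monomial of total degree at least 1, so it
  does not lower the degree of \<gamma>. From 1 = k * tdeg (mu \<tau> \<gamma>) \<ge> k * tdeg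
  \<gamma> \<ge> k it follows that k = 1 and \<gamma> is a variable. For k = 1 the sign in
  \<open>mu_ev_multiple\<close> is 1.\<close>

lemma aut_permutes_variables:
  assumes s: "field_aut K \<sigma>" and t: "field_aut K \<tau>" and inv: "\<And>x. x \<in> K \<Longrightarrow> \<tau> (\<sigma> x) = x"
    and inv': "\<And>x. x \<in> K \<Longrightarrow> \<sigma> (\<tau> x) = x"
  shows "\<exists>w. \<sigma> (xmon (ev v)) = xmon (ev w)"
proof -
  obtain \<gamma> k where g: "\<gamma> \<in> \<Gamma>" "k > 0" "mu \<sigma> (ev v) = rsm (of_nat k) \<gamma>"
    "\<sigma> (xmon (ev v)) = cst (- ((- 1) ^ k)) * xmon (mu \<sigma> (ev v))"
    by (rule mu_ev_multiple[OF s t inv])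
  have gn: "natexpo \<gamma>" by (rule G_nat[OF g(1)])
  have gA: "\<gamma> \<in> Al" by (rule Al_natexpo[OF gn])
  define n where "n = (\<lambda>u. nat \<lfloor>lookup \<gamma> u\<rfloor>)"
  have n: "lookup \<gamma> u = of_nat (n u)" for u
  proof -
    have "lookup \<gamma> u \<in> \<nat>" using gn by (simp add: natexpo_def)
    then show ?thesis by (auto simp: n_def elim!: Nats_cases)
  qed
  have evn: "rsm (of_nat i) (ev u) \<in> Al" for i u
    by (induction i) (auto simp: rsm_add_left Al_0 Al_add ev_Al)
  have d1: "1 \<le> tdeg (mu \<tau> (ev u))" for u
  proof -
    obtain \<delta> i where d: "\<delta> \<in> \<Gamma>" "i > 0" "mu \<tau> (ev u) = rsm (of_nat i) \<delta>"
      by (rule mu_ev_multiple[OF t s inv'])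
    have "1 * 1 \<le> of_nat i * tdeg \<delta>"
      using d(2) natexpo_tdeg(1)[OF G_nat[OF d(1)]] by (intro mult_mono) auto
    then show ?thesis unfolding d(3) tdeg_rsm by simp
  qed
  have "\<gamma> = (\<Sum>u\<in>keys \<gamma>. rsm (of_nat (n u)) (ev u))" using expo_sum_ev[of \<gamma>] by (simp only: n)
  then have "mu \<tau> \<gamma> = mu \<tau> (\<Sum>u\<in>keys \<gamma>. rsm (of_nat (n u)) (ev u))" by (rule arg_cong)
  also have "\<dots> = (\<Sum>u\<in>keys \<gamma>. rsm (of_nat (n u)) (mu \<tau> (ev u)))"
    using evn by (simp add: mu_sum[OF t] mu_rsm[OF t ev_Al])
  finally have "tdeg (mu \<tau> \<gamma>) = (\<Sum>u\<in>keys \<gamma>. of_nat (n u) * tdeg (mu \<tau> (ev u)))"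
    by (simp add: tdeg_sum tdeg_rsm)
  also have "\<dots> \<ge> (\<Sum>u\<in>keys \<gamma>. of_nat (n u) * 1)"
    using d1 by (intro sum_mono mult_left_mono) auto
  finally have le: "tdeg \<gamma> \<le> tdeg (mu \<tau> \<gamma>)" by (simp add: tdeg_def n)
  have "mu \<tau> (mu \<sigma> (ev v)) = ev v" by (rule mu_inverse[OF s t inv ev_Al])
  then have "rsm (of_nat k) (mu \<tau> \<gamma>) = ev v" unfolding g(3) mu_rsm[OF t gA] .
  then have 1: "of_nat k * tdeg (mu \<tau> \<gamma>) = 1" using tdeg_rsm[of "of_nat k" "mu \<tau> \<gamma>"] by (simp add: tdeg_ev)
  have g1: "1 \<le> tdeg \<gamma>" by (rule natexpo_tdeg(1)[OF gn])
  have "of_nat k * 1 \<le> of_nat k * tdeg (mu \<tau> \<gamma>)" using le g1 by (intro mult_left_mono) auto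
  then have k1: "k = 1" using 1 g(2) by simp
  then have "tdeg \<gamma> = 1" using 1 le g1 by simp
  then obtain w where "\<gamma> = ev w" using natexpo_tdeg(2)[OF gn] by blast
  then show ?thesis using g(3,4) k1 by auto
qed

lemma integral_multiple:
  assumes "\<alpha> \<in> Al"
  shows "\<exists>j. \<forall>v. lookup (rsm (of_nat (l ^ j)) \<alpha>) v \<in> \<int>"
proof -
  have "\<forall>v. \<exists>m. of_nat (l ^ m) * lookup \<alpha> v \<in> \<int>" using assms unfolding Al_def by blast
  from choice[OF this] obtain J where J: "\<And>v. of_nat (l ^ J v) * lookup \<alpha> v \<in> \<int>" by blast
  define j where "j = (\<Sum>v\<in>keys \<alpha>. J v)"
  have "of_nat (l ^ j) * lookup \<alpha> v \<in> \<int>" for v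
  proof (cases "v \<in> keys \<alpha>")
    case True
    then have le: "J v \<le> j" unfolding j_def by (intro member_le_sum) auto
    then have "l ^ j = l ^ (j - J v) * l ^ J v" by (simp flip: power_add)
    then have e: "of_nat (l ^ j) * lookup \<alpha> v = of_nat (l ^ (j - J v)) * (of_nat (l ^ J v) * lookup \<alpha> v)"
      by (simp only: of_nat_mult mult.assoc)
    show ?thesis unfolding e by (rule Ints_mult[OF Ints_of_nat J])
  qed (simp add: in_keys_iff)
  then show ?thesis by (intro exI[of _ j]) simp
qed

lemma eact_Al: "bij \<pi> \<Longrightarrow> \<alpha> \<in> Al \<Longrightarrow> eact \<pi> \<alpha> \<in> Al"
  unfolding Al_def by (auto simp: lookup_eact simp del: of_nat_power)

text \<open>The exponents with this property form a group containing all integral ones. Some l^j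
  times \<alpha> is integral; extracting the l^j-th root leaves a constant c of the prime field with
  c^(l^j) = 1, so c = 1.\<close>

lemma aut_xmon_permutation:
  assumes s: "field_aut K \<sigma>" and \<pi>: "bij \<pi>" "\<And>v. \<sigma> (xmon (ev v)) = xmon (ev (\<pi> v))" and a: "\<alpha> \<in> Al"
  shows "\<sigma> (xmon \<alpha>) = xmon (eact \<pi> \<alpha>)"
proof -
  define P where "P = {\<alpha> \<in> Al. \<sigma> (xmon \<alpha>) = xmon (eact \<pi> \<alpha>)}"
  have P0: "0 \<in> P" by (simp add: P_def Al_0 eact_0[OF \<pi>(1)] field_aut_1[OF subfields(4) s])
  have Padd: "\<alpha> + \<beta> \<in> P" if "\<alpha> \<in> P" "\<beta> \<in> P" for \<alpha> \<beta>
    using that by (simp add: P_def Al_add xmon_add eact_add[OF \<pi>(1)] field_aut_mult[OF subfields(4) s] xmon_in_K)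
  have Pum: "- \<alpha> \<in> P" if "\<alpha> \<in> P" for \<alpha>
  proof -
    have "eact \<pi> (- \<alpha>) = - eact \<pi> \<alpha>" using eact_diff[OF \<pi>(1), of 0 \<alpha>] by (simp add: eact_0[OF \<pi>(1)])
    then show ?thesis
      using that by (simp add: P_def Al_uminus xmon_uminus field_aut_inverse[OF subfields(4) s] xmon_in_K)
  qed
  have Pev: "ev v \<in> P" for v by (simp add: P_def ev_Al \<pi>(2) eact_ev[OF \<pi>(1)])
  have Pnat: "rsm (of_nat n) (ev v) \<in> P" for n v by (induction n) (auto simp: rsm_add_left P0 Padd Pev)
  have Pint: "rsm (of_int z) (ev v) \<in> P" for z v
  proof (cases z rule: int_cases2)
    case (nonneg n)
    then show ?thesis using Pnat by simp
  next
    case (nonpos n)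
    have "rsm (- of_nat n) (ev v) = - rsm (of_nat n) (ev v)" by (rule poly_mapping_eqI) simp
    then show ?thesis using Pum[OF Pnat] nonpos by simp
  qed
  have Psum: "sum f A \<in> P" if "\<And>i. i \<in> A \<Longrightarrow> f i \<in> P" for f :: "'v \<Rightarrow> 'v expo" and A
    using that by (induction A rule: infinite_finite_induct) (auto simp: P0 Padd)
  obtain j where j: "\<And>v. lookup (rsm (of_nat (l ^ j)) \<alpha>) v \<in> \<int>" using integral_multiple[OF a] by blast
  define \<beta> where "\<beta> = rsm (of_nat (l ^ j)) \<alpha>"
  have "\<beta> \<in> P"
  proof (subst expo_sum_ev, rule Psum)
    fix v
    obtain z where "lookup \<beta> v = of_int z" using j[of v] unfolding \<beta>_def by (rule Ints_cases)
    then show "rsm (lookup \<beta> v) (ev v) \<in> P" using Pint by simp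
  qed
  then have \<beta>: "\<sigma> (xmon \<beta>) = xmon (eact \<pi> \<beta>)" by (simp add: P_def)
  obtain c where c: "c \<in> k0" "c \<noteq> 0" "\<sigma> (xmon \<alpha>) = cst c * xmon (mu \<sigma> \<alpha>)" by (rule aut_xmon[OF s a])
  have "(cst c * xmon (mu \<sigma> \<alpha>)) ^ (l ^ j) = (xmon (eact \<pi> \<alpha>) ^ (l ^ j) :: ('v, 'k) pfield)"
    using \<beta> unfolding \<beta>_def xmon_rsm eact_rsm[OF \<pi>(1)] by (simp add: field_aut_power[OF subfields(4) s] xmon_in_K[OF a] c(3))
  then have "cst (c ^ (l ^ j)) * xmon (rsm (of_nat (l ^ j)) (mu \<sigma> \<alpha>)) = (xmon (rsm (of_nat (l ^ j)) (eact \<pi> \<alpha>)) :: ('v, 'k) pfield)"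
    by (simp only: power_mult_distrib cst_power xmon_rsm)
  then have e: "lexp (cst (c ^ (l ^ j)) * xmon (rsm (of_nat (l ^ j)) (mu \<sigma> \<alpha>)) :: ('v, 'k) pfield) = rsm (of_nat (l ^ j)) (eact \<pi> \<alpha>)"
    "lco (cst (c ^ (l ^ j)) * xmon (rsm (of_nat (l ^ j)) (mu \<sigma> \<alpha>)) :: ('v, 'k) pfield) = 1" by simp_all
  have cl: "c ^ (l ^ j) \<noteq> 0" using c by simp
  have "c ^ (l ^ j) = 1" using e(2) cl by (simp add: lco_mult lco_cst del: of_nat_power)
  then have "c = 1" using k0_l_power c(1) by blast
  have r: "rsm (of_nat (l ^ j)) (mu \<sigma> \<alpha>) = rsm (of_nat (l ^ j)) (eact \<pi> \<alpha>)"
    using e(1) cl by (simp add: lexp_mult lexp_cst del: of_nat_power)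
  have "mu \<sigma> \<alpha> = eact \<pi> \<alpha>"
  proof (rule poly_mapping_eqI)
    fix v show "lookup (mu \<sigma> \<alpha>) v = lookup (eact \<pi> \<alpha>) v"
      using arg_cong[OF r, of "\<lambda>a. lookup a v"] l_gt_1 by simp
  qed
  then show ?thesis using c(3) \<open>c = 1\<close> by simp
qed

lemma aut_relation_multiple:
  assumes s: "field_aut K \<sigma>" and \<pi>: "bij \<pi>" "\<And>v. \<sigma> (xmon (ev v)) = xmon (ev (\<pi> v))" and g: "\<gamma> \<in> \<Gamma>"
  shows "\<sigma> (yroot q \<gamma>) ^ q = 1 + xmon (eact \<pi> \<gamma>)" "\<exists>\<delta>\<in>\<Gamma>. \<exists>k::nat. eact \<pi> \<gamma> = rsm (of_nat k) \<delta>"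
proof -
  have gA: "\<gamma> \<in> Al" by (rule Al_natexpo[OF G_nat[OF g]])
  have yK: "yroot q \<gamma> \<in> K" by (rule yroot_in_K[OF g])
  have "\<sigma> (yroot q \<gamma>) ^ q = \<sigma> (1 + xmon \<gamma>)"
    using yK by (simp add: yroot_pow[OF g] flip: field_aut_power[OF subfields(4) s])
  then show 1: "\<sigma> (yroot q \<gamma>) ^ q = 1 + xmon (eact \<pi> \<gamma>)"
    using xmon_in_K[OF gA] subfield_1[OF subfields(4)]
    by (simp add: field_aut_add[OF subfields(4) s] field_aut_1[OF subfields(4) s] aut_xmon_permutation[OF s \<pi> gA])
  have n: "natexpo (eact \<pi> \<gamma>)" by (rule natexpo_eact[OF \<pi>(1) G_nat[OF g]])
  have hq: "\<sigma> (yroot q \<gamma>) ^ q = 1 + cst 1 * xmon (eact \<pi> \<gamma>)" using 1 by simp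
  have "\<sigma> (yroot q \<gamma>) \<in> Kc" using aut_in_K[OF s yK] K_subset_Kc by blast
  from binomial_power[OF this hq one_neq_zero Al_natexpo[OF n]] n
  obtain \<delta> k where d: "\<delta> \<in> \<Gamma>" "eact \<pi> \<gamma> = rsm (of_nat k) \<delta> \<or> eact \<pi> \<gamma> = - rsm (of_nat k) \<delta>"
    unfolding natexpo_def by blast
  have "eact \<pi> \<gamma> \<noteq> - rsm (of_nat k) \<delta>"
  proof
    assume e: "eact \<pi> \<gamma> = - rsm (of_nat k) \<delta>"
    have "0 \<le> rsm (of_nat k) \<delta>" using G_nat[OF d(1)] by (intro natexpo_nonneg) (auto simp: natexpo_def Nats_altdef2)
    moreover have "0 \<le> eact \<pi> \<gamma>" using n by (intro natexpo_nonneg) (auto simp: natexpo_def Nats_altdef2)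
    ultimately have "eact \<pi> \<gamma> = 0" unfolding e by simp
    then show False using n by (simp add: natexpo_def)
  qed
  then show "\<exists>\<delta>\<in>\<Gamma>. \<exists>k::nat. eact \<pi> \<gamma> = rsm (of_nat k) \<delta>" using d by blast
qed

lemma rsm_nat_one: "natexpo \<gamma> \<Longrightarrow> \<gamma> = rsm (of_nat (i * k)) \<gamma> \<Longrightarrow> k = 1"
  using rsm_of_nat_eq_iff[of \<gamma> 1 "i * k"] by simp

text \<open>Applying both \<pi> and its inverse gives \<gamma> = k i \<epsilon> with \<epsilon> in
  \<Gamma>. Proportional elements of \<Gamma> coincide, so k i = 1.\<close>

lemma aut_preserves_relations:
  assumes s: "field_aut K \<sigma>" and \<pi>: "bij \<pi>" "\<And>v. \<sigma> (xmon (ev v)) = xmon (ev (\<pi> v))"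
    and t: "field_aut K \<tau>" "\<And>v. \<tau> (xmon (ev v)) = xmon (ev (invf \<pi> v))" and g: "\<gamma> \<in> \<Gamma>"
  shows "eact \<pi> \<gamma> \<in> \<Gamma>"
proof -
  have ib: "bij (invf \<pi>)" by (rule bij_imp_bij_inv[OF \<pi>(1)])
  obtain \<delta> k where d: "\<delta> \<in> \<Gamma>" "eact \<pi> \<gamma> = rsm (of_nat k) \<delta>"
    using aut_relation_multiple(2)[OF s \<pi> g] by blast
  obtain \<epsilon> i where e: "\<epsilon> \<in> \<Gamma>" "eact (invf \<pi>) \<delta> = rsm (of_nat i) \<epsilon>"
    using aut_relation_multiple(2)[OF t(1) ib t(2) d(1)] by blast
  have "\<gamma> = eact (invf \<pi>) (eact \<pi> \<gamma>)" by (simp add: eact_inv[OF \<pi>(1)])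
  also have "\<dots> = rsm (of_nat k) (rsm (of_nat i) \<epsilon>)" unfolding d(2) eact_rsm[OF ib] e(2) ..
  finally have ge: "\<gamma> = rsm (of_nat (k * i)) \<epsilon>" by (simp add: rsm_rsm)
  then have "rsm 1 \<gamma> = rsm (of_nat (k * i)) \<epsilon>" by simp
  then have "\<gamma> = \<epsilon>" by (rule G_indep[OF g e(1)]) simp
  then have "\<gamma> = rsm (of_nat (i * k)) \<gamma>" using ge by (simp add: mult.commute)
  then have "k = 1" by (rule rsm_nat_one[OF G_nat[OF g]])
  then show ?thesis using d by simp
qed

text \<open>The leading exponent is 0 and the leading coefficient is a q-th root of unity in the
  prime field, hence 1; with leading term 1 such an element is 1. Consequently q-th roots in
  \<open>K\<close> are unique.\<close>

lemma K_root_of_unity: "x \<in> K \<Longrightarrow> x ^ q = 1 \<Longrightarrow> x = 1"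
proof -
  assume x: "x \<in> K" "x ^ q = 1"
  have x0: "x \<noteq> 0" using x q_gt_1 by (auto simp: power_0_left)
  have "rsm (of_nat q) (lexp x) = 0" using lexp_pow[OF x0, of q] x by (simp add: lexp_1)
  then have lx: "lexp x = 0" using rsm_inj[of "lexp x" "of_nat q" 0] q_gt_1 by auto
  have "lco x ^ q = 1" using lco_power[OF x0, of q] x by (simp add: lco_1)
  then have "lco x = 1" by (rule k0_q[OF lco_K[OF x(1) x0]])
  then show "x = 1" using root_of_unity_lco_1[OF x(2) q0 x0 lx] by simp
qed

theorem field_aut_K:
  assumes s: "field_aut K \<sigma>"
  shows "\<exists>\<pi>. bij \<pi> \<and> eact \<pi> ` \<Gamma> = \<Gamma> \<and> (\<forall>x\<in>K. \<sigma> x = oact \<pi> x)"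
proof -
  define \<tau> where "\<tau> = inv_into K \<sigma>"
  have t: "field_aut K \<tau>" unfolding \<tau>_def by (rule field_aut_inv[OF subfields(4) s])
  have ts: "\<tau> (\<sigma> x) = x" "\<sigma> (\<tau> x) = x" if "x \<in> K" for x
    using that field_aut_inv_apply[OF subfields(4) s] by (simp_all add: \<tau>_def)
  obtain \<pi> where \<pi>: "\<And>v. \<sigma> (xmon (ev v)) = xmon (ev (\<pi> v))"
    using aut_permutes_variables[OF s t ts] by metis
  obtain \<rho> where \<rho>: "\<And>v. \<tau> (xmon (ev v)) = xmon (ev (\<rho> v))"
    using aut_permutes_variables[OF t s ts(2,1)] by metis
  have evK: "xmon (ev v) \<in> K" for v by (rule xmon_in_K[OF ev_Al])
  have inj_ev: "v = w" if "xmon (ev v) = (xmon (ev w) :: ('v, 'k) pfield)" for v w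
  proof -
    have "ev v = (ev w :: 'v expo)" using that by (rule xmon_inj)
    then have "lookup (ev v :: 'v expo) v = lookup (ev w) v" by simp
    then show ?thesis by (simp add: lookup_single when_def split: if_splits)
  qed
  have 1: "\<rho> (\<pi> v) = v" for v
    by (rule inj_ev) (use ts(1)[OF evK, of v] in \<open>simp add: \<pi> \<rho>\<close>)
  have 2: "\<pi> (\<rho> v) = v" for v
    by (rule inj_ev) (use ts(2)[OF evK, of v] in \<open>simp add: \<pi> \<rho>\<close>)
  have bij: "bij \<pi>" by (rule o_bij[of \<rho>]) (auto simp: 1 2)
  have \<rho>\<pi>: "\<rho> = invf \<pi>" using 1 2 by (metis bij bij_inv_eq_iff ext)
  have ib: "bij (invf \<pi>)" by (rule bij_imp_bij_inv[OF bij])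
  have t': "\<tau> (xmon (ev v)) = xmon (ev (invf \<pi> v))" for v using \<rho> \<rho>\<pi> by simp
  have s': "\<sigma> (xmon (ev v)) = xmon (ev (invf (invf \<pi>) v))" for v using \<pi> by (simp add: inv_inv_eq[OF bij])
  have G1: "eact \<pi> \<gamma> \<in> \<Gamma>" if "\<gamma> \<in> \<Gamma>" for \<gamma> by (rule aut_preserves_relations[OF s bij \<pi> t t' that])
  have G2: "eact (invf \<pi>) \<gamma> \<in> \<Gamma>" if "\<gamma> \<in> \<Gamma>" for \<gamma> by (rule aut_preserves_relations[OF t ib t' s s' that])
  have G: "eact \<pi> ` \<Gamma> = \<Gamma>"
  proof
    show "eact \<pi> ` \<Gamma> \<subseteq> \<Gamma>" using G1 by blast
    show "\<Gamma> \<subseteq> eact \<pi> ` \<Gamma>"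
    proof
      fix \<gamma> assume "\<gamma> \<in> \<Gamma>"
      then show "\<gamma> \<in> eact \<pi> ` \<Gamma>" using G2 eact_inv(2)[OF bij, of \<gamma>] by (metis imageI)
    qed
  qed
  \<comment> \<open>Both sides have the same q-th power and lie in \<open>K\<close>, so their
    quotient is 1 by \<open>K_root_of_unity\<close>.\<close>
  have y: "\<sigma> (yroot q \<gamma>) = oact \<pi> (yroot q \<gamma>)" if g: "\<gamma> \<in> \<Gamma>" for \<gamma>
  proof -
    have yq: "\<sigma> (yroot q \<gamma>) ^ q = yroot q (eact \<pi> \<gamma>) ^ q"
      using aut_relation_multiple(1)[OF s bij \<pi> g] yroot_pow[OF G1[OF g]] by simp
    have y0: "yroot q (eact \<pi> \<gamma>) \<noteq> (0 :: ('v, 'k) pfield)" by (rule yroot_nonzero[OF G_nat[OF G1[OF g]]])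
    have "\<sigma> (yroot q \<gamma>) / yroot q (eact \<pi> \<gamma>) = 1"
    proof (rule K_root_of_unity)
      show "\<sigma> (yroot q \<gamma>) / yroot q (eact \<pi> \<gamma>) \<in> K"
        using aut_in_K[OF s yroot_in_K[OF g]] yroot_in_K[OF G1[OF g]] by (intro subfield_divide) auto
      show "(\<sigma> (yroot q \<gamma>) / yroot q (eact \<pi> \<gamma>)) ^ q = 1" using yq y0 by (simp add: power_divide)
    qed
    then show ?thesis using y0 by (simp add: oact_yroot[OF bij G_nat[OF g]])
  qed
  have "is_subfield {x \<in> K. \<sigma> x = oact \<pi> x}"
    by (rule is_subfieldI)
      (auto simp: field_aut_0[OF subfields(4) s] field_aut_1[OF subfields(4) s] field_aut_add[OF subfields(4) s]
        field_aut_mult[OF subfields(4) s] field_aut_uminus[OF subfields(4) s] field_aut_inverse[OF subfields(4) s]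
        oact_0[OF bij] oact_1[OF bij] oact_add[OF bij] oact_mult[OF bij] oact_uminus[OF bij] oact_inverse[OF bij]
        subfield_0 subfield_1 subfield_add subfield_mult subfield_uminus subfield_inverse)
  then have "gf (xmon ` Al \<union> yroot q ` \<Gamma>) \<subseteq> {x \<in> K. \<sigma> x = oact \<pi> x}"
    by (rule gf_least)
      (auto simp: xmon_in_K yroot_in_K y oact_xmon[OF bij] aut_xmon_permutation[OF s bij \<pi>])
  then have "\<forall>x\<in>K. \<sigma> x = oact \<pi> x" unfolding K_def by blast
  then show ?thesis using bij G by blast
qed

section \<open>Permutations preserving \<Gamma> act faithfully on \<open>K\<close>\<close>

lemma oact_image_K:
  assumes "bij \<pi>" "eact \<pi> ` \<Gamma> = \<Gamma>"
  shows "oact \<pi> ` K = K"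
proof -
  have "eact \<pi> ` Al = Al"
  proof
    show "eact \<pi> ` Al \<subseteq> Al" using eact_Al[OF assms(1)] by blast
    show "Al \<subseteq> eact \<pi> ` Al"
    proof
      fix \<alpha> assume "\<alpha> \<in> Al"
      then have "eact (invf \<pi>) \<alpha> \<in> Al" by (rule eact_Al[OF bij_imp_bij_inv[OF assms(1)]])
      then show "\<alpha> \<in> eact \<pi> ` Al" using eact_inv(2)[OF assms(1), of \<alpha>] by (metis imageI)
    qed
  qed
  moreover have "oact \<pi> ` (xmon ` Al) = (xmon ` (eact \<pi> ` Al) :: ('v, 'k) pfield set)" by (simp add: image_image oact_xmon[OF assms(1)])
  moreover have "oact \<pi> ` (yroot q ` \<Gamma>) = (yroot q ` (eact \<pi> ` \<Gamma>) :: ('v, 'k) pfield set)"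
    unfolding image_image by (intro image_cong refl oact_yroot[OF assms(1) G_nat])
  ultimately show ?thesis
    unfolding K_def oact_image_gf[OF assms(1)] using assms(2) by (simp add: image_Un)
qed

lemma field_aut_oact:
  assumes "bij \<pi>" "eact \<pi> ` \<Gamma> = \<Gamma>"
  shows "field_aut K (oact \<pi>)"
  unfolding field_aut_def bij_betw_def
  using oact_image_K[OF assms] inj_on_subset[OF inj_oact[OF assms(1)] subset_UNIV]
    oact_1[OF assms(1)] oact_add[OF assms(1)] oact_mult[OF assms(1)] by auto

lemma oact_eq_on_K:
  assumes "bij \<pi>" "bij \<rho>" "\<And>x. x \<in> K \<Longrightarrow> oact \<pi> x = oact \<rho> x"
  shows "\<pi> = \<rho>"
proof
  fix v
  have "xmon (ev (\<pi> v)) = (xmon (ev (\<rho> v)) :: ('v, 'k) pfield)"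
    using assms(3)[OF xmon_in_K[OF ev_Al[of v]]] by (simp add: oact_xmon assms(1,2) eact_ev)
  then have "ev (\<pi> v) = (ev (\<rho> v) :: 'v expo)" by (rule xmon_inj)
  then have "lookup (ev (\<pi> v) :: 'v expo) (\<pi> v) = lookup (ev (\<rho> v)) (\<pi> v)" by simp
  then show "\<pi> v = \<rho> v" by (simp add: lookup_single when_def split: if_splits)
qed

lemma eact_comp:
  assumes "bij \<pi>" "bij \<rho>"
  shows "eact (\<pi> \<circ> \<rho>) \<alpha> = eact \<pi> (eact \<rho> \<alpha>)"
  by (rule poly_mapping_eqI) (simp add: lookup_eact assms bij_comp o_inv_distrib)

text \<open>Both sides are automorphisms of \<open>K\<close>, so it suffices to compare them on the
  generators, where the equation reduces to \<open>eact_comp\<close>.\<close>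

lemma oact_comp:
  assumes "bij \<pi>" "eact \<pi> ` \<Gamma> = \<Gamma>" "bij \<rho>" "eact \<rho> ` \<Gamma> = \<Gamma>" and x: "x \<in> K"
  shows "oact (\<pi> \<circ> \<rho>) x = oact \<pi> (oact \<rho> x)"
proof -
  have b: "bij (\<pi> \<circ> \<rho>)" using assms by (simp add: bij_comp)
  have G: "eact (\<pi> \<circ> \<rho>) ` \<Gamma> = \<Gamma>"
    using assms by (simp add: eact_comp[OF assms(1,3)] flip: image_image)
  have f: "field_aut K (\<lambda>x. oact \<pi> (oact \<rho> x))"
  proof -
    have "bij_betw (oact \<pi> \<circ> oact \<rho>) K K"
      using field_aut_oact[OF assms(1,2)] field_aut_oact[OF assms(3,4)] unfolding field_aut_def
      by (blast intro: bij_betw_trans)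
    then show ?thesis unfolding field_aut_def o_def
      by (simp add: oact_1 oact_add oact_mult assms)
  qed
  show ?thesis
  proof (rule field_hom_eq_on_gf[OF subfields(4) field_aut_oact[OF b G] f])
    show "xmon ` Al \<union> yroot q ` \<Gamma> \<subseteq> K" using xmon_in_K yroot_in_K by blast
    show "x \<in> gf (xmon ` Al \<union> yroot q ` \<Gamma>)" using x by (simp add: K_def)
    fix y assume "y \<in> xmon ` Al \<union> yroot q ` \<Gamma>"
    then show "oact (\<pi> \<circ> \<rho>) y = oact \<pi> (oact \<rho> y)"
    proof
      assume "y \<in> xmon ` Al"
      then show ?thesis by (auto simp: oact_xmon b assms eact_comp)
    next
      assume "y \<in> yroot q ` \<Gamma>"
      then obtain \<gamma> where g: "\<gamma> \<in> \<Gamma>" "y = yroot q \<gamma>" by blast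
      have "eact \<rho> \<gamma> \<in> \<Gamma>" using g assms by blast
      then show ?thesis unfolding g(2)
        by (simp add: oact_yroot[OF b G_nat[OF g(1)]] oact_yroot[OF assms(3) G_nat[OF g(1)]]
            oact_yroot[OF assms(1) G_nat] eact_comp[OF assms(1,3)])
    qed
  qed
qed

end

section \<open>Free groups as types and threads of reduced words\<close>

text \<open>Left multiplication by a letter on reduced words. Since opposite letters act inversely
  (\<open>push_push\<close>), words act on reduced words through \<open>foldr push\<close>, and
  associativity is composition of these maps; this is van der Waerden's construction, which avoids a
  confluence argument.\<close>

fun push :: "'g \<times> bool \<Rightarrow> ('g \<times> bool) list \<Rightarrow> ('g \<times> bool) list" where
  "push a [] = [a]"
| "push a (c # w) = (if fst a = fst c \<and> snd a \<noteq> snd c then w else a # c # w)"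

definition nrm :: "('g \<times> bool) list \<Rightarrow> ('g \<times> bool) list" where
  "nrm w = foldr push w []"

lemma reduced_Nil: "reduced []"
  by (simp add: reduced_def)

lemma reduced_Cons: "reduced (a # w) \<longleftrightarrow> reduced w \<and> (w = [] \<or> \<not> (fst a = fst (hd w) \<and> snd a \<noteq> snd (hd w)))"
  by (cases w) (auto simp: reduced_def split: prod.splits)

lemma reduced_push: "reduced w \<Longrightarrow> reduced (push a w)"
  by (cases w) (auto simp: reduced_Cons reduced_Nil)

lemma reduced_foldr_push: "reduced w \<Longrightarrow> reduced (foldr push u w)"
  by (induction u) (auto simp: reduced_push)

lemma reduced_nrm: "reduced (nrm w)"
  by (simp add: nrm_def reduced_foldr_push reduced_Nil)

lemma push_reduced: "reduced (a # w) \<Longrightarrow> push a w = a # w"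
  by (cases w) (auto simp: reduced_Cons)

lemma nrm_reduced: "reduced w \<Longrightarrow> nrm w = w"
  by (induction w) (auto simp: nrm_def push_reduced reduced_Cons)

lemma push_push: "reduced w \<Longrightarrow> push (x, \<not> b) (push (x, b) w) = w"
  by (cases w rule: list.exhaust[case_names Nil Cons], simp)
    (rename_tac c v, case_tac v, auto simp: reduced_Cons prod_eq_iff)

lemma foldr_push_push: "reduced v \<Longrightarrow> foldr push (push a w) v = push a (foldr push w v)"
proof (cases w)
  case (Cons c w')
  assume v: "reduced v"
  show ?thesis
  proof (cases "fst a = fst c \<and> snd a \<noteq> snd c")
    case True
    then have "a = (fst c, \<not> snd c)" by (auto simp: prod_eq_iff)
    then show ?thesis using True Cons push_push[of "foldr push w' v" "fst c" "snd c"] reduced_foldr_push[OF v]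
      by simp
  next
    case False
    then show ?thesis using Cons by auto
  qed
qed simp

lemma foldr_push_foldr:
  "reduced v \<Longrightarrow> foldr push (foldr push u w) v = foldr push u (foldr push w v)"
  by (induction u) (auto simp: foldr_push_push)

lemma nrm_map_push: "nrm (map (apfst f) (push a w)) = push (apfst f a) (nrm (map (apfst f) w))"
proof (cases w)
  case (Cons c w')
  show ?thesis
  proof (cases "fst a = fst c \<and> snd a \<noteq> snd c")
    case True
    then have "apfst f a = (f (fst c), \<not> snd c)" "apfst f c = (f (fst c), snd c)" by (auto simp: prod_eq_iff)
    then show ?thesis using True Cons push_push[OF reduced_nrm, of "f (fst c)" "snd c" "map (apfst f) w'"]
      by (simp add: nrm_def)
  next
    case False
    then show ?thesis using Cons by (auto simp: nrm_def)
  qed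
qed (simp add: nrm_def)

text \<open>A relabelling that identifies letters can create new cancellations, but cancelled pairs
  remain cancelling pairs after relabelling. So reducing beforehand does not affect the
  result.\<close>

lemma nrm_map_nrm: "nrm (map (apfst f) (nrm w)) = nrm (map (apfst f) w)"
proof (induction w)
  case (Cons a w)
  have "nrm (a # w) = push a (nrm w)" by (simp add: nrm_def)
  then show ?case using Cons by (simp add: nrm_map_push) (simp add: nrm_def)
qed (simp add: nrm_def)

lemma length_push: "length (push a w) \<le> Suc (length w)"
  by (cases w) auto

lemma length_nrm: "length (nrm w) \<le> length w"
proof (induction w)
  case (Cons a w)
  then show ?case using length_push[of a "nrm w"] by (simp add: nrm_def)
qed (simp add: nrm_def)

text \<open>Every cancellation shortens the word, so equal lengths mean that none took
  place.\<close>

lemma nrm_eq_if_length: "length (nrm w) = length w \<Longrightarrow> nrm w = w"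
proof (induction w)
  case (Cons a w)
  have e: "nrm (a # w) = push a (nrm w)" by (simp add: nrm_def)
  then have "length (push a (nrm w)) = Suc (length w)" using Cons.prems by simp
  then have "length (nrm w) = length w" using length_push[of a "nrm w"] length_nrm[of w] by linarith
  then have "nrm w = w" by (rule Cons.IH)
  then show ?case using Cons.prems e by (cases w) (auto split: if_splits)
qed (simp add: nrm_def)

section \<open>The free group as a type and its functoriality\<close>

definition winv :: "('g \<times> bool) list \<Rightarrow> ('g \<times> bool) list" where
  "winv w = rev (map (apsnd Not) w)"

lemma winv_Cons: "winv (a # w) = winv w @ [apsnd Not a]"
  by (simp add: winv_def)

lemma reduced_winv: "reduced w \<Longrightarrow> reduced (winv w)"
proof -
  assume "reduced w"
  then have "successively (\<lambda>a c. \<not> (fst a = fst c \<and> snd a \<noteq> snd c)) w"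
    by (simp add: reduced_def case_prod_unfold)
  then show ?thesis
    by (simp add: reduced_def winv_def successively_rev successively_map case_prod_unfold)
      (erule successively_mono, auto)
qed

lemma foldr_push_winv: "reduced w \<Longrightarrow> foldr push (winv w) w = []"
proof (induction w)
  case (Cons a w)
  have r: "reduced w" using Cons.prems by (simp add: reduced_Cons)
  have "push (apsnd Not a) (a # w) = w" by simp
  then show ?case using Cons.IH[OF r] by (simp add: winv_Cons)
qed (simp add: winv_def)

text \<open>The group is written additively because \<open>group_add\<close> is the type class of
  groups, commutative or not.\<close>

typedef 'g fg = "{w :: ('g \<times> bool) list. reduced w}"
  morphisms wd Abs_fg
  by (rule exI[of _ "[]"]) (simp add: reduced_Nil)

lemma reduced_wd: "reduced (wd u)"
  using wd by simp

lemma wd_Abs: "reduced w \<Longrightarrow> wd (Abs_fg w) = w"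
  by (simp add: Abs_fg_inverse)

instantiation fg :: (type) group_add
begin

definition "0 = Abs_fg []"
definition "u + v = Abs_fg (foldr push (wd u) (wd v))"
definition "- u = Abs_fg (winv (wd u))" for u :: "'a fg"
definition "u - v = u + (- v)" for u v :: "'a fg"

lemma wd_0 [simp]: "wd (0 :: 'a fg) = []"
  by (simp add: zero_fg_def wd_Abs reduced_Nil)

lemma wd_plus: "wd (u + v) = foldr push (wd u) (wd v)" for u v :: "'a fg"
  by (simp add: plus_fg_def wd_Abs reduced_foldr_push reduced_wd)

lemma wd_uminus: "wd (- u) = winv (wd u)" for u :: "'a fg"
  by (simp add: uminus_fg_def wd_Abs reduced_winv reduced_wd)

instance
proof
  fix u v w :: "'a fg"
  show "u + v + w = u + (v + w)"
    by (simp add: wd_plus foldr_push_foldr reduced_wd flip: wd_inject)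
  show "0 + u = u" by (simp add: wd_plus flip: wd_inject)
  show "u + 0 = u"
    using nrm_reduced[OF reduced_wd, of u] by (simp add: wd_plus nrm_def flip: wd_inject)
  show "- u + u = 0" by (simp add: wd_plus wd_uminus foldr_push_winv reduced_wd flip: wd_inject)
  show "u + - v = u - v" by (simp add: minus_fg_def)
qed

end

definition fgen :: "'g \<times> bool \<Rightarrow> 'g fg" where
  "fgen a = Abs_fg [a]"

lemma wd_fgen: "wd (fgen a) = [a]"
  by (simp add: fgen_def wd_Abs reduced_Cons reduced_Nil)

lemma fgen_False: "fgen (x, False) = - fgen (x, True)"
  by (simp add: wd_uminus wd_fgen winv_def flip: wd_inject)

definition word_fg :: "('g \<times> bool) list \<Rightarrow> 'g fg" where
  "word_fg w = Abs_fg (nrm w)"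

lemma wd_word_fg: "wd (word_fg w) = nrm w"
  by (simp add: word_fg_def wd_Abs reduced_nrm)

lemma word_fg_wd: "word_fg (wd u) = u"
  by (simp add: wd_word_fg nrm_reduced reduced_wd flip: wd_inject)

lemma word_fg_Nil: "word_fg [] = 0"
  by (simp add: wd_word_fg nrm_def flip: wd_inject)

lemma word_fg_Cons: "word_fg (a # w) = fgen a + word_fg w"
  by (simp add: wd_word_fg wd_plus wd_fgen flip: wd_inject) (simp add: nrm_def)

lemma word_fg_append: "word_fg (u @ v) = word_fg u + word_fg v"
  by (induction u) (simp_all add: word_fg_Nil word_fg_Cons add.assoc)

definition fmap :: "('g \<Rightarrow> 'h) \<Rightarrow> 'g fg \<Rightarrow> 'h fg" where
  "fmap f u = word_fg (map (apfst f) (wd u))"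

lemma fmap_word_fg: "fmap f (word_fg w) = word_fg (map (apfst f) w)"
  by (simp add: fmap_def wd_word_fg nrm_map_nrm flip: wd_inject)

lemma fmap_add: "fmap f (u + v) = fmap f u + fmap f v"
proof -
  have "u + v = word_fg (wd u @ wd v)" by (simp add: word_fg_append word_fg_wd)
  then have "fmap f (u + v) = word_fg (map (apfst f) (wd u @ wd v))" by (simp only: fmap_word_fg)
  then show ?thesis by (simp add: word_fg_append fmap_def)
qed

lemma fmap_0 [simp]: "fmap f 0 = 0"
  by (simp add: fmap_def word_fg_Nil)

lemma fmap_uminus: "fmap f (- u) = - fmap f u"
  using fmap_add[of f "- u" u] by (simp add: eq_neg_iff_add_eq_0)

lemma fmap_fmap: "fmap f (fmap g u) = fmap (\<lambda>x. f (g x)) u"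
proof -
  have "fmap f (fmap g u) = word_fg (map (apfst f) (map (apfst g) (wd u)))"
    unfolding fmap_def[of g] by (rule fmap_word_fg)
  then show ?thesis by (simp add: fmap_def[of "\<lambda>x. f (g x)"] apfst_compose comp_def)
qed

lemma length_fmap: "length (wd (fmap f u)) \<le> length (wd u)"
  using length_nrm[of "map (apfst f) (wd u)"] by (simp add: fmap_def wd_word_fg)

lemma wd_fmap_if_length: "length (wd (fmap f u)) = length (wd u) \<Longrightarrow> wd (fmap f u) = map (apfst f) (wd u)"
  using nrm_eq_if_length[of "map (apfst f) (wd u)"] by (simp add: fmap_def wd_word_fg)

lemma reduced_map_inj: "inj_on f (fst ` set w) \<Longrightarrow> reduced w \<Longrightarrow> reduced (map (apfst f) w)"
proof (induction w)
  case (Cons a w)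
  then have "inj_on f (fst ` set w)" "reduced w" by (auto simp: inj_on_def reduced_Cons)
  then have "reduced (map (apfst f) w)" by (rule Cons.IH)
  moreover have "f (fst a) = f (fst (hd w)) \<Longrightarrow> fst a = fst (hd w)" if "w \<noteq> []"
    using Cons.prems(1) that by (auto simp: inj_on_def)
  ultimately show ?case using Cons.prems(2) by (auto simp: reduced_Cons hd_map)
qed (simp add: reduced_Nil)

lemma fmap_inj:
  assumes "inj_on f (fst ` (set (wd u) \<union> set (wd v)))" "fmap f u = fmap f v"
  shows "u = v"
proof -
  have w: "wd (fmap f u) = map (apfst f) (wd u)" if "inj_on f (fst ` set (wd u))" for u :: "'a fg"
    using reduced_map_inj[OF that reduced_wd] by (simp add: fmap_def wd_word_fg nrm_reduced)
  have "map (apfst f) (wd u) = map (apfst f) (wd v)"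
    using assms w[of u] w[of v] by (metis Un_upper1 Un_upper2 image_mono inj_on_subset)
  moreover have "inj_on (apfst f) (set (wd u) \<union> set (wd v))"
  proof (rule inj_onI)
    fix x y assume xy: "x \<in> set (wd u) \<union> set (wd v)" "y \<in> set (wd u) \<union> set (wd v)" "apfst f x = apfst f y"
    then have "f (fst x) = f (fst y)" "snd x = snd y" by (simp_all add: prod_eq_iff)
    then show "x = y" using inj_onD[OF assms(1), of "fst x" "fst y"] xy by (simp add: prod_eq_iff)
  qed
  ultimately have "wd u = wd v" by (simp add: inj_on_map_eq_map)
  then show ?thesis by (simp add: wd_inject)
qed

text \<open>An element of an inverse limit: over each sequence stands a copy of the free group on
  \<open>nat \<Rightarrow> bool\<close>, and reindexing a sequence by \<phi> reindexes the
  letters.\<close>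

definition thread :: "((nat \<Rightarrow> 'l) \<Rightarrow> (nat \<Rightarrow> bool) fg) \<Rightarrow> bool" where
  "thread h \<longleftrightarrow> (\<forall>s \<phi>. h (s \<circ> \<phi>) = fmap (\<lambda>b. b \<circ> \<phi>) (h s))"

lemma threadD: "thread h \<Longrightarrow> h (s \<circ> \<phi>) = fmap (\<lambda>b. b \<circ> \<phi>) (h s)"
  by (simp add: thread_def)

definition thr :: "('l \<Rightarrow> bool) fg \<Rightarrow> (nat \<Rightarrow> 'l) \<Rightarrow> (nat \<Rightarrow> bool) fg" where
  "thr W s = fmap (\<lambda>f. f \<circ> s) W"

lemma thread_thr: "thread (thr W)"
  by (simp add: thread_def thr_def fmap_fmap o_assoc)

text \<open>Finitely many functions are separated by a countable (even finite) set of points.\<close>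

lemma thr_inj:
  assumes "thr W = thr W'"
  shows "W = W'"
proof -
  define F where "F = fst ` (set (wd W) \<union> set (wd W'))"
  have F: "finite F" by (simp add: F_def)
  define D where "D = (\<lambda>(f, g). SOME x. f x \<noteq> g x) ` (F \<times> F)"
  have D: "countable D" unfolding D_def by (intro countable_finite finite_imageI finite_cartesian_product F)
  \<comment> \<open>The additional point ensures that the set is nonempty, so that a sequence can
    enumerate it.\<close>
  define s where "s = from_nat_into (insert undefined D)"
  have s: "range s = insert undefined D" unfolding s_def using D by (intro range_from_nat_into) auto
  have "inj_on (\<lambda>f. f \<circ> s) F"
  proof (rule inj_onI, rule ccontr)
    fix f g assume fg: "f \<in> F" "g \<in> F" "f \<circ> s = g \<circ> s" "f \<noteq> g"
    define x where "x = (SOME x. f x \<noteq> g x)"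
    have "\<exists>x. f x \<noteq> g x" using fg(4) by blast
    then have x: "f x \<noteq> g x" unfolding x_def by (rule someI_ex)
    have "x \<in> D" unfolding D_def x_def using fg by force
    then obtain n where "x = s n" using s by blast
    then show False using x fun_cong[OF fg(3), of n] by simp
  qed
  then show ?thesis
    using fmap_inj[of "\<lambda>f. f \<circ> s" W W'] fun_cong[OF assms, of s] by (simp add: F_def thr_def)
qed

text \<open>Since countably many sequences are subsequences of a single one, the lengths of the words
  of a thread are bounded, and no cancellation happens below a sequence \<open>s\<^sub>0\<close> of maximal length.\<close>

lemma thread_max:
  assumes h: "thread h"
  obtains s0 where "\<And>s. length (wd (h s)) \<le> length (wd (h s0))"
proof -
  define N where "N = (\<lambda>s. length (wd (h s)))"
  have sub: "N (s \<circ> \<phi>) \<le> N s" for s \<phi>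
    unfolding N_def threadD[OF h] by (rule length_fmap)
  have "\<exists>B. \<forall>s. N s \<le> B"
  proof (rule ccontr)
    assume "\<nexists>B. \<forall>s. N s \<le> B"
    then have "\<forall>n. \<exists>s. n < N s" by (meson not_le)
    from choice[OF this] obtain S where S: "\<And>n. n < N (S n)" by blast
    \<comment> \<open>Through a pairing function t contains every S n as a subsequence, so the word
      over t is at least as long as all of theirs.\<close>
    define t where "t = (\<lambda>k. S (fst (prod_decode k)) (snd (prod_decode k)))"
    have "S n = t \<circ> (\<lambda>i. prod_encode (n, i))" for n by (rule ext) (simp add: t_def)
    then have "N (S (N t)) \<le> N t" by (metis sub)
    then show False using S[of "N t"] by simp
  qed
  then obtain B where B: "\<And>s. N s \<le> B" by blast
  have "\<exists>s0. \<forall>s. N s \<le> N s0"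
    using ex_has_greatest_nat[of "\<lambda>_. True" undefined N "Suc B"] B by (auto simp: less_Suc_eq_le)
  then show ?thesis using that unfolding N_def by blast
qed

text \<open>Any sequence containing s0 as a subsequence has a word of the same length, and
  restricting that word along the reindexing produces no cancellation. Its letters can therefore be
  followed individually; the i-th letter becomes a function on \<open>'l\<close> whose value at x is
  read off a sequence containing x and s0.\<close>

lemma thread_eq_thr:
  assumes h: "thread h"
  obtains W where "h = thr W"
proof -
  obtain s0 where max: "\<And>s. length (wd (h s)) \<le> length (wd (h s0))" by (rule thread_max[OF h]) blast
  have above: "wd (h s0) = map (apfst (\<lambda>b. b \<circ> \<phi>)) (wd (h t))" if "s0 = t \<circ> \<phi>" for t \<phi>
  proof -
    have e: "h s0 = fmap (\<lambda>b. b \<circ> \<phi>) (h t)" unfolding that by (rule threadD[OF h])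
    have "length (wd (fmap (\<lambda>b. b \<circ> \<phi>) (h t))) = length (wd (h t))"
      using max[of t] length_fmap[of "\<lambda>b. b \<circ> \<phi>" "h t"] unfolding e by simp
    then show ?thesis unfolding e by (rule wd_fmap_if_length)
  qed
  \<comment> \<open>The sequence x, s0 0, s0 1, ...; the letters of its word, evaluated at position
    0, define the functions f i.\<close>
  define t where "t = (\<lambda>x. case_nat x s0)"
  define N where "N = length (wd (h s0))"
  define f where "f = (\<lambda>i x. fst (wd (h (t x)) ! i) 0)"
  define w where "w = map (\<lambda>i. (f i, snd (wd (h s0) ! i))) [0..<N]"
  have "h s = word_fg (map (apfst (\<lambda>f. f \<circ> s)) w)" for s
  proof -
    \<comment> \<open>u interleaves s and s0, so its word has the maximal length and restricts to
      the words over s, over s0 and over every t (s n).\<close>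
    define u where "u = (\<lambda>n. if even n then s (n div 2) else s0 (n div 2))"
    have su: "s = u \<circ> (\<lambda>n. 2 * n)" and s0u: "s0 = u \<circ> (\<lambda>n. Suc (2 * n))" by (auto simp: u_def)
    have wu: "wd (h s0) = map (apfst (\<lambda>b. b \<circ> (\<lambda>n. Suc (2 * n)))) (wd (h u))" by (rule above[OF s0u])
    have len: "length (wd (h u)) = N" using arg_cong[OF wu, of length] by (simp add: N_def)
    have snd: "snd (wd (h u) ! i) = snd (wd (h s0) ! i)" if "i < N" for i
      unfolding wu using that len by simp
    have fst: "fst (wd (h u) ! i) (2 * n) = f i (s n)" if "i < N" for i n
    proof -
      \<comment> \<open>This selects from u first the term s n, at the even position 2 n, and then
        all of s0, at the odd positions.\<close>
      define \<psi> where "\<psi> = case_nat (2 * n) (\<lambda>k. Suc (2 * k))"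
      have tu: "t (s n) = u \<circ> \<psi>" by (auto simp: t_def \<psi>_def u_def fun_eq_iff split: nat.splits)
      have s0t: "s0 = t (s n) \<circ> Suc" by (auto simp: t_def)
      have "length (wd (h (t (s n)))) = N" using arg_cong[OF above[OF s0t], of length] by (simp add: N_def)
      then have "wd (h (t (s n))) = map (apfst (\<lambda>b. b \<circ> \<psi>)) (wd (h u))"
        unfolding tu threadD[OF h] using len by (intro wd_fmap_if_length) simp
      then have "fst (wd (h (t (s n))) ! i) = fst (wd (h u) ! i) \<circ> \<psi>" using that len by simp
      then show ?thesis by (simp add: f_def \<psi>_def)
    qed
    have "map (apfst (\<lambda>b. b \<circ> (\<lambda>n. 2 * n))) (wd (h u)) = map (apfst (\<lambda>f. f \<circ> s)) w"
    proof (rule nth_equalityI)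
      fix i assume "i < length (map (apfst (\<lambda>b. b \<circ> (\<lambda>n. 2 * n))) (wd (h u)))"
      then have i: "i < N" using len by simp
      have "fst (wd (h u) ! i) \<circ> (\<lambda>n. 2 * n) = f i \<circ> s" using fst[OF i] by auto
      then show "map (apfst (\<lambda>b. b \<circ> (\<lambda>n. 2 * n))) (wd (h u)) ! i = map (apfst (\<lambda>f. f \<circ> s)) w ! i"
        using i len snd[OF i] by (simp add: w_def prod_eq_iff)
    qed (simp add: w_def len)
    moreover have "h s = fmap (\<lambda>b. b \<circ> (\<lambda>n. 2 * n)) (h u)" unfolding su by (rule threadD[OF h])
    ultimately show ?thesis unfolding fmap_def by simp
  qed
  then have "h = thr (word_fg w)" by (auto simp: thr_def fmap_word_fg)
  then show ?thesis by (rule that)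
qed

section \<open>A set of exponents with prescribed symmetries\<close>

text \<open>The points \<open>Pt s w\<close> form a copy of the free group on \<open>nat \<Rightarrow> bool\<close> over each sequence \<open>s\<close>. The labels \<open>Gen s b\<close>
  name the graph of left multiplication by \<open>b\<close> over \<open>s\<close>, so that symmetries are right translations there, and \<open>Map \<phi>\<close>
  makes the translations over \<open>s\<close> and \<open>s \<circ> \<phi>\<close> compatible.\<close>

datatype 'l vtx = Gen "nat \<Rightarrow> 'l" "nat \<Rightarrow> bool" | Map "nat \<Rightarrow> nat" | Pt "nat \<Rightarrow> 'l" "(nat \<Rightarrow> bool) fg"

text \<open>An arbitrary well-order, chosen once. It serves both as the order of the variables
  underlying the leading exponents and as the order that makes the labels rigid.\<close>

instantiation vtx :: (type) wellorder
begin

definition "vtx_wo = (SOME R :: 'a vtx rel. well_order_on UNIV R)"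

definition "x \<le> y \<longleftrightarrow> (x, y) \<in> vtx_wo" for x y :: "'a vtx"

definition "x < y \<longleftrightarrow> (x, y) \<in> vtx_wo - Id" for x y :: "'a vtx"

lemma vtx_wo: "well_order_on UNIV (vtx_wo :: 'a vtx rel)"
  unfolding vtx_wo_def using well_order_on by (rule someI_ex)

instance
proof
  note [simp] = less_eq_vtx_def less_vtx_def
  have lin: "refl (vtx_wo :: 'a vtx rel)" "trans (vtx_wo :: 'a vtx rel)" "antisym (vtx_wo :: 'a vtx rel)"
    "total (vtx_wo :: 'a vtx rel)" and wf: "wf (vtx_wo - Id :: 'a vtx rel)"
    using vtx_wo by (simp_all add: well_order_on_def linear_order_on_def partial_order_on_def preorder_on_def)
  fix x y z :: "'a vtx" and P
  show "(x < y) = (x \<le> y \<and> \<not> y \<le> x)" using lin by (auto dest: antisymD reflD)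
  show "x \<le> x" using lin by (auto dest: reflD)
  show "x \<le> y \<Longrightarrow> y \<le> z \<Longrightarrow> x \<le> z" using lin by (auto dest: transD)
  show "x \<le> y \<Longrightarrow> y \<le> x \<Longrightarrow> x = y" using lin by (auto dest: antisymD)
  show "x \<le> y \<or> y \<le> x" using lin reflD[OF lin(1), of x] by (cases "x = y") (auto simp: total_on_def)
  show "P x" if "\<And>x. (\<And>y. y < x \<Longrightarrow> P y) \<Longrightarrow> P x"
    using wf by (rule wf_induct_rule) (use that in auto)
qed

end

fun is_label :: "'l vtx \<Rightarrow> bool" where
  "is_label (Pt s w) = False"
| "is_label _ = True"

lemma is_label_iff: "is_label v \<longleftrightarrow> (\<forall>s w. v \<noteq> Pt s w)"
  by (cases v) auto

fun edge :: "'l vtx \<Rightarrow> 'l vtx \<Rightarrow> 'l vtx \<Rightarrow> bool" where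
  "edge (Gen s b) (Pt s' w) z \<longleftrightarrow> s' = s \<and> z = Pt s (fgen (b, True) + w)"
| "edge (Map \<phi>) (Pt s w) z \<longleftrightarrow> z = Pt (s \<circ> \<phi>) (fmap (\<lambda>b. b \<circ> \<phi>) w)"
| "edge _ _ _ \<longleftrightarrow> False"

lemma edge_points: "edge c x y \<Longrightarrow> is_label c \<and> \<not> is_label x \<and> \<not> is_label y"
  by (induction c x y rule: edge.induct) auto

definition pair_expo :: "rat \<Rightarrow> 'v \<Rightarrow> 'v \<Rightarrow> 'v expo" where
  "pair_expo r x y = ev x + rsm r (ev y)"

definition tri_expo :: "rat \<Rightarrow> 'v \<Rightarrow> 'v \<Rightarrow> 'v \<Rightarrow> 'v expo" where
  "tri_expo r x y z = ev x + rsm r (ev y) + rsm (r ^ 2) (ev z)"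

text \<open>The coefficients \<open>1\<close>, \<open>r\<close>, \<open>r\<^sup>2\<close> record the position of a vertex in a pair or triple. The pairs encode a well-order
  of the labels, which makes them rigid.\<close>

definition Gam :: "rat \<Rightarrow> 'l vtx expo set" where
  "Gam r = range ev \<union> {pair_expo r c d | c d. is_label c \<and> is_label d \<and> c < d}
     \<union> {tri_expo r x y c | x y c. edge c x y \<and> x \<noteq> y}"

lemma Gam_cases:
  assumes "\<gamma> \<in> Gam r"
  obtains v where "\<gamma> = ev v"
  | c d where "is_label c" "is_label d" "c < d" "\<gamma> = pair_expo r c d"
  | x y c where "edge c x y" "x \<noteq> y" "x \<noteq> c" "y \<noteq> c" "\<gamma> = tri_expo r x y c"
proof -
  consider v where "\<gamma> = ev v" | c d where "is_label c" "is_label d" "c < d" "\<gamma> = pair_expo r c d"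
    | x y c where "edge c x y" "x \<noteq> y" "\<gamma> = tri_expo r x y c"
    using assms unfolding Gam_def by auto
  then show thesis
  proof cases
    case (3 x y c)
    have "x \<noteq> c" "y \<noteq> c" using edge_points[OF 3(1)] by auto
    with 3 show thesis using that(3) by blast
  qed (use that in blast)+
qed

lemma lookup_ev: "lookup (ev v) u = (if u = v then 1 else 0)"
  by (simp add: lookup_single when_def)

context
  fixes r :: rat
  assumes r: "1 < r"
begin

lemma r_ne: "r \<noteq> 0" "r \<noteq> 1" "r ^ 2 \<noteq> 0" "r ^ 2 \<noteq> 1" "r ^ 2 \<noteq> r" "1 < r ^ 2"
proof -
  have "r < r * r" using mult_strict_right_mono[OF r, of r] r by simp
  then have "1 < r * r" "r * r \<noteq> r" using less_trans[OF r] by auto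
  then show "r ^ 2 \<noteq> r" "1 < r ^ 2" "r ^ 2 \<noteq> 0" "r ^ 2 \<noteq> 1" using r by (auto simp: power2_eq_square)
qed (use r in auto)

text \<open>Recovers the vertex in a given position: 1, r and r^2 are distinct and nonzero, so the
  level sets at these values are singletons or empty for the exponents in
  \<open>Gam r\<close>.\<close>

definition lev :: "rat \<Rightarrow> 'v expo \<Rightarrow> 'v set" where
  "lev k \<gamma> = {u. lookup \<gamma> u = k}"

lemma lev_ev: "lev 1 (ev v) = {v}" "lev r (ev v) = {}" "lev (r ^ 2) (ev v) = {}"
  by (auto simp: lev_def lookup_ev r_ne r_ne(1-5)[symmetric] split: if_splits)

lemma lev_pair:
  assumes "x \<noteq> y"
  shows "lev 1 (pair_expo r x y) = {x}" "lev r (pair_expo r x y) = {y}" "lev (r ^ 2) (pair_expo r x y) = {}"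
  using assms by (auto simp: lev_def pair_expo_def lookup_add lookup_ev r_ne r_ne(1-5)[symmetric] split: if_splits)

lemma lev_tri:
  assumes "x \<noteq> y" "x \<noteq> z" "y \<noteq> z"
  shows "lev 1 (tri_expo r x y z) = {x}" "lev r (tri_expo r x y z) = {y}" "lev (r ^ 2) (tri_expo r x y z) = {z}"
  using assms by (auto simp: lev_def tri_expo_def lookup_add lookup_ev r_ne r_ne(1-5)[symmetric] split: if_splits)

lemma pair_in_Gam:
  assumes "pair_expo r c d \<in> Gam r" "c \<noteq> d"
  shows "is_label c \<and> is_label d \<and> c < d"
  using assms(1)
proof (cases rule: Gam_cases)
  case (1 v)
  show ?thesis using arg_cong[OF 1, of "lev r"] by (simp add: lev_pair[OF assms(2)] lev_ev)
next
  case (2 c' d')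
  then have "c' \<noteq> d'" by auto
  then have "lev 1 \<gamma> = {c'}" "lev r \<gamma> = {d'}" if "\<gamma> = pair_expo r c' d'" for \<gamma> using that by (simp_all add: lev_pair)
  from this[OF 2(4)] have "{c} = {c'}" "{d} = {d'}" unfolding lev_pair[OF assms(2)] .
  then show ?thesis using 2 by simp
next
  case (3 x y z)
  show ?thesis using arg_cong[OF 3(5), of "lev (r ^ 2)"] unfolding lev_tri(3)[OF 3(2-4)] lev_pair(3)[OF assms(2)] by simp
qed

lemma tri_in_Gam:
  assumes "tri_expo r x y z \<in> Gam r" "x \<noteq> y" "x \<noteq> z" "y \<noteq> z"
  shows "edge z x y"
  using assms(1)
proof (cases rule: Gam_cases)
  case (1 v)
  show ?thesis using arg_cong[OF 1, of "lev r"] by (simp add: lev_tri[OF assms(2-4)] lev_ev)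
next
  case (2 c' d')
  then have "c' \<noteq> d'" by auto
  then show ?thesis using arg_cong[OF 2(4), of "lev (r ^ 2)"] by (simp add: lev_tri[OF assms(2-4)] lev_pair)
next
  case (3 x' y' z')
  then have "lev 1 \<gamma> = {x'}" "lev r \<gamma> = {y'}" "lev (r ^ 2) \<gamma> = {z'}" if "\<gamma> = tri_expo r x' y' z'" for \<gamma>
    using that by (simp_all add: lev_tri)
  from this[OF 3(5)] have "{x} = {x'}" "{y} = {y'}" "{z} = {z'}" unfolding lev_tri[OF assms(2-4)] .
  then show ?thesis using 3 by simp
qed

lemma Gam_lookup: "\<gamma> \<in> Gam r \<Longrightarrow> lookup \<gamma> u \<in> {0, 1, r, r ^ 2}"
  by (erule Gam_cases) (auto simp: pair_expo_def tri_expo_def lookup_add lookup_ev)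

lemma Gam_one: "\<gamma> \<in> Gam r \<Longrightarrow> \<exists>u. lookup \<gamma> u = 1"
  by (erule Gam_cases) (use r_ne in \<open>auto simp: pair_expo_def tri_expo_def lookup_add lookup_ev intro: exI\<close>)

text \<open>Each exponent has a coordinate equal to 1, and its nonzero coordinates are at least 1.
  The ratio of two proportional exponents and its inverse both occur as coordinates, so both are at
  least 1, and the ratio is 1.\<close>

lemma Gam_indep:
  assumes g: "\<gamma> \<in> Gam r" "\<delta> \<in> Gam r" and eq: "rsm a \<gamma> = rsm b \<delta>" and a: "a \<noteq> 0"
  shows "\<gamma> = \<delta>"
proof -
  have eq': "a * lookup \<gamma> u = b * lookup \<delta> u" for u using arg_cong[OF eq, of "\<lambda>e. lookup e u"] by simp
  obtain u where u: "lookup \<gamma> u = 1" using Gam_one[OF g(1)] by blast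
  obtain w where w: "lookup \<delta> w = 1" using Gam_one[OF g(2)] by blast
  have 1: "a = b * lookup \<delta> u" "a * lookup \<gamma> w = b" using eq'[of u] eq'[of w] u w by simp_all
  then have n0: "lookup \<delta> u \<noteq> 0" and b: "b \<noteq> 0" using a by auto
  have n1: "lookup \<gamma> w \<noteq> 0" using 1(2) b by auto
  have ge: "1 \<le> lookup \<delta> u" "1 \<le> lookup \<gamma> w" using Gam_lookup[OF g(2), of u] Gam_lookup[OF g(1), of w] n0 n1 r r_ne by auto
  have "a * (lookup \<gamma> w * lookup \<delta> u) = b * lookup \<delta> u" by (simp only: 1(2) flip: mult.assoc)
  then have "a * (lookup \<gamma> w * lookup \<delta> u) = a" using 1(1) by simp
  then have "lookup \<gamma> w * lookup \<delta> u = 1" using a by simp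
  moreover have "lookup \<gamma> w * 1 \<le> lookup \<gamma> w * lookup \<delta> u" using ge by (intro mult_left_mono) auto
  ultimately have "lookup \<gamma> w = 1" using ge by simp
  then have "a = b" using 1 by simp
  then show ?thesis using eq' a by (intro poly_mapping_eqI) simp
qed

end

lemma Gam_natexpo:
  assumes q: "1 < q" and g: "\<gamma> \<in> Gam (of_nat q)"
  shows "natexpo \<gamma>"
proof -
  have r: "1 < (of_nat q :: rat)" using q by simp
  obtain u where "lookup \<gamma> u = 1" using Gam_one[OF r g] by blast
  then have "\<gamma> \<noteq> 0" by auto
  moreover have "lookup \<gamma> v \<in> \<nat>" for v using Gam_lookup[OF r g, of v] by (auto simp flip: of_nat_power)
  ultimately show ?thesis by (simp add: natexpo_def)
qed

section \<open>The symmetries\<close>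

text \<open>The sign turns right translations, which compose in reverse order, into a homomorphism.\<close>

definition pw :: "('l \<Rightarrow> bool) fg \<Rightarrow> 'l vtx \<Rightarrow> 'l vtx" where
  "pw W v = (case v of Pt s w \<Rightarrow> Pt s (w - thr W s) | _ \<Rightarrow> v)"

lemma pw_simps [simp]: "pw W (Pt s w) = Pt s (w - thr W s)" "is_label v \<Longrightarrow> pw W v = v"
  "is_label (pw W v) = is_label v"
  by (auto simp: pw_def split: vtx.splits)

lemma thr_add: "thr (U + W) s = thr U s + thr W s" and thr_0: "thr 0 s = 0"
  by (simp_all add: thr_def fmap_add)

lemma pw_add: "pw (U + W) = pw U \<circ> pw W"
  by (rule ext) (auto simp: pw_def thr_add diff_conv_add_uminus minus_add add.assoc simp del: add_uminus_conv_diff split: vtx.splits)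

lemma pw_0: "pw 0 = id"
  by (rule ext) (auto simp: pw_def thr_0 split: vtx.splits)

lemma bij_pw: "bij (pw W)"
  by (rule o_bij[of "pw (- W)"]) (simp_all add: pw_0 flip: pw_add)

lemma pw_inj: "pw U = pw W \<Longrightarrow> U = W"
proof (rule thr_inj, rule ext)
  fix s assume "pw U = pw W"
  then have "pw U (Pt s 0) = pw W (Pt s 0)" by simp
  then show "thr U s = thr W s" by simp
qed

text \<open>Right translations commute with the left multiplications encoded by \<open>Gen\<close>;
  the \<open>Map\<close> edges are preserved because the translations come from a thread.\<close>

lemma edge_pw: "edge c x y \<Longrightarrow> edge c (pw W x) (pw W y)"
proof (induction c x y rule: edge.induct)
  case (2 \<phi> s w z)
  have "fmap (\<lambda>b. b \<circ> \<phi>) (w - thr W s) = fmap (\<lambda>b. b \<circ> \<phi>) w - thr W (s \<circ> \<phi>)"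
    unfolding threadD[OF thread_thr] by (simp only: diff_conv_add_uminus fmap_add fmap_uminus)
  then show ?case using 2 by simp
qed (auto simp: add_diff_eq)

lemma eact_pair: "bij \<pi> \<Longrightarrow> eact \<pi> (pair_expo r x y) = pair_expo r (\<pi> x) (\<pi> y)"
  and eact_tri: "bij \<pi> \<Longrightarrow> eact \<pi> (tri_expo r x y z) = tri_expo r (\<pi> x) (\<pi> y) (\<pi> z)"
  by (simp_all add: pair_expo_def tri_expo_def eact_add eact_rsm eact_ev)

lemma eact_pw: "eact (pw W) ` Gam r = Gam r"
proof -
  have sub: "eact (pw W) \<gamma> \<in> Gam r" if "\<gamma> \<in> Gam r" for \<gamma> and W :: "('l \<Rightarrow> bool) fg"
    using that
  proof (cases rule: Gam_cases)
    case (1 v)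
    then show ?thesis by (auto simp: eact_ev[OF bij_pw] Gam_def)
  next
    case (2 c d)
    then show ?thesis using that by (simp add: eact_pair[OF bij_pw])
  next
    case (3 x y c)
    then have "edge c (pw W x) (pw W y)" "pw W x \<noteq> pw W y" "pw W c = c"
      using edge_pw[OF 3(1)] bij_pw[of W] edge_points[OF 3(1)] by (simp_all add: bij_def inj_eq)
    then show ?thesis using 3 by (auto simp: eact_tri[OF bij_pw] Gam_def)
  qed
  have inv: "invf (pw W) = pw (- W)"
    by (rule inv_unique_comp) (simp_all add: pw_0 flip: pw_add)
  show ?thesis
  proof
    show "Gam r \<subseteq> eact (pw W) ` Gam r"
    proof
      fix \<gamma> :: "'a vtx expo" assume "\<gamma> \<in> Gam r"
      then have "eact (invf (pw W)) \<gamma> \<in> Gam r" unfolding inv by (rule sub)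
      then show "\<gamma> \<in> eact (pw W) ` Gam r" using eact_inv(2)[OF bij_pw, of W \<gamma>] by (metis imageI)
    qed
  qed (use sub in blast)
qed

lemma fg_induct:
  assumes "P 0" "\<And>x w. P w \<Longrightarrow> P (fgen (x, True) + w)" "\<And>x w. P w \<Longrightarrow> P (- fgen (x, True) + w)"
  shows "P (w :: 'g fg)"
proof -
  have "P (word_fg u)" for u :: "('g \<times> bool) list"
  proof (induction u)
    case (Cons a u)
    obtain x b where "a = (x, b)" by force
    then show ?case using assms(2,3) Cons by (cases b) (simp_all add: word_fg_Cons fgen_False)
  qed (simp add: word_fg_Nil assms(1))
  then show ?thesis using word_fg_wd by metis
qed

context
  fixes r :: rat and \<pi> :: "'l vtx \<Rightarrow> 'l vtx"
  assumes r: "1 < r" and bij: "bij \<pi>" and G: "\<And>\<gamma>. \<gamma> \<in> Gam r \<Longrightarrow> eact \<pi> \<gamma> \<in> Gam r"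
begin

lemma sym_label_less:
  assumes "is_label c" "is_label d" "c < d"
  shows "is_label (\<pi> c) \<and> is_label (\<pi> d) \<and> \<pi> c < \<pi> d"
proof (rule pair_in_Gam[OF r])
  have "pair_expo r c d \<in> Gam r" using assms by (auto simp: Gam_def)
  from G[OF this] show "pair_expo r (\<pi> c) (\<pi> d) \<in> Gam r" by (simp add: eact_pair[OF bij])
  show "\<pi> c \<noteq> \<pi> d" using assms bij by (auto simp: bij_def inj_eq)
qed

lemma sym_label: "is_label c \<Longrightarrow> is_label (\<pi> c)"
proof -
  assume c: "is_label c"
  have "Map id \<noteq> (Map Suc :: 'l vtx)" by (auto simp: fun_eq_iff)
  then obtain d :: "'l vtx" where d: "is_label d" "d \<noteq> c" by (metis is_label.simps(3))
  show ?thesis using sym_label_less[OF c d(1)] sym_label_less[OF d(1) c] d(2) by (metis linorder_neqE)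
qed

lemma sym_edge:
  assumes "edge c x y" "x \<noteq> y"
  shows "edge (\<pi> c) (\<pi> x) (\<pi> y)"
proof (rule tri_in_Gam[OF r])
  have "tri_expo r x y c \<in> Gam r" using assms by (auto simp: Gam_def)
  from G[OF this] show "tri_expo r (\<pi> x) (\<pi> y) (\<pi> c) \<in> Gam r" by (simp add: eact_tri[OF bij])
  have "x \<noteq> c" "y \<noteq> c" using edge_points[OF assms(1)] by auto
  then show "\<pi> x \<noteq> \<pi> y" "\<pi> x \<noteq> \<pi> c" "\<pi> y \<noteq> \<pi> c" using assms bij by (auto simp: bij_def inj_eq)
qed

end

text \<open>The labels are fixed, so over each s the symmetry commutes with left multiplication by
  all generators and is a right translation, determined by the image of the neutral element. The
  \<open>Map\<close> edges make these translations a thread, and \<open>thread_eq_thr\<close>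
  supplies the word.\<close>

theorem symmetry_eq_pw:
  fixes \<pi> :: "'l vtx \<Rightarrow> 'l vtx"
  assumes r: "1 < r" and bij: "bij \<pi>" and G: "eact \<pi> ` Gam r = Gam r"
  shows "\<exists>W. \<pi> = pw W"
proof -
  define \<rho> where "\<rho> = invf \<pi>"
  have bij': "bij \<rho>" unfolding \<rho>_def by (rule bij_imp_bij_inv[OF bij])
  have \<pi>\<rho> [simp]: "\<pi> (\<rho> v) = v" "\<rho> (\<pi> v) = v" for v
    using bij by (simp_all add: \<rho>_def bij_is_surj surj_f_inv_f bij_is_inj)
  have G1: "eact \<pi> \<gamma> \<in> Gam r" if "\<gamma> \<in> Gam r" for \<gamma> using G that by blast
  have G2: "eact \<rho> \<gamma> \<in> Gam r" if "\<gamma> \<in> Gam r" for \<gamma>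
  proof -
    have "\<gamma> \<in> eact \<pi> ` Gam r" unfolding G by (rule that)
    then obtain \<delta> where "\<delta> \<in> Gam r" "\<gamma> = eact \<pi> \<delta>" by blast
    then show ?thesis by (simp add: \<rho>_def eact_inv[OF bij])
  qed
  note lab = sym_label[OF r bij G1] sym_label[OF r bij' G2]
  note mono = sym_label_less[OF r bij' G2]
  \<comment> \<open>An order automorphism of a well-order is the identity: at the least moved label
    c, either \<pi> c or \<rho> c is a smaller label, hence fixed, which is impossible.\<close>
  have fix_lab: "is_label c \<Longrightarrow> \<pi> c = c" for c
  proof (induction c rule: less_induct)
    case (less c)
    show ?case
    proof (rule ccontr)
      assume ne: "\<pi> c \<noteq> c"
      consider "\<pi> c < c" | "c < \<pi> c" using ne by (metis linorder_neqE)
      then show False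
      proof cases
        case 1
        then have "\<pi> (\<pi> c) = \<pi> c" using less lab by blast
        then show False using ne by (metis \<pi>\<rho>(2))
      next
        case 2
        then have "\<rho> c < \<rho> (\<pi> c)" using mono less.prems lab by blast
        then have "\<rho> c < c" by simp
        then have "\<pi> (\<rho> c) = \<rho> c" using less lab by blast
        then show False using ne by (metis \<pi>\<rho>(1))
      qed
    qed
  qed
  have fix_lab': "\<rho> c = c" if "is_label c" for c using fix_lab[OF that] by (metis \<pi>\<rho>(2))
  have edge1: "edge c (\<pi> x) (\<pi> y)" if "edge c x y" "x \<noteq> y" for c x y
    using sym_edge[OF r bij G1 that] fix_lab edge_points[OF that(1)] by simp
  have edge2: "edge c (\<rho> x) (\<rho> y)" if "edge c x y" "x \<noteq> y" for c x y
    using sym_edge[OF r bij' G2 that] fix_lab' edge_points[OF that(1)] by simp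
  have fgen_ne: "fgen a + w \<noteq> w" for a and w :: "(nat \<Rightarrow> bool) fg"
  proof
    assume "fgen a + w = w"
    then have "fgen a + w = 0 + w" by simp
    then have "fgen a = 0" by (rule add_right_imp_eq)
    then have "wd (fgen a) = []" by simp
    then show False by (simp add: wd_fgen)
  qed
  have gen: "\<exists>w'. \<pi> (Pt s w) = Pt s w' \<and> \<pi> (Pt s (fgen (b, True) + w)) = Pt s (fgen (b, True) + w')" for s w b
  proof -
    have "edge (Gen s b) (\<pi> (Pt s w)) (\<pi> (Pt s (fgen (b, True) + w)))"
      by (rule edge1) (use fgen_ne in \<open>auto simp: eq_commute\<close>)
    then show ?thesis by (cases "\<pi> (Pt s w)") auto
  qed
  define f where "f = (\<lambda>s w. SOME w'. \<pi> (Pt s w) = Pt s w')"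
  have f: "\<pi> (Pt s w) = Pt s (f s w)" for s w
    unfolding f_def by (rule someI_ex) (use gen[of s w] in blast)
  have f_gen: "f s (fgen (b, True) + w) = fgen (b, True) + f s w" for s b w
    using gen[of s w b] by (auto simp: f)
  have f_eq: "f s w = w + f s 0" for s w
  proof (induction w rule: fg_induct)
    case (3 x w)
    have e: "f s w = fgen (x, True) + f s (- fgen (x, True) + w)"
      using f_gen[of s x "- fgen (x, True) + w"] by simp
    have "f s (- fgen (x, True) + w) = - fgen (x, True) + f s w" unfolding e by simp
    then show ?case unfolding 3 by (simp only: add.assoc)
  qed (simp_all add: f_gen add.assoc)
  have f_map: "f (s \<circ> \<phi>) 0 = fmap (\<lambda>b. b \<circ> \<phi>) (f s 0)" for s \<phi>
  proof (cases "s \<circ> \<phi> = s")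
    case False
    have "edge (Map \<phi>) (\<pi> (Pt s 0)) (\<pi> (Pt (s \<circ> \<phi>) 0))" by (rule edge1) (use False in auto)
    then show ?thesis by (simp add: f)
  next
    \<comment> \<open>Here the edge at Pt s 0 is a loop, and \<open>Gam\<close> records no loops. If
      the claim failed, the edge at the image of Pt s 0 would not be a loop; pulling it back by
      \<rho> shows that its end is the image of Pt s 0 too, a contradiction.\<close>
    case True
    show ?thesis
    proof (rule ccontr)
      let ?y = "Pt s (fmap (\<lambda>b. b \<circ> \<phi>) (f s 0))"
      assume "f (s \<circ> \<phi>) 0 \<noteq> fmap (\<lambda>b. b \<circ> \<phi>) (f s 0)"
      then have ne: "Pt s (f s 0) \<noteq> ?y" using True by simp
      have "edge (Map \<phi>) (\<rho> (Pt s (f s 0))) (\<rho> ?y)"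
        by (rule edge2[OF _ ne]) (use True in simp)
      moreover have "\<rho> (Pt s (f s 0)) = Pt s 0" by (simp flip: f)
      ultimately have "\<rho> ?y = Pt s 0" using True by simp
      then have "?y = \<pi> (Pt s 0)" by (metis \<pi>\<rho>(1))
      then show False using ne by (simp add: f)
    qed
  qed
  \<comment> \<open>The sign matches \<open>pw\<close>, which translates by the negative of the
    thread.\<close>
  have "thread (\<lambda>s. - f s 0)"
    unfolding thread_def using f_map by (simp add: fmap_uminus)
  then obtain W where W: "(\<lambda>s. - f s 0) = thr W" by (rule thread_eq_thr)
  have "\<pi> v = pw W v" for v
  proof (cases "is_label v")
    case False
    then obtain s w where v: "v = Pt s w" by (auto simp: is_label_iff)
    have "w - thr W s = w + f s 0" using fun_cong[OF W, of s] by (metis diff_minus_eq_add)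
    then show ?thesis using f_eq[of s w] by (simp add: v f)
  qed (simp add: fix_lab)
  then show ?thesis by blast
qed

section \<open>Cardinalities\<close>

lemma card_image_bound: "|A| \<le>o r \<Longrightarrow> |f ` A| \<le>o r"
  using card_of_image ordLeq_transitive by blast

lemma card_subset_bound: "A \<subseteq> B \<Longrightarrow> |B| \<le>o r \<Longrightarrow> |A| \<le>o r"
  using card_of_mono1 ordLeq_transitive by blast

context
  fixes r :: "'r rel"
  assumes r: "Cinfinite r"
begin

lemma card_Times_bound: "|A| \<le>o r \<Longrightarrow> |B| \<le>o r \<Longrightarrow> |A \<times> B| \<le>o r"
  using card_of_Times_ordLeq_infinite_Field r by (auto simp: cinfinite_def)

lemma card_countable_bound: "countable A \<Longrightarrow> |A| \<le>o r"
proof -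
  assume "countable A"
  then obtain f :: "'a \<Rightarrow> nat" where "inj_on f A" by (rule countableE)
  then have "|A| \<le>o |UNIV :: nat set|" by (rule card_of_ordLeqI) simp
  also have "|UNIV :: nat set| =o natLeq" by (rule card_of_nat)
  also have "natLeq \<le>o r" using r by (intro natLeq_ordLeq_cinfinite) auto
  finally (ordLeq_ordIso_trans ordLeq_transitive) show ?thesis .
qed

lemma card_UN_bound: "(\<And>n :: nat. |F n| \<le>o r) \<Longrightarrow> |\<Union>n. F n| \<le>o r"
  using r by (intro UNION_Cinfinite_bound card_countable_bound) auto

lemma card_Un_bound: "|A| \<le>o r \<Longrightarrow> |B| \<le>o r \<Longrightarrow> |A \<union> B| \<le>o r"
  using r by (rule Un_Cinfinite_bound[rotated 2])

lemma card_lists_bound: "|A| \<le>o r \<Longrightarrow> |lists A| \<le>o r"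
proof -
  assume A: "|A| \<le>o r"
  have n: "|{xs \<in> lists A. length xs = n}| \<le>o r" for n
  proof (induction n)
    case 0
    show ?case by (rule card_countable_bound) (rule countable_subset[of _ "{[]}"], auto)
  next
    case (Suc n)
    have "{xs \<in> lists A. length xs = Suc n} \<subseteq> (\<lambda>(a, xs). a # xs) ` (A \<times> {xs \<in> lists A. length xs = n})"
    proof
      fix xs assume "xs \<in> {xs \<in> lists A. length xs = Suc n}"
      then show "xs \<in> (\<lambda>(a, xs). a # xs) ` (A \<times> {xs \<in> lists A. length xs = n})"
        by (cases xs) (auto intro!: image_eqI[where x = "(hd xs, tl xs)"])
    qed
    then show ?case using card_image_bound[OF card_Times_bound[OF A Suc]] by (rule card_subset_bound)
  qed
  have "lists A = (\<Union>n. {xs \<in> lists A. length xs = n})" by auto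
  then show ?thesis using card_UN_bound[of "\<lambda>n. {xs \<in> lists A. length xs = n}"] n by simp
qed

text \<open>The generated subfield is exhausted by countably many rounds of closing under the
  operations, and no round exceeds an infinite bound.\<close>

lemma card_gf_bound:
  fixes S :: "'b :: Fields.field set"
  assumes S: "|S| \<le>o r"
  shows "|gf S| \<le>o r"
proof -
  define step :: "'b set \<Rightarrow> 'b set" where
    "step T = T \<union> {0, 1} \<union> ((\<lambda>(x, y). x + y) ` (T \<times> T) \<union> ((\<lambda>(x, y). x * y) ` (T \<times> T) \<union> (uminus ` T \<union> inverse ` T)))" for T
  define F where "F n = (step ^^ n) S" for n
  have mono: "F n \<subseteq> F (Suc n)" for n by (auto simp: F_def step_def)
  have le: "F m \<subseteq> F n" if "m \<le> n" for m n using lift_Suc_mono_le[of F] mono that by blast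
  have 01: "|{0, 1 :: 'b}| \<le>o r" by (rule card_countable_bound) simp
  have "|step T| \<le>o r" if "|T| \<le>o r" for T
    unfolding step_def by (intro card_Un_bound card_image_bound card_Times_bound that 01)
  then have "|F n| \<le>o r" for n by (induction n) (auto simp: F_def S)
  then have bound: "|\<Union>n. F n| \<le>o r" by (rule card_UN_bound)
  have two: "\<exists>n. x \<in> F n \<and> y \<in> F n" if xy: "x \<in> (\<Union>n. F n)" "y \<in> (\<Union>n. F n)" for x y
  proof -
    obtain m n where "x \<in> F m" "y \<in> F n" using xy by blast
    then show ?thesis using le[of m "max m n"] le[of n "max m n"] by (intro exI[of _ "max m n"]) auto
  qed
  have "is_subfield (\<Union>n. F n)"
  proof (rule is_subfieldI)
    show "0 \<in> (\<Union>n. F n)" "1 \<in> (\<Union>n. F n)" by (auto simp: F_def step_def intro!: exI[of _ 1])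
  next
    fix x y assume "x \<in> (\<Union>n. F n)" "y \<in> (\<Union>n. F n)"
    then obtain n where "x \<in> F n" "y \<in> F n" using two by blast
    then have "x + y \<in> F (Suc n)" "x * y \<in> F (Suc n)" by (auto simp: F_def step_def)
    then show "x + y \<in> (\<Union>n. F n)" "x * y \<in> (\<Union>n. F n)" by blast+
  next
    fix x assume "x \<in> (\<Union>n. F n)"
    then obtain n where "x \<in> F n" by blast
    then have "- x \<in> F (Suc n)" "inverse x \<in> F (Suc n)" by (auto simp: F_def step_def)
    then show "- x \<in> (\<Union>n. F n)" "inverse x \<in> (\<Union>n. F n)" by blast+
  qed
  moreover have "F 0 = S" by (simp add: F_def)
  then have "S \<subseteq> (\<Union>n. F n)" by blast
  ultimately have "gf S \<subseteq> (\<Union>n. F n)" by (rule gf_least)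
  then show ?thesis using bound by (rule card_subset_bound)
qed

lemma card_fg_bound:
  assumes "|UNIV :: 'g set| \<le>o r"
  shows "|UNIV :: 'g fg set| \<le>o r"
proof -
  have "|UNIV :: ('g \<times> bool) set| \<le>o r"
    unfolding UNIV_Times_UNIV[symmetric] by (rule card_Times_bound[OF assms card_countable_bound[OF countableI_type]])
  then have "|lists (UNIV :: ('g \<times> bool) set)| \<le>o r" by (rule card_lists_bound)
  then have "|word_fg ` lists (UNIV :: ('g \<times> bool) set)| \<le>o r" by (rule card_image_bound)
  moreover have "u \<in> word_fg ` lists (UNIV :: ('g \<times> bool) set)" for u
    by (rule image_eqI[of _ _ "wd u"]) (simp_all add: word_fg_wd)
  then have "word_fg ` lists (UNIV :: ('g \<times> bool) set) = UNIV" by blast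
  ultimately show ?thesis by simp
qed

lemma card_expo_bound:
  assumes "|UNIV :: 'v set| \<le>o r"
  shows "|UNIV :: 'v expo set| \<le>o r"
proof -
  define ex where "ex xs = (\<Sum>(v, a)\<leftarrow>xs. rsm a (ev v))" for xs :: "('v \<times> rat) list"
  have "|UNIV :: ('v \<times> rat) set| \<le>o r"
    unfolding UNIV_Times_UNIV[symmetric] by (rule card_Times_bound[OF assms card_countable_bound[OF countableI_type]])
  then have "|ex ` lists (UNIV :: ('v \<times> rat) set)| \<le>o r" by (intro card_image_bound card_lists_bound)
  moreover have "\<alpha> \<in> ex ` lists UNIV" for \<alpha>
  proof -
    obtain vs where vs: "set vs = keys \<alpha>" "distinct vs" using finite_distinct_list[OF finite_keys[of \<alpha>]] by blast
    have "\<alpha> = (\<Sum>v\<in>keys \<alpha>. rsm (lookup \<alpha> v) (ev v))" by (rule expo_sum_ev)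
    also have "\<dots> = ex (map (\<lambda>v. (v, lookup \<alpha> v)) vs)"
      unfolding vs(1)[symmetric] ex_def by (simp add: sum_list_distinct_conv_sum_set[OF vs(2)] o_def)
    finally show ?thesis by (rule image_eqI) simp
  qed
  then have "ex ` lists UNIV = UNIV" by blast
  ultimately show ?thesis by simp
qed

end

text \<open>The bound on sequences in \<open>'l\<close> also bounds
  \<open>nat \<Rightarrow> nat\<close> and \<open>nat \<Rightarrow> bool\<close>, because the
  infinite type \<open>'l\<close> contains a copy of \<open>nat\<close>.\<close>

lemma card_vtx_bound:
  assumes inf: "infinite (UNIV :: 'l set)" and om: "|UNIV :: (nat \<Rightarrow> 'l) set| \<le>o |UNIV :: 'l set|"
  shows "|UNIV :: 'l vtx set| \<le>o |UNIV :: 'l set|"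
proof -
  let ?r = "|UNIV :: 'l set|"
  have r: "Cinfinite ?r" using inf by (simp add: cinfinite_def Field_card_of card_of_card_order_on)
  obtain e :: "nat \<Rightarrow> 'l" where e: "inj e" using inf infinite_countable_subset by blast
  have nn: "|UNIV :: (nat \<Rightarrow> nat) set| \<le>o ?r"
  proof -
    have "inj (\<lambda>\<phi> :: nat \<Rightarrow> nat. e \<circ> \<phi>)" using e by (auto simp: inj_def fun_eq_iff)
    then have "|UNIV :: (nat \<Rightarrow> nat) set| \<le>o |UNIV :: (nat \<Rightarrow> 'l) set|" by (rule card_of_ordLeqI) simp
    then show ?thesis using om by (rule ordLeq_transitive)
  qed
  have nb: "|UNIV :: (nat \<Rightarrow> bool) set| \<le>o ?r"
  proof -
    have "inj (\<lambda>(b :: nat \<Rightarrow> bool) n. of_bool (b n) :: nat)" by (auto simp: inj_def fun_eq_iff)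
    then have "|UNIV :: (nat \<Rightarrow> bool) set| \<le>o |UNIV :: (nat \<Rightarrow> nat) set|" by (rule card_of_ordLeqI) simp
    then show ?thesis using nn by (rule ordLeq_transitive)
  qed
  have "v \<in> range (\<lambda>(s, b). Gen s b) \<union> (range Map \<union> range (\<lambda>(s, w). Pt s w))" for v :: "'l vtx"
    by (cases v) auto
  then have "(UNIV :: 'l vtx set) = range (\<lambda>(s, b). Gen s b) \<union> (range Map \<union> range (\<lambda>(s, w). Pt s w))" by blast
  moreover have "|range (\<lambda>(s, b). Gen s b) \<union> (range Map \<union> range (\<lambda>(s, w). Pt s w)) :: 'l vtx set| \<le>o ?r"
    unfolding UNIV_Times_UNIV[symmetric]
    by (intro card_Un_bound[OF r] card_image_bound card_Times_bound[OF r] om nn nb card_fg_bound[OF r])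
  ultimately show ?thesis by simp
qed

lemma card_fg_Pow:
  assumes inf: "infinite (UNIV :: 'l set)"
  shows "|UNIV :: ('l \<Rightarrow> bool) fg set| =o ctwo ^c |UNIV :: 'l set|"
proof -
  have c: "ctwo ^c |UNIV :: 'l set| = |UNIV :: ('l \<Rightarrow> bool) set|"
    by (simp add: cexp_def ctwo_def Field_card_of Func_def)
  have "infinite (UNIV :: ('l \<Rightarrow> bool) set)"
  proof
    assume "finite (UNIV :: ('l \<Rightarrow> bool) set)"
    then have "finite (range ((=) :: 'l \<Rightarrow> _))" by (rule finite_subset[OF subset_UNIV])
    then have "finite (UNIV :: 'l set)" by (rule finite_imageD) (auto simp: inj_def fun_eq_iff)
    then show False using inf by simp
  qed
  then have r: "Cinfinite |UNIV :: ('l \<Rightarrow> bool) set|"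
    by (simp add: cinfinite_def Field_card_of card_of_card_order_on)
  have "inj (\<lambda>f :: 'l \<Rightarrow> bool. fgen (f, True))" by (rule injI) (metis wd_fgen list.inject prod.inject)
  then have "|UNIV :: ('l \<Rightarrow> bool) set| \<le>o |UNIV :: ('l \<Rightarrow> bool) fg set|" by (rule card_of_ordLeqI) simp
  moreover have "|UNIV :: ('l \<Rightarrow> bool) fg set| \<le>o |UNIV :: ('l \<Rightarrow> bool) set|"
    by (rule card_fg_bound[OF r]) (simp add: ordLeq_refl card_of_Card_order)
  ultimately show ?thesis unfolding c by (simp add: ordIso_iff_ordLeq)
qed

section \<open>Transport to a ring on a given carrier\<close>

text \<open>A word in the images of the generators evaluates to the image of the element it
  represents. Uniqueness of reduced words in \<open>'g fg\<close> thus becomes uniqueness over the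
  basis.\<close>

lemma free_basis_fg:
  fixes \<Phi> :: "'g fg \<Rightarrow> 'x"
  assumes G: "group G" and bij: "bij_betw \<Phi> UNIV (carrier G)" and hom: "\<And>u v. \<Phi> (u + v) = \<Phi> u \<otimes>\<^bsub>G\<^esub> \<Phi> v"
  shows "free_basis G (range (\<lambda>x. \<Phi> (fgen (x, True))))"
proof -
  interpret group G by (rule G)
  define gx where "gx = (\<lambda>x. \<Phi> (fgen (x, True)))"
  have cl [simp]: "\<Phi> u \<in> carrier G" for u using bij by (auto simp: bij_betw_def)
  have inj: "\<Phi> u = \<Phi> v \<longleftrightarrow> u = v" for u v using bij by (auto simp: bij_betw_def inj_def)
  have "\<Phi> 0 \<otimes>\<^bsub>G\<^esub> \<Phi> 0 = \<Phi> 0" by (simp flip: hom)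
  then have one: "\<Phi> 0 = \<one>\<^bsub>G\<^esub>" using r_cancel_one[of "\<Phi> 0" "\<Phi> 0"] by simp
  have inv: "inv\<^bsub>G\<^esub> (\<Phi> u) = \<Phi> (- u)" for u
    by (rule inv_equality) (simp_all add: one flip: hom)
  have letter: "letter_value G (apfst gx a) = \<Phi> (fgen a)" for a
    by (cases a) (auto simp: gx_def inv fgen_False)
  have wval: "word_value G (map (apfst gx) w) = \<Phi> (word_fg w)" for w
    by (induction w) (simp_all add: word_fg_Nil word_fg_Cons one hom letter del: letter_value.simps)
  have injg: "inj gx"
  proof (rule injI)
    fix x y assume "gx x = gx y"
    then have "wd (fgen (x, True)) = wd (fgen (y, True))" by (simp add: gx_def inj)
    then show "x = y" by (simp add: wd_fgen)
  qed
  have words: "\<exists>u. v = map (apfst gx) u \<and> reduced u" if v: "v \<in> reduced_words (range gx)" for v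
  proof (intro exI conjI)
    have sub: "fst ` set v \<subseteq> range gx" and red: "reduced v" using v by (auto simp: reduced_words_def)
    let ?h = "inv_into UNIV gx"
    have "map (apfst gx) (map (apfst ?h) v) = v"
      unfolding map_map using sub by (intro map_idI) (auto simp: f_inv_into_f prod_eq_iff subset_iff)
    then show "v = map (apfst gx) (map (apfst ?h) v)" by simp
    show "reduced (map (apfst ?h) v)"
      by (rule reduced_map_inj[OF inj_on_subset[OF inj_on_inv_into[OF order_refl] sub] red])
  qed
  have "bij_betw (word_value G) (reduced_words (range gx)) (carrier G)"
    unfolding bij_betw_def
  proof
    show "inj_on (word_value G) (reduced_words (range gx))"
    proof (rule inj_onI)
      fix v v' assume v: "v \<in> reduced_words (range gx)" "v' \<in> reduced_words (range gx)"
        and eq: "word_value G v = word_value G v'"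
      obtain u u' where u: "v = map (apfst gx) u" "reduced u" "v' = map (apfst gx) u'" "reduced u'"
        using words v by meson
      have "word_fg u = word_fg u'" using eq by (simp add: u wval inj)
      then have "nrm u = nrm u'" using wd_word_fg by metis
      then show "v = v'" using u by (simp add: nrm_reduced)
    qed
    show "word_value G ` reduced_words (range gx) = carrier G"
    proof
      show "word_value G ` reduced_words (range gx) \<subseteq> carrier G" using words wval by force
      show "carrier G \<subseteq> word_value G ` reduced_words (range gx)"
      proof
        fix g assume "g \<in> carrier G"
        then obtain u where u: "g = \<Phi> u" using bij by (auto simp: bij_betw_def)
        have "reduced (map (apfst gx) (wd u))"
          by (rule reduced_map_inj[OF inj_on_subset[OF injg subset_UNIV] reduced_wd])
        then have "map (apfst gx) (wd u) \<in> reduced_words (range gx)" by (auto simp: reduced_words_def)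
        moreover have "g = word_value G (map (apfst gx) (wd u))" by (simp add: wval word_fg_wd u)
        ultimately show "g \<in> word_value G ` reduced_words (range gx)" by blast
      qed
    qed
  qed
  then show ?thesis by (auto simp: free_basis_def gx_def)
qed

context
  fixes K :: "'b :: Fields.field set" and f :: "'b \<Rightarrow> 'a" and C :: "'a set"
  assumes K: "is_subfield K" and f: "bij_betw f K C"
begin

text \<open>The structure of \<open>K\<close> transported along \<open>f\<close>: the theorem asks
  for a ring over the type underlying \<kappa>, while \<open>K\<close> lives in a type of fractions
  of series.\<close>

definition tring :: "'a ring" where
  "tring = \<lparr>carrier = C, monoid.mult = \<lambda>x y. f (inv_into K f x * inv_into K f y), one = f 1,
     zero = f 0, add = \<lambda>x y. f (inv_into K f x + inv_into K f y)\<rparr>"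

lemma f_in: "x \<in> K \<Longrightarrow> f x \<in> C" and g_f: "x \<in> K \<Longrightarrow> inv_into K f (f x) = x"
  and g_in: "y \<in> C \<Longrightarrow> inv_into K f y \<in> K" and f_g: "y \<in> C \<Longrightarrow> f (inv_into K f y) = y"
  using f by (auto simp: bij_betw_def f_inv_into_f inv_into_into)

lemmas K_cl = subfield_0[OF K] subfield_1[OF K] subfield_add[OF K] subfield_mult[OF K] subfield_uminus[OF K]
  subfield_inverse[OF K]

lemma carrier_cases: "y \<in> C \<Longrightarrow> (\<And>x. x \<in> K \<Longrightarrow> y = f x \<Longrightarrow> P) \<Longrightarrow> P"
  using g_in f_g by metis

lemma f_eq_iff: "x \<in> K \<Longrightarrow> y \<in> K \<Longrightarrow> f x = f y \<longleftrightarrow> x = y"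
  using g_f by metis

lemma tring_sel: "carrier tring = C" "\<one>\<^bsub>tring\<^esub> = f 1" "\<zero>\<^bsub>tring\<^esub> = f 0"
  "x \<in> K \<Longrightarrow> y \<in> K \<Longrightarrow> f x \<otimes>\<^bsub>tring\<^esub> f y = f (x * y)"
  "x \<in> K \<Longrightarrow> y \<in> K \<Longrightarrow> f x \<oplus>\<^bsub>tring\<^esub> f y = f (x + y)"
  by (simp_all add: tring_def g_f)

lemma field_tring: "Ring.field tring"
proof -
  note [simp] = tring_sel K_cl f_in
  have ab: "abelian_group tring"
  proof (rule abelian_groupI)
    fix x assume "x \<in> carrier tring"
    then obtain a where a: "a \<in> K" "x = f a" by (auto elim: carrier_cases)
    then show "\<exists>y\<in>carrier tring. y \<oplus>\<^bsub>tring\<^esub> x = \<zero>\<^bsub>tring\<^esub>" by (intro bexI[of _ "f (- a)"]) auto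
  qed (auto simp: algebra_simps elim!: carrier_cases)
  have cm: "comm_monoid tring" by (rule comm_monoidI) (auto simp: algebra_simps elim!: carrier_cases)
  have cr: "cring tring" by (rule cringI[OF ab cm]) (auto simp: algebra_simps elim!: carrier_cases)
  show ?thesis
  proof (rule cring.cring_fieldI[OF cr])
    show "Units tring = carrier tring - {\<zero>\<^bsub>tring\<^esub>}"
    proof (intro equalityI subsetI)
      fix x assume "x \<in> Units tring"
      then obtain y where xy: "x \<in> C" "y \<in> C" "x \<otimes>\<^bsub>tring\<^esub> y = \<one>\<^bsub>tring\<^esub>" by (auto simp: Units_def)
      then show "x \<in> carrier tring - {\<zero>\<^bsub>tring\<^esub>}" by (auto simp: f_eq_iff elim!: carrier_cases)
    next
      fix x assume x: "x \<in> carrier tring - {\<zero>\<^bsub>tring\<^esub>}"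
      then obtain a where a: "a \<in> K" "x = f a" "a \<noteq> 0" by (auto elim: carrier_cases)
      then show "x \<in> Units tring" unfolding Units_def by (auto intro!: bexI[of _ "f (inverse a)"])
    qed
  qed
qed

lemma tring_nat: "[n] \<cdot>\<^bsub>tring\<^esub> \<one>\<^bsub>tring\<^esub> = f (of_nat n) \<and> of_nat n \<in> K"
proof (induction n)
  case (Suc n)
  interpret F: field tring by (rule field_tring)
  have "[Suc n] \<cdot>\<^bsub>tring\<^esub> \<one>\<^bsub>tring\<^esub> = [n] \<cdot>\<^bsub>tring\<^esub> \<one>\<^bsub>tring\<^esub> \<oplus>\<^bsub>tring\<^esub> \<one>\<^bsub>tring\<^esub>" by simp
  also have "\<dots> = f (of_nat n + 1)" using Suc by (simp add: tring_sel K_cl)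
  finally show ?case using Suc by (simp add: K_cl add.commute)
qed (simp_all add: add_pow_def nat_pow_def tring_sel K_cl)

lemma ring_characteristic_tring:
  assumes p: "\<And>n. of_nat n = (0 :: 'b) \<longleftrightarrow> p dvd n"
  shows "ring_characteristic tring = p"
proof -
  have iff: "[n] \<cdot>\<^bsub>tring\<^esub> \<one>\<^bsub>tring\<^esub> = \<zero>\<^bsub>tring\<^esub> \<longleftrightarrow> p dvd n" for n :: nat
    using tring_nat[of n] by (simp add: tring_sel f_eq_iff K_cl p)
  show ?thesis
  proof (cases "p = 0")
    case False
    have "(LEAST n. 0 < n \<and> p dvd n) = p"
      by (rule Least_equality) (use False in \<open>auto intro: dvd_imp_le\<close>)
    then show ?thesis using False unfolding ring_characteristic_def iff by auto
  qed (auto simp: ring_characteristic_def iff)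
qed

text \<open>Restricted to \<open>C\<close> because \<open>ring_AutoGroup\<close> keeps only the maps
  that are \<open>undefined\<close> outside the carrier.\<close>

definition tconj :: "('b \<Rightarrow> 'b) \<Rightarrow> 'a \<Rightarrow> 'a" where
  "tconj \<sigma> = (\<lambda>x\<in>C. f (\<sigma> (inv_into K f x)))"

lemma tconj_f: "x \<in> K \<Longrightarrow> tconj \<sigma> (f x) = f (\<sigma> x)"
  by (simp add: tconj_def f_in g_f)

lemma tconj_aut:
  assumes s: "field_aut K \<sigma>"
  shows "tconj \<sigma> \<in> carrier (ring_AutoGroup tring)"
proof -
  note s' = field_aut_in[OF K s] field_aut_add[OF K s] field_aut_mult[OF K s] field_aut_1[OF K s]
  have "bij_betw (f \<circ> (\<sigma> \<circ> inv_into K f)) C C"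
    by (intro bij_betw_trans[OF _ f] bij_betw_trans[OF bij_betw_inv_into[OF f]] field_aut_bij[OF K s])
  then have b: "bij_betw (tconj \<sigma>) C C"
    by (rule bij_betw_cong[THEN iffD1, rotated]) (simp add: tconj_def)
  then have "tconj \<sigma> \<in> Bij C" by (simp add: Bij_def tconj_def)
  moreover have "tconj \<sigma> \<in> Ring.ring_hom tring tring"
    by (rule ring_hom_memI) (auto simp: tring_sel tconj_f K_cl s' f_in elim!: carrier_cases)
  ultimately show ?thesis using b by (simp add: ring_AutoGroup_def ring_iso_def tring_sel)
qed

lemma aut_eq_tconj:
  assumes "\<tau> \<in> carrier (ring_AutoGroup tring)"
  shows "\<exists>\<sigma>. field_aut K \<sigma> \<and> \<tau> = tconj \<sigma>"
proof -
  have b: "\<tau> \<in> extensional C" "bij_betw \<tau> C C" and h: "\<tau> \<in> Ring.ring_hom tring tring"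
    using assms by (auto simp: ring_AutoGroup_def ring_iso_def tring_sel Bij_def)
  define \<sigma> where "\<sigma> = inv_into K f \<circ> (\<tau> \<circ> f)"
  have tin: "\<tau> y \<in> C" if "y \<in> C" for y using b(2) that by (auto simp: bij_betw_def)
  have fs: "f (\<sigma> x) = \<tau> (f x)" and sK: "\<sigma> x \<in> K" if "x \<in> K" for x
    using that by (simp_all add: \<sigma>_def f_g g_in tin f_in)
  have "bij_betw \<sigma> K K"
    unfolding \<sigma>_def by (rule bij_betw_trans[OF bij_betw_trans[OF f b(2)] bij_betw_inv_into[OF f]])
  moreover have "\<sigma> (x + y) = \<sigma> x + \<sigma> y" "\<sigma> (x * y) = \<sigma> x * \<sigma> y" if "x \<in> K" "y \<in> K" for x y
  proof -
    have "f (\<sigma> (x + y)) = f (\<sigma> x + \<sigma> y)" "f (\<sigma> (x * y)) = f (\<sigma> x * \<sigma> y)"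
      using ring_hom_add[OF h, of "f x" "f y"] ring_hom_mult[OF h, of "f x" "f y"] that
      by (simp_all add: tring_sel f_in fs sK K_cl flip: fs)
    then show "\<sigma> (x + y) = \<sigma> x + \<sigma> y" "\<sigma> (x * y) = \<sigma> x * \<sigma> y" using that by (simp_all add: f_eq_iff K_cl sK)
  qed
  moreover have "\<sigma> 1 = 1"
    using ring_hom_one[OF h] fs[of 1] sK[of 1] f_eq_iff[of "\<sigma> 1" 1] by (simp add: tring_sel K_cl)
  ultimately have "field_aut K \<sigma>" by (auto simp: field_aut_def)
  moreover have "\<tau> = tconj \<sigma>"
  proof (rule extensionalityI[OF b(1)])
    show "tconj \<sigma> \<in> extensional C" by (simp add: tconj_def)
    fix x assume "x \<in> C"
    then show "\<tau> x = tconj \<sigma> x" by (auto simp: tconj_f fs elim!: carrier_cases)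
  qed
  ultimately show ?thesis by blast
qed

lemma free_group_tring:
  fixes \<sigma> :: "'g fg \<Rightarrow> 'b \<Rightarrow> 'b"
  assumes aut: "\<And>u. field_aut K (\<sigma> u)"
    and surj: "\<And>\<tau>. field_aut K \<tau> \<Longrightarrow> \<exists>u. \<forall>x\<in>K. \<tau> x = \<sigma> u x"
    and inj: "\<And>u v. (\<And>x. x \<in> K \<Longrightarrow> \<sigma> u x = \<sigma> v x) \<Longrightarrow> u = v"
    and hom: "\<And>u v x. x \<in> K \<Longrightarrow> \<sigma> (u + v) x = \<sigma> u (\<sigma> v x)"
  shows "free_group (ring_AutoGroup tring)" "|carrier (ring_AutoGroup tring)| =o |UNIV :: 'g fg set|"
proof -
  interpret F: field tring by (rule field_tring)
  have G: "group (ring_AutoGroup tring)" by (rule F.group_ring_AutoGroup)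
  have bij: "bij_betw (\<lambda>u. tconj (\<sigma> u)) UNIV (carrier (ring_AutoGroup tring))"
    unfolding bij_betw_def
  proof
    show "inj (\<lambda>u. tconj (\<sigma> u))"
    proof (rule injI, rule inj)
      fix u v x assume eq: "tconj (\<sigma> u) = tconj (\<sigma> v)" and x: "x \<in> K"
      have "f (\<sigma> u x) = f (\<sigma> v x)" using fun_cong[OF eq, of "f x"] x by (simp add: tconj_f)
      then show "\<sigma> u x = \<sigma> v x" using x by (simp add: f_eq_iff field_aut_in[OF K aut])
    qed
    show "range (\<lambda>u. tconj (\<sigma> u)) = carrier (ring_AutoGroup tring)"
    proof
      show "carrier (ring_AutoGroup tring) \<subseteq> range (\<lambda>u. tconj (\<sigma> u))"
      proof
        fix \<rho> assume "\<rho> \<in> carrier (ring_AutoGroup tring)"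
        then obtain \<tau> where \<tau>: "field_aut K \<tau>" "\<rho> = tconj \<tau>" using aut_eq_tconj by blast
        obtain u where "\<forall>x\<in>K. \<tau> x = \<sigma> u x" using surj[OF \<tau>(1)] by blast
        then have "\<rho> = tconj (\<sigma> u)" by (auto simp: \<tau>(2) tconj_def g_in)
        then show "\<rho> \<in> range (\<lambda>u. tconj (\<sigma> u))" by blast
      qed
    qed (use tconj_aut aut in blast)
  qed
  have mult: "tconj (\<sigma> (u + v)) = tconj (\<sigma> u) \<otimes>\<^bsub>ring_AutoGroup tring\<^esub> tconj (\<sigma> v)" for u v
  proof -
    have B: "tconj (\<sigma> w) \<in> Bij C" for w
      using tconj_aut[OF aut[of w]] by (simp add: ring_AutoGroup_def tring_sel)
    have "tconj (\<sigma> (u + v)) x = compose C (tconj (\<sigma> u)) (tconj (\<sigma> v)) x" for x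
    proof (cases "x \<in> C")
      case True
      then show ?thesis
        by (auto simp: compose_def tconj_f hom field_aut_in[OF K aut] elim!: carrier_cases)
    qed (simp add: compose_def tconj_def)
    then show ?thesis using B by (auto simp: ring_AutoGroup_def BijGroup_def tring_sel)
  qed
  show "free_group (ring_AutoGroup tring)"
    unfolding free_group_def using G free_basis_fg[OF G bij mult] by blast
  show "|carrier (ring_AutoGroup tring)| =o |UNIV :: 'g fg set|"
    using bij card_of_ordIso ordIso_symmetric by blast
qed

end

section \<open>The construction over given types\<close>

text \<open>Elements of the prime field are fractions a / b of integers, and a^n = b^n with n odd
  forces a = b.\<close>

lemma prime_field_torsion_char_0:
  fixes x :: "'k :: Fields.field"
  assumes c: "CHAR('k) = 0" and n: "odd n" and x: "x \<in> gf {}" "x ^ n = 1"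
  shows "x = 1"
proof -
  have inj: "of_int a = (0 :: 'k) \<longleftrightarrow> a = 0" for a :: int
  proof -
    have "of_int a = (0 :: 'k) \<longleftrightarrow> of_nat (nat \<bar>a\<bar>) = (0 :: 'k)"
      by (cases "a \<ge> 0") (simp_all add: abs_of_nonneg abs_of_neg)
    also have "\<dots> \<longleftrightarrow> a = 0" unfolding of_nat_eq_0_iff_char_dvd c by auto
    finally show ?thesis .
  qed
  let ?Q = "{of_int a / of_int b | a b. b \<noteq> 0} :: 'k set"
  have "is_subfield ?Q"
  proof (rule is_subfieldI)
    show "0 \<in> ?Q" by (intro CollectI exI[of _ 0] exI[of _ 1]) simp
    show "1 \<in> ?Q" by (intro CollectI exI[of _ 1]) simp
  next
    fix x y assume "x \<in> ?Q" "y \<in> ?Q"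
    then obtain a b a' b' where xy: "x = of_int a / of_int b" "b \<noteq> 0" "y = of_int a' / of_int b'" "b' \<noteq> 0" by auto
    show "x + y \<in> ?Q"
      by (rule CollectI, rule exI[of _ "a * b' + a' * b"], rule exI[of _ "b * b'"]) (use xy in \<open>simp add: add_frac_eq inj\<close>)
    show "x * y \<in> ?Q"
      by (rule CollectI, rule exI[of _ "a * a'"], rule exI[of _ "b * b'"]) (use xy in simp)
  next
    fix x assume "x \<in> ?Q"
    then obtain a b where ab: "x = of_int a / of_int b" "b \<noteq> 0" by auto
    show "- x \<in> ?Q" by (rule CollectI, rule exI[of _ "- a"], rule exI[of _ b]) (use ab in simp)
    show "inverse x \<in> ?Q"
    proof (cases "a = 0")
      case True
      then show ?thesis using \<open>x \<in> ?Q\<close> ab by simp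
    next
      case False
      then show ?thesis by (intro CollectI exI[of _ b] exI[of _ a]) (use ab in simp)
    qed
  qed
  then have "gf {} \<subseteq> ?Q" by (rule gf_least) simp
  then obtain a b where ab: "x = of_int a / of_int b" "b \<noteq> 0" using x by auto
  then have "of_int a = x * of_int b" by (simp add: inj)
  then have "of_int (a ^ n) = (of_int (b ^ n) :: 'k)" using x(2) by (simp add: power_mult_distrib)
  then have "of_int (a ^ n - b ^ n) = (0 :: 'k)" by simp
  then have e: "a ^ n = b ^ n" unfolding inj by simp
  have "\<bar>a\<bar> = \<bar>b\<bar>"
    using arg_cong[OF e, of abs] odd_pos[OF n] by (simp add: power_abs power_eq_iff_eq_base)
  then have "a = b" using e ab(2) n by (auto simp: abs_eq_iff)
  then show ?thesis using ab by (simp add: inj)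
qed

text \<open>The prime field is contained in the fixed field of y -> y^p, so x^(p-1) = 1; a prime n >
  p is prime to p - 1, and Bezout gives x = 1.\<close>

lemma prime_field_torsion_char_p:
  fixes x :: "'k :: Fields.field"
  assumes p: "Factorial_Ring.prime p" "CHAR('k) = p" and n: "Factorial_Ring.prime n" "p < n" and x: "x \<in> gf {}" "x ^ n = 1"
  shows "x = 1"
proof -
  have p0: "p > 0" using p(1) by (rule prime_gt_0_nat)
  have fr: "(y + z) ^ p = y ^ p + z ^ p" for y z :: 'k using p by (auto intro: freshmans_dream)
  have neg: "(- y) ^ p = - (y ^ p)" for y :: 'k
    using fr[of "- y" y] p0 by (simp add: power_0_left eq_neg_iff_add_eq_0)
  have "is_subfield {y :: 'k. y ^ p = y}"
    by (rule is_subfieldI) (use p0 in \<open>auto simp: fr neg power_mult_distrib power_inverse power_0_left\<close>)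
  then have "gf {} \<subseteq> {y :: 'k. y ^ p = y}" by (rule gf_least) simp
  then have xp: "x ^ p = x" using x by auto
  have x0: "x \<noteq> 0" using x(2) prime_gt_0_nat[OF n(1)] by (auto simp: power_0_left)
  have "x * x ^ (p - 1) = x" using xp p0 by (simp flip: power_Suc)
  then have x1: "x ^ (p - 1) = 1" using x0 by simp
  have p1: "p - 1 \<noteq> 0" using prime_gt_1_nat[OF p(1)] by simp
  have "coprime n (p - 1)"
  proof (rule prime_imp_coprime[OF n(1)])
    show "\<not> n dvd p - 1" using p1 n(2) by (auto dest: dvd_imp_le)
  qed
  moreover have "n \<noteq> 0" using n(2) by simp
  ultimately obtain a b where ab: "n * a = (p - 1) * b + 1" using bezout_nat[of n "p - 1"] by (auto simp: coprime_iff_gcd_eq_1)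
  have "x = x ^ ((p - 1) * b + 1)" using x1 by (simp add: power_mult)
  also have "\<dots> = 1" unfolding ab[symmetric] by (simp add: power_mult x(2))
  finally show ?thesis .
qed

text \<open>Taking r = q makes the coefficients of the exponents 1, q and q^2: they are natural
  numbers, distinct as rationals, and nonzero in characteristic p because q is a prime above
  p.\<close>

lemma binomial_field_Gam:
  fixes p :: nat
  assumes c: "CHAR('k :: alg_closed_field) = p" and p: "p = 0 \<or> Factorial_Ring.prime p"
    and q: "Factorial_Ring.prime q" "p < q" "2 < q" and l: "Factorial_Ring.prime l" "p < l" "2 < l" and ql: "q \<noteq> l"
  shows "binomial_field q l (Gam (of_nat q) :: 'l vtx expo set) (gf {} :: 'k set)"
proof
  have r: "1 < (of_nat q :: rat)" using q(3) by simp
  have nz: "of_nat n \<noteq> (0 :: 'k)" if "Factorial_Ring.prime n" "p < n" for n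
  proof
    assume "of_nat n = (0 :: 'k)"
    then have "p dvd n" by (simp add: of_nat_eq_0_iff_char_dvd c)
    moreover from this have "p \<noteq> 0" using not_prime_0 that(1) by (metis dvd_0_left)
    ultimately show False using p that primes_dvd_imp_eq[of p n] by auto
  qed
  have tors: "x = 1" if n: "Factorial_Ring.prime n" "p < n" "2 < n" and x: "x \<in> gf {}" "x ^ n = 1" for n and x :: 'k
  proof (cases "p = 0")
    case True
    have "odd n" using prime_odd_nat[OF n(1,3)] .
    then show ?thesis using prime_field_torsion_char_0[of n x] x True c by simp
  next
    case False
    then show ?thesis using prime_field_torsion_char_p[of p n x] p c n x by simp
  qed
  show "Factorial_Ring.prime q" "Factorial_Ring.prime l" "q \<noteq> l" by (fact q l ql)+
  show "of_nat q \<noteq> (0 :: 'k)" "of_nat l \<noteq> (0 :: 'k)" by (rule nz; fact q l)+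
  show "gf {} = (gf {} :: 'k set)" ..
  show "x = 1" if "x \<in> gf {}" "x ^ l = 1" for x :: 'k using tors[OF l that] .
  show "x = 1" if "x \<in> gf {}" "x ^ q = 1" for x :: 'k using tors[OF q that] .
  fix \<gamma> \<gamma>' :: "'l vtx expo" and v :: "'l vtx" and n :: nat and a b :: rat
  show "ev v \<in> Gam (of_nat q)" by (auto simp: Gam_def)
  assume g: "\<gamma> \<in> Gam (of_nat q)"
  show "natexpo \<gamma>" using q(3) g by (intro Gam_natexpo) auto
  show "\<gamma> = \<gamma>'" if "\<gamma>' \<in> Gam (of_nat q)" "rsm a \<gamma> = rsm b \<gamma>'" "a \<noteq> 0" using Gam_indep[OF r g that] .
  show "of_nat n \<noteq> (0 :: 'k)" if "lookup \<gamma> v = of_nat n" "n \<noteq> 0"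
  proof -
    have "(of_nat n :: rat) \<in> {0, of_nat 1, of_nat q, of_nat (q ^ 2)}" using Gam_lookup[OF r g, of v] that(1) by auto
    then have "n = 1 \<or> n = q \<or> n = q ^ 2" using that(2) by (simp only: insert_iff of_nat_eq_iff of_nat_eq_0_iff empty_iff) auto
    then show ?thesis using nz[OF q(1,2)] by auto
  qed
qed

lemma exists_ring_from_types:
  fixes \<kappa> :: "'a rel"
  assumes \<kappa>: "Card_order \<kappa>" and card_l: "|UNIV :: 'l set| =o \<kappa>" and inf: "infinite (UNIV :: 'l set)"
    and om: "|UNIV :: (nat \<Rightarrow> 'l) set| \<le>o |UNIV :: 'l set|"
    and c: "CHAR('k :: alg_closed_field) = p" and p: "p = 0 \<or> Factorial_Ring.prime p"
  shows "\<exists>R :: 'a ring. Ring.field R \<and> ring_characteristic R = p \<and> |carrier R| =o \<kappa> \<and>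
    free_group (ring_AutoGroup R) \<and> |carrier (ring_AutoGroup R)| =o ctwo ^c \<kappa>"
proof -
  \<comment> \<open>Primes above \<open>max p 2\<close> are odd and nonzero in the constants, and
    they do not divide p - 1 when p > 0; the prime field then has no nontrivial q-th or m-th roots
    of unity. The prime \<open>m\<close> plays the part of \<open>l\<close>.\<close>
  obtain q where q: "Factorial_Ring.prime q" "max p 2 < q" using bigger_prime by blast
  obtain m where m: "Factorial_Ring.prime m" "q < m" using bigger_prime by blast
  interpret binomial_field q m "Gam (of_nat q) :: 'l vtx expo set" "gf {} :: 'k set"
    by (rule binomial_field_Gam[OF c p]) (use q m in auto)
  have r: "1 < (of_nat q :: rat)" using prime_gt_1_nat[OF q(1)] by simp
  let ?\<rho> = "|UNIV :: 'l set|"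
  have \<rho>: "Cinfinite ?\<rho>" using inf by (simp add: cinfinite_def Field_card_of card_of_card_order_on)
  have cardv: "|UNIV :: 'l vtx expo set| \<le>o ?\<rho>"
    by (rule card_expo_bound[OF \<rho> card_vtx_bound[OF inf om]])
  have "|K| \<le>o ?\<rho>"
    unfolding K_def
    by (intro card_gf_bound[OF \<rho>] card_Un_bound[OF \<rho>] card_image_bound card_subset_bound[OF subset_UNIV cardv])
  \<comment> \<open>The points over constant sequences already give as many distinct variables as
    \<open>'l\<close> has elements.\<close>
  moreover have "?\<rho> \<le>o |K|"
  proof (rule card_of_ordLeqI)
    show "inj (\<lambda>x :: 'l. xmon (ev (Pt (\<lambda>_. x) 0)) :: ('l vtx, 'k) pfield)"
    proof (rule injI)
      fix x y :: 'l
      assume "xmon (ev (Pt (\<lambda>_. x) 0)) = (xmon (ev (Pt (\<lambda>_. y) 0)) :: ('l vtx, 'k) pfield)"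
      then have "ev (Pt (\<lambda>_. x) 0) = ev (Pt (\<lambda>_. y :: 'l) 0)" by (rule xmon_inj)
      then have "Pt (\<lambda>_. x) 0 = Pt (\<lambda>_. y :: 'l) 0" by (metis lookup_ev zero_neq_one)
      then show "x = y" by (simp add: fun_eq_iff)
    qed
  qed (rule xmon_in_K[OF ev_Al])
  ultimately have "|K| =o ?\<rho>" by (simp add: ordIso_iff_ordLeq)
  then have cardK: "|K| =o \<kappa>" using card_l by (rule ordIso_transitive)
  have Fk: "|Field \<kappa>| =o \<kappa>" by (rule card_of_Field_ordIso[OF \<kappa>])
  have "|K| =o |Field \<kappa>|" by (rule ordIso_transitive[OF cardK ordIso_symmetric[OF Fk]])
  then obtain f where f: "bij_betw f K (Field \<kappa>)" using card_of_ordIso by blast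
  note Ksub = subfields(4)
  have G: "eact (pw W) ` Gam (of_nat q) = Gam (of_nat q)" for W :: "('l \<Rightarrow> bool) fg" by (rule eact_pw)
  have aut: "field_aut K (oact (pw W))" for W by (rule field_aut_oact[OF bij_pw G])
  have surj: "\<exists>W. \<forall>x\<in>K. \<tau> x = oact (pw W) x" if "field_aut K \<tau>" for \<tau>
  proof -
    obtain \<pi> where \<pi>: "bij \<pi>" "eact \<pi> ` Gam (of_nat q) = Gam (of_nat q)" "\<forall>x\<in>K. \<tau> x = oact \<pi> x"
      using field_aut_K[OF \<open>field_aut K \<tau>\<close>] by blast
    then show ?thesis using symmetry_eq_pw[OF r \<pi>(1,2)] by blast
  qed
  have inj: "U = W" if "\<And>x. x \<in> K \<Longrightarrow> oact (pw U) x = oact (pw W) x" for U W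
    by (rule pw_inj, rule oact_eq_on_K[OF bij_pw bij_pw]) (rule that)
  have hom: "oact (pw (U + W)) x = oact (pw U) (oact (pw W) x)" if "x \<in> K" for U W x
    unfolding pw_add by (rule oact_comp[OF bij_pw G bij_pw G that])
  have char: "of_nat n = (0 :: ('l vtx, 'k) pfield) \<longleftrightarrow> p dvd n" for n
    using cst_eq_0_iff[where 'b = 'k and c = "of_nat n"] by (simp add: cst_of_nat of_nat_eq_0_iff_char_dvd c)
  let ?R = "tring K f (Field \<kappa>)"
  note free = free_group_tring[OF Ksub f, of "\<lambda>W. oact (pw W)", OF aut surj inj hom]
  have "|carrier (ring_AutoGroup ?R)| =o ctwo ^c |UNIV :: 'l set|"
    using free(2) card_fg_Pow[OF inf] by (rule ordIso_transitive)
  also have "ctwo ^c |UNIV :: 'l set| =o ctwo ^c \<kappa>"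
    by (rule cexp_cong2[OF card_l Card_order_ctwo card_of_Card_order])
  finally (ordIso_transitive) have "|carrier (ring_AutoGroup ?R)| =o ctwo ^c \<kappa>" .
  then show ?thesis
    using field_tring[OF Ksub f] ring_characteristic_tring[OF Ksub f char] free(1) Fk
    by (intro exI[of _ ?R]) (simp add: tring_sel[OF Ksub f])
qed

section \<open>Types of prescribed cardinality\<close>

definition admits_ring :: "'a rel \<Rightarrow> nat \<Rightarrow> bool" where
  "admits_ring \<kappa> p \<longleftrightarrow> (\<exists>R :: 'a ring. Ring.field R \<and> ring_characteristic R = p \<and> |carrier R| =o \<kappa> \<and>
    free_group (ring_AutoGroup R) \<and> |carrier (ring_AutoGroup R)| =o ctwo ^c \<kappa>)"

definition counterexample :: "'a rel \<Rightarrow> nat \<Rightarrow> bool" where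
  "counterexample \<kappa> p \<longleftrightarrow> Card_order \<kappa> \<and> cinfinite \<kappa> \<and> \<kappa> =o \<kappa> ^c natLeq \<and>
    (p = 0 \<or> Factorial_Ring.prime p) \<and> \<not> admits_ring \<kappa> p"

text \<open>A type definition cannot depend on the variables \<open>\<kappa>\<close> and \<open>p\<close>. We therefore fix a hypothetical
  counterexample once and for all (an arbitrary pair if there is none), and use types of the
  corresponding sizes.\<close>

definition bad :: "'a rel \<times> nat" where
  "bad = (SOME (\<kappa>, p). counterexample \<kappa> p)"

text \<open>The default \<open>UNIV\<close> keeps the set nonempty when there is no counterexample,
  so that the type definition below is always justified.\<close>

definition bad_set :: "'a set" where
  "bad_set = (let (\<kappa>, p) = bad in if counterexample \<kappa> p then Field \<kappa> else UNIV)"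

typedef 'a lam = "bad_set :: 'a set"
proof -
  have "Field \<kappa> \<noteq> {}" if "counterexample \<kappa> p" for \<kappa> :: "'a rel" and p
  proof
    assume "Field \<kappa> = {}"
    then show False using that by (simp add: counterexample_def cinfinite_def)
  qed
  then have "(bad_set :: 'a set) \<noteq> {}" by (auto simp: bad_set_def Let_def split: prod.splits)
  then show ?thesis by auto
qed

text \<open>The default 2 covers characteristic 0, so that \<open>gfp\<close> is a type of prime
  cardinality in every case.\<close>

definition bad_prime :: "'a itself \<Rightarrow> nat" where
  "bad_prime _ = (let p = snd (bad :: 'a rel \<times> nat) in if Factorial_Ring.prime p then p else 2)"

lemma prime_bad_prime: "Factorial_Ring.prime (bad_prime TYPE('a))"
  by (simp add: bad_prime_def Let_def)

typedef 'a gfp = "{..<bad_prime TYPE('a)}"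
  using prime_gt_0_nat[OF prime_bad_prime] by auto

lemma card_gfp: "CARD('a gfp) = bad_prime TYPE('a)"
  using type_definition.card[OF type_definition_gfp] by simp

instance gfp :: (type) prime_card
  by standard (simp add: card_gfp prime_bad_prime)

text \<open>If some pair is a counterexample, then so is the chosen pair \<open>bad\<close>,
  possibly another one. For that pair \<open>lam\<close> has the right cardinality and
  \<open>rat\<close> or \<open>gfp\<close> the right characteristic, and the construction over these
  types refutes it.\<close>

lemma no_counterexample: "\<not> counterexample (\<kappa> :: 'a rel) p"
proof
  assume "counterexample \<kappa> p"
  then have "case_prod counterexample (bad :: 'a rel \<times> nat)"
    unfolding bad_def by (intro someI[of "\<lambda>(\<kappa>, p). counterexample \<kappa> p" "(\<kappa>, p)"]) simp
  then have bad: "counterexample (fst (bad :: 'a rel \<times> nat)) (snd (bad :: 'a rel \<times> nat))" by (simp add: case_prod_unfold)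
  define \<mu> where "\<mu> = fst (bad :: 'a rel \<times> nat)"
  define p0 where "p0 = snd (bad :: 'a rel \<times> nat)"
  have \<mu>: "Card_order \<mu>" "cinfinite \<mu>" "\<mu> =o \<mu> ^c natLeq" "p0 = 0 \<or> Factorial_Ring.prime p0" "\<not> admits_ring \<mu> p0"
    using bad by (auto simp: counterexample_def \<mu>_def p0_def)
  interpret lam: type_definition "Rep_lam :: 'a lam \<Rightarrow> 'a" Abs_lam "Field \<mu>"
    using type_definition_lam[where 'a = 'a] bad by (simp add: \<mu>_def bad_set_def Let_def case_prod_unfold)
  have "bij_betw (Rep_lam :: 'a lam \<Rightarrow> 'a) UNIV (Field \<mu>)"
    unfolding bij_betw_def using lam.Rep_range lam.Rep_inject by (auto simp: inj_def)
  then have UF: "|UNIV :: 'a lam set| =o |Field \<mu>|" using card_of_ordIso by blast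
  then have l: "|UNIV :: 'a lam set| =o \<mu>" using card_of_Field_ordIso[OF \<mu>(1)] by (rule ordIso_transitive)
  have inf: "infinite (UNIV :: 'a lam set)"
    using card_of_ordIso_finite[OF UF] \<mu>(2) by (simp add: cinfinite_def)
  have "|UNIV :: (nat \<Rightarrow> 'a lam) set| = |UNIV :: 'a lam set| ^c natLeq"
    by (simp add: cexp_def Field_card_of Field_natLeq Func_def)
  also have "|UNIV :: 'a lam set| ^c natLeq =o \<mu> ^c natLeq" by (rule cexp_cong1[OF l natLeq_Card_order])
  finally have "|UNIV :: (nat \<Rightarrow> 'a lam) set| =o |UNIV :: 'a lam set|"
    using \<mu>(3) l ordIso_symmetric ordIso_transitive by metis
  then have om: "|UNIV :: (nat \<Rightarrow> 'a lam) set| \<le>o |UNIV :: 'a lam set|" by (rule ordIso_imp_ordLeq)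
  have "admits_ring \<mu> p0"
  proof (cases "p0 = 0")
    case True
    have "CHAR(rat alg_closure) = p0" using True by simp
    then show ?thesis
      unfolding admits_ring_def by (rule exists_ring_from_types[OF \<mu>(1) l inf om _ \<mu>(4)])
  next
    case False
    then have "bad_prime TYPE('a) = p0" using \<mu>(4) by (simp add: bad_prime_def Let_def p0_def)
    then have "CHAR('a gfp mod_ring alg_closure) = p0" by (simp add: card_gfp)
    then show ?thesis
      unfolding admits_ring_def by (rule exists_ring_from_types[OF \<mu>(1) l inf om _ \<mu>(4)])
  qed
  then show False using \<mu>(5) by blast
qed

theorem theorem1p4:
  fixes \<kappa> :: "'a rel" and p :: nat
  assumes "Card_order \<kappa>" and "cinfinite \<kappa>"
    and "\<kappa> =o \<kappa> ^c natLeq"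
    and "p = 0 \<or> Factorial_Ring.prime p"
  shows "\<exists>K :: 'a ring.
           field K \<and>
           ring_characteristic K = p \<and>
           |carrier K| =o \<kappa> \<and>
           free_group (ring_AutoGroup K) \<and>
           |carrier (ring_AutoGroup K)| =o ctwo ^c \<kappa>"
  using no_counterexample[of \<kappa> p] assms unfolding counterexample_def admits_ring_def by blast

end
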